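(* Let $M$ be a closed PPCF term of type $\mathtt{real}$ ($\vdash M:\mathtt{real}$). Then for every Borel set $U\subseteq\mathbb R$, $$[\![M]\!](U)=\mathrm{Red}^\infty(M,\underline U),$$ where $\underline U$ is the set of numerals $\underline r$ with $r\in U$.
   Context: PPCF: types $A,B::=\mathtt{real}\mid A\to B$. Terms: variables, $\lambda x^A.M$, $MN$, $\mathtt{fix}\,M$, numerals $\underline r$ ($r\in\mathbb R$), $\underline f(M_1,\dots,M_n)$ for $f$ in a fixed countable set of measurable maps $\mathbb R^n\to\mathbb R$, $\mathtt{ifz}(L,M,N)$, $\mathtt{sample}$, $\mathtt{let}\,x=M\,\mathtt{in}\,N$. Typing is the standard simply-typed one with: $\mathtt{fix}\,M:A$ if $M:A\to A$; numerals, $\mathtt{sample}$, $\underline f(\vec M)$ (all $M_i:\mathtt{real}$), $\mathtt{ifz}(L,M,N)$ (all of type $\mathtt{real}$) have type $\mathtt{real}$; $\Gamma\vdash\mathtt{let}\,x=M\,\mathtt{in}\,N:\mathtt{real}$ if $\Gamma\vdash M:\mathtt{real}$ and $\Gamma,x:\mathtt{real}\vdash N:\mathtt{real}$. Redex rules: $(\lambda x.M)N\to M\{N/x\}$; $\underline f(\underline{r_1},\dots,\underline{r_n})\to\underline{f(r_1,\dots,r_n)}$; $\mathtt{ifz}(\underline r,M,N)\to M$ if $r=0$, $\to N$ otherwise; $\mathtt{let}\,x=\underline r\,\mathtt{in}\,M\to M\{\underline r/x\}$; $\mathtt{fix}\,M\to M(\mathtt{fix}\,M)$; $\mathtt{sample}\to\underline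 r$ for $r\in[0,1]$. Evaluation contexts $E::=[\,]\mid E\,M\mid\mathtt{ifz}(E,M,N)\mid\mathtt{let}\,x=E\,\mathtt{in}\,N\mid\underline f(\underline{r_1},\dots,\underline{r_{i-1}},E,M_{i+1},\dots,M_n)$; every term is either a normal form or uniquely $E[R]$ with $R$ a redex. The set $\mathrm{Terms}(\Gamma\vdash A)$ of terms of type $A$ in context $\Gamma$ is a measurable space: each term is uniquely $T\vec r$ where $T$ is a numeral-free skeleton with $n$ holes (in left-to-right order) and $\vec r\in\mathbb R^n$ fills them; $U$ is measurable iff for every $n$ and skeleton $T$, $\{\vec r\in\mathbb R^n: T\vec r\in U\}$ is Borel. The kernel $\mathrm{Red}$ is $\mathrm{Red}(M,U)=\delta_{E[N]}(U)$ if $M=E[R]$, $R\to N$, $R\ne\mathtt{sample}$; $\mathrm{Red}(M,U)=\lambda\{r\in[0,1]:E[\underline r]\in U\}$ ($\lambda$ Lebesgue measure) if $M=E[\mathtt{sample}]$; $\mathrm{Red}(M,U)=\delta_M(U)$ if $M$ is normal. $\mathrm{Red}^1=\mathrm{Red}$, $\mathrm{Red}^{n+1}(M,U)=\int\mathrm{Red}(t,U)\,\mathrm{Red}^n(M,dt)$, and $\mathrm{Red}^\infty(M,U)=\sup_n\mathrm{Red}^n(M,U)$ for $U$ a measurable set of normal forms. Denotational semantics: in the cartesian closed category whose objects are measurable complete cones and morphisms measurable stable maps sending unit ball to unit ball (cones, unit balls $\mathcal B P$, cone order, products and function spaces $P\Rightarrow Q$ as in the standard definitions of this setting: cones are normed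 $\mathbb R_{\ge0}$-semimodules with order $x\le x'$ iff $x'=x+y$; morphisms are Scott-continuous maps satisfying $\sum_{|I|\equiv n+1\,(2)}f(x+\sum_{i\in I}u_i)\le\sum_{|I|\equiv n\,(2)}f(x+\sum_{i\in I}u_i)$ for all finite families; function spaces have pointwise operations and lubs), $[\![\mathtt{real}]\!]$ is the cone of finite Borel measures on $\mathbb R$ (pointwise operations, norm $\mu(\mathbb R)$, tests $\vec r\mapsto(\mu\mapsto\mu(U))$ for Borel $U$), $[\![A\to B]\!]=[\![A]\!]\Rightarrow[\![B]\!]$, contexts go to products, and for $\vec g$ in the unit ball of $[\![\Gamma]\!]$: $[\![x_i]\!]\vec g=g_i$; $[\![\underline r]\!]\vec g=\delta_r$; $[\![\mathtt{sample}]\!]\vec g=\lambda_{[0,1]}$; $[\![\lambda x.M]\!]\vec g=a\mapsto[\![M]\!](\vec g,a)$; $[\![MN]\!]\vec g=[\![M]\!]\vec g([\![N]\!]\vec g)$; $[\![\underline f(M_1,\dots,M_n)]\!]\vec g=U\mapsto([\![M_1]\!]\vec g\otimes\cdots\otimes[\![M_n]\!]\vec g)(f^{-1}(U))$; $[\![\mathtt{ifz}(L,M,N)]\!]\vec g=([\![L]\!]\vec g)(\{0\})[\![M]\!]\vec g+([\![L]\!]\vec g)(\mathbb R\setminus\{0\})[\![N]\!]\vec g$; $[\![\mathtt{fix}\,M]\!]\vec g=\sup_n([\![M]\!]\vec g)^n(0)$; $[\![\mathtt{let}\,x=M\,\mathtt{in}\,N]\!]\vec g=U\mapsto\int_{\mathbb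 R}[\![N]\!](\vec g,\delta_r)(U)\,[\![M]\!]\vec g(dr)$. For a closed term, $[\![M]\!]$ denotes the resulting measure. *)

theory Defs
  imports "HOL-Probability.Probability"
begin

section \<open>Syntax of PPCF\<close>

datatype ty = RealT | FunT ty ty (infixr "\<rightarrow>" 60)

text \<open>
  De Bruijn terms. The parameter \<open>'r\<close> is the type of the labels carried by the numeral leaves:
  PPCF terms are \<open>real tm\<close>, and the numeral-free skeletons with holes \<open>0, \<dots>, n - 1\<close> are elements
  of \<open>nat tm\<close>, so that plugging \<open>x\<close> into the skeleton \<open>T\<close> is \<open>map_tm x T\<close>. A map
  from \<open>\<real>\<^sup>n\<close> to \<open>\<real>\<close> is represented by a function on lists, of which only the values on lists of
  length \<open>n\<close> matter.
\<close>

datatype 'r tm =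
    Var nat
  | Lam ty "'r tm"
  | App "'r tm" "'r tm"
  | Fix "'r tm"
  | Numeral 'r
  | Prim "real list \<Rightarrow> real" "'r tm list"
  | Ifz "'r tm" "'r tm" "'r tm"
  | Sample
  | LetIn "'r tm" "'r tm"

type_synonym signature = "(nat \<times> (real list \<Rightarrow> real)) set"

abbreviation Rn :: "nat \<Rightarrow> (nat \<Rightarrow> real) measure" where
  "Rn n \<equiv> (\<Pi>\<^sub>M i\<in>{..<n}. borel)"

definition measurable_signature :: "signature \<Rightarrow> bool" where
  "measurable_signature F \<longleftrightarrow> countable F \<and>
     (\<forall>(n, f)\<in>F. (\<lambda>x. f (map x [0..<n])) \<in> borel_measurable (Rn n))"

inductive typing :: "signature \<Rightarrow> ty list \<Rightarrow> 'r tm \<Rightarrow> ty \<Rightarrow> bool" for F :: signature where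
  Var: "i < length \<Gamma> \<Longrightarrow> typing F \<Gamma> (Var i) (\<Gamma> ! i)"
| Lam: "typing F (A # \<Gamma>) M B \<Longrightarrow> typing F \<Gamma> (Lam A M) (A \<rightarrow> B)"
| App: "typing F \<Gamma> M (A \<rightarrow> B) \<Longrightarrow> typing F \<Gamma> N A \<Longrightarrow> typing F \<Gamma> (App M N) B"
| Fix: "typing F \<Gamma> M (A \<rightarrow> A) \<Longrightarrow> typing F \<Gamma> (Fix M) A"
| Numeral: "typing F \<Gamma> (Numeral r) RealT"
| Prim: "(length Ms, f) \<in> F \<Longrightarrow> (\<And>M. M \<in> set Ms \<Longrightarrow> typing F \<Gamma> M RealT)
    \<Longrightarrow> typing F \<Gamma> (Prim f Ms) RealT"
| Ifz: "typing F \<Gamma> L RealT \<Longrightarrow> typing F \<Gamma> M RealT \<Longrightarrow> typing F \<Gamma> N RealT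
    \<Longrightarrow> typing F \<Gamma> (Ifz L M N) RealT"
| Sample: "typing F \<Gamma> Sample RealT"
| LetIn: "typing F \<Gamma> M RealT \<Longrightarrow> typing F (RealT # \<Gamma>) N RealT
    \<Longrightarrow> typing F \<Gamma> (LetIn M N) RealT"

fun codom :: "ty \<Rightarrow> ty" where
  "codom (A \<rightarrow> B) = B"
| "codom RealT = RealT"

primrec type_of :: "'r tm \<Rightarrow> ty list \<Rightarrow> ty" where
  "type_of (Var i) \<Gamma> = \<Gamma> ! i"
| "type_of (Lam A M) \<Gamma> = (A \<rightarrow> type_of M (A # \<Gamma>))"
| "type_of (App M N) \<Gamma> = codom (type_of M \<Gamma>)"
| "type_of (Fix M) \<Gamma> = codom (type_of M \<Gamma>)"
| "type_of (Numeral r) \<Gamma> = RealT"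
| "type_of (Prim f Ms) \<Gamma> = RealT"
| "type_of (Ifz L M N) \<Gamma> = RealT"
| "type_of Sample \<Gamma> = RealT"
| "type_of (LetIn M N) \<Gamma> = RealT"

lemma type_of_typing: "typing F \<Gamma> M A \<Longrightarrow> type_of M \<Gamma> = A"
  by (induction rule: typing.induct) auto

text \<open>The types of all subterms, that is, all types assigned in the unique typing derivation.\<close>

primrec types_in :: "'r tm \<Rightarrow> ty list \<Rightarrow> ty set" where
  "types_in (Var i) \<Gamma> = {\<Gamma> ! i}"
| "types_in (Lam A M) \<Gamma> = insert (type_of (Lam A M) \<Gamma>) (types_in M (A # \<Gamma>))"
| "types_in (App M N) \<Gamma> = insert (type_of (App M N) \<Gamma>) (types_in M \<Gamma> \<union> types_in N \<Gamma>)"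
| "types_in (Fix M) \<Gamma> = insert (type_of (Fix M) \<Gamma>) (types_in M \<Gamma>)"
| "types_in (Numeral r) \<Gamma> = {RealT}"
| "types_in (Prim f Ms) \<Gamma> = insert RealT (\<Union> (set (map (\<lambda>M. types_in M \<Gamma>) Ms)))"
| "types_in (Ifz L M N) \<Gamma> = insert RealT (types_in L \<Gamma> \<union> types_in M \<Gamma> \<union> types_in N \<Gamma>)"
| "types_in Sample \<Gamma> = {RealT}"
| "types_in (LetIn M N) \<Gamma> = insert RealT (types_in M \<Gamma> \<union> types_in N (RealT # \<Gamma>))"

lemma finite_types_in: "finite (types_in M \<Gamma>)"
  by (induction M arbitrary: \<Gamma>) auto


section \<open>Operational semantics\<close>

primrec lift :: "'r tm \<Rightarrow> nat \<Rightarrow> 'r tm" where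
  "lift (Var i) k = (if i < k then Var i else Var (Suc i))"
| "lift (Lam A M) k = Lam A (lift M (Suc k))"
| "lift (App M N) k = App (lift M k) (lift N k)"
| "lift (Fix M) k = Fix (lift M k)"
| "lift (Numeral r) k = Numeral r"
| "lift (Prim f Ms) k = Prim f (map (\<lambda>M. lift M k) Ms)"
| "lift (Ifz L M N) k = Ifz (lift L k) (lift M k) (lift N k)"
| "lift Sample k = Sample"
| "lift (LetIn M N) k = LetIn (lift M k) (lift N (Suc k))"

primrec subst :: "'r tm \<Rightarrow> nat \<Rightarrow> 'r tm \<Rightarrow> 'r tm" where
  "subst (Var i) k P = (if i < k then Var i else if i = k then P else Var (i - 1))"
| "subst (Lam A M) k P = Lam A (subst M (Suc k) (lift P 0))"
| "subst (App M N) k P = App (subst M k P) (subst N k P)"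
| "subst (Fix M) k P = Fix (subst M k P)"
| "subst (Numeral r) k P = Numeral r"
| "subst (Prim f Ms) k P = Prim f (map (\<lambda>M. subst M k P) Ms)"
| "subst (Ifz L M N) k P = Ifz (subst L k P) (subst M k P) (subst N k P)"
| "subst Sample k P = Sample"
| "subst (LetIn M N) k P = LetIn (subst M k P) (subst N (Suc k) (lift P 0))"

text \<open>All redex rules except the one for \<^const>\<open>Sample\<close>, which the kernel treats separately.\<close>

inductive redex :: "real tm \<Rightarrow> real tm \<Rightarrow> bool" where
  "redex (App (Lam A M) N) (subst M 0 N)"
| "redex (Prim f (map Numeral rs)) (Numeral (f rs))"
| "redex (Ifz (Numeral r) M N) (if r = 0 then M else N)"
| "redex (LetIn (Numeral r) M) (subst M 0 (Numeral r))"
| "redex (Fix M) (App M (Fix M))"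

datatype ectx =
    Hole
  | AppC ectx "real tm"
  | IfzC ectx "real tm" "real tm"
  | LetC ectx "real tm"
  | PrimC "real list \<Rightarrow> real" "real list" ectx "real tm list"

primrec fill :: "ectx \<Rightarrow> real tm \<Rightarrow> real tm" where
  "fill Hole R = R"
| "fill (AppC E M) R = App (fill E R) M"
| "fill (IfzC E M N) R = Ifz (fill E R) M N"
| "fill (LetC E N) R = LetIn (fill E R) N"
| "fill (PrimC f rs E Ms) R = Prim f (map Numeral rs @ fill E R # Ms)"

definition red :: "real tm \<Rightarrow> real tm set \<Rightarrow> ennreal" where
  "red M U =
    (if \<exists>E. M = fill E Sample then
       emeasure lborel {r \<in> {0..1}. fill (THE E. M = fill E Sample) (Numeral r) \<in> U}
     else if \<exists>E R N. M = fill E R \<and> redex R N then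
       indicator U (THE M'. \<exists>E R N. M = fill E R \<and> redex R N \<and> M' = fill E N)
     else indicator U M)"

text \<open>The labels of the numeral leaves, from left to right.\<close>

primrec labels :: "'r tm \<Rightarrow> 'r list" where
  "labels (Var i) = []"
| "labels (Lam A M) = labels M"
| "labels (App M N) = labels M @ labels N"
| "labels (Fix M) = labels M"
| "labels (Numeral r) = [r]"
| "labels (Prim f Ms) = concat (map labels Ms)"
| "labels (Ifz L M N) = labels L @ labels M @ labels N"
| "labels Sample = []"
| "labels (LetIn M N) = labels M @ labels N"

definition skeletons :: "nat \<Rightarrow> nat tm set" where
  "skeletons n = {T. labels T = [0..<n]}"

definition Terms :: "signature \<Rightarrow> ty list \<Rightarrow> ty \<Rightarrow> real tm measure" where
  "Terms F \<Gamma> A = sigma {M. typing F \<Gamma> M A}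
     {U. U \<subseteq> {M. typing F \<Gamma> M A} \<and>
         (\<forall>n. \<forall>T\<in>skeletons n. {x \<in> space (Rn n). map_tm x T \<in> U} \<in> sets (Rn n))}"

text \<open>\<open>Red_iter F \<Gamma> A n M\<close> is the measure \<open>Red\<^sup>n\<^sup>+\<^sup>1(M, _)\<close> on the terms of type \<open>A\<close> in context \<open>\<Gamma>\<close>.\<close>

primrec Red_iter :: "signature \<Rightarrow> ty list \<Rightarrow> ty \<Rightarrow> nat \<Rightarrow> real tm \<Rightarrow> real tm measure" where
  "Red_iter F \<Gamma> A 0 M =
     measure_of (space (Terms F \<Gamma> A)) (sets (Terms F \<Gamma> A)) (red M)"
| "Red_iter F \<Gamma> A (Suc n) M =
     measure_of (space (Terms F \<Gamma> A)) (sets (Terms F \<Gamma> A))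
       (\<lambda>U. \<integral>\<^sup>+ t. red t U \<partial>Red_iter F \<Gamma> A n M)"

definition Red_inf :: "signature \<Rightarrow> ty list \<Rightarrow> ty \<Rightarrow> real tm \<Rightarrow> real tm set \<Rightarrow> ennreal" where
  "Red_inf F \<Gamma> A M U = (SUP n. emeasure (Red_iter F \<Gamma> A n M) U)"


section \<open>Measurable cones\<close>

text \<open>\<open>tests P n\<close> is the set of measurability tests of arity \<open>n\<close>; only the values of a test at
  parameters in \<open>space (Rn n)\<close> and at elements of the cone matter.\<close>

record 'a mcone =
  carr :: "'a set"
  add :: "'a \<Rightarrow> 'a \<Rightarrow> 'a"
  zero :: "'a"
  scale :: "real \<Rightarrow> 'a \<Rightarrow> 'a"
  cnorm :: "'a \<Rightarrow> real"
  tests :: "nat \<Rightarrow> ((nat \<Rightarrow> real) \<Rightarrow> 'a \<Rightarrow> real) set"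

definition unit_ball :: "'a mcone \<Rightarrow> 'a set" where
  "unit_ball P = {x \<in> carr P. cnorm P x \<le> 1}"

definition cone_le :: "'a mcone \<Rightarrow> 'a \<Rightarrow> 'a \<Rightarrow> bool" where
  "cone_le P x x' \<longleftrightarrow> x \<in> carr P \<and> (\<exists>y\<in>carr P. x' = add P x y)"

definition cone_is_lub :: "'a mcone \<Rightarrow> 'a set \<Rightarrow> 'a \<Rightarrow> bool" where
  "cone_is_lub P X l \<longleftrightarrow> l \<in> carr P \<and> (\<forall>x\<in>X. cone_le P x l) \<and>
     (\<forall>b\<in>carr P. (\<forall>x\<in>X. cone_le P x b) \<longrightarrow> cone_le P l b)"

definition cone_lub :: "'a mcone \<Rightarrow> 'a set \<Rightarrow> 'a" where
  "cone_lub P X = (THE l. cone_is_lub P X l)"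

definition csum :: "'a mcone \<Rightarrow> 'a list \<Rightarrow> 'a" where
  "csum P xs = foldr (add P) xs (zero P)"

text \<open>The families \<open>(u\<^sub>i)\<^sub>i\<^sub><\<^sub>n\<close> are lists; \<open>List.subseqs us\<close> lists the subfamilies \<open>(u\<^sub>i)\<^sub>i\<^sub>\<in>\<^sub>I\<close>, one entry for
  each set of positions \<open>I\<close> (so with \<open>2\<^sup>n\<close> entries, even when some \<open>u\<^sub>i\<close> coincide).\<close>

definition pre_stable :: "'a mcone \<Rightarrow> 'b mcone \<Rightarrow> ('a \<Rightarrow> 'b) \<Rightarrow> bool" where
  "pre_stable P Q f \<longleftrightarrow>
    (\<forall>x us. x \<in> carr P \<longrightarrow> set us \<subseteq> carr P \<longrightarrow> add P x (csum P us) \<in> unit_ball P \<longrightarrow>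
      cone_le Q
        (csum Q [f (add P x (csum P vs)). vs \<leftarrow> List.subseqs us, odd (length us + length vs)])
        (csum Q [f (add P x (csum P vs)). vs \<leftarrow> List.subseqs us, even (length us + length vs)]))"

text \<open>Completeness and Scott-continuity refer to non-decreasing sequences.\<close>

definition scott_continuous :: "'a mcone \<Rightarrow> 'b mcone \<Rightarrow> ('a \<Rightarrow> 'b) \<Rightarrow> bool" where
  "scott_continuous P Q f \<longleftrightarrow>
    (\<forall>X l. (\<forall>n. X n \<in> unit_ball P \<and> cone_le P (X n) (X (Suc n))) \<longrightarrow> l \<in> unit_ball P \<longrightarrow>
      cone_is_lub P (range X) l \<longrightarrow> cone_is_lub Q (range (\<lambda>n::nat. f (X n))) (f l))"

definition paths :: "'a mcone \<Rightarrow> nat \<Rightarrow> ((nat \<Rightarrow> real) \<Rightarrow> 'a) set" where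
  "paths P n = {\<gamma>. (\<forall>s\<in>space (Rn n). \<gamma> s \<in> carr P) \<and>
     (\<exists>c. \<forall>s\<in>space (Rn n). cnorm P (\<gamma> s) \<le> c) \<and>
     (\<forall>k. \<forall>m\<in>tests P k. (\<lambda>(r, s). m r (\<gamma> s)) \<in> borel_measurable (Rn k \<Otimes>\<^sub>M Rn n))}"

definition unit_paths :: "'a mcone \<Rightarrow> nat \<Rightarrow> ((nat \<Rightarrow> real) \<Rightarrow> 'a) set" where
  "unit_paths P n = {\<gamma> \<in> paths P n. \<forall>s\<in>space (Rn n). \<gamma> s \<in> unit_ball P}"

definition measurable_fun :: "'a mcone \<Rightarrow> 'b mcone \<Rightarrow> ('a \<Rightarrow> 'b) \<Rightarrow> bool" where
  "measurable_fun P Q f \<longleftrightarrow> (\<forall>n. \<forall>\<gamma>\<in>unit_paths P n. (\<lambda>s. f (\<gamma> s)) \<in> paths Q n)"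

text \<open>The cone \<open>P \<Rightarrow> Q\<close>: bounded measurable stable maps, defined on the unit ball of \<open>P\<close> (and
  \<^term>\<open>undefined\<close> outside it); its unit ball consists of the maps sending the unit ball of \<open>P\<close> to
  that of \<open>Q\<close>, that is, of the morphisms.\<close>

definition fun_cone :: "'a mcone \<Rightarrow> 'b mcone \<Rightarrow> ('a \<Rightarrow> 'b) mcone" where
  "fun_cone P Q = \<lparr>
     carr = {f \<in> unit_ball P \<rightarrow>\<^sub>E carr Q. (\<exists>c. \<forall>x\<in>unit_ball P. cnorm Q (f x) \<le> c) \<and>
       pre_stable P Q f \<and> scott_continuous P Q f \<and> measurable_fun P Q f},
     add = (\<lambda>f g. \<lambda>x\<in>unit_ball P. add Q (f x) (g x)),
     zero = (\<lambda>x\<in>unit_ball P. zero Q),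
     scale = (\<lambda>c f. \<lambda>x\<in>unit_ball P. scale Q c (f x)),
     cnorm = (\<lambda>f. SUP x\<in>unit_ball P. cnorm Q (f x)),
     tests = (\<lambda>n. {\<lambda>r f. m r (f (\<gamma> r)) | \<gamma> m. \<gamma> \<in> unit_paths P n \<and> m \<in> tests Q n}) \<rparr>"

definition finite_borel_measures :: "real measure set" where
  "finite_borel_measures = {\<mu>. sets \<mu> = sets borel \<and> finite_measure \<mu>}"

definition add_measure :: "real measure \<Rightarrow> real measure \<Rightarrow> real measure" where
  "add_measure \<mu> \<nu> = measure_of UNIV (sets borel) (\<lambda>U. emeasure \<mu> U + emeasure \<nu> U)"

definition meas_cone :: "real measure mcone" where
  "meas_cone = \<lparr>
     carr = finite_borel_measures,
     add = add_measure,
     zero = null_measure borel,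
     scale = (\<lambda>c. scale_measure (ennreal c)),
     cnorm = (\<lambda>\<mu>. measure \<mu> UNIV),
     tests = (\<lambda>n. {\<lambda>r \<mu>. measure \<mu> U | U. U \<in> sets borel}) \<rparr>"

definition transport :: "('a \<Rightarrow> 'b) \<Rightarrow> ('b \<Rightarrow> 'a) \<Rightarrow> 'a mcone \<Rightarrow> 'b mcone" where
  "transport e d P = \<lparr>
     carr = e ` carr P,
     add = (\<lambda>x y. e (add P (d x) (d y))),
     zero = e (zero P),
     scale = (\<lambda>c x. e (scale P c (d x))),
     cnorm = (\<lambda>x. cnorm P (d x)),
     tests = (\<lambda>n. {\<lambda>r x. m r (d x) | m. m \<in> tests P n}) \<rparr>"


section \<open>Denotational semantics\<close>

text \<open>
  The cones \<open>\<lbrakk>A\<rbrakk>\<close>, for \<open>A\<close> ranging over all PPCF types, have no common HOL type: they may be as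
  large as the finite iterates of the power set of \<open>\<real>\<close>, and HOL has no type containing all of these.
  Only finitely many types occur in a given term, however, so we code the elements of the cones
  involved into a type \<open>'v\<close> that is large enough for them. A \<open>'v universe\<close> provides maps coding
  finite Borel measures and functions; \<open>\<lbrakk>A\<rbrakk>\<close> is then the cone of measures (for the type of reals) or
  the function cone (for an arrow type), transported along these maps. \<open>faithful V A\<close> says that the
  coding is injective, with the given decoding as left inverse, on the cones of \<open>A\<close> and of its
  subformulas, so that \<open>ty_cone V A\<close> is isomorphic to \<open>\<lbrakk>A\<rbrakk>\<close>. Such universes exist for types \<open>A\<close> of any
  bounded depth, see the end of this theory.
\<close>

record 'v universe =
  enc_meas :: "real measure \<Rightarrow> 'v"
  dec_meas :: "'v \<Rightarrow> real measure"
  enc_fun :: "('v \<Rightarrow> 'v) \<Rightarrow> 'v"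
  dec_fun :: "'v \<Rightarrow> 'v \<Rightarrow> 'v"

primrec ty_cone :: "'v universe \<Rightarrow> ty \<Rightarrow> 'v mcone" where
  "ty_cone V RealT = transport (enc_meas V) (dec_meas V) meas_cone"
| "ty_cone V (A \<rightarrow> B) =
     transport (enc_fun V) (dec_fun V) (fun_cone (ty_cone V A) (ty_cone V B))"

primrec faithful :: "'v universe \<Rightarrow> ty \<Rightarrow> bool" where
  "faithful V RealT \<longleftrightarrow> (\<forall>\<mu>\<in>carr meas_cone. dec_meas V (enc_meas V \<mu>) = \<mu>)"
| "faithful V (A \<rightarrow> B) \<longleftrightarrow> faithful V A \<and> faithful V B \<and>
     (\<forall>f\<in>carr (fun_cone (ty_cone V A) (ty_cone V B)). dec_fun V (enc_fun V f) = f)"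

text \<open>
  \<open>sem V M \<Gamma> g\<close> is \<open>\<lbrakk>M\<rbrakk> g\<close> for \<open>M\<close> a term in context \<open>\<Gamma>\<close> and \<open>g\<close> in the unit ball of \<open>\<lbrakk>\<Gamma>\<rbrakk>\<close>, a tuple of
  elements of the unit balls of the components, as a list.
\<close>

primrec sem :: "'v universe \<Rightarrow> real tm \<Rightarrow> ty list \<Rightarrow> 'v list \<Rightarrow> 'v" where
  "sem V (Var i) \<Gamma> g = g ! i"
| "sem V (Lam A M) \<Gamma> g =
     enc_fun V (\<lambda>a\<in>unit_ball (ty_cone V A). sem V M (A # \<Gamma>) (a # g))"
| "sem V (App M N) \<Gamma> g = dec_fun V (sem V M \<Gamma> g) (sem V N \<Gamma> g)"
| "sem V (Fix M) \<Gamma> g =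
     (let C = ty_cone V (type_of (Fix M) \<Gamma>)
      in cone_lub C (range (\<lambda>n. (dec_fun V (sem V M \<Gamma> g) ^^ n) (zero C))))"
| "sem V (Numeral r) \<Gamma> g = enc_meas V (return borel r)"
| "sem V (Prim f Ms) \<Gamma> g =
     (let \<mu>s = map (dec_meas V) (map (\<lambda>M. sem V M \<Gamma> g) Ms); n = length Ms
      in enc_meas V (distr (\<Pi>\<^sub>M i\<in>{..<n}. \<mu>s ! i) borel (\<lambda>x. f (map x [0..<n]))))"
| "sem V (Ifz L M N) \<Gamma> g =
     (let l = dec_meas V (sem V L \<Gamma> g)
      in enc_meas V (add_measure
           (scale_measure (emeasure l {0}) (dec_meas V (sem V M \<Gamma> g)))
           (scale_measure (emeasure l (UNIV - {0})) (dec_meas V (sem V N \<Gamma> g)))))"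
| "sem V Sample \<Gamma> g = enc_meas V (density lborel (indicator {0..1}))"
| "sem V (LetIn M N) \<Gamma> g =
     enc_meas V (measure_of UNIV (sets borel)
       (\<lambda>U. \<integral>\<^sup>+ r. emeasure (dec_meas V (sem V N (RealT # \<Gamma>) (enc_meas V (return borel r) # g))) U
            \<partial>dec_meas V (sem V M \<Gamma> g)))"

definition denotation :: "'v universe \<Rightarrow> real tm \<Rightarrow> real measure" where
  "denotation V M = dec_meas V (sem V M [] [])"


section \<open>Existence of universes\<close>

text \<open>
  \<open>large e g k\<close> makes \<open>'v\<close> large enough for all PPCF types of depth at most \<open>k\<close>. The type of real
  measures is large enough for depth \<open>0\<close>, and if \<open>'v\<close> is large enough for depth \<open>k\<close>, then
  \<open>'v + ('v \<rightharpoonup> 'v)\<close> is large enough for depth \<open>k + 1\<close>. Hence the hypothesis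
  \<open>\<forall>A\<in>types_in M []. faithful V A\<close> is satisfiable for every term \<open>M\<close>, at a suitable type \<open>'v\<close>.
\<close>

primrec depth :: "ty \<Rightarrow> nat" where
  "depth RealT = 0"
| "depth (A \<rightarrow> B) = Suc (max (depth A) (depth B))"

definition maps_in :: "'v set \<Rightarrow> ('v \<rightharpoonup> 'v) set" where
  "maps_in X = {m. dom m \<subseteq> X \<and> ran m \<subseteq> X}"

definition large :: "(real measure \<Rightarrow> 'v) \<Rightarrow> (('v \<rightharpoonup> 'v) \<Rightarrow> 'v) \<Rightarrow> nat \<Rightarrow> bool" where
  "large e g k \<longleftrightarrow> (\<exists>X. (\<forall>i<k. X i \<subseteq> X (Suc i)) \<and>
     inj_on e finite_borel_measures \<and> e ` finite_borel_measures \<subseteq> X 0 \<and>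
     inj_on g (\<Union>i<k. maps_in (X i)) \<and> (\<forall>i<k. g ` maps_in (X i) \<subseteq> X (Suc i)))"

lemma large_real_measure: "large (\<lambda>\<mu>. \<mu>) g 0"
  unfolding large_def by auto

lemma large_step:
  fixes e :: "real measure \<Rightarrow> 'v"
  assumes "large e g k"
  shows "\<exists>g'. large (\<lambda>\<mu>. Inl (e \<mu>) :: 'v + ('v \<rightharpoonup> 'v)) g' (Suc k)"
proof -
  obtain X where X: "\<forall>i<k. X i \<subseteq> X (Suc i)"
    and e: "inj_on e finite_borel_measures" "e ` finite_borel_measures \<subseteq> X 0"
    and g: "inj_on g (\<Union>i<k. maps_in (X i))" "\<forall>i<k. g ` maps_in (X i) \<subseteq> X (Suc i)"
    using assms unfolding large_def by auto
  define p :: "('v + ('v \<rightharpoonup> 'v) \<rightharpoonup> 'v + ('v \<rightharpoonup> 'v)) \<Rightarrow> ('v \<rightharpoonup> 'v)"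
    where "p m = (\<lambda>v. map_option projl (m (Inl v)))" for m
  define W :: "('v + ('v \<rightharpoonup> 'v) \<rightharpoonup> 'v + ('v \<rightharpoonup> 'v)) set" where "W = maps_in (range Inl)"
  have p_inj: "inj_on p W"
  proof (rule inj_onI)
    fix m m' assume m: "m \<in> W" and m': "m' \<in> W" and eq: "p m = p m'"
    show "m = m'"
    proof
      fix w
      show "m w = m' w"
      proof (cases w)
        case (Inl v)
        have *: "map_option projl (m w) = map_option projl (m' w)"
          using fun_cong[OF eq, of v] by (simp add: p_def Inl)
        have "\<forall>y. m w = Some y \<longrightarrow> y \<in> range Inl" "\<forall>y. m' w = Some y \<longrightarrow> y \<in> range Inl"
          using m m' by (auto simp: W_def maps_in_def ran_def)
        with * show ?thesis by (cases "m w"; cases "m' w") auto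
      next
        case (Inr b)
        then have "w \<notin> dom m" "w \<notin> dom m'"
          using m m' by (auto simp: W_def maps_in_def)
        then show ?thesis by (simp add: domIff)
      qed
    qed
  qed
  have p_maps: "p m \<in> maps_in S" if m: "m \<in> maps_in (Inl ` S)" for m S
  proof -
    have "v \<in> S" if "v \<in> dom (p m)" for v
    proof -
      from that have "Inl v \<in> dom m" by (auto simp: p_def)
      with m show ?thesis by (auto simp: maps_in_def)
    qed
    moreover have "v \<in> S" if "v \<in> ran (p m)" for v
    proof -
      from that obtain u w where "m (Inl u) = Some w" "v = projl w"
        by (auto simp: p_def ran_def)
      with m show ?thesis by (auto simp: maps_in_def ran_def)
    qed
    ultimately show ?thesis by (auto simp: maps_in_def)
  qed
  define L :: "('v + ('v \<rightharpoonup> 'v) \<rightharpoonup> 'v + ('v \<rightharpoonup> 'v)) set"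
    where "L = (\<Union>i<k. maps_in (Inl ` X i))"
  define g' where "g' m = (if m \<in> L then Inl (g (p m)) else Inr (p m))" for m
  define Y :: "nat \<Rightarrow> ('v + ('v \<rightharpoonup> 'v)) set"
    where "Y i = (if i \<le> k then Inl ` X i else UNIV)" for i
  have YW: "(\<Union>i<Suc k. maps_in (Y i)) \<subseteq> W"
  proof -
    have "maps_in (Y i) \<subseteq> W" if "i < Suc k" for i
    proof -
      have "Y i \<subseteq> range Inl" using that by (auto simp: Y_def)
      then show ?thesis unfolding W_def maps_in_def by blast
    qed
    then show ?thesis by blast
  qed
  have pL: "p m \<in> (\<Union>i<k. maps_in (X i))" if m: "m \<in> L" for m
  proof -
    from m obtain i where "i < k" "m \<in> maps_in (Inl ` X i)" unfolding L_def by blast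
    with p_maps[of m "X i"] show ?thesis by blast
  qed
  have "inj_on g' (\<Union>i<Suc k. maps_in (Y i))"
  proof (rule inj_onI)
    fix m m' assume "m \<in> (\<Union>i<Suc k. maps_in (Y i))" "m' \<in> (\<Union>i<Suc k. maps_in (Y i))"
      and eq: "g' m = g' m'"
    then have mm: "m \<in> W" "m' \<in> W" using YW by blast+
    have "p m = p m'"
    proof (cases "m \<in> L \<and> m' \<in> L")
      case True
      with eq have "g (p m) = g (p m')" by (simp add: g'_def)
      with True show ?thesis using inj_onD[OF g(1) _ pL pL, of m m'] by simp
    next
      case False
      with eq show ?thesis by (simp add: g'_def split: if_splits)
    qed
    with p_inj mm show "m = m'" by (auto dest: inj_onD)
  qed
  moreover have "g' m \<in> Y (Suc i)" if "i < Suc k" "m \<in> maps_in (Y i)" for i m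
  proof (cases "i < k")
    case True
    with that have m: "m \<in> maps_in (Inl ` X i)" by (simp add: Y_def)
    with True have "m \<in> L" by (auto simp: L_def)
    moreover from p_maps[OF m] g(2) True have "g (p m) \<in> X (Suc i)" by blast
    ultimately show ?thesis using True by (simp add: g'_def Y_def)
  next
    case False
    with that show ?thesis by (simp add: Y_def)
  qed
  moreover have "\<forall>i<Suc k. Y i \<subseteq> Y (Suc i)"
    using X by (simp add: Y_def less_Suc_eq image_mono)
  moreover have "inj_on (\<lambda>\<mu>. Inl (e \<mu>) :: 'v + ('v \<rightharpoonup> 'v)) finite_borel_measures"
    using e(1) by (auto simp: inj_on_def)
  moreover have "(\<lambda>\<mu>. Inl (e \<mu>) :: 'v + ('v \<rightharpoonup> 'v)) ` finite_borel_measures \<subseteq> Y 0"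
    using e(2) by (auto simp: Y_def)
  ultimately show ?thesis
    unfolding large_def by blast
qed

lemma large_faithful:
  fixes e :: "real measure \<Rightarrow> 'v"
  assumes "large e g k"
  shows "\<exists>V :: 'v universe. \<forall>A. depth A \<le> k \<longrightarrow> faithful V A"
proof -
  obtain X where X: "\<forall>i<k. X i \<subseteq> X (Suc i)"
    and e: "inj_on e finite_borel_measures" "e ` finite_borel_measures \<subseteq> X 0"
    and g: "inj_on g (\<Union>i<k. maps_in (X i))" "\<forall>i<k. g ` maps_in (X i) \<subseteq> X (Suc i)"
    using assms unfolding large_def by auto
  have X_mono: "X i \<subseteq> X j" if "i \<le> j" "j \<le> k" for i j
    using that
  proof (induction j rule: dec_induct)
    case base
    show ?case by simp
  next
    case (step j)
    then have "X i \<subseteq> X j" "X j \<subseteq> X (Suc j)" using X by simp_all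
    then show ?case by (rule subset_trans)
  qed
  define q :: "('v \<Rightarrow> 'v) \<Rightarrow> ('v \<rightharpoonup> 'v)"
    where "q f = (\<lambda>v. if f v = undefined then None else Some (f v))" for f
  have q_inj: "f = f'" if "q f = q f'" for f f'
  proof
    fix v
    show "f v = f' v"
      using fun_cong[OF that, of v] by (auto simp: q_def split: if_splits)
  qed
  define H where "H = {f. \<exists>i<k. q f \<in> maps_in (X i)}"
  define enc where "enc f = g (q f)" for f
  have enc_inj: "inj_on enc H"
  proof (rule inj_onI)
    fix f f' assume "f \<in> H" "f' \<in> H" "enc f = enc f'"
    then have "q f = q f'"
      using inj_onD[OF g(1), of "q f" "q f'"] by (auto simp: H_def enc_def)
    then show "f = f'" by (rule q_inj)
  qed
  define V where "V = \<lparr>enc_meas = e, dec_meas = inv_into finite_borel_measures e,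
    enc_fun = enc, dec_fun = inv_into H enc\<rparr>"
  have "faithful V A \<and> carr (ty_cone V A) \<subseteq> X (depth A)" if "depth A \<le> k" for A
    using that
  proof (induction A)
    case RealT
    show ?case
      using e by (auto simp: V_def meas_cone_def transport_def)
  next
    case (FunT A B)
    define i where "i = max (depth A) (depth B)"
    have i: "i < k" "depth A \<le> i" "depth B \<le> i"
      using FunT.prems by (auto simp: i_def)
    have IH: "faithful V A" "faithful V B"
      "carr (ty_cone V A) \<subseteq> X i" "carr (ty_cone V B) \<subseteq> X i"
      using FunT.IH i X_mono[of "depth A" i] X_mono[of "depth B" i] by auto
    have q: "q f \<in> maps_in (X i)" if "f \<in> carr (fun_cone (ty_cone V A) (ty_cone V B))" for f
    proof -
      from that have f: "f \<in> unit_ball (ty_cone V A) \<rightarrow>\<^sub>E carr (ty_cone V B)"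
        by (simp add: fun_cone_def)
      have "v \<in> X i \<and> f v \<in> X i" if "f v \<noteq> undefined" for v
      proof -
        from that f have "v \<in> unit_ball (ty_cone V A)" by (meson PiE_arb)
        with f IH show ?thesis by (auto simp: unit_ball_def dest: PiE_mem)
      qed
      then show ?thesis
        by (auto simp: maps_in_def q_def dom_def ran_def split: if_splits)
    qed
    have "dec_fun V (enc_fun V f) = f"
      if "f \<in> carr (fun_cone (ty_cone V A) (ty_cone V B))" for f
    proof -
      from q[OF that] i have "f \<in> H" by (auto simp: H_def)
      with enc_inj show ?thesis by (simp add: V_def)
    qed
    moreover have "enc_fun V f \<in> X (Suc i)"
      if "f \<in> carr (fun_cone (ty_cone V A) (ty_cone V B))" for f
      using q[OF that] g(2) i(1) by (auto simp: V_def enc_def)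
    ultimately show ?case
      using IH by (auto simp: transport_def i_def)
  qed
  then show ?thesis by blast
qed

end

theory Submission
  imports Defs
begin

text \<open>Each cone is equipped with a set of additive functionals to \<open>\<real>\<^sub>\<ge>\<^sub>0\<close> that determines the cone order and
  the least upper bounds of bounded increasing sequences, so that the order theory of cones reduces to
  real numbers. A family indexed by the subsets of a finite set is a cube if every functional turns it
  into a family with nonnegative Moebius coefficients. A map is pre-stable if and only if it preserves
  cubes, and preservation of cubes, of convergent chains and of measurable paths passes through every
  term constructor; a function is measured by the functionals
  \<open>f \<mapsto> \<Sum>\<^sub>I (-1)\<^bsup>|N| - |I|\<^esup> \<sigma> (f (\<phi> I))\<close>, one for each cube \<open>\<phi>\<close> and functional \<open>\<sigma>\<close>.

  For the upper bound on \<open>Red\<close>, one reduction step preserves the integrals of the denotation once the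
  sampled value is averaged out. For the lower bound, a logical relation between terms and denotations
  says at type \<open>real\<close> that the integral of \<open>h\<close> against the denotation is at most the supremum of the
  expectations of \<open>h\<close> on the numerals reached within \<open>n\<close> steps. It is closed under limits of chains,
  which gives the case of \<open>fix\<close>.\<close>

section \<open>Moebius coefficients of families of reals\<close>

text \<open>The order of \<open>P \<Rightarrow> Q\<close> is the stable order:
  \<open>f \<le> g\<close> means that \<open>g - f\<close> exists and is again pre-stable, which is
  stronger than pointwise comparison. Evaluations at points, which is all that the tests of
  \<open>fun_cone\<close> see, cannot express this. Functionals along cubes can, since pre-stability
  of the difference says that its Moebius coefficients along cubes are nonnegative; hence
  functionals are kept apart from tests. Codings are inverted only on the carriers, so beta,
  unfolding of \<open>fix\<close> and integration under \<open>let\<close> presuppose that the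
  denotations involved are morphisms. The preservation properties therefore come before any
  comparison with reduction. Currying combines two cubes into one over a disjoint union, so index
  sets are taken in a type that contains such unions, the sets of natural numbers. On the
  operational side the draw is separated from the reduction: a deterministic \<open>step\<close>
  takes the sampled value as an argument, and the kernel is the image of the uniform law under it,
  so that iterated reduction becomes iterated integration.\<close>

definition moebius :: "'i set \<Rightarrow> ('i set \<Rightarrow> real) \<Rightarrow> real" where
  "moebius N \<phi> = (\<Sum>I\<in>Pow N. (-1) ^ (card N - card I) * \<phi> I)"

text \<open>Equivalently, all finite differences of \<open>\<phi>\<close> are nonnegative: these are
  the totally monotone set functions. Stated through coefficients \<open>m\<close>, the closure
  properties become bookkeeping about the set at which each weight sits.\<close>

definition rcube :: "'i set \<Rightarrow> ('i set \<Rightarrow> real) \<Rightarrow> bool" where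
  "rcube N \<phi> \<longleftrightarrow> (\<exists>m. (\<forall>J\<subseteq>N. 0 \<le> m J) \<and> (\<forall>I\<subseteq>N. \<phi> I = sum m (Pow I)))"

lemma moebius_cong: "(\<And>I. I \<subseteq> N \<Longrightarrow> \<phi> I = \<psi> I) \<Longrightarrow> moebius N \<phi> = moebius N \<psi>"
  unfolding moebius_def by (rule sum.cong) auto

lemma moebius_add: "moebius N (\<lambda>I. \<phi> I + \<psi> I) = moebius N \<phi> + moebius N \<psi>"
  by (simp add: moebius_def algebra_simps sum.distrib)

lemma moebius_diff: "moebius N (\<lambda>I. \<phi> I - \<psi> I) = moebius N \<phi> - moebius N \<psi>"
  by (simp add: moebius_def algebra_simps sum_subtractf)

lemma moebius_zero: "moebius N (\<lambda>I. 0) = 0"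
  by (simp add: moebius_def)

lemma moebius_empty: "moebius {} \<phi> = \<phi> {}"
  by (simp add: moebius_def)

lemma moebius_single: "moebius {a} \<phi> = \<phi> {a} - \<phi> {}"
proof -
  have "moebius {a} \<phi> = (\<Sum>I\<in>{{}, {a}}. (-1) ^ (card {a} - card I) * \<phi> I)"
    unfolding moebius_def by (rule sum.cong) auto
  then show ?thesis by simp
qed

lemma tendsto_moebius:
  assumes "\<And>I. I \<subseteq> N \<Longrightarrow> (\<lambda>n. \<phi> n I) \<longlonglongrightarrow> \<psi> I"
  shows "(\<lambda>n. moebius N (\<phi> n)) \<longlonglongrightarrow> moebius N \<psi>"
  unfolding moebius_def by (intro tendsto_sum tendsto_mult tendsto_const assms) auto

text \<open>Moebius inversion on the Boolean lattice. The symmetric form of inclusion-exclusion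
  carries a sign \<open>(-1) ^ card T\<close> in both directions, so the two signs are first merged
  into \<open>(-1) ^ (card J - card T)\<close>.\<close>

lemma sum_moebius_Pow:
  assumes "finite I"
  shows "(\<Sum>J\<in>Pow I. moebius J \<phi>) = \<phi> I"
proof -
  define g where "g S = (\<Sum>T\<in>Pow S. (-1) ^ card T * \<phi> T)" for S
  have "(-1) ^ card J * g J = moebius J \<phi>" if "J \<in> Pow I" for J
  proof -
    have "finite J" using that assms finite_subset by auto
    have "(-1::real) ^ card J * (-1) ^ card T = (-1) ^ (card J - card T)" if "T \<in> Pow J" for T
    proof -
      have "card T \<le> card J" using that \<open>finite J\<close> by (auto intro: card_mono)
      then obtain d where "card J = card T + d" using le_Suc_ex by blast
      then show ?thesis
        by (simp add: power_add mult.assoc flip: power_mult_distrib)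
    qed
    then show ?thesis
      unfolding g_def moebius_def sum_distrib_left
      by (intro sum.cong refl) (simp flip: mult.assoc)
  qed
  moreover have "\<phi> I = (\<Sum>T\<in>Pow I. (-1) ^ card T * g T)"
    by (rule inclusion_exclusion_symmetric) (simp_all add: g_def assms)
  ultimately show ?thesis by simp
qed

text \<open>The other half of the inversion: coefficients in a representation by sums over subsets
  are unique, so nonnegativity can be read off from any such representation.\<close>

lemma moebius_sum_Pow:
  assumes "finite N" "\<And>I. I \<subseteq> N \<Longrightarrow> \<phi> I = sum m (Pow I)"
  shows "moebius N \<phi> = m N"
proof -
  have "m N = (\<Sum>T\<in>Pow N. (-1) ^ (card N - card T) * sum m (Pow T))"
    by (rule inclusion_exclusion_mobius) (simp_all add: assms)
  also have "\<dots> = moebius N \<phi>"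
    unfolding moebius_def by (intro sum.cong refl) (simp add: assms)
  finally show ?thesis by simp
qed

lemma rcube_iff_moebius:
  assumes "finite N"
  shows "rcube N \<phi> \<longleftrightarrow> (\<forall>J\<subseteq>N. 0 \<le> moebius J \<phi>)"
proof
  assume "rcube N \<phi>"
  then obtain m where m: "\<forall>J\<subseteq>N. 0 \<le> m J" "\<forall>I\<subseteq>N. \<phi> I = sum m (Pow I)"
    unfolding rcube_def by blast
  have "moebius J \<phi> = m J" if J: "J \<subseteq> N" for J
  proof (rule moebius_sum_Pow)
    show "finite J" by (rule finite_subset[OF J assms])
    show "\<phi> I = sum m (Pow I)" if "I \<subseteq> J" for I
      using m(2) that J by (meson order_trans)
  qed
  with m show "\<forall>J\<subseteq>N. 0 \<le> moebius J \<phi>" by simp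
next
  assume *: "\<forall>J\<subseteq>N. 0 \<le> moebius J \<phi>"
  have "\<forall>I\<subseteq>N. \<phi> I = sum (\<lambda>J. moebius J \<phi>) (Pow I)"
    using sum_moebius_Pow[OF finite_subset[OF _ assms]] by simp
  with * show "rcube N \<phi>" unfolding rcube_def by (intro exI[of _ "\<lambda>J. moebius J \<phi>"] conjI)
qed

lemma rcube_cong: "(\<And>I. I \<subseteq> N \<Longrightarrow> \<phi> I = \<psi> I) \<Longrightarrow> rcube N \<phi> \<longleftrightarrow> rcube N \<psi>"
  by (simp add: rcube_def)

lemma rcube_subset: "rcube N \<phi> \<Longrightarrow> N' \<subseteq> N \<Longrightarrow> rcube N' \<phi>"
  unfolding rcube_def by (meson subset_trans)

lemma rcube_moebius_nonneg: "finite N \<Longrightarrow> rcube N \<phi> \<Longrightarrow> 0 \<le> moebius N \<phi>"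
  by (simp add: rcube_iff_moebius)

lemma rcube_add:
  assumes "finite N" "rcube N \<phi>" "rcube N \<psi>" shows "rcube N (\<lambda>I. \<phi> I + \<psi> I)"
  using assms by (auto simp: rcube_iff_moebius moebius_add)

text \<open>Each coefficient is a fixed finite signed sum, hence continuous in the values, and
  nonnegativity survives the limit.\<close>

lemma rcube_limit:
  assumes "finite N" "\<And>n. rcube N (\<phi> n)" "\<And>I. I \<subseteq> N \<Longrightarrow> (\<lambda>n. \<phi> n I) \<longlonglongrightarrow> \<psi> I"
  shows "rcube N \<psi>"
  unfolding rcube_iff_moebius[OF assms(1)]
proof (intro allI impI)
  fix J assume J: "J \<subseteq> N"
  have "(\<lambda>n. moebius J (\<phi> n)) \<longlonglongrightarrow> moebius J \<psi>"
    using J by (intro tendsto_moebius assms(3)) auto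
  moreover have "0 \<le> moebius J (\<phi> n)" for n
    using assms(1,2) J by (simp add: rcube_iff_moebius)
  ultimately show "0 \<le> moebius J \<psi>" by (meson LIMSEQ_le_const)
qed

text \<open>A weight \<open>d s\<close> that is switched on from the set \<open>u s\<close> upwards
  contributes to the single coefficient at \<open>u s\<close>. Several closure properties below
  reduce to finding these sets.\<close>

lemma rcube_sum_le:
  assumes "finite S" "finite N" "\<And>s. s \<in> S \<Longrightarrow> 0 \<le> d s"
  shows "rcube N (\<lambda>I. \<Sum>s\<in>{s\<in>S. u s \<subseteq> I}. d s)"
  unfolding rcube_def
proof (intro exI[of _ "\<lambda>J. \<Sum>s\<in>{s\<in>S. u s = J}. d s"] conjI allI impI)
  fix I assume "I \<subseteq> N"
  then have fin: "finite I" using assms finite_subset by auto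
  have "(\<Sum>s\<in>{s\<in>S. u s \<subseteq> I}. d s) =
    (\<Sum>J\<in>Pow I. \<Sum>s\<in>{s\<in>{s\<in>S. u s \<subseteq> I}. u s = J}. d s)"
    using fin assms by (intro sum.group[symmetric]) auto
  also have "\<dots> = (\<Sum>J\<in>Pow I. \<Sum>s\<in>{s\<in>S. u s = J}. d s)"
    by (intro sum.cong refl) auto
  finally show "(\<Sum>s\<in>{s\<in>S. u s \<subseteq> I}. d s) = (\<Sum>J\<in>Pow I. \<Sum>s\<in>{s\<in>S. u s = J}. d s)" .
qed (use assms in \<open>auto intro: sum_nonneg\<close>)

text \<open>The coefficient at \<open>s \<subseteq> K\<close> is included as soon as
  \<open>I\<close> contains every \<open>u k\<close> with \<open>k \<in> s\<close>, so its weight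
  moves to the union of these sets.\<close>

lemma rcube_image:
  assumes "finite K" "finite N" "rcube K h"
  shows "rcube N (\<lambda>I. h {k\<in>K. u k \<subseteq> I})"
proof -
  obtain m where m: "\<forall>J\<subseteq>K. 0 \<le> m J" "\<forall>I\<subseteq>K. h I = sum m (Pow I)"
    using assms unfolding rcube_def by blast
  have "h {k\<in>K. u k \<subseteq> I} = (\<Sum>s\<in>{s\<in>Pow K. (\<Union>k\<in>s. u k) \<subseteq> I}. m s)" for I
  proof -
    have "Pow {k\<in>K. u k \<subseteq> I} = {s\<in>Pow K. (\<Union>k\<in>s. u k) \<subseteq> I}" by auto
    then show ?thesis using m(2)[rule_format, of "{k\<in>K. u k \<subseteq> I}"] by auto
  qed
  then show ?thesis using assms m by (simp only:) (intro rcube_sum_le; auto)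
qed

text \<open>Product of two expansions: the pair \<open>(J, K)\<close> is switched on at
  \<open>J \<union> K\<close>.\<close>

lemma rcube_bilinear:
  assumes "finite N" "\<And>J K. J \<subseteq> N \<Longrightarrow> K \<subseteq> N \<Longrightarrow> 0 \<le> d J K"
    "\<And>I. I \<subseteq> N \<Longrightarrow> \<phi> I = (\<Sum>J\<in>Pow I. \<Sum>K\<in>Pow I. d J K)"
  shows "rcube N \<phi>"
proof -
  have "rcube N (\<lambda>I. \<Sum>s\<in>{s\<in>Pow N \<times> Pow N. fst s \<union> snd s \<subseteq> I}. d (fst s) (snd s))"
    using assms by (intro rcube_sum_le) auto
  moreover have "(\<Sum>s\<in>{s\<in>Pow N \<times> Pow N. fst s \<union> snd s \<subseteq> I}. d (fst s) (snd s)) = \<phi> I"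
    if "I \<subseteq> N" for I
  proof -
    have "{s\<in>Pow N \<times> Pow N. fst s \<union> snd s \<subseteq> I} = Pow I \<times> Pow I"
      using that by auto
    then show ?thesis using assms(3)[OF that] by (simp add: sum.cartesian_product case_prod_beta)
  qed
  ultimately show ?thesis by (simp cong: rcube_cong)
qed

lemma rcube_const: "finite N \<Longrightarrow> 0 \<le> c \<Longrightarrow> rcube N (\<lambda>I. c)"
  using rcube_sum_le[of "{()}" N "\<lambda>_. c" "\<lambda>_. {}"] by simp

text \<open>Expand in the inner index first, then expand each inner coefficient in the outer one.
  This serves families in which one index set moves both a function and its argument.\<close>

lemma rcube_diagonal:
  assumes "finite N" "\<And>J. J \<subseteq> N \<Longrightarrow> rcube N (\<lambda>I. moebius J (c I))"
  shows "rcube N (\<lambda>I. c I I)"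
proof (rule rcube_bilinear[where d="\<lambda>J K. moebius K (\<lambda>I. moebius J (c I))"])
  fix J K assume "J \<subseteq> N" "K \<subseteq> N"
  then show "0 \<le> moebius K (\<lambda>I. moebius J (c I))"
    using assms by (simp add: rcube_iff_moebius)
next
  fix I assume "I \<subseteq> N"
  then have "finite I" using assms finite_subset by auto
  then show "c I I = (\<Sum>J\<in>Pow I. \<Sum>K\<in>Pow I. moebius K (\<lambda>I. moebius J (c I)))"
    by (simp add: sum_moebius_Pow)
qed fact

text \<open>Disjoint unions of index sets are encoded by the even and the odd numbers.\<close>

definition interleave :: "nat set \<Rightarrow> nat set \<Rightarrow> nat set" where
  "interleave A B = (\<lambda>i. 2 * i) ` A \<union> (\<lambda>i. 2 * i + 1) ` B"

definition evens :: "nat set \<Rightarrow> nat set" where "evens K = {i. 2 * i \<in> K}"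
definition odds :: "nat set \<Rightarrow> nat set" where "odds K = {i. 2 * i + 1 \<in> K}"

lemma interleave_even[simp]: "2 * i \<in> interleave A B \<longleftrightarrow> i \<in> A"
  and interleave_odd[simp]: "Suc (2 * i) \<in> interleave A B \<longleftrightarrow> i \<in> B"
  unfolding interleave_def by (auto simp: image_iff; presburger)+

lemma evens_interleave[simp]: "evens (interleave A B) = A"
  and odds_interleave[simp]: "odds (interleave A B) = B"
  by (auto simp: evens_def odds_def)

lemma subset_interleave: "K \<subseteq> interleave A B \<longleftrightarrow> evens K \<subseteq> A \<and> odds K \<subseteq> B"
proof
  assume K: "K \<subseteq> interleave A B"
  show "evens K \<subseteq> A \<and> odds K \<subseteq> B"
    by (auto simp: evens_def odds_def dest!: subsetD[OF K])
next
  assume *: "evens K \<subseteq> A \<and> odds K \<subseteq> B"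
  show "K \<subseteq> interleave A B"
  proof
    fix k assume k: "k \<in> K"
    consider i where "k = 2 * i" | i where "k = 2 * i + 1" by (meson evenE oddE)
    then show "k \<in> interleave A B"
      using k * by cases (auto simp: interleave_def evens_def odds_def)
  qed
qed

lemma finite_interleave[simp]: "finite A \<Longrightarrow> finite B \<Longrightarrow> finite (interleave A B)"
  by (simp add: interleave_def)

text \<open>Currying for cubes. Requiring the odd part of \<open>L\<close> to be all of
  \<open>B\<close> extracts the coefficient in the second variable, and the remaining weights sit at
  the even parts \<open>evens L\<close>.\<close>

lemma rcube_interleave:
  assumes fin: "finite A" "finite B"
    and cube: "rcube (interleave A B) (\<lambda>K. c (evens K) (odds K))"
  shows "rcube A (\<lambda>I. moebius B (c I))"
proof -
  let ?N = "interleave A B"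
  obtain m where m: "\<forall>J\<subseteq>?N. 0 \<le> m J" "\<forall>I\<subseteq>?N. c (evens I) (odds I) = sum m (Pow I)"
    using cube unfolding rcube_def by blast
  have finN: "finite ?N" using fin by simp
  have "moebius B (c I) = (\<Sum>L\<in>{L\<in>{L\<in>Pow ?N. odds L = B}. evens L \<subseteq> I}. m L)" if I: "I \<subseteq> A" for I
  proof -
    have "moebius B (c I) = (\<Sum>L\<in>{L\<in>Pow ?N. odds L = B \<and> evens L \<subseteq> I}. m L)"
    proof (rule moebius_sum_Pow[where m="\<lambda>B'. \<Sum>L\<in>{L\<in>Pow ?N. odds L = B' \<and> evens L \<subseteq> I}. m L"])
      fix J assume J: "J \<subseteq> B"
      have sub: "interleave I J \<subseteq> ?N" using I J by (simp add: subset_interleave)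
      have fin': "finite (interleave I J)" using finN sub finite_subset by auto
      have "c I J = sum m (Pow (interleave I J))"
        using m(2) sub by (metis evens_interleave odds_interleave)
      also have "\<dots> = (\<Sum>B'\<in>Pow J. \<Sum>L\<in>{L\<in>Pow (interleave I J). odds L = B'}. m L)"
        using fin' J fin(2) finite_subset[OF J] by (intro sum.group[symmetric]) (auto simp: subset_interleave)
      also have "\<dots> = (\<Sum>B'\<in>Pow J. \<Sum>L\<in>{L\<in>Pow ?N. odds L = B' \<and> evens L \<subseteq> I}. m L)"
        using I J by (intro sum.cong refl) (auto simp: subset_interleave)
      finally show "c I J = (\<Sum>B'\<in>Pow J. \<Sum>L\<in>{L\<in>Pow ?N. odds L = B' \<and> evens L \<subseteq> I}. m L)" .
    qed (rule fin)
    also have "{L\<in>Pow ?N. odds L = B \<and> evens L \<subseteq> I} = {L\<in>{L\<in>Pow ?N. odds L = B}. evens L \<subseteq> I}"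
      by auto
    finally show ?thesis .
  qed
  moreover have "rcube A (\<lambda>I. \<Sum>L\<in>{L\<in>{L\<in>Pow ?N. odds L = B}. evens L \<subseteq> I}. m L)"
    using fin finN m by (intro rcube_sum_le) auto
  ultimately show ?thesis by (simp cong: rcube_cong)
qed

section \<open>Limits of monotone double sequences\<close>

text \<open>Every entry is at most \<open>c\<close>, and an entry close to \<open>c\<close> is
  dominated by the diagonal from some index on. Monotonicity in both indices takes the place of
  uniform convergence.\<close>

lemma diagonal_limit:
  fixes a :: "nat \<Rightarrow> nat \<Rightarrow> real"
  assumes a1: "\<And>k. incseq (\<lambda>n. a n k)" and a2: "\<And>n. incseq (a n)"
    and b: "\<And>n. a n \<longlonglongrightarrow> b n" "b \<longlonglongrightarrow> c"
  shows "(\<lambda>n. a n n) \<longlonglongrightarrow> c"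
proof (rule LIMSEQ_I)
  fix e :: real assume "0 < e"
  have b_mono: "incseq b"
    by (rule incseq_SucI, rule LIMSEQ_le[OF b(1) b(1)]) (use incseq_SucD[OF a1] in blast)
  have le: "a n k \<le> c" for n k
    using incseq_le[OF a2 b(1)] incseq_le[OF b_mono b(2)] order_trans by blast
  obtain n0 where n0: "c - e < b n0"
    using order_tendstoD(1)[OF b(2), of "c - e"] \<open>0 < e\<close> by (auto simp: eventually_sequentially)
  obtain k0 where k0: "c - e < a n0 k0"
    using order_tendstoD(1)[OF b(1) n0] by (auto simp: eventually_sequentially)
  have "norm (a n n - c) < e" if "max n0 k0 \<le> n" for n
  proof -
    have "a n0 k0 \<le> a n k0" "a n k0 \<le> a n n"
      using a1 a2 that by (auto simp: incseq_def)
    then show ?thesis using le[of n n] k0 by auto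
  qed
  then show "\<exists>no. \<forall>n\<ge>no. norm (a n n - c) < e" by blast
qed

text \<open>Interchange of two suprema. It yields the continuity of a limit of continuous maps and
  of the fixed point operator.\<close>

lemma exchange_limit:
  fixes a :: "nat \<Rightarrow> nat \<Rightarrow> real"
  assumes a1: "\<And>k. incseq (\<lambda>n. a n k)" and a2: "\<And>n. incseq (a n)"
    and b: "\<And>n. a n \<longlonglongrightarrow> b n"
    and d: "\<And>k. (\<lambda>n. a n k) \<longlonglongrightarrow> d k" "d \<longlonglongrightarrow> c"
  shows "b \<longlonglongrightarrow> c"
proof (rule LIMSEQ_I)
  fix e :: real assume "0 < e"
  have b_mono: "incseq b"
    by (rule incseq_SucI, rule LIMSEQ_le[OF b(1) b(1)]) (use incseq_SucD[OF a1] in blast)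
  have d_mono: "incseq d"
    by (rule incseq_SucI, rule LIMSEQ_le[OF d(1) d(1)]) (use incseq_SucD[OF a2] in blast)
  have le: "a n k \<le> c" for n k
    using incseq_le[OF a1 d(1)] incseq_le[OF d_mono d(2)] order_trans by blast
  then have le': "b n \<le> c" for n
    using b by (meson LIMSEQ_le_const2)
  obtain k0 where k0: "c - e < d k0"
    using order_tendstoD(1)[OF d(2), of "c - e"] \<open>0 < e\<close> by (auto simp: eventually_sequentially)
  obtain n0 where n0: "c - e < a n0 k0"
    using order_tendstoD(1)[OF d(1) k0] by (auto simp: eventually_sequentially)
  have "norm (b n - c) < e" if "n0 \<le> n" for n
  proof -
    have "a n0 k0 \<le> b n0" using incseq_le[OF a2 b] .
    also have "\<dots> \<le> b n" using b_mono that by (auto simp: incseq_def)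
    finally show ?thesis using le'[of n] n0 by auto
  qed
  then show "\<exists>no. \<forall>n\<ge>no. norm (b n - c) < e" by blast
qed

section \<open>Cones with separating functionals\<close>

text \<open>\<open>T\<close> carries the order and the limits, the tests of \<open>P\<close> carry
  measurability, and \<open>test_limit\<close> links the two. \<open>test_reindex\<close> is there
  for function cones: a function test feeds the same parameter to its path and to its inner test, so
  independent parameters have to be packed into one tuple.\<close>

locale rcone =
  fixes P :: "'a mcone" and T :: "('a \<Rightarrow> real) set"
  assumes zero_carr: "zero P \<in> carr P"
    and add_carr: "x \<in> carr P \<Longrightarrow> y \<in> carr P \<Longrightarrow> add P x y \<in> carr P"
    and fn_zero: "\<tau> \<in> T \<Longrightarrow> \<tau> (zero P) = 0"
    and fn_add: "\<tau> \<in> T \<Longrightarrow> x \<in> carr P \<Longrightarrow> y \<in> carr P \<Longrightarrow> \<tau> (add P x y) = \<tau> x + \<tau> y"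
    and fn_nonneg: "\<tau> \<in> T \<Longrightarrow> x \<in> carr P \<Longrightarrow> 0 \<le> \<tau> x"
    and separate: "x \<in> carr P \<Longrightarrow> y \<in> carr P \<Longrightarrow> (\<And>\<tau>. \<tau> \<in> T \<Longrightarrow> \<tau> x = \<tau> y) \<Longrightarrow> x = y"
    and difference: "x \<in> carr P \<Longrightarrow> y \<in> carr P \<Longrightarrow> (\<And>\<tau>. \<tau> \<in> T \<Longrightarrow> \<tau> x \<le> \<tau> y) \<Longrightarrow>
      \<exists>z\<in>carr P. y = add P x z"
    and complete: "(\<And>n. X n \<in> carr P) \<Longrightarrow> (\<And>n. cnorm P (X n) \<le> c) \<Longrightarrow>
      (\<And>\<tau>. \<tau> \<in> T \<Longrightarrow> incseq (\<lambda>n. \<tau> (X n))) \<Longrightarrow>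
      \<exists>l\<in>carr P. cnorm P l \<le> c \<and> (\<forall>\<tau>\<in>T. (\<lambda>n. \<tau> (X n)) \<longlonglongrightarrow> \<tau> l)"
    and norm_zero: "cnorm P (zero P) = 0"
    and norm_mono: "x \<in> carr P \<Longrightarrow> y \<in> carr P \<Longrightarrow> cnorm P x \<le> cnorm P (add P x y)"
    and norm_add: "x \<in> carr P \<Longrightarrow> y \<in> carr P \<Longrightarrow> cnorm P (add P x y) \<le> cnorm P x + cnorm P y"
    and test_zero: "m \<in> tests P k \<Longrightarrow> r \<in> space (Rn k) \<Longrightarrow> m r (zero P) = 0"
    and test_add: "m \<in> tests P k \<Longrightarrow> r \<in> space (Rn k) \<Longrightarrow> x \<in> carr P \<Longrightarrow> y \<in> carr P \<Longrightarrow>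
      m r (add P x y) = m r x + m r y"
    and test_limit: "m \<in> tests P k \<Longrightarrow> r \<in> space (Rn k) \<Longrightarrow> (\<And>n. X n \<in> carr P) \<Longrightarrow>
      (\<And>n. cnorm P (X n) \<le> c) \<Longrightarrow> l \<in> carr P \<Longrightarrow> (\<And>\<tau>. \<tau> \<in> T \<Longrightarrow> incseq (\<lambda>n. \<tau> (X n))) \<Longrightarrow>
      (\<And>\<tau>. \<tau> \<in> T \<Longrightarrow> (\<lambda>n. \<tau> (X n)) \<longlonglongrightarrow> \<tau> l) \<Longrightarrow> (\<lambda>n. m r (X n)) \<longlonglongrightarrow> m r l"
    and test_reindex: "m \<in> tests P k \<Longrightarrow> p \<in> measurable (Rn k') (Rn k) \<Longrightarrow> (\<lambda>r. m (p r)) \<in> tests P k'"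
    and test_measurable: "m \<in> tests P k \<Longrightarrow> x \<in> carr P \<Longrightarrow> (\<lambda>r. m r x) \<in> borel_measurable (Rn k)"
begin

lemma zero_ball: "zero P \<in> unit_ball P"
  by (simp add: unit_ball_def zero_carr norm_zero)

lemma ball_carr: "x \<in> unit_ball P \<Longrightarrow> x \<in> carr P"
  by (simp add: unit_ball_def)

lemma cone_le_iff:
  assumes "x \<in> carr P" "y \<in> carr P"
  shows "cone_le P x y \<longleftrightarrow> (\<forall>\<tau>\<in>T. \<tau> x \<le> \<tau> y)"
  using assms difference[OF assms] by (auto simp: cone_le_def fn_add fn_nonneg)

lemma norm_le:
  assumes "x \<in> carr P" "y \<in> carr P" "\<And>\<tau>. \<tau> \<in> T \<Longrightarrow> \<tau> x \<le> \<tau> y"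
  shows "cnorm P x \<le> cnorm P y"
  using difference[OF assms] norm_mono assms by auto

lemma ball_le:
  assumes "x \<in> carr P" "y \<in> unit_ball P" "\<And>\<tau>. \<tau> \<in> T \<Longrightarrow> \<tau> x \<le> \<tau> y"
  shows "x \<in> unit_ball P"
  using norm_le[of x y] assms by (auto simp: unit_ball_def)

lemma is_lub_limit:
  assumes X: "\<And>n. X n \<in> carr P" "l \<in> carr P"
    and mono: "\<And>\<tau>. \<tau> \<in> T \<Longrightarrow> incseq (\<lambda>n. \<tau> (X n))"
    and lim: "\<And>\<tau>. \<tau> \<in> T \<Longrightarrow> (\<lambda>n. \<tau> (X n)) \<longlonglongrightarrow> \<tau> l"
  shows "cone_is_lub P (range X) l"
  unfolding cone_is_lub_def
proof (intro conjI ballI impI)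
  fix x assume "x \<in> range X"
  then obtain n where x: "x = X n" by auto
  have "\<tau> (X n) \<le> \<tau> l" if "\<tau> \<in> T" for \<tau>
    using incseq_le[OF mono lim, OF that that, of n] .
  then show "cone_le P x l"
    using X by (simp add: x cone_le_iff)
next
  fix b assume b: "b \<in> carr P" "\<forall>x\<in>range X. cone_le P x b"
  show "cone_le P l b"
    unfolding cone_le_iff[OF X(2) b(1)]
  proof
    fix \<tau> assume \<tau>: "\<tau> \<in> T"
    have "\<tau> (X n) \<le> \<tau> b" for n
      using b \<tau> X by (auto simp: cone_le_iff)
    then show "\<tau> l \<le> \<tau> b"
      using lim[OF \<tau>] by (meson LIMSEQ_le_const2)
  qed
qed fact

lemma is_lub_unique:
  assumes "cone_is_lub P A l" "cone_is_lub P A l'"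
  shows "l = l'"
proof -
  have "l \<in> carr P" "l' \<in> carr P" "cone_le P l l'" "cone_le P l' l"
    using assms by (auto simp: cone_is_lub_def)
  then show ?thesis
    by (intro separate) (auto simp: cone_le_iff intro: antisym)
qed

text \<open>Turns the least upper bounds of the definitions into numerical limits: completeness
  supplies some limit, that limit is a least upper bound, and least upper bounds are unique.\<close>

lemma limit_is_lub:
  assumes X: "\<And>n. X n \<in> carr P" "\<And>n. cnorm P (X n) \<le> c"
    and mono: "\<And>\<tau>. \<tau> \<in> T \<Longrightarrow> incseq (\<lambda>n. \<tau> (X n))"
    and lub: "cone_is_lub P (range X) l" and \<tau>: "\<tau> \<in> T"
  shows "(\<lambda>n. \<tau> (X n)) \<longlonglongrightarrow> \<tau> l"
proof -
  obtain l' where l': "l' \<in> carr P" "\<forall>\<tau>\<in>T. (\<lambda>n. \<tau> (X n)) \<longlonglongrightarrow> \<tau> l'"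
    using complete[where X=X and c=c] X mono by blast
  then have "cone_is_lub P (range X) l'"
    using X mono by (intro is_lub_limit) auto
  then have "l' = l" using lub is_lub_unique by blast
  then show ?thesis using l' \<tau> by simp
qed

lemma cone_lub_limit:
  assumes "\<And>n. X n \<in> carr P" "l \<in> carr P"
    and "\<And>\<tau>. \<tau> \<in> T \<Longrightarrow> incseq (\<lambda>n. \<tau> (X n))"
    and "\<And>\<tau>. \<tau> \<in> T \<Longrightarrow> (\<lambda>n. \<tau> (X n)) \<longlonglongrightarrow> \<tau> l"
  shows "cone_lub P (range X) = l"
  unfolding cone_lub_def
  by (rule the_equality) (use is_lub_limit[OF assms] is_lub_unique in blast)+

lemma csum_carr: "set us \<subseteq> carr P \<Longrightarrow> csum P us \<in> carr P"
  by (induction us) (auto simp: csum_def zero_carr add_carr)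

lemma fn_csum: "set us \<subseteq> carr P \<Longrightarrow> \<tau> \<in> T \<Longrightarrow> \<tau> (csum P us) = sum_list (map \<tau> us)"
proof (induction us)
  case (Cons u us)
  then have "csum P us \<in> carr P" by (simp add: csum_carr)
  with Cons show ?case by (simp add: csum_def fn_add)
qed (simp add: csum_def fn_zero)

lemma finite_sum_exists:
  assumes "finite A" "\<And>i. i \<in> A \<Longrightarrow> g i \<in> carr P"
  shows "\<exists>y\<in>carr P. \<forall>\<tau>\<in>T. \<tau> y = (\<Sum>i\<in>A. \<tau> (g i))"
  using assms
proof (induction A)
  case empty
  then show ?case using zero_carr fn_zero by auto
next
  case (insert a A)
  then obtain y where "y \<in> carr P" "\<forall>\<tau>\<in>T. \<tau> y = (\<Sum>i\<in>A. \<tau> (g i))" by auto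
  with insert show ?case by (intro bexI[of _ "add P (g a) y"]) (auto simp: fn_add add_carr)
qed

lemma unit_path_const: "x \<in> unit_ball P \<Longrightarrow> (\<lambda>s. x) \<in> unit_paths P n"
  using test_measurable[of _ _ x]
  by (auto simp: unit_paths_def paths_def unit_ball_def case_prod_beta intro: measurable_compose[OF measurable_fst])

end

section \<open>Cubes and chains in a cone\<close>

definition cone_cube :: "'a mcone \<Rightarrow> ('a \<Rightarrow> real) set \<Rightarrow> 'i set \<Rightarrow> ('i set \<Rightarrow> 'a) \<Rightarrow> bool" where
  "cone_cube P T N \<phi> \<longleftrightarrow> finite N \<and> (\<forall>I\<subseteq>N. \<phi> I \<in> unit_ball P) \<and> (\<forall>\<tau>\<in>T. rcube N (\<lambda>I. \<tau> (\<phi> I)))"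

text \<open>Convergence is stated through the functionals so that limits can be manipulated in the
  reals; \<open>is_lub_limit\<close> and \<open>limit_is_lub\<close> translate to and from least
  upper bounds.\<close>

definition cone_chain :: "'a mcone \<Rightarrow> ('a \<Rightarrow> real) set \<Rightarrow> (nat \<Rightarrow> 'a) \<Rightarrow> 'a \<Rightarrow> bool" where
  "cone_chain P T X l \<longleftrightarrow> (\<forall>n. X n \<in> unit_ball P) \<and> l \<in> unit_ball P \<and>
     (\<forall>\<tau>\<in>T. incseq (\<lambda>n. \<tau> (X n)) \<and> (\<lambda>n. \<tau> (X n)) \<longlonglongrightarrow> \<tau> l)"

lemma cone_cube_subset: "cone_cube P T N \<phi> \<Longrightarrow> N' \<subseteq> N \<Longrightarrow> cone_cube P T N' \<phi>"
  unfolding cone_cube_def by (auto intro: rcube_subset finite_subset)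

lemma cone_cube_image:
  assumes "cone_cube P T K \<phi>" "finite N"
  shows "cone_cube P T N (\<lambda>I. \<phi> {k\<in>K. u k \<subseteq> I})"
  using assms unfolding cone_cube_def by (auto intro: rcube_image[where h="\<lambda>I. \<tau> (\<phi> I)" for \<tau>])

text \<open>Pullback along the projection to the first summand: the element \<open>2 * k\<close> of
  the disjoint union stands for \<open>k\<close>.\<close>

lemma cone_cube_evens:
  assumes "cone_cube P T A \<phi>" "finite B"
  shows "cone_cube P T (interleave A B) (\<lambda>K. \<phi> (evens K))"
proof -
  have "cone_cube P T (interleave A B) (\<lambda>K. \<phi> {k\<in>A. {2 * k} \<subseteq> K})"
    using assms by (intro cone_cube_image) (auto simp: cone_cube_def)
  moreover have "{k\<in>A. {2 * k} \<subseteq> K} = evens K" if "K \<subseteq> interleave A B" for K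
    using that unfolding subset_interleave by (auto simp: evens_def)
  ultimately show ?thesis by (simp add: cone_cube_def cong: rcube_cong)
qed

lemma cone_cube_odds:
  assumes "cone_cube P T B \<phi>" "finite A"
  shows "cone_cube P T (interleave A B) (\<lambda>K. \<phi> (odds K))"
proof -
  have "cone_cube P T (interleave A B) (\<lambda>K. \<phi> {k\<in>B. {2 * k + 1} \<subseteq> K})"
    using assms by (intro cone_cube_image) (auto simp: cone_cube_def)
  moreover have "{k\<in>B. {2 * k + 1} \<subseteq> K} = odds K" if "K \<subseteq> interleave A B" for K
    using that unfolding subset_interleave by (auto simp: odds_def)
  ultimately show ?thesis by (simp add: cone_cube_def cong: rcube_cong)
qed

context rcone begin

lemma cube_const: "x \<in> unit_ball P \<Longrightarrow> finite N \<Longrightarrow> cone_cube P T N (\<lambda>I. x)"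
  by (auto simp: cone_cube_def ball_carr fn_nonneg intro: rcube_const)

text \<open>A comparable pair is a one-dimensional cube; this is how monotonicity comes out of
  preservation of cubes.\<close>

lemma cube_pair:
  assumes "x \<in> unit_ball P" "y \<in> unit_ball P" "\<And>\<tau>. \<tau> \<in> T \<Longrightarrow> \<tau> x \<le> \<tau> y"
  shows "cone_cube P T {0::nat} (\<lambda>I. if 0 \<in> I then y else x)"
proof -
  have "moebius J (\<lambda>I. \<tau> (if 0 \<in> I then y else x)) \<ge> 0" if "\<tau> \<in> T" "J \<subseteq> {0::nat}" for J \<tau>
  proof -
    have "J = {} \<or> J = {0}" using that by auto
    then show ?thesis
    proof
      assume "J = {}"
      then show ?thesis using that assms by (simp add: moebius_empty fn_nonneg ball_carr)
    next
      assume "J = {0}"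
      then show ?thesis using that assms by (simp add: moebius_single)
    qed
  qed
  then show ?thesis using assms by (auto simp: cone_cube_def rcube_iff_moebius)
qed

lemma chain_const: "x \<in> unit_ball P \<Longrightarrow> cone_chain P T (\<lambda>n. x) x"
  by (simp add: cone_chain_def)

text \<open>A signed sum has no direct meaning in a cone, so the terms of positive and of negative
  sign are summed separately. Nonnegativity of the coefficient under every functional allows the
  second sum to be subtracted from the first.\<close>

lemma moebius_exists:
  assumes "cone_cube P T N \<phi>"
  shows "\<exists>z\<in>carr P. \<forall>\<tau>\<in>T. \<tau> z = moebius N (\<lambda>I. \<tau> (\<phi> I))"
proof -
  have N: "finite N" and \<phi>: "\<And>I. I \<subseteq> N \<Longrightarrow> \<phi> I \<in> carr P"
    using assms by (auto simp: cone_cube_def ball_carr)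
  define E where "E = {I\<in>Pow N. even (card N - card I)}"
  define D where "D = {I\<in>Pow N. odd (card N - card I)}"
  obtain e where e: "e \<in> carr P" "\<forall>\<tau>\<in>T. \<tau> e = (\<Sum>I\<in>E. \<tau> (\<phi> I))"
    using finite_sum_exists[of E \<phi>] N \<phi> by (auto simp: E_def)
  obtain d where d: "d \<in> carr P" "\<forall>\<tau>\<in>T. \<tau> d = (\<Sum>I\<in>D. \<tau> (\<phi> I))"
    using finite_sum_exists[of D \<phi>] N \<phi> by (auto simp: D_def)
  have eq: "moebius N (\<lambda>I. \<tau> (\<phi> I)) = \<tau> e - \<tau> d" if "\<tau> \<in> T" for \<tau>
  proof -
    have "moebius N (\<lambda>I. \<tau> (\<phi> I)) = (\<Sum>I\<in>E. \<tau> (\<phi> I)) + (\<Sum>I\<in>D. - \<tau> (\<phi> I))"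
    proof -
      have "Pow N = E \<union> D" "E \<inter> D = {}" by (auto simp: E_def D_def)
      then have "moebius N (\<lambda>I. \<tau> (\<phi> I)) = (\<Sum>I\<in>E. (-1) ^ (card N - card I) * \<tau> (\<phi> I)) +
         (\<Sum>I\<in>D. (-1) ^ (card N - card I) * \<tau> (\<phi> I))"
        unfolding moebius_def using N by (simp only:) (subst sum.union_disjoint; auto simp: E_def D_def)
      then show ?thesis by (simp add: E_def D_def)
    qed
    then show ?thesis using e d that by (simp add: sum_negf)
  qed
  have "\<tau> d \<le> \<tau> e" if "\<tau> \<in> T" for \<tau>
    using eq[OF that] rcube_moebius_nonneg[OF N, of "\<lambda>I. \<tau> (\<phi> I)"] assms that by (simp add: cone_cube_def)
  then obtain z where "z \<in> carr P" "e = add P d z" using difference[OF d(1) e(1)] by blast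
  then show ?thesis using eq d by (intro bexI[of _ z]) (auto simp: fn_add)
qed

end

section \<open>Pre-stability as preservation of cubes\<close>

text \<open>The entries of \<open>List.subseqs\<close> correspond to sets of positions. Multisets
  count them correctly even when \<open>m\<close> sends distinct keys to the same element.\<close>

lemma mset_subseqs_map:
  assumes "distinct ks"
  shows "mset (List.subseqs (map m ks)) = image_mset (\<lambda>S. map m (filter (\<lambda>k. k \<in> S) ks)) (mset_set (Pow (set ks)))"
  using assms
proof (induction ks)
  case (Cons k ks)
  let ?g = "\<lambda>S. map m (filter (\<lambda>k. k \<in> S) ks)"
  let ?h = "\<lambda>S. map m (filter (\<lambda>k. k \<in> S) (k # ks))"
  have k: "k \<notin> set ks" using Cons by simp
  have inj: "inj_on (insert k) (Pow (set ks))"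
    using k by (auto simp: inj_on_def)
  have "mset_set (Pow (set (k # ks))) = mset_set (Pow (set ks)) + mset_set (insert k ` Pow (set ks))"
    unfolding list.set Pow_insert by (rule mset_set_Union) (use k in auto)
  also have "mset_set (insert k ` Pow (set ks)) = image_mset (insert k) (mset_set (Pow (set ks)))"
    using inj by (simp add: image_mset_mset_set)
  finally have "image_mset ?h (mset_set (Pow (set (k # ks)))) =
     image_mset ?h (mset_set (Pow (set ks))) + image_mset (\<lambda>S. ?h (insert k S)) (mset_set (Pow (set ks)))"
    by (simp add: image_mset.compositionality comp_def)
  also have "image_mset ?h (mset_set (Pow (set ks))) = image_mset ?g (mset_set (Pow (set ks)))"
    using k by (intro image_mset_cong) auto
  also have "image_mset (\<lambda>S. ?h (insert k S)) (mset_set (Pow (set ks))) =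
     image_mset (\<lambda>S. m k # ?g S) (mset_set (Pow (set ks)))"
  proof (intro image_mset_cong)
    fix S
    have "filter (\<lambda>x. x \<in> insert k S) ks = filter (\<lambda>x. x \<in> S) ks"
      using k by (intro filter_cong) auto
    then show "?h (insert k S) = m k # ?g S" by simp
  qed
  finally show ?case
    using Cons by (simp add: Let_def image_mset.compositionality comp_def)
qed simp

lemma sum_list_subseqs_map:
  fixes G :: "'b list \<Rightarrow> real"
  assumes "distinct ks"
  shows "(\<Sum>vs\<leftarrow>List.subseqs (map m ks). G vs) = (\<Sum>S\<in>Pow (set ks). G (map m (filter (\<lambda>k. k \<in> S) ks)))"
proof -
  have "(\<Sum>vs\<leftarrow>List.subseqs (map m ks). G vs) = sum_mset (image_mset G (mset (List.subseqs (map m ks))))"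
    by (metis mset_map sum_mset_sum_list)
  also have "\<dots> = (\<Sum>S\<in>Pow (set ks). G (map m (filter (\<lambda>k. k \<in> S) ks)))"
    by (simp add: mset_subseqs_map[OF assms] image_mset.compositionality comp_def sum_unfold_sum_mset)
  finally show ?thesis .
qed

lemma sum_list_concat_if:
  "sum_list (map \<tau> (concat (map (\<lambda>vs. if Q vs then [g vs] else []) xs))) =
    (\<Sum>vs\<leftarrow>xs. if Q vs then \<tau> (g vs) else (0::real))"
  by (induction xs) auto

text \<open>The parity of \<open>length us + length vs\<close> is the sign of a subset in the top
  Moebius coefficient, so the inequality of the two sums is nonnegativity of that coefficient for
  \<open>f\<close> along \<open>A \<mapsto> x + \<Sum>k\<in>A. m k\<close>.\<close>

lemma pre_stable_step_iff:
  fixes m :: "'k \<Rightarrow> 'a"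
  assumes "rcone P T" "rcone Q S" and f: "\<And>x. x \<in> unit_ball P \<Longrightarrow> f x \<in> carr Q"
    and ks: "distinct ks" "m ` set ks \<subseteq> carr P" and x: "x \<in> carr P"
    and ball: "add P x (csum P (map m ks)) \<in> unit_ball P"
  defines "us \<equiv> map m ks"
  shows "cone_le Q
      (csum Q [f (add P x (csum P vs)). vs \<leftarrow> List.subseqs us, odd (length us + length vs)])
      (csum Q [f (add P x (csum P vs)). vs \<leftarrow> List.subseqs us, even (length us + length vs)]) \<longleftrightarrow>
    (\<forall>\<tau>\<in>S. 0 \<le> moebius (set ks) (\<lambda>A. \<tau> (f (add P x (csum P (map m (filter (\<lambda>k. k \<in> A) ks)))))))"
proof -
  interpret P: rcone P T by fact
  interpret Q: rcone Q S by fact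
  let ?v = "\<lambda>A. map m (filter (\<lambda>k. k \<in> A) ks)"
  have v_carr: "set (?v A) \<subseteq> carr P" for A using ks by auto
  have sum_v: "sum_list (map \<tau> (?v A)) = (\<Sum>k\<in>set ks \<inter> A. \<tau> (m k))" for \<tau> :: "'a \<Rightarrow> real" and A
  proof -
    have "sum_list (map \<tau> (?v A)) = sum_list (map (\<lambda>k. \<tau> (m k)) (filter (\<lambda>k. k \<in> A) ks))"
      by (simp add: comp_def)
    also have "\<dots> = (\<Sum>k\<in>set (filter (\<lambda>k. k \<in> A) ks). \<tau> (m k))"
      using ks(1) by (intro sum_list_distinct_conv_sum_set) auto
    also have "set (filter (\<lambda>k. k \<in> A) ks) = set ks \<inter> A" by auto
    finally show ?thesis .
  qed
  have full: "?v (set ks) = us" unfolding us_def by (simp add: filter_id_conv)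
  \<comment> \<open>A partial sum lies below the full sum, and the unit ball is closed
    downwards.\<close>
  have v_ball: "add P x (csum P (?v A)) \<in> unit_ball P" for A
  proof (rule P.ball_le)
    show "add P x (csum P (?v A)) \<in> carr P"
      using v_carr x by (intro P.add_carr P.csum_carr)
    show "add P x (csum P us) \<in> unit_ball P" using ball by (simp add: us_def)
    fix \<tau> assume \<tau>: "\<tau> \<in> T"
    have "(\<Sum>k\<in>set ks \<inter> A. \<tau> (m k)) \<le> (\<Sum>k\<in>set ks. \<tau> (m k))"
      using ks(2) \<tau> by (intro sum_mono2) (auto simp: P.fn_nonneg)
    moreover have "\<tau> (add P x (csum P (?v B))) = \<tau> x + (\<Sum>k\<in>set ks \<inter> B. \<tau> (m k))" for B
      using \<tau> x v_carr[of B] by (simp only: P.fn_add P.csum_carr P.fn_csum sum_v)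
    note this[of A] this[of "set ks"]
    ultimately show "\<tau> (add P x (csum P (?v A))) \<le> \<tau> (add P x (csum P us))"
      unfolding full by simp
  qed
  have sub_ball: "add P x (csum P vs) \<in> unit_ball P" if "vs \<in> set (List.subseqs us)" for vs
  proof -
    have "vs \<in># mset (List.subseqs us)" using that by simp
    then obtain A where "vs = ?v A"
      unfolding us_def mset_subseqs_map[OF ks(1)] by auto
    then show ?thesis using v_ball by simp
  qed
  let ?L = "\<lambda>p. [f (add P x (csum P vs)). vs \<leftarrow> List.subseqs us, p (length us + length vs)]"
  have L_carr: "set (?L p) \<subseteq> carr Q" for p
    using sub_ball f by auto
  let ?g = "\<lambda>\<tau> A. \<tau> (f (add P x (csum P (?v A))))"
  have lenv: "length (?v A) = card A" if "A \<subseteq> set ks" for A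
  proof -
    have "length (?v A) = card (set (filter (\<lambda>k. k \<in> A) ks))"
      using distinct_card[of "filter (\<lambda>k. k \<in> A) ks"] ks(1) by simp
    also have "set (filter (\<lambda>k. k \<in> A) ks) = A" using that by auto
    finally show ?thesis .
  qed
  have L_sum: "\<tau> (csum Q (?L p)) =
     (\<Sum>A\<in>Pow (set ks). if p (card (set ks) + card A) then ?g \<tau> A else 0)" if "\<tau> \<in> S" for \<tau> p
  proof -
    have "\<tau> (csum Q (?L p)) = sum_list (map \<tau> (?L p))"
      using Q.fn_csum[OF L_carr that] .
    also have "\<dots> = (\<Sum>vs\<leftarrow>List.subseqs us. if p (length us + length vs) then \<tau> (f (add P x (csum P vs))) else 0)"
      by (rule sum_list_concat_if)
    also have "\<dots> = (\<Sum>A\<in>Pow (set ks). if p (length us + length (?v A)) then ?g \<tau> A else 0)"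
      unfolding us_def by (rule sum_list_subseqs_map[OF ks(1)])
    also have "\<dots> = (\<Sum>A\<in>Pow (set ks). if p (card (set ks) + card A) then ?g \<tau> A else 0)"
      using ks(1) lenv by (intro sum.cong refl) (simp add: us_def distinct_card)
    finally show ?thesis .
  qed
  have moebius_eq: "moebius (set ks) (?g \<tau>) = \<tau> (csum Q (?L even)) - \<tau> (csum Q (?L odd))" if "\<tau> \<in> S" for \<tau>
  proof -
    have "\<tau> (csum Q (?L even)) - \<tau> (csum Q (?L odd)) =
      (\<Sum>A\<in>Pow (set ks). (if even (card (set ks) + card A) then ?g \<tau> A else 0) -
         (if odd (card (set ks) + card A) then ?g \<tau> A else 0))"
      unfolding L_sum[OF that, of even] L_sum[OF that, of "\<lambda>n. odd n"] by (rule sum_subtractf[symmetric])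
    also have "\<dots> = moebius (set ks) (?g \<tau>)"
      unfolding moebius_def
    proof (intro sum.cong refl)
      fix A assume "A \<in> Pow (set ks)"
      then have "card A \<le> card (set ks)" by (intro card_mono) auto
      then have "even (card (set ks) - card A) \<longleftrightarrow> even (card (set ks) + card A)" by simp
      then show "(if even (card (set ks) + card A) then ?g \<tau> A else 0) -
         (if odd (card (set ks) + card A) then ?g \<tau> A else 0) =
         (-1) ^ (card (set ks) - card A) * ?g \<tau> A"
        by (cases "even (card (set ks) + card A)") auto
    qed
    finally show ?thesis by simp
  qed
  have "cone_le Q (csum Q (?L odd)) (csum Q (?L even)) \<longleftrightarrow> (\<forall>\<tau>\<in>S. \<tau> (csum Q (?L odd)) \<le> \<tau> (csum Q (?L even)))"
    using L_carr by (intro Q.cone_le_iff Q.csum_carr)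
  then show ?thesis using moebius_eq by auto
qed

text \<open>A pre-stable map \<open>f\<close> sends a cube \<open>\<phi>\<close> with Moebius coefficients \<open>m\<^sub>J\<close> to a cube: on the larger
  index set \<open>Pow N\<close>, the map \<open>S \<mapsto> f (\<Sum>\<^sub>J\<^sub>\<in>\<^sub>S m\<^sub>J)\<close> is a cube by the very definition of pre-stability,
  and \<open>I \<mapsto> f (\<phi> I)\<close> is its restriction along \<open>I \<mapsto> Pow I\<close>.\<close>

lemma pre_stable_cube:
  assumes "rcone P T" "rcone Q S" and f: "\<And>x. x \<in> unit_ball P \<Longrightarrow> f x \<in> carr Q"
    and pre: "pre_stable P Q f" and cube: "cone_cube P T N \<phi>" and \<sigma>: "\<sigma> \<in> S"
  shows "rcube N (\<lambda>I. \<sigma> (f (\<phi> I)))"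
proof -
  interpret P: rcone P T by fact
  interpret Q: rcone Q S by fact
  have N: "finite N" using cube by (simp add: cone_cube_def)
  have "\<forall>J. \<exists>z. J \<subseteq> N \<longrightarrow> z \<in> carr P \<and> (\<forall>\<tau>\<in>T. \<tau> z = moebius J (\<lambda>I. \<tau> (\<phi> I)))"
    using P.moebius_exists[OF cone_cube_subset[OF cube]] by blast
  \<comment> \<open>The coefficients are realised by elements of the cone, to which pre-stability of
    \<open>f\<close> can be applied.\<close>
  then obtain m where m: "\<And>J. J \<subseteq> N \<Longrightarrow> m J \<in> carr P"
      "\<And>J \<tau>. J \<subseteq> N \<Longrightarrow> \<tau> \<in> T \<Longrightarrow> \<tau> (m J) = moebius J (\<lambda>I. \<tau> (\<phi> I))"
    by metis
  obtain ks where ks: "set ks = Pow N" "distinct ks"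
    using N finite_distinct_list[of "Pow N"] by auto
  let ?v = "\<lambda>ks A. map m (filter (\<lambda>k. k \<in> A) ks)"
  let ?\<psi> = "\<lambda>ks A. add P (zero P) (csum P (?v ks A))"
  have \<psi>: "?\<psi> ls A \<in> carr P" "\<tau> \<in> T \<Longrightarrow> \<tau> (?\<psi> ls A) = (\<Sum>J\<in>set ls \<inter> A. \<tau> (m J))"
    if "set ls \<subseteq> Pow N" "distinct ls" for ls A \<tau>
  proof -
    have sub: "set (?v ls A) \<subseteq> carr P" using m that by auto
    then show "?\<psi> ls A \<in> carr P" by (intro P.add_carr P.zero_carr P.csum_carr)
    assume \<tau>: "\<tau> \<in> T"
    have "\<tau> (?\<psi> ls A) = sum_list (map \<tau> (?v ls A))"
      using \<tau> sub by (simp only: P.fn_add P.csum_carr P.fn_csum P.zero_carr P.fn_zero)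
    also have "\<dots> = (\<Sum>J\<in>set (filter (\<lambda>k. k \<in> A) ls). \<tau> (m J))"
      using that by (simp add: comp_def sum_list_distinct_conv_sum_set)
    also have "set (filter (\<lambda>k. k \<in> A) ls) = set ls \<inter> A" by auto
    finally show "\<tau> (?\<psi> ls A) = (\<Sum>J\<in>set ls \<inter> A. \<tau> (m J))" .
  qed
  have \<psi>_\<phi>: "?\<psi> ks (Pow I) = \<phi> I" if "I \<subseteq> N" for I
  proof (rule P.separate)
    fix \<tau> assume \<tau>: "\<tau> \<in> T"
    have "set ks \<inter> Pow I = Pow I" using ks that by auto
    then have "\<tau> (?\<psi> ks (Pow I)) = (\<Sum>J\<in>Pow I. \<tau> (m J))"
      using \<psi>(2)[of ks \<tau> "Pow I"] ks \<tau> by simp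
    also have "\<dots> = (\<Sum>J\<in>Pow I. moebius J (\<lambda>I. \<tau> (\<phi> I)))"
      using that \<tau> by (intro sum.cong refl m) auto
    also have "\<dots> = \<tau> (\<phi> I)"
      using finite_subset[OF that N] by (rule sum_moebius_Pow)
    finally show "\<tau> (?\<psi> ks (Pow I)) = \<tau> (\<phi> I)" .
  next
    show "?\<psi> ks (Pow I) \<in> carr P" by (rule \<psi>(1)) (use ks in auto)
  qed (use cube that in \<open>simp add: cone_cube_def P.ball_carr\<close>)
  have ball: "?\<psi> ls A \<in> unit_ball P" if "set ls \<subseteq> Pow N" "distinct ls" for ls A
  proof (rule P.ball_le)
    show "\<phi> N \<in> unit_ball P" using cube by (simp add: cone_cube_def)
    fix \<tau> assume \<tau>: "\<tau> \<in> T"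
    have "\<tau> (?\<psi> ls A) = (\<Sum>J\<in>set ls \<inter> A. \<tau> (m J))" using \<psi> that \<tau> by auto
    also have "\<dots> \<le> (\<Sum>J\<in>Pow N. \<tau> (m J))"
      using that N m \<tau> by (intro sum_mono2) (auto simp: P.fn_nonneg)
    also have "\<dots> = \<tau> (\<phi> N)"
      using \<psi>(2)[of ks \<tau> "Pow N"] ks \<tau> \<psi>_\<phi>[of N] by simp
    finally show "\<tau> (?\<psi> ls A) \<le> \<tau> (\<phi> N)" .
  qed (use \<psi> that in auto)
  have "rcube (Pow N) (\<lambda>A. \<sigma> (f (?\<psi> ks A)))"
    unfolding rcube_iff_moebius[OF finite_Pow_iff[THEN iffD2, OF N]]
  proof (intro allI impI)
    fix K assume K: "K \<subseteq> Pow N"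
    \<comment> \<open>The coefficient at \<open>K\<close> involves only the summands from
      \<open>K\<close>, so pre-stability is applied to the sublist \<open>ls\<close> with base point
      zero.\<close>
    define ls where "ls = filter (\<lambda>k. k \<in> K) ks"
    have ls: "set ls = K" "distinct ls" using ks K by (auto simp: ls_def)
    have lsm: "map m ls = ?v ls UNIV" by simp
    have all: "add P (zero P) (csum P (map m ls)) \<in> unit_ball P"
      unfolding lsm by (rule ball) (use ls K in auto)
    have "0 \<le> moebius (set ls) (\<lambda>A. \<sigma> (f (?\<psi> ls A)))"
    proof (rule bspec[OF iffD1[OF pre_stable_step_iff[OF assms(1,2) f]] \<sigma>])
      show "cone_le Q
      (csum Q [f (add P (zero P) (csum P vs)). vs \<leftarrow> List.subseqs (map m ls), odd (length (map m ls) + length vs)])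
      (csum Q [f (add P (zero P) (csum P vs)). vs \<leftarrow> List.subseqs (map m ls), even (length (map m ls) + length vs)])"
        by (rule pre[unfolded pre_stable_def, rule_format]) (use all P.zero_carr m K ls in auto)
    qed (use ls m K P.zero_carr all in auto)
    also have "moebius (set ls) (\<lambda>A. \<sigma> (f (?\<psi> ls A))) = moebius K (\<lambda>A. \<sigma> (f (?\<psi> ks A)))"
    proof -
      have "filter (\<lambda>k. k \<in> A) ls = filter (\<lambda>k. k \<in> A) ks" if "A \<subseteq> K" for A
        using that unfolding ls_def by (auto intro: filter_cong)
      then show ?thesis unfolding ls(1) by (intro moebius_cong) simp
    qed
    finally show "0 \<le> moebius K (\<lambda>A. \<sigma> (f (?\<psi> ks A)))" .
  qed
  then have "rcube N (\<lambda>I. \<sigma> (f (?\<psi> ks {k\<in>Pow N. k \<subseteq> I})))"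
    using N by (intro rcube_image) auto
  also have "?this \<longleftrightarrow> ?thesis"
  proof (rule rcube_cong)
    fix I assume I: "I \<subseteq> N"
    then have "{k\<in>Pow N. k \<subseteq> I} = Pow I" by auto
    then show "\<sigma> (f (?\<psi> ks {k\<in>Pow N. k \<subseteq> I})) = \<sigma> (f (\<phi> I))"
      using \<psi>_\<phi>[OF I] by simp
  qed
  finally show ?thesis .
qed

text \<open>The family \<open>A \<mapsto> x + \<Sum>k\<in>A. u k\<close> is a cube: its coefficients
  are \<open>x\<close> at the empty set, the \<open>u k\<close> at the singletons, and zero
  elsewhere. Hence its image has a nonnegative top coefficient.\<close>

lemma cube_pre_stable:
  assumes "rcone P T" "rcone Q S" and f: "\<And>x. x \<in> unit_ball P \<Longrightarrow> f x \<in> carr Q"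
    and cube: "\<And>N \<phi> \<sigma>. cone_cube P T (N::nat set) \<phi> \<Longrightarrow> \<sigma> \<in> S \<Longrightarrow> rcube N (\<lambda>I. \<sigma> (f (\<phi> I)))"
  shows "pre_stable P Q f"
  unfolding pre_stable_def
proof (intro allI impI)
  interpret P: rcone P T by fact
  interpret Q: rcone Q S by fact
  fix x us assume x: "x \<in> carr P" and us: "set us \<subseteq> carr P" and ball: "add P x (csum P us) \<in> unit_ball P"
  \<comment> \<open>Positions serve as keys, so that equal members of the family remain
    distinct.\<close>
  define ks where "ks = [0..<length us]"
  define m where "m = nth us"
  have us_eq: "us = map m ks" by (simp add: m_def ks_def map_nth)
  have ks: "distinct ks" "m ` set ks \<subseteq> carr P"
    using us by (auto simp: ks_def m_def)
  let ?v = "\<lambda>A. map m (filter (\<lambda>k. k \<in> A) ks)"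
  have v: "set (?v A) \<subseteq> carr P" for A using ks by auto
  have val: "\<tau> (add P x (csum P (?v A))) = \<tau> x + (\<Sum>k\<in>{k\<in>set ks. {k} \<subseteq> A}. \<tau> (m k))" if "\<tau> \<in> T" for \<tau> A
  proof -
    have "\<tau> (add P x (csum P (?v A))) = \<tau> x + sum_list (map \<tau> (?v A))"
      using that x v by (simp only: P.fn_add P.csum_carr P.fn_csum)
    also have "sum_list (map \<tau> (?v A)) = (\<Sum>k\<in>set (filter (\<lambda>k. k \<in> A) ks). \<tau> (m k))"
      using ks by (simp add: comp_def sum_list_distinct_conv_sum_set)
    finally show ?thesis by simp
  qed
  have full: "?v (set ks) = us" unfolding us_eq by (simp add: filter_id_conv)
  have cub: "cone_cube P T (set ks) (\<lambda>A. add P x (csum P (?v A)))"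
    unfolding cone_cube_def
  proof (intro conjI ballI allI impI)
    fix A assume "A \<subseteq> set ks"
    show "add P x (csum P (?v A)) \<in> unit_ball P"
    proof (rule P.ball_le[OF _ ball])
      show "add P x (csum P (?v A)) \<in> carr P" using x v by (intro P.add_carr P.csum_carr)
      fix \<tau> assume \<tau>: "\<tau> \<in> T"
      have "(\<Sum>k\<in>{k\<in>set ks. {k} \<subseteq> A}. \<tau> (m k)) \<le> (\<Sum>k\<in>{k\<in>set ks. {k} \<subseteq> set ks}. \<tau> (m k))"
        using \<tau> ks by (intro sum_mono2) (auto simp: P.fn_nonneg)
      then show "\<tau> (add P x (csum P (?v A))) \<le> \<tau> (add P x (csum P us))"
        using val[OF \<tau>, of "set ks"] val[OF \<tau>, of A] unfolding full by simp
    qed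
  next
    fix \<tau> assume \<tau>: "\<tau> \<in> T"
    show "rcube (set ks) (\<lambda>A. \<tau> (add P x (csum P (?v A))))"
      unfolding val[OF \<tau>] using \<tau> x ks
      by (intro rcube_add rcube_const rcube_sum_le) (auto simp: P.fn_nonneg)
  qed simp
  show "cone_le Q
        (csum Q [f (add P x (csum P vs)). vs \<leftarrow> List.subseqs us, odd (length us + length vs)])
        (csum Q [f (add P x (csum P vs)). vs \<leftarrow> List.subseqs us, even (length us + length vs)])"
    unfolding us_eq
  proof (rule iffD2[OF pre_stable_step_iff[OF assms(1,2) f ks x]])
    show "\<forall>\<tau>\<in>S. 0 \<le> moebius (set ks) (\<lambda>A. \<tau> (f (add P x (csum P (?v A)))))"
      using cube[OF cub] by (auto intro: rcube_moebius_nonneg)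
  qed (use ball us_eq in auto)
qed

section \<open>The cones of maps and of measures\<close>

lemma unit_paths_ball: "\<gamma> \<in> unit_paths P n \<Longrightarrow> s \<in> space (Rn n) \<Longrightarrow> \<gamma> s \<in> unit_ball P"
  by (simp add: unit_paths_def)

lemma unit_paths_test:
  "\<gamma> \<in> unit_paths P n \<Longrightarrow> m \<in> tests P k \<Longrightarrow> (\<lambda>(r, s). m r (\<gamma> s)) \<in> borel_measurable (Rn k \<Otimes>\<^sub>M Rn n)"
  by (auto simp: unit_paths_def paths_def)

lemma unit_pathsI:
  assumes "\<And>s. s \<in> space (Rn n) \<Longrightarrow> \<gamma> s \<in> unit_ball P"
    and "\<And>k m. m \<in> tests P k \<Longrightarrow> (\<lambda>(r, s). m r (\<gamma> s)) \<in> borel_measurable (Rn k \<Otimes>\<^sub>M Rn n)"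
  shows "\<gamma> \<in> unit_paths P n"
  unfolding unit_paths_def paths_def using assms by (auto simp: unit_ball_def)

lemma unit_paths_reindex:
  assumes \<gamma>: "\<gamma> \<in> unit_paths P n" and p: "p \<in> measurable (Rn n') (Rn n)"
  shows "(\<lambda>s. \<gamma> (p s)) \<in> unit_paths P n'"
proof (rule unit_pathsI)
  fix s assume "s \<in> space (Rn n')"
  then show "\<gamma> (p s) \<in> unit_ball P"
    using unit_paths_ball[OF \<gamma>] measurable_space[OF p] by blast
next
  fix k m assume m: "m \<in> tests P k"
  have "(\<lambda>x. (fst x, p (snd x))) \<in> measurable (Rn k \<Otimes>\<^sub>M Rn n') (Rn k \<Otimes>\<^sub>M Rn n)"
    using p by measurable
  from measurable_compose[OF this unit_paths_test[OF \<gamma> m]]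
  show "(\<lambda>(r, s). m r (\<gamma> (p s))) \<in> borel_measurable (Rn k \<Otimes>\<^sub>M Rn n')"
    by (simp add: case_prod_beta)
qed

lemma measurable_fun_iff:
  assumes "\<And>x. x \<in> unit_ball P \<Longrightarrow> f x \<in> carr Q" "\<And>x. x \<in> unit_ball P \<Longrightarrow> cnorm Q (f x) \<le> c"
  shows "measurable_fun P Q f \<longleftrightarrow> (\<forall>n k \<gamma> m. \<gamma> \<in> unit_paths P n \<longrightarrow> m \<in> tests Q k \<longrightarrow>
    (\<lambda>(r, s). m r (f (\<gamma> s))) \<in> borel_measurable (Rn k \<Otimes>\<^sub>M Rn n))"
proof -
  have "(\<forall>s\<in>space (Rn n). f (\<gamma> s) \<in> carr Q) \<and> (\<exists>c. \<forall>s\<in>space (Rn n). cnorm Q (f (\<gamma> s)) \<le> c)"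
    if "\<gamma> \<in> unit_paths P n" for \<gamma> n
    using assms unit_paths_ball[OF that] by auto
  then show ?thesis unfolding measurable_fun_def paths_def by auto
qed

text \<open>The carrier condition of \<open>fun_cone\<close> rephrased through functionals, without
  extensionality. The bound on the norms is arbitrary because all elements of the cone are meant,
  not only those of its unit ball. Monotonicity is contained in the clause on cubes.\<close>

definition cone_map ::
  "'a mcone \<Rightarrow> ('a \<Rightarrow> real) set \<Rightarrow> 'b mcone \<Rightarrow> ('b \<Rightarrow> real) set \<Rightarrow> ('a \<Rightarrow> 'b) \<Rightarrow> bool" where
  "cone_map P T Q S f \<longleftrightarrow> (\<forall>x\<in>unit_ball P. f x \<in> carr Q) \<and> (\<exists>c. \<forall>x\<in>unit_ball P. cnorm Q (f x) \<le> c) \<and>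
    (\<forall>N \<phi> \<sigma>. cone_cube P T (N::nat set) \<phi> \<longrightarrow> \<sigma> \<in> S \<longrightarrow> rcube N (\<lambda>I. \<sigma> (f (\<phi> I)))) \<and>
    (\<forall>X l \<sigma>. cone_chain P T X l \<longrightarrow> \<sigma> \<in> S \<longrightarrow> (\<lambda>n. \<sigma> (f (X n))) \<longlonglongrightarrow> \<sigma> (f l)) \<and>
    measurable_fun P Q f"

lemma cone_map_carr: "cone_map P T Q S f \<Longrightarrow> x \<in> unit_ball P \<Longrightarrow> f x \<in> carr Q"
  by (simp add: cone_map_def)

lemma cone_map_cube:
  "cone_map P T Q S f \<Longrightarrow> cone_cube P T N \<phi> \<Longrightarrow> \<sigma> \<in> S \<Longrightarrow> rcube (N::nat set) (\<lambda>I. \<sigma> (f (\<phi> I)))"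
  by (simp add: cone_map_def)

lemma cone_map_limit:
  "cone_map P T Q S f \<Longrightarrow> cone_chain P T X l \<Longrightarrow> \<sigma> \<in> S \<Longrightarrow> (\<lambda>n. \<sigma> (f (X n))) \<longlonglongrightarrow> \<sigma> (f l)"
  by (simp add: cone_map_def)

lemma cone_map_test:
  assumes "cone_map P T Q S f" "\<gamma> \<in> unit_paths P n" "m \<in> tests Q k"
  shows "(\<lambda>(r, s). m r (f (\<gamma> s))) \<in> borel_measurable (Rn k \<Otimes>\<^sub>M Rn n)"
  using assms unfolding cone_map_def measurable_fun_def paths_def by auto

lemma cone_mapI:
  assumes "\<And>x. x \<in> unit_ball P \<Longrightarrow> f x \<in> carr Q" "\<And>x. x \<in> unit_ball P \<Longrightarrow> cnorm Q (f x) \<le> c"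
    and "\<And>N \<phi> \<sigma>. cone_cube P T (N::nat set) \<phi> \<Longrightarrow> \<sigma> \<in> S \<Longrightarrow> rcube N (\<lambda>I. \<sigma> (f (\<phi> I)))"
    and "\<And>X l \<sigma>. cone_chain P T X l \<Longrightarrow> \<sigma> \<in> S \<Longrightarrow> (\<lambda>n. \<sigma> (f (X n))) \<longlonglongrightarrow> \<sigma> (f l)"
    and "\<And>n k \<gamma> m. \<gamma> \<in> unit_paths P n \<Longrightarrow> m \<in> tests Q k \<Longrightarrow>
      (\<lambda>(r, s). m r (f (\<gamma> s))) \<in> borel_measurable (Rn k \<Otimes>\<^sub>M Rn n)"
  shows "cone_map P T Q S f"
  unfolding cone_map_def
proof (intro conjI)
  show "measurable_fun P Q f"
    using assms(5) by (simp add: measurable_fun_iff[OF assms(1,2)])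
qed (use assms(1-4) in blast)+

lemma cone_chain_Suc: "cone_chain P T X l \<Longrightarrow> \<tau> \<in> T \<Longrightarrow> \<tau> (X n) \<le> \<tau> (X (Suc n))"
  by (auto simp: cone_chain_def incseq_Suc_iff)

lemma cone_map_mono:
  assumes "rcone P T" "cone_map P T Q S f" "x \<in> unit_ball P" "y \<in> unit_ball P"
    "\<And>\<tau>. \<tau> \<in> T \<Longrightarrow> \<tau> x \<le> \<tau> y" "\<sigma> \<in> S"
  shows "\<sigma> (f x) \<le> \<sigma> (f y)"
proof -
  have "rcube {0::nat} (\<lambda>I. \<sigma> (f (if 0 \<in> I then y else x)))"
    by (intro cone_map_cube[OF assms(2)] rcone.cube_pair[OF assms(1)] assms)
  then have "0 \<le> moebius {0::nat} (\<lambda>I. \<sigma> (f (if 0 \<in> I then y else x)))"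
    by (intro rcube_moebius_nonneg) auto
  then show ?thesis by (simp add: moebius_single)
qed

lemma cone_map_incseq:
  assumes "rcone P T" "cone_map P T Q S f" "cone_chain P T X l" "\<sigma> \<in> S"
  shows "incseq (\<lambda>n. \<sigma> (f (X n)))"
proof (rule incseq_SucI)
  fix n
  show "\<sigma> (f (X n)) \<le> \<sigma> (f (X (Suc n)))"
    by (rule cone_map_mono[OF assms(1,2) _ _ _ assms(4)])
      (use assms(3) cone_chain_Suc[OF assms(3)] in \<open>auto simp: cone_chain_def\<close>)
qed

text \<open>These functionals determine the stable order. The empty cube gives evaluation at a
  point, a singleton the increment along a comparable pair.\<close>

definition fun_fns :: "'a mcone \<Rightarrow> ('a \<Rightarrow> real) set \<Rightarrow> ('b \<Rightarrow> real) set \<Rightarrow> (('a \<Rightarrow> 'b) \<Rightarrow> real) set" where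
  "fun_fns P T S = {\<lambda>f. moebius N (\<lambda>I. \<sigma> (f (\<phi> I))) | N \<phi> \<sigma>. cone_cube P T (N::nat set) \<phi> \<and> \<sigma> \<in> S}"

section \<open>The cone of maps\<close>

locale rcone_pair = P: rcone P T + Q: rcone Q S
  for P :: "'a mcone" and T and Q :: "'b mcone" and S
begin

text \<open>For cubes the two directions are \<open>pre_stable_cube\<close> and
  \<open>cube_pre_stable\<close>. For continuity, least upper bounds are exchanged for limits;
  monotonicity, the one-dimensional case of cube preservation, is what makes the images of a chain
  increasing.\<close>

lemma fun_carr_iff:
  "f \<in> carr (fun_cone P Q) \<longleftrightarrow> f \<in> extensional (unit_ball P) \<and> cone_map P T Q S f"
proof
  assume f: "f \<in> carr (fun_cone P Q)"
  then have vals: "\<And>x. x \<in> unit_ball P \<Longrightarrow> f x \<in> carr Q" and ext: "f \<in> extensional (unit_ball P)"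
    by (auto simp: fun_cone_def PiE_def)
  obtain c where c: "\<And>x. x \<in> unit_ball P \<Longrightarrow> cnorm Q (f x) \<le> c"
    using f by (auto simp: fun_cone_def)
  have pre: "pre_stable P Q f" and sc: "scott_continuous P Q f" and mf: "measurable_fun P Q f"
    using f by (auto simp: fun_cone_def)
  have cube: "rcube N (\<lambda>I. \<sigma> (f (\<phi> I)))" if "cone_cube P T (N::nat set) \<phi>" "\<sigma> \<in> S" for N \<phi> \<sigma>
    by (rule pre_stable_cube[OF P.rcone_axioms Q.rcone_axioms vals pre that])
  have mono: "\<sigma> (f x) \<le> \<sigma> (f y)"
    if "x \<in> unit_ball P" "y \<in> unit_ball P" "\<And>\<tau>. \<tau> \<in> T \<Longrightarrow> \<tau> x \<le> \<tau> y" "\<sigma> \<in> S" for x y \<sigma>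
  proof -
    have "rcube {0::nat} (\<lambda>I. \<sigma> (f (if 0 \<in> I then y else x)))"
      by (intro cube P.cube_pair that)
    then have "0 \<le> moebius {0::nat} (\<lambda>I. \<sigma> (f (if 0 \<in> I then y else x)))"
      by (intro rcube_moebius_nonneg) auto
    then show ?thesis by (simp add: moebius_single)
  qed
  have lim: "(\<lambda>n. \<sigma> (f (X n))) \<longlonglongrightarrow> \<sigma> (f l)" if ch: "cone_chain P T X l" and \<sigma>: "\<sigma> \<in> S" for X l \<sigma>
  proof -
    have X: "X n \<in> unit_ball P" "l \<in> unit_ball P" for n using ch by (auto simp: cone_chain_def)
    have inc: "\<tau> (X n) \<le> \<tau> (X (Suc n))" if "\<tau> \<in> T" for \<tau> n
      using cone_chain_Suc[OF ch that] .
    have "cone_is_lub P (range X) l"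
      using ch X by (intro P.is_lub_limit) (auto simp: cone_chain_def P.ball_carr)
    moreover have "cone_le P (X n) (X (Suc n))" for n
      using X inc by (simp add: P.cone_le_iff P.ball_carr)
    ultimately have "cone_is_lub Q (range (\<lambda>n. f (X n))) (f l)"
      using sc X unfolding scott_continuous_def by blast
    moreover have "incseq (\<lambda>n. \<tau> (f (X n)))" if "\<tau> \<in> S" for \<tau>
      using X inc that by (intro incseq_SucI mono) auto
    ultimately show ?thesis
      using X vals c \<sigma> by (intro Q.limit_is_lub[where c=c]) auto
  qed
  show "f \<in> extensional (unit_ball P) \<and> cone_map P T Q S f"
    unfolding cone_map_def using ext vals c cube lim mf by blast
next
  assume f: "f \<in> extensional (unit_ball P) \<and> cone_map P T Q S f"
  then have map: "cone_map P T Q S f" ..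
  have vals: "\<And>x. x \<in> unit_ball P \<Longrightarrow> f x \<in> carr Q" using map by (rule cone_map_carr)
  have "pre_stable P Q f"
    by (rule cube_pre_stable[OF P.rcone_axioms Q.rcone_axioms vals]) (use cone_map_cube[OF map] in auto)
  moreover have "scott_continuous P Q f"
    unfolding scott_continuous_def
  proof (intro allI impI)
    fix X l assume X: "\<forall>n. X n \<in> unit_ball P \<and> cone_le P (X n) (X (Suc n))" "l \<in> unit_ball P"
      and lub: "cone_is_lub P (range X) l"
    have inc: "incseq (\<lambda>n. \<tau> (X n))" if "\<tau> \<in> T" for \<tau>
      using X that by (intro incseq_SucI) (metis P.ball_carr P.cone_le_iff)
    have "cone_chain P T X l"
      unfolding cone_chain_def using X inc P.limit_is_lub[OF _ _ inc lub, of 1]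
      by (auto simp: unit_ball_def)
    then show "cone_is_lub Q (range (\<lambda>n. f (X n))) (f l)"
      using X vals by (intro Q.is_lub_limit cone_map_incseq[OF P.rcone_axioms map] cone_map_limit[OF map]) auto
  qed
  ultimately show "f \<in> carr (fun_cone P Q)"
    using f by (auto simp: fun_cone_def PiE_def cone_map_def)
qed

text \<open>A real supremum bounds its members once the set is bounded, which membership in the
  carrier guarantees; the zero of the cone makes the set nonempty.\<close>

lemma fun_norm_le_iff:
  assumes "f \<in> carr (fun_cone P Q)"
  shows "cnorm (fun_cone P Q) f \<le> c \<longleftrightarrow> (\<forall>x\<in>unit_ball P. cnorm Q (f x) \<le> c)"
proof -
  obtain b where "\<forall>x\<in>unit_ball P. cnorm Q (f x) \<le> b"
    using assms by (auto simp: fun_carr_iff cone_map_def)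
  then have "bdd_above ((\<lambda>x. cnorm Q (f x)) ` unit_ball P)" by (auto intro: bdd_aboveI)
  then have "(SUP x\<in>unit_ball P. cnorm Q (f x)) \<le> c \<longleftrightarrow> (\<forall>x\<in>unit_ball P. cnorm Q (f x) \<le> c)"
    using P.zero_ball by (intro cSUP_le_iff) auto
  then show ?thesis by (simp add: fun_cone_def)
qed

lemma fun_norm_upper:
  "f \<in> carr (fun_cone P Q) \<Longrightarrow> x \<in> unit_ball P \<Longrightarrow> cnorm Q (f x) \<le> cnorm (fun_cone P Q) f"
  using fun_norm_le_iff[of f "cnorm (fun_cone P Q) f"] by simp

lemma point_fns: "x \<in> unit_ball P \<Longrightarrow> \<sigma> \<in> S \<Longrightarrow> (\<lambda>f. \<sigma> (f x)) \<in> fun_fns P T S"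
  unfolding fun_fns_def mem_Collect_eq
  by (intro exI[of _ "{}"] exI[of _ "\<lambda>_. x"] exI[of _ \<sigma>]) (auto simp: moebius_empty intro: P.cube_const)

lemma fun_mapD: "f \<in> carr (fun_cone P Q) \<Longrightarrow> cone_map P T Q S f"
  by (simp add: fun_carr_iff)

lemma fun_fnsE:
  assumes "\<tau> \<in> fun_fns P T S"
  obtains N \<phi> \<sigma> where "cone_cube P T (N::nat set) \<phi>" "\<sigma> \<in> S" "\<tau> = (\<lambda>f. moebius N (\<lambda>I. \<sigma> (f (\<phi> I))))"
  using assms unfolding fun_fns_def by blast

lemma restrict_fun_carrI:
  assumes "cone_map P T Q S (\<lambda>x\<in>unit_ball P. f x)"
  shows "(\<lambda>x\<in>unit_ball P. f x) \<in> carr (fun_cone P Q)"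
  using assms by (simp add: fun_carr_iff)

text \<open>Cubes, chains and paths take their values in the unit ball, so every condition may be
  checked on the map before restriction.\<close>

lemma restrict_mapI:
  assumes "\<And>x. x \<in> unit_ball P \<Longrightarrow> f x \<in> carr Q" "\<And>x. x \<in> unit_ball P \<Longrightarrow> cnorm Q (f x) \<le> c"
    and "\<And>N \<phi> \<sigma>. cone_cube P T (N::nat set) \<phi> \<Longrightarrow> \<sigma> \<in> S \<Longrightarrow> rcube N (\<lambda>I. \<sigma> (f (\<phi> I)))"
    and "\<And>X l \<sigma>. cone_chain P T X l \<Longrightarrow> \<sigma> \<in> S \<Longrightarrow> (\<lambda>n. \<sigma> (f (X n))) \<longlonglongrightarrow> \<sigma> (f l)"
    and "\<And>n k \<gamma> m. \<gamma> \<in> unit_paths P n \<Longrightarrow> m \<in> tests Q k \<Longrightarrow>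
      (\<lambda>(r, s). m r (f (\<gamma> s))) \<in> borel_measurable (Rn k \<Otimes>\<^sub>M Rn n)"
  shows "(\<lambda>x\<in>unit_ball P. f x) \<in> carr (fun_cone P Q)"
proof (intro restrict_fun_carrI cone_mapI[where c=c])
  fix N :: "nat set" and \<phi> \<sigma> assume *: "cone_cube P T N \<phi>" "\<sigma> \<in> S"
  then have "\<phi> I \<in> unit_ball P" if "I \<subseteq> N" for I using that by (auto simp: cone_cube_def)
  then show "rcube N (\<lambda>I. \<sigma> ((\<lambda>x\<in>unit_ball P. f x) (\<phi> I)))"
    using assms(3)[OF *] by (simp cong: rcube_cong)
next
  fix X l \<sigma> assume *: "cone_chain P T X l" "\<sigma> \<in> S"
  then have "X n \<in> unit_ball P" "l \<in> unit_ball P" for n by (auto simp: cone_chain_def)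
  then show "(\<lambda>n. \<sigma> ((\<lambda>x\<in>unit_ball P. f x) (X n))) \<longlonglongrightarrow> \<sigma> ((\<lambda>x\<in>unit_ball P. f x) l)"
    using assms(4)[OF *] by simp
next
  fix n k \<gamma> m assume *: "\<gamma> \<in> unit_paths P n" "m \<in> tests Q k"
  have "(\<lambda>(r, s). m r ((\<lambda>x\<in>unit_ball P. f x) (\<gamma> s))) \<in> borel_measurable (Rn k \<Otimes>\<^sub>M Rn n) \<longleftrightarrow>
    (\<lambda>(r, s). m r (f (\<gamma> s))) \<in> borel_measurable (Rn k \<Otimes>\<^sub>M Rn n)"
    using unit_paths_ball[OF *(1)] by (intro measurable_cong) (auto simp: space_pair_measure)
  then show "(\<lambda>(r, s). m r ((\<lambda>x\<in>unit_ball P. f x) (\<gamma> s))) \<in> borel_measurable (Rn k \<Otimes>\<^sub>M Rn n)"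
    using assms(5)[OF *] by simp
qed (use assms in auto)

lemma fun_zero_carr: "zero (fun_cone P Q) \<in> carr (fun_cone P Q)"
proof -
  have "(\<lambda>x\<in>unit_ball P. zero Q) \<in> carr (fun_cone P Q)"
  proof (rule restrict_mapI[where c=0])
    fix n k \<gamma> m assume "m \<in> tests Q k"
    then have "(\<lambda>(r, s). m r (zero Q)) \<in> borel_measurable (Rn k \<Otimes>\<^sub>M Rn n) \<longleftrightarrow>
      (\<lambda>_. 0::real) \<in> borel_measurable (Rn k \<Otimes>\<^sub>M Rn n)"
      by (intro measurable_cong) (auto simp: space_pair_measure Q.test_zero)
    then show "(\<lambda>(r, s). m r (zero Q)) \<in> borel_measurable (Rn k \<Otimes>\<^sub>M Rn n)" by simp
  qed (auto simp: Q.zero_carr Q.norm_zero Q.fn_zero cone_cube_def intro: rcube_const)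
  then show ?thesis by (simp add: fun_cone_def)
qed

lemma fun_add_carr:
  assumes "f \<in> carr (fun_cone P Q)" "g \<in> carr (fun_cone P Q)"
  shows "add (fun_cone P Q) f g \<in> carr (fun_cone P Q)"
proof -
  note f = fun_mapD[OF assms(1)] and g = fun_mapD[OF assms(2)]
  have "(\<lambda>x\<in>unit_ball P. add Q (f x) (g x)) \<in> carr (fun_cone P Q)"
  proof (rule restrict_mapI[where c="cnorm (fun_cone P Q) f + cnorm (fun_cone P Q) g"])
    fix x assume x: "x \<in> unit_ball P"
    then have "cnorm Q (add Q (f x) (g x)) \<le> cnorm Q (f x) + cnorm Q (g x)"
      using cone_map_carr[OF f] cone_map_carr[OF g] by (intro Q.norm_add)
    also have "\<dots> \<le> cnorm (fun_cone P Q) f + cnorm (fun_cone P Q) g"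
      using assms x by (intro add_mono fun_norm_upper)
    finally show "cnorm Q (add Q (f x) (g x)) \<le> cnorm (fun_cone P Q) f + cnorm (fun_cone P Q) g" .
  next
    fix N :: "nat set" and \<phi> \<sigma> assume *: "cone_cube P T N \<phi>" "\<sigma> \<in> S"
    have "rcube N (\<lambda>I. \<sigma> (f (\<phi> I)) + \<sigma> (g (\<phi> I)))"
      using * cone_map_cube[OF f *] cone_map_cube[OF g *] by (intro rcube_add) (auto simp: cone_cube_def)
    moreover have "\<sigma> (add Q (f (\<phi> I)) (g (\<phi> I))) = \<sigma> (f (\<phi> I)) + \<sigma> (g (\<phi> I))" if "I \<subseteq> N" for I
      using * that cone_map_carr[OF f] cone_map_carr[OF g] by (auto simp: Q.fn_add cone_cube_def)
    ultimately show "rcube N (\<lambda>I. \<sigma> (add Q (f (\<phi> I)) (g (\<phi> I))))" by (simp cong: rcube_cong)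
  next
    fix X l \<sigma> assume *: "cone_chain P T X l" "\<sigma> \<in> S"
    then have "X n \<in> unit_ball P" "l \<in> unit_ball P" for n by (auto simp: cone_chain_def)
    then show "(\<lambda>n. \<sigma> (add Q (f (X n)) (g (X n)))) \<longlonglongrightarrow> \<sigma> (add Q (f l) (g l))"
      using tendsto_add[OF cone_map_limit[OF f *] cone_map_limit[OF g *]] *
        cone_map_carr[OF f] cone_map_carr[OF g] by (simp add: Q.fn_add)
  next
    fix n k \<gamma> m assume *: "\<gamma> \<in> unit_paths P n" "m \<in> tests Q k"
    have "(\<lambda>x. (case x of (r, s) \<Rightarrow> m r (f (\<gamma> s))) + (case x of (r, s) \<Rightarrow> m r (g (\<gamma> s))))
        \<in> borel_measurable (Rn k \<Otimes>\<^sub>M Rn n)"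
      using cone_map_test[OF f *] cone_map_test[OF g *] by (rule borel_measurable_add)
    also have "?this \<longleftrightarrow> (\<lambda>(r, s). m r (add Q (f (\<gamma> s)) (g (\<gamma> s)))) \<in> borel_measurable (Rn k \<Otimes>\<^sub>M Rn n)"
      using unit_paths_ball[OF *(1)] * cone_map_carr[OF f] cone_map_carr[OF g]
      by (intro measurable_cong) (auto simp: space_pair_measure Q.test_add)
    finally show "(\<lambda>(r, s). m r (add Q (f (\<gamma> s)) (g (\<gamma> s)))) \<in> borel_measurable (Rn k \<Otimes>\<^sub>M Rn n)" .
  qed (use cone_map_carr[OF f] cone_map_carr[OF g] in \<open>auto intro: Q.add_carr\<close>)
  then show ?thesis by (simp add: fun_cone_def)
qed

text \<open>The difference is formed pointwise, which the point evaluations permit. That it maps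
  cubes to cubes is precisely the hypothesis for the other functionals, and this is where cubes of
  higher dimension enter \<open>fun_fns\<close>. Limits and measurability pass through subtraction
  of reals.\<close>

lemma fun_difference:
  assumes "f \<in> carr (fun_cone P Q)" "g \<in> carr (fun_cone P Q)"
    and le: "\<And>\<tau>. \<tau> \<in> fun_fns P T S \<Longrightarrow> \<tau> f \<le> \<tau> g"
  shows "\<exists>h\<in>carr (fun_cone P Q). g = add (fun_cone P Q) f h"
proof -
  note f = fun_mapD[OF assms(1)] and g = fun_mapD[OF assms(2)]
  have "\<forall>x\<in>unit_ball P. \<exists>z\<in>carr Q. g x = add Q (f x) z"
    using le[OF point_fns] cone_map_carr[OF f] cone_map_carr[OF g] by (auto intro!: Q.difference)
  then obtain z where z: "\<And>x. x \<in> unit_ball P \<Longrightarrow> z x \<in> carr Q"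
      "\<And>x. x \<in> unit_ball P \<Longrightarrow> g x = add Q (f x) (z x)"
    by metis
  have \<sigma>z: "\<sigma> (z x) = \<sigma> (g x) - \<sigma> (f x)" if "x \<in> unit_ball P" "\<sigma> \<in> S" for x \<sigma>
    using z that cone_map_carr[OF f] by (simp add: Q.fn_add)
  have mz: "m r (z x) = m r (g x) - m r (f x)" if "x \<in> unit_ball P" "m \<in> tests Q k" "r \<in> space (Rn k)" for x m k r
    using z that cone_map_carr[OF f] by (simp add: Q.test_add)
  have "(\<lambda>x\<in>unit_ball P. z x) \<in> carr (fun_cone P Q)"
  proof (rule restrict_mapI[where c="cnorm (fun_cone P Q) g"])
    fix x assume x: "x \<in> unit_ball P"
    have "cnorm Q (z x) \<le> cnorm Q (g x)"
      using x z cone_map_carr[OF f] cone_map_carr[OF g]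
      by (intro Q.norm_le) (auto simp: \<sigma>z Q.fn_nonneg)
    also have "\<dots> \<le> cnorm (fun_cone P Q) g" using assms x by (intro fun_norm_upper)
    finally show "cnorm Q (z x) \<le> cnorm (fun_cone P Q) g" .
  next
    fix N :: "nat set" and \<phi> \<sigma> assume *: "cone_cube P T N \<phi>" "\<sigma> \<in> S"
    have N: "finite N" using * by (simp add: cone_cube_def)
    show "rcube N (\<lambda>I. \<sigma> (z (\<phi> I)))"
      unfolding rcube_iff_moebius[OF N]
    proof (intro allI impI)
      fix J assume J: "J \<subseteq> N"
      have "moebius J (\<lambda>I. \<sigma> (z (\<phi> I))) = moebius J (\<lambda>I. \<sigma> (g (\<phi> I)) - \<sigma> (f (\<phi> I)))"
        using * J by (intro moebius_cong \<sigma>z) (auto simp: cone_cube_def)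
      also have "\<dots> = moebius J (\<lambda>I. \<sigma> (g (\<phi> I))) - moebius J (\<lambda>I. \<sigma> (f (\<phi> I)))" by (rule moebius_diff)
      also have "\<dots> \<ge> 0"
      proof -
        have "(\<lambda>f. moebius J (\<lambda>I. \<sigma> (f (\<phi> I)))) \<in> fun_fns P T S"
          unfolding fun_fns_def using cone_cube_subset[OF *(1) J] *(2) by blast
        from le[OF this] show ?thesis by simp
      qed
      finally show "0 \<le> moebius J (\<lambda>I. \<sigma> (z (\<phi> I)))" by simp
    qed
  next
    fix X l \<sigma> assume *: "cone_chain P T X l" "\<sigma> \<in> S"
    then have "X n \<in> unit_ball P" "l \<in> unit_ball P" for n by (auto simp: cone_chain_def)
    then show "(\<lambda>n. \<sigma> (z (X n))) \<longlonglongrightarrow> \<sigma> (z l)"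
      using tendsto_diff[OF cone_map_limit[OF g *] cone_map_limit[OF f *]] * by (simp add: \<sigma>z)
  next
    fix n k \<gamma> m assume *: "\<gamma> \<in> unit_paths P n" "m \<in> tests Q k"
    have "(\<lambda>x. (case x of (r, s) \<Rightarrow> m r (g (\<gamma> s))) - (case x of (r, s) \<Rightarrow> m r (f (\<gamma> s))))
        \<in> borel_measurable (Rn k \<Otimes>\<^sub>M Rn n)"
      using cone_map_test[OF g *] cone_map_test[OF f *] by (rule borel_measurable_diff)
    also have "?this \<longleftrightarrow> (\<lambda>(r, s). m r (z (\<gamma> s))) \<in> borel_measurable (Rn k \<Otimes>\<^sub>M Rn n)"
      using unit_paths_ball[OF *(1)] * mz
      by (intro measurable_cong) (auto simp: space_pair_measure)
    finally show "(\<lambda>(r, s). m r (z (\<gamma> s))) \<in> borel_measurable (Rn k \<Otimes>\<^sub>M Rn n)" .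
  qed (use z in auto)
  moreover have "g = add (fun_cone P Q) f (\<lambda>x\<in>unit_ball P. z x)"
    using assms(2) z by (auto simp: fun_cone_def fun_eq_iff PiE_def extensional_def)
  ultimately show ?thesis by blast
qed

text \<open>The limit is pointwise. Its continuity interchanges two monotone limits, and its
  measurability holds because tests commute with bounded increasing limits.\<close>

lemma fun_complete:
  assumes X: "\<And>n. X n \<in> carr (fun_cone P Q)" and c: "\<And>n. cnorm (fun_cone P Q) (X n) \<le> c"
    and mono: "\<And>\<tau>. \<tau> \<in> fun_fns P T S \<Longrightarrow> incseq (\<lambda>n. \<tau> (X n))"
  shows "\<exists>l\<in>carr (fun_cone P Q). cnorm (fun_cone P Q) l \<le> c \<and>
    (\<forall>\<tau>\<in>fun_fns P T S. (\<lambda>n. \<tau> (X n)) \<longlonglongrightarrow> \<tau> l)"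
proof -
  note map = fun_mapD[OF X]
  have val: "X n x \<in> carr Q" and nrm: "cnorm Q (X n x) \<le> c" and inc: "\<sigma> \<in> S \<Longrightarrow> incseq (\<lambda>n. \<sigma> (X n x))"
    if "x \<in> unit_ball P" for n x \<sigma>
    using that cone_map_carr[OF map] order_trans[OF fun_norm_upper[OF X] c] mono[OF point_fns] by auto
  have "\<forall>x\<in>unit_ball P. \<exists>l\<in>carr Q. cnorm Q l \<le> c \<and> (\<forall>\<sigma>\<in>S. (\<lambda>n. \<sigma> (X n x)) \<longlonglongrightarrow> \<sigma> l)"
    using val nrm inc by (intro ballI Q.complete) auto
  then obtain l where l: "\<And>x. x \<in> unit_ball P \<Longrightarrow> l x \<in> carr Q"
      "\<And>x. x \<in> unit_ball P \<Longrightarrow> cnorm Q (l x) \<le> c"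
      "\<And>x \<sigma>. x \<in> unit_ball P \<Longrightarrow> \<sigma> \<in> S \<Longrightarrow> (\<lambda>n. \<sigma> (X n x)) \<longlonglongrightarrow> \<sigma> (l x)"
    by metis
  let ?l = "\<lambda>x\<in>unit_ball P. l x"
  have carr: "?l \<in> carr (fun_cone P Q)"
  proof (rule restrict_mapI[where c=c])
    fix N :: "nat set" and \<phi> \<sigma> assume *: "cone_cube P T N \<phi>" "\<sigma> \<in> S"
    show "rcube N (\<lambda>I. \<sigma> (l (\<phi> I)))"
      by (rule rcube_limit[where \<phi>="\<lambda>n I. \<sigma> (X n (\<phi> I))", OF _ cone_map_cube[OF map *]]) (use * l in \<open>auto simp: cone_cube_def\<close>)
  next
    fix Y y \<sigma> assume *: "cone_chain P T Y y" "\<sigma> \<in> S"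
    then have Y: "Y n \<in> unit_ball P" "y \<in> unit_ball P" for n by (auto simp: cone_chain_def)
    show "(\<lambda>k. \<sigma> (l (Y k))) \<longlonglongrightarrow> \<sigma> (l y)"
    proof (rule exchange_limit[where a="\<lambda>k n. \<sigma> (X n (Y k))"])
      show "incseq (\<lambda>k. \<sigma> (X n (Y k)))" for n
        using cone_map_incseq[OF P.rcone_axioms map *] .
      show "(\<lambda>k. \<sigma> (X n (Y k))) \<longlonglongrightarrow> \<sigma> (X n y)" for n
        using cone_map_limit[OF map *] .
    qed (use Y l inc * in auto)
  next
    fix n k \<gamma> m assume *: "\<gamma> \<in> unit_paths P n" "m \<in> tests Q k"
    show "(\<lambda>(r, s). m r (l (\<gamma> s))) \<in> borel_measurable (Rn k \<Otimes>\<^sub>M Rn n)"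
    proof (rule borel_measurable_LIMSEQ_metric)
      show "(\<lambda>(r, s). m r (X j (\<gamma> s))) \<in> borel_measurable (Rn k \<Otimes>\<^sub>M Rn n)" for j
        using cone_map_test[OF map *] .
      fix x assume "x \<in> space (Rn k \<Otimes>\<^sub>M Rn n)"
      then obtain r s where x: "x = (r, s)" "r \<in> space (Rn k)" "s \<in> space (Rn n)"
        by (auto simp: space_pair_measure)
      have "\<gamma> s \<in> unit_ball P" using unit_paths_ball[OF *(1)] x by blast
      then have "(\<lambda>j. m r (X j (\<gamma> s))) \<longlonglongrightarrow> m r (l (\<gamma> s))"
        using l val nrm inc by (intro Q.test_limit[OF *(2) x(2), where c=c]) auto
      then show "(\<lambda>j. case x of (r, s) \<Rightarrow> m r (X j (\<gamma> s))) \<longlonglongrightarrow> (case x of (r, s) \<Rightarrow> m r (l (\<gamma> s)))"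
        by (simp add: x)
    qed
  qed (use l in auto)
  moreover have "cnorm (fun_cone P Q) ?l \<le> c"
    using l by (simp add: fun_norm_le_iff[OF carr])
  moreover have "(\<lambda>n. \<tau> (X n)) \<longlonglongrightarrow> \<tau> ?l" if "\<tau> \<in> fun_fns P T S" for \<tau>
  proof -
    from that obtain N \<phi> \<sigma> where *: "cone_cube P T (N::nat set) \<phi>" "\<sigma> \<in> S"
      and \<tau>: "\<tau> = (\<lambda>f. moebius N (\<lambda>I. \<sigma> (f (\<phi> I))))" by (rule fun_fnsE)
    show ?thesis
      unfolding \<tau> by (rule tendsto_moebius) (use * l in \<open>auto simp: cone_cube_def\<close>)
  qed
  ultimately show ?thesis by blast
qed

lemma fun_norm_mono:
  assumes "f \<in> carr (fun_cone P Q)" "g \<in> carr (fun_cone P Q)"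
  shows "cnorm (fun_cone P Q) f \<le> cnorm (fun_cone P Q) (add (fun_cone P Q) f g)"
  unfolding fun_norm_le_iff[OF assms(1)]
proof
  fix x assume x: "x \<in> unit_ball P"
  have "cnorm Q (f x) \<le> cnorm Q (add Q (f x) (g x))"
    using x cone_map_carr[OF fun_mapD] assms by (intro Q.norm_mono) auto
  also have "\<dots> = cnorm Q (add (fun_cone P Q) f g x)"
    using x by (simp add: fun_cone_def)
  also have "\<dots> \<le> cnorm (fun_cone P Q) (add (fun_cone P Q) f g)"
    using x assms by (intro fun_norm_upper fun_add_carr)
  finally show "cnorm Q (f x) \<le> cnorm (fun_cone P Q) (add (fun_cone P Q) f g)" .
qed

lemma fun_norm_add:
  assumes "f \<in> carr (fun_cone P Q)" "g \<in> carr (fun_cone P Q)"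
  shows "cnorm (fun_cone P Q) (add (fun_cone P Q) f g) \<le> cnorm (fun_cone P Q) f + cnorm (fun_cone P Q) g"
  unfolding fun_norm_le_iff[OF fun_add_carr[OF assms]]
proof
  fix x assume x: "x \<in> unit_ball P"
  have "cnorm Q (add (fun_cone P Q) f g x) = cnorm Q (add Q (f x) (g x))"
    using x by (simp add: fun_cone_def)
  also have "\<dots> \<le> cnorm Q (f x) + cnorm Q (g x)"
    using x cone_map_carr[OF fun_mapD] assms by (intro Q.norm_add) auto
  also have "\<dots> \<le> cnorm (fun_cone P Q) f + cnorm (fun_cone P Q) g"
    using assms x by (intro add_mono fun_norm_upper)
  finally show "cnorm Q (add (fun_cone P Q) f g x) \<le> cnorm (fun_cone P Q) f + cnorm (fun_cone P Q) g" .
qed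

lemma fun_testsE:
  assumes "t \<in> tests (fun_cone P Q) k"
  obtains \<gamma> m where "\<gamma> \<in> unit_paths P k" "m \<in> tests Q k" "t = (\<lambda>r f. m r (f (\<gamma> r)))"
  using assms by (auto simp: fun_cone_def)

lemma fun_add_apply: "x \<in> unit_ball P \<Longrightarrow> add (fun_cone P Q) f g x = add Q (f x) (g x)"
  and fun_zero_apply: "x \<in> unit_ball P \<Longrightarrow> zero (fun_cone P Q) x = zero Q"
  by (simp_all add: fun_cone_def)

lemma rcone_fun: "rcone (fun_cone P Q) (fun_fns P T S)"
proof
  fix \<tau> assume "\<tau> \<in> fun_fns P T S"
  then obtain N \<phi> \<sigma> where *: "cone_cube P T (N::nat set) \<phi>" "\<sigma> \<in> S"
    and \<tau>: "\<tau> = (\<lambda>f. moebius N (\<lambda>I. \<sigma> (f (\<phi> I))))" by (rule fun_fnsE)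
  have ball: "\<phi> I \<in> unit_ball P" if "I \<subseteq> N" for I using * that by (simp add: cone_cube_def)
  have "moebius N (\<lambda>I. \<sigma> (zero (fun_cone P Q) (\<phi> I))) = moebius N (\<lambda>I. 0)"
    using ball * by (intro moebius_cong) (simp add: fun_zero_apply Q.fn_zero)
  then show "\<tau> (zero (fun_cone P Q)) = 0" by (simp add: \<tau> moebius_zero)
  show "0 \<le> \<tau> f" if "f \<in> carr (fun_cone P Q)" for f
    unfolding \<tau> using cone_map_cube[OF fun_mapD[OF that] *] *
    by (intro rcube_moebius_nonneg) (auto simp: cone_cube_def)
  show "\<tau> (add (fun_cone P Q) f g) = \<tau> f + \<tau> g"
    if f: "f \<in> carr (fun_cone P Q)" and g: "g \<in> carr (fun_cone P Q)" for f g
    unfolding \<tau> moebius_add[symmetric]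
    using ball * cone_map_carr[OF fun_mapD[OF f]] cone_map_carr[OF fun_mapD[OF g]]
    by (intro moebius_cong) (simp add: fun_add_apply Q.fn_add)
next
  fix f g assume f: "f \<in> carr (fun_cone P Q)" and g: "g \<in> carr (fun_cone P Q)"
    and eq: "\<And>\<tau>. \<tau> \<in> fun_fns P T S \<Longrightarrow> \<tau> f = \<tau> g"
  have "f x = g x" if "x \<in> unit_ball P" for x
    using that cone_map_carr[OF fun_mapD] f g eq[OF point_fns] by (intro Q.separate) auto
  then show "f = g"
    using f g by (intro extensionalityI[of f "unit_ball P"]) (auto simp: fun_carr_iff)
next
  have "cnorm (fun_cone P Q) (zero (fun_cone P Q)) = (SUP x\<in>unit_ball P. 0)"
    by (simp add: fun_cone_def Q.norm_zero)
  also have "\<dots> = 0" by (rule cSUP_const) (use P.zero_ball in auto)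
  finally show "cnorm (fun_cone P Q) (zero (fun_cone P Q)) = 0" .
next
  fix t k r assume t: "t \<in> tests (fun_cone P Q) k" and r: "r \<in> space (Rn k)"
  from t obtain \<gamma> m where \<gamma>: "\<gamma> \<in> unit_paths P k" and m: "m \<in> tests Q k" and t_eq: "t = (\<lambda>r f. m r (f (\<gamma> r)))"
    by (rule fun_testsE)
  have ball: "\<gamma> r \<in> unit_ball P" using unit_paths_ball[OF \<gamma> r] .
  show "t r (zero (fun_cone P Q)) = 0"
    using m r ball by (simp add: t_eq fun_zero_apply Q.test_zero)
  show "t r (add (fun_cone P Q) f g) = t r f + t r g"
    if f: "f \<in> carr (fun_cone P Q)" and g: "g \<in> carr (fun_cone P Q)" for f g
    using m r ball cone_map_carr[OF fun_mapD[OF f]] cone_map_carr[OF fun_mapD[OF g]]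
    by (simp add: t_eq fun_add_apply Q.test_add)
  show "(\<lambda>n. t r (X n)) \<longlonglongrightarrow> t r l"
    if X: "\<And>n. X n \<in> carr (fun_cone P Q)" and c: "\<And>n. cnorm (fun_cone P Q) (X n) \<le> c"
      and l: "l \<in> carr (fun_cone P Q)"
      and inc: "\<And>\<tau>. \<tau> \<in> fun_fns P T S \<Longrightarrow> incseq (\<lambda>n. \<tau> (X n))"
      and lim: "\<And>\<tau>. \<tau> \<in> fun_fns P T S \<Longrightarrow> (\<lambda>n. \<tau> (X n)) \<longlonglongrightarrow> \<tau> l" for X c l
    unfolding t_eq
  proof (rule Q.test_limit[OF m r, where c=c])
    show "cnorm Q (X n (\<gamma> r)) \<le> c" for n using fun_norm_upper[OF X ball] c order_trans by blast
  qed (use cone_map_carr[OF fun_mapD] X l ball inc[OF point_fns] lim[OF point_fns] in auto)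
next
  fix t k k' and p :: "(nat \<Rightarrow> real) \<Rightarrow> nat \<Rightarrow> real"
  assume t: "t \<in> tests (fun_cone P Q) k" and p: "p \<in> measurable (Rn k') (Rn k)"
  from t obtain \<gamma> m where \<gamma>: "\<gamma> \<in> unit_paths P k" and m: "m \<in> tests Q k" and t_eq: "t = (\<lambda>r f. m r (f (\<gamma> r)))"
    by (rule fun_testsE)
  show "(\<lambda>r. t (p r)) \<in> tests (fun_cone P Q) k'"
    unfolding t_eq using unit_paths_reindex[OF \<gamma> p] Q.test_reindex[OF m p]
    by (auto simp: fun_cone_def)
next
  fix t k f assume t: "t \<in> tests (fun_cone P Q) k" and f: "f \<in> carr (fun_cone P Q)"
  from t obtain \<gamma> m where \<gamma>: "\<gamma> \<in> unit_paths P k" and m: "m \<in> tests Q k" and t_eq: "t = (\<lambda>r f. m r (f (\<gamma> r)))"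
    by (rule fun_testsE)
  \<comment> \<open>A function test evaluates its path and its inner test at the same parameter,
    hence the diagonal.\<close>
  have "(\<lambda>r. (r, r)) \<in> measurable (Rn k) (Rn k \<Otimes>\<^sub>M Rn k)" by measurable
  from measurable_compose[OF this cone_map_test[OF fun_mapD[OF f] \<gamma> m]]
  show "(\<lambda>r. t r f) \<in> borel_measurable (Rn k)" by (simp add: t_eq)
qed (use fun_zero_carr fun_add_carr fun_difference fun_complete fun_norm_mono fun_norm_add in blast)+

end

section \<open>The cone of finite Borel measures\<close>

definition meas_fns :: "(real measure \<Rightarrow> real) set" where
  "meas_fns = {\<lambda>\<mu>. measure \<mu> U | U. U \<in> sets borel}"

lemma sets_add_measure[simp]: "sets (add_measure \<mu> \<nu>) = sets borel"
  by (simp add: add_measure_def sets.sigma_sets_eq[of borel, simplified])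

lemma emeasure_add_measure:
  assumes "sets \<mu> = sets borel" "sets \<nu> = sets borel" "U \<in> sets borel"
  shows "emeasure (add_measure \<mu> \<nu>) U = emeasure \<mu> U + emeasure \<nu> U"
proof (rule emeasure_measure_of[OF add_measure_def])
  show "countably_additive (sets (add_measure \<mu> \<nu>)) (\<lambda>U. emeasure \<mu> U + emeasure \<nu> U)"
    unfolding sets_add_measure
  proof (rule countably_additiveI)
    fix A :: "nat \<Rightarrow> real set" assume A: "range A \<subseteq> sets borel" "disjoint_family A" "\<Union> (range A) \<in> sets borel"
    have "(\<Sum>i. emeasure \<mu> (A i) + emeasure \<nu> (A i)) = (\<Sum>i. emeasure \<mu> (A i)) + (\<Sum>i. emeasure \<nu> (A i))"
      by (intro suminf_add[symmetric]) auto
    also have "\<dots> = emeasure \<mu> (\<Union> (range A)) + emeasure \<nu> (\<Union> (range A))"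
      using A assms by (simp add: suminf_emeasure)
    finally show "(\<Sum>i. emeasure \<mu> (A i) + emeasure \<nu> (A i)) =
      emeasure \<mu> (\<Union> (range A)) + emeasure \<nu> (\<Union> (range A))" .
  qed
qed (use assms in \<open>auto simp: positive_def\<close>)

lemma finite_borel_measuresI:
  "sets \<mu> = sets borel \<Longrightarrow> emeasure \<mu> UNIV \<noteq> \<infinity> \<Longrightarrow> \<mu> \<in> finite_borel_measures"
  unfolding finite_borel_measures_def
  by (auto intro!: finite_measureI dest: sets_eq_imp_space_eq)

lemma finite_borel_emeasure:
  "\<mu> \<in> finite_borel_measures \<Longrightarrow> emeasure \<mu> U = ennreal (measure \<mu> U)"
  by (simp add: finite_borel_measures_def finite_measure.emeasure_eq_measure)

lemma finite_borel_sets: "\<mu> \<in> finite_borel_measures \<Longrightarrow> sets \<mu> = sets borel"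
  and finite_borel_space: "\<mu> \<in> finite_borel_measures \<Longrightarrow> space \<mu> = UNIV"
  by (auto simp: finite_borel_measures_def dest: sets_eq_imp_space_eq)

lemma measure_add_measure:
  assumes "\<mu> \<in> finite_borel_measures" "\<nu> \<in> finite_borel_measures" "U \<in> sets borel"
  shows "measure (add_measure \<mu> \<nu>) U = measure \<mu> U + measure \<nu> U"
proof (rule measure_eq_emeasure_eq_ennreal)
  show "emeasure (add_measure \<mu> \<nu>) U = ennreal (measure \<mu> U + measure \<nu> U)"
    using assms(3) by (simp add: emeasure_add_measure finite_borel_sets[OF assms(1)]
      finite_borel_sets[OF assms(2)] finite_borel_emeasure[OF assms(1)] finite_borel_emeasure[OF assms(2)])
qed simp

lemma add_measure_finite:
  assumes "\<mu> \<in> finite_borel_measures" "\<nu> \<in> finite_borel_measures"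
  shows "add_measure \<mu> \<nu> \<in> finite_borel_measures"
  using assms by (intro finite_borel_measuresI)
    (auto simp: emeasure_add_measure finite_borel_sets finite_borel_emeasure)

text \<open>The limit is the supremum in the lattice of measures, which on chains is computed set by
  set.\<close>

lemma measure_chain_limit:
  assumes X: "\<And>n. X n \<in> finite_borel_measures" and c: "\<And>n. measure (X n) UNIV \<le> c"
    and mono: "\<And>U. U \<in> sets borel \<Longrightarrow> incseq (\<lambda>n. measure (X n) U)"
  shows "\<exists>l\<in>finite_borel_measures. measure l UNIV \<le> c \<and>
    (\<forall>U\<in>sets borel. (\<lambda>n. measure (X n) U) \<longlonglongrightarrow> measure l U)"
proof -
  define l where "l = (SUP n. X n)"
  have sets_l: "sets l = sets borel"
    unfolding l_def using finite_borel_sets[OF X] by (intro sets_SUP) auto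
  have le: "X m \<le> X n" if "m \<le> n" for m n
  proof (rule less_eq_measure.intros(3))
    show "emeasure (X m) \<le> emeasure (X n)"
    proof (rule le_funI)
      \<comment> \<open>Off the Borel sets both measures vanish, so the comparison extends to all
        sets, as the order on measures demands.\<close>
      fix U show "emeasure (X m) U \<le> emeasure (X n) U"
      proof (cases "U \<in> sets borel")
        case True
        then show ?thesis
          using mono[OF True] that by (simp add: finite_borel_emeasure[OF X] incseq_def)
      next
        case False
        then show ?thesis by (simp add: emeasure_notin_sets finite_borel_sets[OF X])
      qed
    qed
  qed (use finite_borel_sets[OF X] finite_borel_space[OF X] in auto)
  have em: "emeasure l U = (SUP n. emeasure (X n) U)" if "U \<in> sets borel" for U
    unfolding l_def
  proof (rule emeasure_SUP_chain)
    show "Complete_Partial_Order.chain (\<le>) (range X)"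
      using le by (auto simp: Complete_Partial_Order.chain_def) (meson le nle_le)
  qed (use that finite_borel_sets[OF X] in auto)
  have c0: "0 \<le> c" using c[of 0] measure_nonneg order_trans by blast
  have "emeasure l UNIV \<le> ennreal c"
    using c by (auto simp: em finite_borel_emeasure[OF X] intro!: SUP_least ennreal_leI)
  then have l: "l \<in> finite_borel_measures"
    using sets_l by (intro finite_borel_measuresI) (auto simp: top_unique)
  have "measure l UNIV \<le> c"
    using \<open>emeasure l UNIV \<le> ennreal c\<close> c0 by (simp add: finite_borel_emeasure[OF l])
  moreover have "(\<lambda>n. measure (X n) U) \<longlonglongrightarrow> measure l U" if U: "U \<in> sets borel" for U
  proof -
    have "(\<lambda>n. emeasure (X n) U) \<longlonglongrightarrow> emeasure l U"
      unfolding em[OF U] using mono[OF U]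
      by (intro LIMSEQ_SUP) (simp add: finite_borel_emeasure[OF X] incseq_def)
    then show ?thesis by (simp add: finite_borel_emeasure[OF X] finite_borel_emeasure[OF l])
  qed
  ultimately show ?thesis using l by blast
qed

lemma measure_difference:
  assumes "\<mu> \<in> finite_borel_measures" "\<nu> \<in> finite_borel_measures"
    and le: "\<And>U. U \<in> sets borel \<Longrightarrow> measure \<mu> U \<le> measure \<nu> U"
  shows "\<exists>\<rho>\<in>finite_borel_measures. \<nu> = add_measure \<mu> \<rho>"
proof
  define \<rho> where "\<rho> = diff_measure \<nu> \<mu>"
  have em: "emeasure \<rho> U = emeasure \<nu> U - emeasure \<mu> U" if "U \<in> sets borel" for U
    unfolding \<rho>_def using assms that
    by (intro emeasure_diff_measure) (auto simp: finite_borel_measures_def finite_measure.emeasure_eq_measure)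
  have sets: "sets \<rho> = sets borel" by (simp add: \<rho>_def finite_borel_sets[OF assms(2)])
  show \<rho>: "\<rho> \<in> finite_borel_measures"
    using sets by (intro finite_borel_measuresI)
      (auto simp: em finite_borel_emeasure assms simp flip: ennreal_minus)
  show "\<nu> = add_measure \<mu> \<rho>"
  proof (rule measure_eqI)
    fix U assume "U \<in> sets \<nu>"
    then have U: "U \<in> sets borel" using finite_borel_sets[OF assms(2)] by simp
    then show "emeasure \<nu> U = emeasure (add_measure \<mu> \<rho>) U"
      using le[OF U] by (simp add: emeasure_add_measure finite_borel_sets[OF assms(1)] sets em
          finite_borel_emeasure[OF assms(1)] finite_borel_emeasure[OF assms(2)] ennreal_minus
          flip: ennreal_plus)
  qed (simp add: finite_borel_sets[OF assms(2)])
qed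

lemma rcone_meas: "rcone meas_cone meas_fns"
proof
  have null: "null_measure borel \<in> finite_borel_measures"
    by (intro finite_borel_measuresI) auto
  then show "zero meas_cone \<in> carr meas_cone" by (simp add: meas_cone_def)
  show "\<exists>l\<in>carr meas_cone. cnorm meas_cone l \<le> c \<and> (\<forall>\<tau>\<in>meas_fns. (\<lambda>n. \<tau> (X n)) \<longlonglongrightarrow> \<tau> l)"
    if "\<And>n. X n \<in> carr meas_cone" "\<And>n. cnorm meas_cone (X n) \<le> c"
      "\<And>\<tau>. \<tau> \<in> meas_fns \<Longrightarrow> incseq (\<lambda>n. \<tau> (X n))" for X c
    using measure_chain_limit[of X c] that by (fastforce simp: meas_cone_def meas_fns_def)
  show "\<exists>z\<in>carr meas_cone. y = add meas_cone x z"
    if "x \<in> carr meas_cone" "y \<in> carr meas_cone" "\<And>\<tau>. \<tau> \<in> meas_fns \<Longrightarrow> \<tau> x \<le> \<tau> y" for x y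
    using measure_difference[of x y] that by (fastforce simp: meas_cone_def meas_fns_def)
  show "x = y" if "x \<in> carr meas_cone" "y \<in> carr meas_cone" "\<And>\<tau>. \<tau> \<in> meas_fns \<Longrightarrow> \<tau> x = \<tau> y" for x y
  proof (rule measure_eqI)
    show "sets x = sets y" using that by (simp add: meas_cone_def finite_borel_sets)
    fix U assume "U \<in> sets x"
    then have "U \<in> sets borel" using that by (simp add: meas_cone_def finite_borel_sets)
    then show "emeasure x U = emeasure y U"
      using that(1,2) that(3)[of "\<lambda>\<mu>. measure \<mu> U"]
      by (auto simp: meas_cone_def meas_fns_def finite_borel_emeasure)
  qed
  fix m k and r :: "nat \<Rightarrow> real" assume m: "m \<in> tests meas_cone k"
  then obtain U where U: "U \<in> sets borel" "m = (\<lambda>r \<mu>. measure \<mu> U)" by (auto simp: meas_cone_def)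
  show "(\<lambda>n. m r (X n)) \<longlonglongrightarrow> m r l"
    if "\<And>\<tau>. \<tau> \<in> meas_fns \<Longrightarrow> (\<lambda>n. \<tau> (X n)) \<longlonglongrightarrow> \<tau> l" for X l
    using that U by (auto simp: meas_fns_def)
qed (auto simp: meas_cone_def meas_fns_def add_measure_finite measure_add_measure)

section \<open>Transport along a coding\<close>

lemma rcone_transport:
  assumes "rcone P T" and inv: "\<And>x. x \<in> carr P \<Longrightarrow> d (e x) = x"
  shows "rcone (transport e d P) ((\<lambda>\<tau> x. \<tau> (d x)) ` T)"
proof -
  interpret P: rcone P T by fact
  show ?thesis
  proof
    fix X c assume X: "\<And>n. X n \<in> carr (transport e d P)" and c: "\<And>n. cnorm (transport e d P) (X n) \<le> c"
      and mono: "\<And>\<tau>. \<tau> \<in> (\<lambda>\<tau> x. \<tau> (d x)) ` T \<Longrightarrow> incseq (\<lambda>n. \<tau> (X n))"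
    have X': "d (X n) \<in> carr P" for n using X[of n] inv by (auto simp: transport_def)
    have c': "cnorm P (d (X n)) \<le> c" for n using c[of n] by (simp add: transport_def)
    have "incseq (\<lambda>n. \<tau> (d (X n)))" if "\<tau> \<in> T" for \<tau> using mono[OF imageI[OF that]] .
    from P.complete[of "\<lambda>n. d (X n)", OF X' c' this]
    have "\<exists>l\<in>carr P. cnorm P l \<le> c \<and> (\<forall>\<tau>\<in>T. (\<lambda>n. \<tau> (d (X n))) \<longlonglongrightarrow> \<tau> l)" .
    then obtain l where "l \<in> carr P" "cnorm P l \<le> c" "\<forall>\<tau>\<in>T. (\<lambda>n. \<tau> (d (X n))) \<longlonglongrightarrow> \<tau> l"
      by blast
    then show "\<exists>l\<in>carr (transport e d P). cnorm (transport e d P) l \<le> c \<and>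
        (\<forall>\<tau>\<in>(\<lambda>\<tau> x. \<tau> (d x)) ` T. (\<lambda>n. \<tau> (X n)) \<longlonglongrightarrow> \<tau> l)"
      using inv by (intro bexI[of _ "e l"]) (auto simp: transport_def)
  next
    fix m k r X c l assume m: "m \<in> tests (transport e d P) k" and r: "r \<in> space (Rn k)"
      and X: "\<And>n. X n \<in> carr (transport e d P)" and c: "\<And>n. cnorm (transport e d P) (X n) \<le> c"
      and l: "l \<in> carr (transport e d P)"
      and inc: "\<And>\<tau>. \<tau> \<in> (\<lambda>\<tau> x. \<tau> (d x)) ` T \<Longrightarrow> incseq (\<lambda>n. \<tau> (X n))"
      and lim: "\<And>\<tau>. \<tau> \<in> (\<lambda>\<tau> x. \<tau> (d x)) ` T \<Longrightarrow> (\<lambda>n. \<tau> (X n)) \<longlonglongrightarrow> \<tau> l"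
    obtain m' where m': "m' \<in> tests P k" "m = (\<lambda>r x. m' r (d x))"
      using m by (auto simp: transport_def)
    have "(\<lambda>n. m' r (d (X n))) \<longlonglongrightarrow> m' r (d l)"
    proof (rule P.test_limit[OF m'(1) r, where c=c])
      show "d (X n) \<in> carr P" for n using X[of n] inv by (auto simp: transport_def)
      show "d l \<in> carr P" using l inv by (auto simp: transport_def)
      show "cnorm P (d (X n)) \<le> c" for n using c[of n] by (simp add: transport_def)
      show "incseq (\<lambda>n. \<tau> (d (X n)))" if "\<tau> \<in> T" for \<tau> using inc[OF imageI[OF that]] .
      show "(\<lambda>n. \<tau> (d (X n))) \<longlonglongrightarrow> \<tau> (d l)" if "\<tau> \<in> T" for \<tau> using lim[OF imageI[OF that]] .
    qed
    then show "(\<lambda>n. m r (X n)) \<longlonglongrightarrow> m r l" by (simp add: m')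
  next
    fix x y assume xy: "x \<in> carr (transport e d P)" "y \<in> carr (transport e d P)"
      and le: "\<And>\<tau>. \<tau> \<in> (\<lambda>\<tau> x. \<tau> (d x)) ` T \<Longrightarrow> \<tau> x \<le> \<tau> y"
    then obtain x' y' where *: "x = e x'" "y = e y'" "x' \<in> carr P" "y' \<in> carr P"
      by (auto simp: transport_def)
    have "\<tau> x' \<le> \<tau> y'" if "\<tau> \<in> T" for \<tau> using le[OF imageI[OF that]] * inv by simp
    from P.difference[OF *(3,4) this] obtain z where "z \<in> carr P" "y' = add P x' z" by blast
    with * show "\<exists>z\<in>carr (transport e d P). y = add (transport e d P) x z"
      using inv by (intro bexI[of _ "e z"]) (auto simp: transport_def)
  next
    fix x y assume xy: "x \<in> carr (transport e d P)" "y \<in> carr (transport e d P)"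
      and eq: "\<And>\<tau>. \<tau> \<in> (\<lambda>\<tau> x. \<tau> (d x)) ` T \<Longrightarrow> \<tau> x = \<tau> y"
    then obtain x' y' where *: "x = e x'" "y = e y'" "x' \<in> carr P" "y' \<in> carr P"
      by (auto simp: transport_def)
    have "\<tau> x' = \<tau> y'" if "\<tau> \<in> T" for \<tau> using eq[OF imageI[OF that]] * inv by simp
    from P.separate[OF *(3,4) this] * show "x = y" by simp
  next
    fix m k k' and p :: "(nat \<Rightarrow> real) \<Rightarrow> nat \<Rightarrow> real"
    assume m: "m \<in> tests (transport e d P) k" and p: "p \<in> measurable (Rn k') (Rn k)"
    from m obtain m' where m': "m' \<in> tests P k" "m = (\<lambda>r x. m' r (d x))"
      by (auto simp: transport_def)
    show "(\<lambda>r. m (p r)) \<in> tests (transport e d P) k'"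
      using P.test_reindex[OF m'(1) p] by (auto simp: transport_def m'(2))
  next
    fix m k x assume "m \<in> tests (transport e d P) k" "x \<in> carr (transport e d P)"
    then show "(\<lambda>r. m r x) \<in> borel_measurable (Rn k)"
      using P.test_measurable by (auto simp: transport_def inv)
  qed (auto simp: transport_def inv P.zero_carr P.add_carr P.fn_zero P.fn_add P.fn_nonneg
      P.norm_zero P.norm_mono P.norm_add P.test_zero P.test_add)
qed

section \<open>Kernels and cubes of measures\<close>

text \<open>Identifies the unit ball with the space of subprobability measures of the Giry monad, so
  that kernels and bind become available.\<close>

lemma unit_ball_meas: "unit_ball meas_cone = space (subprob_algebra borel)"
proof (intro set_eqI iffI)
  fix \<mu> :: "real measure" assume "\<mu> \<in> unit_ball meas_cone"
  then have \<mu>: "\<mu> \<in> finite_borel_measures" "measure \<mu> UNIV \<le> 1"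
    by (auto simp: unit_ball_def meas_cone_def)
  have "subprob_space \<mu>"
    using \<mu> by (intro subprob_spaceI) (auto simp: finite_borel_space finite_borel_emeasure)
  then show "\<mu> \<in> space (subprob_algebra borel)"
    using finite_borel_sets[OF \<mu>(1)] by (simp add: space_subprob_algebra)
next
  fix \<mu> :: "real measure" assume "\<mu> \<in> space (subprob_algebra borel)"
  then have \<mu>: "subprob_space \<mu>" "sets \<mu> = sets borel" by (auto simp: space_subprob_algebra)
  interpret subprob_space \<mu> by fact
  show "\<mu> \<in> unit_ball meas_cone"
    using \<mu>(2) subprob_measure_le_1
    by (auto simp: unit_ball_def meas_cone_def finite_borel_measures_def finite_measure_axioms)
qed

lemma ball_meas_finite: "\<mu> \<in> unit_ball meas_cone \<Longrightarrow> \<mu> \<in> finite_borel_measures"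
  by (simp add: unit_ball_def meas_cone_def)

lemma kernel_ball:
  "\<nu> \<in> measurable M (subprob_algebra borel) \<Longrightarrow> x \<in> space M \<Longrightarrow> \<nu> x \<in> unit_ball meas_cone"
  unfolding unit_ball_meas by (rule measurable_space)

text \<open>The tests are the evaluations at Borel sets, so a measurable path in the unit ball is
  the same as a kernel.\<close>

lemma unit_paths_meas: "\<gamma> \<in> unit_paths meas_cone n \<longleftrightarrow> \<gamma> \<in> measurable (Rn n) (subprob_algebra borel)"
proof
  assume \<gamma>: "\<gamma> \<in> unit_paths meas_cone n"
  have ball: "\<gamma> s \<in> space (subprob_algebra borel)" if "s \<in> space (Rn n)" for s
    using unit_paths_ball[OF \<gamma> that] by (simp add: unit_ball_meas)
  show "\<gamma> \<in> measurable (Rn n) (subprob_algebra borel)"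
  proof (rule measurable_subprob_algebra)
    fix A :: "real set" assume A: "A \<in> sets borel"
    have "(\<lambda>(r, s). measure (\<gamma> s) A) \<in> borel_measurable (Rn 0 \<Otimes>\<^sub>M Rn n)"
      using unit_paths_test[OF \<gamma>, of "\<lambda>r \<mu>. measure \<mu> A" 0] A by (auto simp: meas_cone_def)
    \<comment> \<open>The constant \<open>undefined\<close> function is the one point of
      \<open>Rn 0\<close>, the parameter space of a test of arity 0.\<close>
    from measurable_compose[OF measurable_Pair1'[of "\<lambda>_. undefined"] this]
    have "(\<lambda>s. measure (\<gamma> s) A) \<in> borel_measurable (Rn n)" by (simp add: space_PiM)
    then have "(\<lambda>s. ennreal (measure (\<gamma> s) A)) \<in> borel_measurable (Rn n)" by measurable
    also have "?this \<longleftrightarrow> (\<lambda>s. emeasure (\<gamma> s) A) \<in> borel_measurable (Rn n)"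
      using ball unfolding unit_ball_meas[symmetric]
      by (intro measurable_cong) (simp add: finite_borel_emeasure ball_meas_finite)
    finally show "(\<lambda>s. emeasure (\<gamma> s) A) \<in> borel_measurable (Rn n)" .
  qed (use ball in \<open>auto simp: space_subprob_algebra\<close>)
next
  assume \<gamma>[measurable]: "\<gamma> \<in> measurable (Rn n) (subprob_algebra borel)"
  show "\<gamma> \<in> unit_paths meas_cone n"
  proof (rule unit_pathsI)
    fix k m assume "m \<in> tests meas_cone k"
    then obtain U where U[measurable]: "U \<in> sets borel" and m: "m = (\<lambda>r \<mu>. measure \<mu> U)" by (auto simp: meas_cone_def)
    show "(\<lambda>(r, s). m r (\<gamma> s)) \<in> borel_measurable (Rn k \<Otimes>\<^sub>M Rn n)"
      unfolding m by measurable
  qed (use kernel_ball[OF \<gamma>] in auto)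
qed

text \<open>Carries the expansion of a measure into Moebius coefficients through an integral. The
  measures are compared set by set, so the proof climbs from indicators to all nonnegative
  functions.\<close>

lemma nn_integral_measure_sum:
  assumes "finite A" and f: "f \<in> borel_measurable borel" and M: "sets M = sets borel"
    and m: "\<And>J. J \<in> A \<Longrightarrow> sets (m J) = sets borel"
    and sum: "\<And>U. U \<in> sets borel \<Longrightarrow> emeasure M U = (\<Sum>J\<in>A. emeasure (m J) U)"
  shows "(\<integral>\<^sup>+x. f x \<partial>M) = (\<Sum>J\<in>A. \<integral>\<^sup>+x. f x \<partial>m J)"
  using f
proof (induction f rule: borel_measurable_induct)
  case (cong f g)
  have "(\<integral>\<^sup>+x. f x \<partial>N) = (\<integral>\<^sup>+x. g x \<partial>N)" for N
    using cong by (intro nn_integral_cong) auto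
  then show ?case using cong by simp
next
  case (set U)
  then show ?case using M m by (simp add: sum)
next
  case (mult u c)
  have "(\<integral>\<^sup>+x. c * u x \<partial>N) = c * (\<integral>\<^sup>+x. u x \<partial>N)" if "sets N = sets borel" for N
    using mult that by (intro nn_integral_cmult) (simp add: measurable_cong_sets[OF that refl])
  then show ?case using mult M m by (simp add: sum_distrib_left)
next
  case (add u v)
  have "(\<integral>\<^sup>+x. v x + u x \<partial>N) = (\<integral>\<^sup>+x. v x \<partial>N) + (\<integral>\<^sup>+x. u x \<partial>N)" if "sets N = sets borel" for N
    using add that by (intro nn_integral_add) (simp_all add: measurable_cong_sets[OF that refl])
  then show ?case using add M m by (simp add: sum.distrib)
next
  case (seq F)
  have *: "(\<integral>\<^sup>+x. (SUP i. F i) x \<partial>N) = (SUP i. \<integral>\<^sup>+x. F i x \<partial>N)" if "sets N = sets borel" for N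
    unfolding SUP_apply using seq that
    by (intro nn_integral_monotone_convergence_SUP) (simp_all add: measurable_cong_sets[OF that refl])
  have inc: "incseq (\<lambda>i. \<integral>\<^sup>+x. F i x \<partial>N)" for N
    using seq by (auto simp: incseq_def le_fun_def intro!: nn_integral_mono)
  have "(\<integral>\<^sup>+x. (SUP i. F i) x \<partial>M) = (SUP i. \<integral>\<^sup>+x. F i x \<partial>M)"
    by (rule *[OF M])
  also have "\<dots> = (SUP i. \<Sum>J\<in>A. \<integral>\<^sup>+x. F i x \<partial>m J)"
    using seq by simp
  also have "\<dots> = (\<Sum>J\<in>A. SUP i. \<integral>\<^sup>+x. F i x \<partial>m J)"
    using inc by (intro ennreal_SUP_sum) auto
  also have "\<dots> = (\<Sum>J\<in>A. \<integral>\<^sup>+x. (SUP i. F i) x \<partial>m J)"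
    by (intro sum.cong refl *[symmetric] m)
  finally show ?case using seq by simp
qed

lemma nn_integral_add_measure:
  assumes "f \<in> borel_measurable borel" "sets \<mu> = sets borel" "sets \<nu> = sets borel"
  shows "(\<integral>\<^sup>+x. f x \<partial>add_measure \<mu> \<nu>) = (\<integral>\<^sup>+x. f x \<partial>\<mu>) + (\<integral>\<^sup>+x. f x \<partial>\<nu>)"
  using nn_integral_measure_sum[of "{True, False}" f "add_measure \<mu> \<nu>" "\<lambda>b. if b then \<mu> else \<nu>"] assms
  by (simp add: emeasure_add_measure split: if_splits)

lemma ball_meas_sets: "\<mu> \<in> unit_ball meas_cone \<Longrightarrow> sets \<mu> = sets borel"
  and ball_meas_space: "\<mu> \<in> unit_ball meas_cone \<Longrightarrow> space \<mu> = UNIV"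
  by (simp_all add: finite_borel_sets finite_borel_space ball_meas_finite)

lemma measurable_ball_iff: "\<mu> \<in> unit_ball meas_cone \<Longrightarrow> f \<in> measurable \<mu> N \<longleftrightarrow> f \<in> measurable borel N"
  by (simp only: measurable_cong_sets[OF ball_meas_sets refl])

lemma emeasure_bind_ball:
  fixes \<nu> :: "real \<Rightarrow> real measure"
  assumes "\<mu> \<in> unit_ball meas_cone" "\<nu> \<in> measurable borel (subprob_algebra borel)" "U \<in> sets borel"
  shows "emeasure (\<mu> \<bind> \<nu>) U = (\<integral>\<^sup>+r. emeasure (\<nu> r) U \<partial>\<mu>)"
  by (rule emeasure_bind[where N=borel]) (simp_all add: measurable_ball_iff ball_meas_space assms)

lemma bind_ball:
  assumes "\<mu> \<in> unit_ball meas_cone" "\<nu> \<in> measurable borel (subprob_algebra borel)"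
  shows "\<mu> \<bind> \<nu> \<in> unit_ball meas_cone"
proof -
  have k: "\<nu> \<in> measurable \<mu> (subprob_algebra borel)"
    using assms by (simp add: measurable_ball_iff)
  have "subprob_space \<mu>" using assms by (simp add: unit_ball_meas space_subprob_algebra)
  then have "subprob_space (\<mu> \<bind> \<nu>)" using k by (rule subprob_space_bind)
  moreover have "sets (\<mu> \<bind> \<nu>) = sets borel"
    by (rule sets_bind_measurable[OF k]) (simp add: ball_meas_space assms)
  ultimately show ?thesis by (simp add: unit_ball_meas space_subprob_algebra)
qed

text \<open>The semantics of \<open>let\<close> is a set function under \<open>measure_of\<close>;
  this recognises it as the bind of a measure with a kernel.\<close>

lemma measure_of_bind:
  fixes \<nu> :: "real \<Rightarrow> real measure"
  assumes "\<mu> \<in> unit_ball meas_cone" "\<nu> \<in> measurable borel (subprob_algebra borel)"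
  shows "measure_of UNIV (sets borel) (\<lambda>U. \<integral>\<^sup>+r. emeasure (\<nu> r) U \<partial>\<mu>) = \<mu> \<bind> \<nu>"
proof -
  have sets: "sets (\<mu> \<bind> \<nu>) = sets borel" "space (\<mu> \<bind> \<nu>) = UNIV"
    using bind_ball[OF assms] by (simp_all add: finite_borel_sets finite_borel_space ball_meas_finite)
  have "measure_of UNIV (sets borel) (\<lambda>U. \<integral>\<^sup>+r. emeasure (\<nu> r) U \<partial>\<mu>) =
    measure_of (space (\<mu> \<bind> \<nu>)) (sets (\<mu> \<bind> \<nu>)) (emeasure (\<mu> \<bind> \<nu>))"
    unfolding sets
    by (rule measure_of_eq)
      (auto simp: emeasure_bind_ball[OF assms] sets.sigma_sets_eq[of borel, simplified])
  then show ?thesis by (simp add: measure_of_of_measure)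
qed

lemma meas_chain_iff:
  "cone_chain meas_cone meas_fns X l \<longleftrightarrow> (\<forall>n. X n \<in> unit_ball meas_cone) \<and> l \<in> unit_ball meas_cone \<and>
     (\<forall>U\<in>sets borel. incseq (\<lambda>n. measure (X n) U) \<and> (\<lambda>n. measure (X n) U) \<longlonglongrightarrow> measure l U)"
  by (simp add: cone_chain_def meas_fns_def Setcompr_eq_image)

lemma meas_cube_iff:
  "cone_cube meas_cone meas_fns N \<phi> \<longleftrightarrow> finite N \<and> (\<forall>I\<subseteq>N. \<phi> I \<in> unit_ball meas_cone) \<and>
     (\<forall>U\<in>sets borel. rcube N (\<lambda>I. measure (\<phi> I) U))"
  by (simp add: cone_cube_def meas_fns_def Setcompr_eq_image)

text \<open>Expand \<open>\<phi>\<close> and the densities of \<open>\<nu>\<close> in their nonnegative Moebius coefficients and use that bind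
  is bilinear.\<close>

lemma bind_cube:
  assumes \<phi>: "cone_cube meas_cone meas_fns N \<phi>"
    and \<nu>: "\<And>I. I \<subseteq> N \<Longrightarrow> \<nu> I \<in> measurable borel (subprob_algebra borel)"
    and \<nu>_cube: "\<And>r. cone_cube meas_cone meas_fns N (\<lambda>I. \<nu> I r)"
  shows "cone_cube meas_cone meas_fns N (\<lambda>I. \<phi> I \<bind> \<nu> I)"
  unfolding meas_cube_iff
proof (intro conjI ballI allI impI)
  interpret rcone meas_cone meas_fns by (rule rcone_meas)
  show N: "finite N" using \<phi> by (simp add: meas_cube_iff)
  have ball: "\<phi> I \<in> unit_ball meas_cone" if "I \<subseteq> N" for I using \<phi> that by (simp add: meas_cube_iff)
  show "\<phi> I \<bind> \<nu> I \<in> unit_ball meas_cone" if "I \<subseteq> N" for I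
    using bind_ball[OF ball \<nu>] that by blast
  fix U :: "real set" assume U: "U \<in> sets borel"
  have "\<forall>J. \<exists>z. J \<subseteq> N \<longrightarrow> z \<in> carr meas_cone \<and> (\<forall>\<tau>\<in>meas_fns. \<tau> z = moebius J (\<lambda>I. \<tau> (\<phi> I)))"
    using moebius_exists[OF cone_cube_subset[OF \<phi>]] by blast
  \<comment> \<open>The coefficients of \<open>\<phi>\<close> are realised as measures, against
    which one can integrate.\<close>
  then obtain m where m: "\<And>J. J \<subseteq> N \<Longrightarrow> m J \<in> carr meas_cone"
      "\<And>J \<tau>. J \<subseteq> N \<Longrightarrow> \<tau> \<in> meas_fns \<Longrightarrow> \<tau> (m J) = moebius J (\<lambda>I. \<tau> (\<phi> I))"
    by metis
  have m_fin: "m J \<in> finite_borel_measures" if "J \<subseteq> N" for J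
    using m(1)[OF that] by (simp add: meas_cone_def)
  have m_moebius: "measure (m J) W = moebius J (\<lambda>I. measure (\<phi> I) W)" if "J \<subseteq> N" "W \<in> sets borel" for J W
    using m(2)[OF that(1), of "\<lambda>\<mu>. measure \<mu> W"] that(2) by (auto simp: meas_fns_def)
  define c where "c J r = moebius J (\<lambda>I. measure (\<nu> I r) U)" for J r
  have c0: "0 \<le> c J r" if "J \<subseteq> N" for J r
  proof -
    have "rcube N (\<lambda>I. measure (\<nu> I r) U)" using \<nu>_cube[of r] U by (simp add: meas_cube_iff)
    then show ?thesis using that N by (simp add: c_def rcube_iff_moebius)
  qed
  have c_sum: "measure (\<nu> I r) U = (\<Sum>J\<in>Pow I. c J r)" if "I \<subseteq> N" for I r
    unfolding c_def using finite_subset[OF that N] by (rule sum_moebius_Pow[symmetric])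
  have c_meas: "(\<lambda>r. ennreal (c J r)) \<in> borel_measurable borel" if "J \<subseteq> N" for J
  proof -
    have "(\<lambda>r. measure (\<nu> I r) U) \<in> borel_measurable borel" if "I \<in> Pow J" for I
    proof -
      have [measurable]: "\<nu> I \<in> measurable borel (subprob_algebra borel)" using \<nu>[of I] that \<open>J \<subseteq> N\<close> by auto
      show ?thesis using U by measurable
    qed
    then show ?thesis unfolding c_def moebius_def
      by (intro measurable_compose[OF _ measurable_ennreal] borel_measurable_sum borel_measurable_times) auto
  qed
  \<comment> \<open>\<open>c J r\<close> is one of the nonnegative terms adding up to
    \<open>measure (\<nu> J r) U\<close>. The bound keeps the integrals \<open>d\<close> finite, so
    that the expansion can be taken back to the reals.\<close>
  have c_le: "c J r \<le> 1" if "J \<subseteq> N" for J r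
  proof -
    have "c J r \<le> (\<Sum>J\<in>Pow J. c J r)"
      using that finite_subset[OF that N] c0 by (intro member_le_sum) auto
    also have "\<dots> = measure (\<nu> J r) U" using c_sum[OF that] by simp
    also have "\<dots> \<le> 1"
    proof -
      have "subprob_space (\<nu> J r)"
        using kernel_ball[OF \<nu>[OF that], of r] by (simp add: unit_ball_meas space_subprob_algebra)
      then show ?thesis by (rule subprob_space.subprob_measure_le_1)
    qed
    finally show ?thesis .
  qed
  define d where "d J K = (\<integral>\<^sup>+r. ennreal (c K r) \<partial>m J)" for J K
  have d_fin: "d J K < \<infinity>" if "J \<subseteq> N" "K \<subseteq> N" for J K
  proof -
    have "d J K \<le> (\<integral>\<^sup>+r. 1 \<partial>m J)"
      unfolding d_def using c_le[OF that(2)] by (intro nn_integral_mono) (simp add: ennreal_le_1)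
    also have "\<dots> < \<infinity>" by (simp add: finite_borel_emeasure[OF m_fin[OF that(1)]])
    finally show ?thesis .
  qed
  have em: "emeasure (\<phi> I \<bind> \<nu> I) U = (\<Sum>J\<in>Pow I. \<Sum>K\<in>Pow I. d J K)" if I: "I \<subseteq> N" for I
  proof -
    have finI: "finite I" using finite_subset[OF I N] .
    have "emeasure (\<phi> I \<bind> \<nu> I) U = (\<integral>\<^sup>+r. emeasure (\<nu> I r) U \<partial>\<phi> I)"
      using emeasure_bind_ball[OF ball[OF I] \<nu>[OF I] U] .
    also have "\<dots> = (\<integral>\<^sup>+r. (\<Sum>K\<in>Pow I. ennreal (c K r)) \<partial>\<phi> I)"
    proof (intro nn_integral_cong)
      fix r
      have "\<nu> I r \<in> finite_borel_measures"
        using kernel_ball[OF \<nu>[OF I], of r] by (simp add: ball_meas_finite)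
      then have "emeasure (\<nu> I r) U = ennreal (\<Sum>K\<in>Pow I. c K r)"
        by (simp add: finite_borel_emeasure c_sum[OF I])
      then show "emeasure (\<nu> I r) U = (\<Sum>K\<in>Pow I. ennreal (c K r))"
        using I c0 by (subst sum_ennreal) auto
    qed
    also have "\<dots> = (\<Sum>J\<in>Pow I. \<integral>\<^sup>+r. (\<Sum>K\<in>Pow I. ennreal (c K r)) \<partial>m J)"
    proof (rule nn_integral_measure_sum)
      show "finite (Pow I)" using finI by simp
      show "sets (\<phi> I) = sets borel" using ball[OF I] by (simp add: finite_borel_sets ball_meas_finite)
      show "sets (m J) = sets borel" if "J \<in> Pow I" for J
        using that I by (intro finite_borel_sets m_fin) auto
      show "(\<lambda>r. \<Sum>K\<in>Pow I. ennreal (c K r)) \<in> borel_measurable borel"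
        using I by (intro borel_measurable_sum c_meas) auto
      fix W :: "real set" assume W: "W \<in> sets borel"
      have "measure (\<phi> I) W = (\<Sum>J\<in>Pow I. moebius J (\<lambda>I. measure (\<phi> I) W))"
        using finI by (rule sum_moebius_Pow[symmetric])
      also have "\<dots> = (\<Sum>J\<in>Pow I. measure (m J) W)"
        using I W by (intro sum.cong refl m_moebius[symmetric]) auto
      finally have "ennreal (measure (\<phi> I) W) = (\<Sum>J\<in>Pow I. ennreal (measure (m J) W))"
        by (simp add: sum_ennreal)
      moreover have "(\<Sum>J\<in>Pow I. ennreal (measure (m J) W)) = (\<Sum>J\<in>Pow I. emeasure (m J) W)"
        using I by (intro sum.cong refl finite_borel_emeasure[symmetric] m_fin) auto
      ultimately show "emeasure (\<phi> I) W = (\<Sum>J\<in>Pow I. emeasure (m J) W)"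
        using ball[OF I] by (simp add: finite_borel_emeasure ball_meas_finite)
    qed
    also have "\<dots> = (\<Sum>J\<in>Pow I. \<Sum>K\<in>Pow I. d J K)"
    proof (intro sum.cong refl)
      fix J assume J: "J \<in> Pow I"
      then have s: "sets (m J) = sets borel" using I by (intro finite_borel_sets m_fin) auto
      show "(\<integral>\<^sup>+r. (\<Sum>K\<in>Pow I. ennreal (c K r)) \<partial>m J) = (\<Sum>K\<in>Pow I. d J K)"
        unfolding d_def using I c_meas
        by (intro nn_integral_sum) (auto simp: measurable_cong_sets[OF s refl])
    qed
    finally show ?thesis .
  qed
  show "rcube N (\<lambda>I. measure (\<phi> I \<bind> \<nu> I) U)"
  proof (rule rcube_bilinear[where d="\<lambda>J K. enn2real (d J K)"])
    fix I assume I: "I \<subseteq> N"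
    have "ennreal (\<Sum>J\<in>Pow I. \<Sum>K\<in>Pow I. enn2real (d J K)) = (\<Sum>J\<in>Pow I. \<Sum>K\<in>Pow I. ennreal (enn2real (d J K)))"
      by (simp add: sum_nonneg flip: sum_ennreal)
    also have "\<dots> = (\<Sum>J\<in>Pow I. \<Sum>K\<in>Pow I. d J K)"
    proof (intro sum.cong refl ennreal_enn2real)
      fix J K assume "J \<in> Pow I" "K \<in> Pow I"
      then have "J \<subseteq> N" "K \<subseteq> N" using I by auto
      then show "d J K < top" using d_fin by simp
    qed
    finally have "emeasure (\<phi> I \<bind> \<nu> I) U = ennreal (\<Sum>J\<in>Pow I. \<Sum>K\<in>Pow I. enn2real (d J K))"
      by (simp add: em[OF I])
    then show "measure (\<phi> I \<bind> \<nu> I) U = (\<Sum>J\<in>Pow I. \<Sum>K\<in>Pow I. enn2real (d J K))"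
      by (simp add: measure_def sum_nonneg)
  qed (use N in auto)
qed

text \<open>Write \<open>l = X n + \<rho> n\<close>. The mass of \<open>\<rho> n\<close> tends to
  zero, and since \<open>f\<close> is at most 1 this mass bounds the error of the integral.\<close>

lemma integral_chain_limit:
  assumes X: "cone_chain meas_cone meas_fns X l" and f: "f \<in> borel_measurable borel" "\<And>x. f x \<le> (1::ennreal)"
  shows "incseq (\<lambda>n. \<integral>\<^sup>+x. f x \<partial>X n)" "(\<lambda>n. \<integral>\<^sup>+x. f x \<partial>X n) \<longlonglongrightarrow> (\<integral>\<^sup>+x. f x \<partial>l)"
proof -
  have Xb: "X n \<in> finite_borel_measures" "l \<in> finite_borel_measures" for n
    using X by (auto simp: meas_chain_iff ball_meas_finite)
  have inc: "incseq (\<lambda>n. measure (X n) U)" and lim: "(\<lambda>n. measure (X n) U) \<longlonglongrightarrow> measure l U"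
    if "U \<in> sets borel" for U
    using X that by (auto simp: meas_chain_iff)
  show "incseq (\<lambda>n. \<integral>\<^sup>+x. f x \<partial>X n)"
  proof (rule incseq_SucI)
    fix n
    obtain \<rho> where "\<rho> \<in> finite_borel_measures" "X (Suc n) = add_measure (X n) \<rho>"
      using measure_difference[OF Xb(1) Xb(1), of n "Suc n"] incseq_SucD[OF inc] by blast
    then show "(\<integral>\<^sup>+x. f x \<partial>X n) \<le> (\<integral>\<^sup>+x. f x \<partial>X (Suc n))"
      using f Xb by (simp add: nn_integral_add_measure finite_borel_sets)
  qed
  have "\<exists>\<rho>\<in>finite_borel_measures. l = add_measure (X n) \<rho>" for n
    using measure_difference[OF Xb(1) Xb(2), of n] incseq_le[OF inc lim] by blast
  then obtain \<rho> where \<rho>: "\<And>n. \<rho> n \<in> finite_borel_measures" "\<And>n. l = add_measure (X n) (\<rho> n)"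
    by metis
  have "measure (\<rho> n) UNIV = measure l UNIV - measure (X n) UNIV" for n
  proof -
    have "measure l UNIV = measure (X n) UNIV + measure (\<rho> n) UNIV"
      using measure_add_measure[OF Xb(1) \<rho>(1), of UNIV n n] \<rho>(2)[of n] by simp
    then show ?thesis by simp
  qed
  then have "(\<lambda>n. measure (\<rho> n) UNIV) \<longlonglongrightarrow> measure l UNIV - measure l UNIV"
    using tendsto_diff[OF tendsto_const[of "measure l UNIV"] lim[of UNIV]] by simp
  then have r0: "(\<lambda>n. emeasure (\<rho> n) UNIV) \<longlonglongrightarrow> 0"
    using \<rho>(1) by (simp add: finite_borel_emeasure tendsto_ennreal_iff[where x=0, simplified])
  have eq: "(\<integral>\<^sup>+x. f x \<partial>l) = (\<integral>\<^sup>+x. f x \<partial>X n) + (\<integral>\<^sup>+x. f x \<partial>\<rho> n)" for n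
    using nn_integral_add_measure[OF f(1), of "X n" "\<rho> n"] \<rho> Xb by (simp add: finite_borel_sets flip: \<rho>(2))
  have le: "(\<integral>\<^sup>+x. f x \<partial>\<rho> n) \<le> emeasure (\<rho> n) UNIV" for n
  proof -
    have "(\<integral>\<^sup>+x. f x \<partial>\<rho> n) \<le> (\<integral>\<^sup>+x. 1 \<partial>\<rho> n)" using f(2) by (intro nn_integral_mono) auto
    then show ?thesis using finite_borel_space[OF \<rho>(1)] by simp
  qed
  show "(\<lambda>n. \<integral>\<^sup>+x. f x \<partial>X n) \<longlonglongrightarrow> (\<integral>\<^sup>+x. f x \<partial>l)"
  proof (rule tendsto_sandwich[OF _ _ _ tendsto_const])
    have "(\<integral>\<^sup>+x. f x \<partial>l) - emeasure (\<rho> n) UNIV \<le> (\<integral>\<^sup>+x. f x \<partial>X n)" for n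
      using eq[of n] le[of n] by (metis add_left_mono ennreal_minus_le_iff add.commute finite_borel_emeasure[OF \<rho>(1)] ennreal_neq_top)
    then show "\<forall>\<^sub>F n in sequentially. (\<integral>\<^sup>+x. f x \<partial>l) - emeasure (\<rho> n) UNIV \<le> (\<integral>\<^sup>+x. f x \<partial>X n)" by simp
    have "(\<integral>\<^sup>+x. f x \<partial>X n) \<le> (\<integral>\<^sup>+x. f x \<partial>l)" for n using eq[of n] by simp
    then show "\<forall>\<^sub>F n in sequentially. (\<integral>\<^sup>+x. f x \<partial>X n) \<le> (\<integral>\<^sup>+x. f x \<partial>l)" by simp
    have "(\<integral>\<^sup>+x. f x \<partial>l) \<noteq> \<infinity>"
    proof -
      have "(\<integral>\<^sup>+x. f x \<partial>l) \<le> (\<integral>\<^sup>+x. 1 \<partial>l)" using f(2) by (intro nn_integral_mono) auto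
      also have "\<dots> < \<infinity>" by (simp add: finite_borel_emeasure[OF Xb(2)])
      finally show ?thesis by simp
    qed
    then have "(\<lambda>n. (\<integral>\<^sup>+x. f x \<partial>l) - emeasure (\<rho> n) UNIV) \<longlonglongrightarrow> (\<integral>\<^sup>+x. f x \<partial>l) - 0"
      by (intro tendsto_diff_ennreal tendsto_const r0) auto
    then show "(\<lambda>n. (\<integral>\<^sup>+x. f x \<partial>l) - emeasure (\<rho> n) UNIV) \<longlonglongrightarrow> (\<integral>\<^sup>+x. f x \<partial>l)" by simp
  qed
qed

text \<open>The measure and the kernel move together. Splitting the index in two gives a double
  sequence, increasing in both indices, with monotone convergence in the kernel and
  \<open>integral_chain_limit\<close> in the measure; the claim concerns its diagonal.\<close>

lemma bind_chain:
  assumes X: "cone_chain meas_cone meas_fns X l"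
    and \<nu>: "\<And>n. \<nu> n \<in> measurable borel (subprob_algebra borel)" "\<nu>' \<in> measurable borel (subprob_algebra borel)"
    and ch: "\<And>r. cone_chain meas_cone meas_fns (\<lambda>n. \<nu> n r) (\<nu>' r)"
  shows "cone_chain meas_cone meas_fns (\<lambda>n. X n \<bind> \<nu> n) (l \<bind> \<nu>')"
  unfolding meas_chain_iff
proof (intro conjI allI ballI)
  have Xb: "X n \<in> unit_ball meas_cone" "l \<in> unit_ball meas_cone" for n
    using X by (auto simp: meas_chain_iff)
  have Xs: "sets (X n) = sets borel" for n
    using Xb by (simp add: finite_borel_sets ball_meas_finite)
  show b: "X n \<bind> \<nu> n \<in> unit_ball meas_cone" "l \<bind> \<nu>' \<in> unit_ball meas_cone" for n
    using Xb \<nu> by (auto intro: bind_ball)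
  fix U :: "real set" assume U[measurable]: "U \<in> sets borel"
  have fin: "\<nu> n r \<in> finite_borel_measures" "\<nu>' r \<in> finite_borel_measures" for n r
    using kernel_ball[OF \<nu>(1)] kernel_ball[OF \<nu>(2)] by (auto intro: ball_meas_finite)
  have sp: "subprob_space (\<nu> n r)" "subprob_space (\<nu>' r)" for n r
    using kernel_ball[OF \<nu>(1)] kernel_ball[OF \<nu>(2)] by (auto simp: unit_ball_meas space_subprob_algebra)
  have le1: "emeasure (\<nu> n r) U \<le> 1" "emeasure (\<nu>' r) U \<le> 1" for n r
    using sp by (auto intro: subprob_space.subprob_emeasure_le_1)
  note [measurable] = \<nu>
  have m: "(\<lambda>r. emeasure (\<nu> n r) U) \<in> borel_measurable borel" "(\<lambda>r. emeasure (\<nu>' r) U) \<in> borel_measurable borel" for n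
    by measurable
  have inc\<nu>: "incseq (\<lambda>n. emeasure (\<nu> n r) U)" and lim\<nu>: "(\<lambda>n. emeasure (\<nu> n r) U) \<longlonglongrightarrow> emeasure (\<nu>' r) U" for r
    using ch[of r] U by (auto simp: meas_chain_iff finite_borel_emeasure fin incseq_def)
  define a where "a n k = enn2real (\<integral>\<^sup>+r. emeasure (\<nu> k r) U \<partial>X n)" for n k
  have int_fin: "(\<integral>\<^sup>+r. f r \<partial>\<mu>) < \<infinity>" if "\<And>r. f r \<le> 1" "\<mu> \<in> unit_ball meas_cone" for f :: "real \<Rightarrow> ennreal" and \<mu>
  proof -
    have "(\<integral>\<^sup>+r. f r \<partial>\<mu>) \<le> (\<integral>\<^sup>+r. 1 \<partial>\<mu>)" using that by (intro nn_integral_mono) auto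
    also have "\<dots> < \<infinity>" by (simp add: finite_borel_emeasure ball_meas_finite[OF that(2)])
    finally show ?thesis .
  qed
  have a_inc1: "incseq (\<lambda>n. a n k)" for k
    unfolding a_def incseq_def
    using integral_chain_limit(1)[OF X m(1) le1(1)] int_fin[OF le1(1) Xb(1)]
    by (auto intro!: enn2real_mono simp: incseq_def)
  have a_inc2: "incseq (a n)" for n
    unfolding a_def incseq_def using inc\<nu> int_fin[OF le1(1) Xb(1)]
    by (auto intro!: enn2real_mono nn_integral_mono simp: incseq_def)
  have lim: "(\<lambda>n. a n n) \<longlonglongrightarrow> enn2real (\<integral>\<^sup>+r. emeasure (\<nu>' r) U \<partial>l)"
  proof (rule diagonal_limit[OF a_inc1 a_inc2])
    fix n
    have "(\<lambda>k. \<integral>\<^sup>+r. emeasure (\<nu> k r) U \<partial>X n) \<longlonglongrightarrow> (\<integral>\<^sup>+r. emeasure (\<nu>' r) U \<partial>X n)"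
    proof (rule nn_integral_LIMSEQ)
      show "incseq (\<lambda>k r. emeasure (\<nu> k r) U)" using inc\<nu> by (auto simp: incseq_def le_fun_def)
      show "(\<lambda>r. emeasure (\<nu> k r) U) \<in> borel_measurable (X n)" for k
        using m(1)[of k] by (simp add: measurable_cong_sets[OF Xs refl])
    qed (rule lim\<nu>)
    then show "a n \<longlonglongrightarrow> enn2real (\<integral>\<^sup>+r. emeasure (\<nu>' r) U \<partial>X n)"
      unfolding a_def using int_fin[OF le1(2) Xb(1)[of n]] int_fin[OF le1(1) Xb(1)[of n]] by (intro tendsto_enn2real) auto
  next
    show "(\<lambda>n. enn2real (\<integral>\<^sup>+r. emeasure (\<nu>' r) U \<partial>X n)) \<longlonglongrightarrow> enn2real (\<integral>\<^sup>+r. emeasure (\<nu>' r) U \<partial>l)"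
      using integral_chain_limit(2)[OF X m(2) le1(2)] int_fin[OF le1(2) Xb(1)] int_fin[OF le1(2) Xb(2)]
      by (intro tendsto_enn2real) auto
  qed
  have eq: "measure (X n \<bind> \<nu> n) U = a n n" for n
    by (simp add: measure_def emeasure_bind_ball[OF Xb(1) \<nu>(1) U] a_def)
  have eq': "measure (l \<bind> \<nu>') U = enn2real (\<integral>\<^sup>+r. emeasure (\<nu>' r) U \<partial>l)"
    by (simp add: measure_def emeasure_bind_ball[OF Xb(2) \<nu>(2) U])
  show "(\<lambda>n. measure (X n \<bind> \<nu> n) U) \<longlonglongrightarrow> measure (l \<bind> \<nu>') U"
    unfolding eq eq' by (rule lim)
  show "incseq (\<lambda>n. measure (X n \<bind> \<nu> n) U)"
    unfolding eq using a_inc1 a_inc2 by (fastforce simp: incseq_def intro: order_trans)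
qed

lemma ifz_bind:
  assumes "l \<in> unit_ball meas_cone" "\<mu> \<in> unit_ball meas_cone" "\<nu> \<in> unit_ball meas_cone"
  shows "add_measure (scale_measure (emeasure l {0}) \<mu>) (scale_measure (emeasure l (UNIV - {0})) \<nu>) =
    l \<bind> (\<lambda>r. if r = 0 then \<mu> else \<nu>)"
proof (rule measure_eqI)
  have k: "(\<lambda>r::real. if r = 0 then \<mu> else \<nu>) \<in> measurable borel (subprob_algebra borel)"
    using assms unfolding unit_ball_meas by (intro measurable_If measurable_const) auto
  have s: "sets l = sets borel" "sets \<mu> = sets borel" "sets \<nu> = sets borel"
    using assms by (simp_all add: finite_borel_sets ball_meas_finite)
  have sb: "sets (l \<bind> (\<lambda>r. if r = 0 then \<mu> else \<nu>)) = sets borel"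
    using bind_ball[OF assms(1) k] by (simp add: finite_borel_sets ball_meas_finite)
  show "sets (add_measure (scale_measure (emeasure l {0}) \<mu>) (scale_measure (emeasure l (UNIV - {0})) \<nu>)) =
      sets (l \<bind> (\<lambda>r. if r = 0 then \<mu> else \<nu>))" by (simp add: sb)
  fix U assume "U \<in> sets (add_measure (scale_measure (emeasure l {0}) \<mu>) (scale_measure (emeasure l (UNIV - {0})) \<nu>))"
  then have U: "U \<in> sets borel" by simp
  have "emeasure (l \<bind> (\<lambda>r. if r = 0 then \<mu> else \<nu>)) U = (\<integral>\<^sup>+r. emeasure (if r = 0 then \<mu> else \<nu>) U \<partial>l)"
    by (rule emeasure_bind_ball[OF assms(1) k U])
  also have "\<dots> = (\<integral>\<^sup>+r. emeasure \<mu> U * indicator {0} r + emeasure \<nu> U * indicator (UNIV - {0}) r \<partial>l)"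
    by (intro nn_integral_cong) (auto split: split_indicator)
  also have "\<dots> = emeasure \<mu> U * emeasure l {0} + emeasure \<nu> U * emeasure l (UNIV - {0})"
    using s by (subst nn_integral_add) (auto simp: nn_integral_cmult_indicator)
  finally show "emeasure (add_measure (scale_measure (emeasure l {0}) \<mu>) (scale_measure (emeasure l (UNIV - {0})) \<nu>)) U =
    emeasure (l \<bind> (\<lambda>r. if r = 0 then \<mu> else \<nu>)) U"
    using s U by (simp add: emeasure_add_measure mult.commute)
qed

text \<open>The law of \<open>f (x\<^sub>0, \<dots>)\<close> for independent \<open>x\<^sub>i\<close>, where \<open>r\<close> fixes the first \<open>k\<close> coordinates and the
  remaining ones have the listed laws.\<close>

primrec prim_law :: "real measure list \<Rightarrow> (real list \<Rightarrow> real) \<Rightarrow> nat \<Rightarrow> (nat \<Rightarrow> real) \<Rightarrow> real measure" where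
  "prim_law [] f k r = return borel (f (map r [0..<k]))"
| "prim_law (\<mu> # \<mu>s) f k r = \<mu> \<bind> (\<lambda>q. prim_law \<mu>s f (Suc k) (r(k := q)))"

definition prim_measurable :: "nat \<Rightarrow> (real list \<Rightarrow> real) \<Rightarrow> bool" where
  "prim_measurable n f \<longleftrightarrow> (\<lambda>x. f (map x [0..<n])) \<in> borel_measurable (Rn n)"

lemma measurable_extend_Rn: "(\<lambda>(r, q). r(k := q)) \<in> measurable (Rn k \<Otimes>\<^sub>M borel) (Rn (Suc k))"
  using measurable_add_dim[of k "{..<k}" "\<lambda>_. borel :: real measure"] by (simp add: lessThan_Suc)

text \<open>The laws depend on a parameter \<open>w\<close> because the statement serves twice: for
  fixed laws, as measurability in the coordinates already drawn, and for laws that vary along a path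
  of environments.\<close>

lemma prim_law_kernel:
  assumes "\<And>\<kappa>. \<kappa> \<in> set \<kappa>s \<Longrightarrow> \<kappa> \<in> measurable M (subprob_algebra borel)"
    and "prim_measurable (k + length \<kappa>s) f"
  shows "(\<lambda>(w, r). prim_law (map (\<lambda>\<kappa>. \<kappa> w) \<kappa>s) f k r) \<in> measurable (M \<Otimes>\<^sub>M Rn k) (subprob_algebra borel)"
  using assms
proof (induction \<kappa>s arbitrary: k)
  case Nil
  then have [measurable]: "(\<lambda>x. f (map x [0..<k])) \<in> borel_measurable (Rn k)" by (simp add: prim_measurable_def)
  show ?case by simp
next
  case (Cons \<kappa> \<kappa>s)
  have IH: "(\<lambda>(w, r). prim_law (map (\<lambda>\<kappa>. \<kappa> w) \<kappa>s) f (Suc k) r) \<in> measurable (M \<Otimes>\<^sub>M Rn (Suc k)) (subprob_algebra borel)"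
    using Cons by (intro Cons.IH) auto
  have "(\<lambda>x. (fst (fst x), (\<lambda>(r, q). r(k := q)) (snd (fst x), snd x)))
     \<in> measurable ((M \<Otimes>\<^sub>M Rn k) \<Otimes>\<^sub>M borel) (M \<Otimes>\<^sub>M Rn (Suc k))"
    by (intro measurable_Pair measurable_compose[OF _ measurable_extend_Rn]) measurable
  from measurable_compose[OF this IH]
  have "(\<lambda>(x, q). prim_law (map (\<lambda>\<kappa>. \<kappa> (fst x)) \<kappa>s) f (Suc k) ((snd x)(k := q)))
     \<in> measurable ((M \<Otimes>\<^sub>M Rn k) \<Otimes>\<^sub>M borel) (subprob_algebra borel)"
    by (simp add: case_prod_beta)
  moreover have "(\<lambda>x. \<kappa> (fst x)) \<in> measurable (M \<Otimes>\<^sub>M Rn k) (subprob_algebra borel)"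
    using Cons.prems by (intro measurable_compose[OF measurable_fst]) auto
  ultimately show ?case
    by (simp add: case_prod_beta)
qed

lemma prim_law_kernel':
  assumes "set \<mu>s \<subseteq> unit_ball meas_cone" "prim_measurable (k + length \<mu>s) f"
  shows "prim_law \<mu>s f k \<in> measurable (Rn k) (subprob_algebra borel)"
proof -
  \<comment> \<open>Constant laws over a one-point parameter space.\<close>
  have "(\<lambda>(w, r). prim_law (map (\<lambda>\<kappa>. \<kappa> w) (map (\<lambda>\<mu> _. \<mu>) \<mu>s)) f k r) \<in>
      measurable (count_space {()} \<Otimes>\<^sub>M Rn k) (subprob_algebra borel)"
    using assms unfolding unit_ball_meas by (intro prim_law_kernel) auto
  from measurable_compose[OF measurable_Pair1'[of "()"] this] show ?thesis
    by (simp add: comp_def)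
qed

lemma prim_law_step_kernel:
  assumes "set \<mu>s \<subseteq> unit_ball meas_cone" "prim_measurable (Suc k + length \<mu>s) f" "r \<in> space (Rn k)"
  shows "(\<lambda>q. prim_law \<mu>s f (Suc k) (r(k := q))) \<in> measurable borel (subprob_algebra borel)"
proof -
  have "(\<lambda>q. (\<lambda>(r, q). r(k := q)) (r, q)) \<in> measurable borel (Rn (Suc k))"
    by (rule measurable_compose[OF measurable_Pair1'[OF assms(3)] measurable_extend_Rn])
  from measurable_compose[OF this prim_law_kernel'[OF assms(1,2)]] show ?thesis by simp
qed

lemma extend_Rn_space: "r \<in> space (Rn k) \<Longrightarrow> r(k := q) \<in> space (Rn (Suc k))"
  by (auto simp: space_PiM PiE_def extensional_def)

lemma prim_law_cube:
  assumes "finite N" "\<And>\<kappa>. \<kappa> \<in> set \<kappa>s \<Longrightarrow> cone_cube meas_cone meas_fns N \<kappa>"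
    and "prim_measurable (k + length \<kappa>s) f" "r \<in> space (Rn k)"
  shows "cone_cube meas_cone meas_fns N (\<lambda>I. prim_law (map (\<lambda>\<kappa>. \<kappa> I) \<kappa>s) f k r)"
  using assms(2-)
proof (induction \<kappa>s arbitrary: k r)
  case Nil
  have "return borel (f (map r [0..<k])) \<in> unit_ball meas_cone"
    by (auto simp: unit_ball_meas space_subprob_algebra intro!: prob_space_imp_subprob_space prob_space_return)
  then show ?case using rcone.cube_const[OF rcone_meas] assms(1) by simp
next
  case (Cons \<kappa> \<kappa>s)
  have ball: "set (map (\<lambda>\<kappa>. \<kappa> I) \<kappa>s) \<subseteq> unit_ball meas_cone" if "I \<subseteq> N" for I
    using Cons.prems that by (auto simp: cone_cube_def)
  show ?case
    unfolding list.map prim_law.simps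
  proof (rule bind_cube)
    show "cone_cube meas_cone meas_fns N \<kappa>" using Cons by simp
    show "(\<lambda>q. prim_law (map (\<lambda>\<kappa>. \<kappa> I) \<kappa>s) f (Suc k) (r(k := q))) \<in> measurable borel (subprob_algebra borel)"
      if "I \<subseteq> N" for I
      using ball[OF that] Cons.prems by (intro prim_law_step_kernel) auto
    show "cone_cube meas_cone meas_fns N (\<lambda>I. prim_law (map (\<lambda>\<kappa>. \<kappa> I) \<kappa>s) f (Suc k) (r(k := q)))" for q
      using Cons.prems by (intro Cons.IH extend_Rn_space) auto
  qed
qed

text \<open>Each entry of the list pairs a chain with its limit, which keeps the two aligned during
  the induction.\<close>

lemma prim_law_chain:
  assumes "\<And>\<kappa>. \<kappa> \<in> set \<kappa>s \<Longrightarrow> cone_chain meas_cone meas_fns (fst \<kappa>) (snd \<kappa>)"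
    and "prim_measurable (k + length \<kappa>s) f" "r \<in> space (Rn k)"
  shows "cone_chain meas_cone meas_fns (\<lambda>n. prim_law (map (\<lambda>\<kappa>. fst \<kappa> n) \<kappa>s) f k r) (prim_law (map snd \<kappa>s) f k r)"
  using assms
proof (induction \<kappa>s arbitrary: k r)
  case Nil
  have "return borel (f (map r [0..<k])) \<in> unit_ball meas_cone"
    by (auto simp: unit_ball_meas space_subprob_algebra intro!: prob_space_imp_subprob_space prob_space_return)
  then show ?case using rcone.chain_const[OF rcone_meas] by simp
next
  case (Cons \<kappa> \<kappa>s)
  have ball: "set (map (\<lambda>\<kappa>. fst \<kappa> n) \<kappa>s) \<subseteq> unit_ball meas_cone" "set (map snd \<kappa>s) \<subseteq> unit_ball meas_cone" for n
    using Cons.prems by (auto simp: cone_chain_def)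
  show ?case
    unfolding list.map prim_law.simps
  proof (rule bind_chain)
    show "cone_chain meas_cone meas_fns (fst \<kappa>) (snd \<kappa>)" using Cons by simp
    show "(\<lambda>q. prim_law (map (\<lambda>\<kappa>. fst \<kappa> n) \<kappa>s) f (Suc k) (r(k := q))) \<in> measurable borel (subprob_algebra borel)" for n
      using ball Cons.prems by (intro prim_law_step_kernel) auto
    show "(\<lambda>q. prim_law (map snd \<kappa>s) f (Suc k) (r(k := q))) \<in> measurable borel (subprob_algebra borel)"
      using ball Cons.prems by (intro prim_law_step_kernel) auto
    show "cone_chain meas_cone meas_fns (\<lambda>n. prim_law (map (\<lambda>\<kappa>. fst \<kappa> n) \<kappa>s) f (Suc k) (r(k := q)))
       (prim_law (map snd \<kappa>s) f (Suc k) (r(k := q)))" for q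
      using Cons.prems by (intro Cons.IH extend_Rn_space) auto
  qed
qed

lemma prim_law_ball:
  assumes "set \<mu>s \<subseteq> unit_ball meas_cone" "prim_measurable (k + length \<mu>s) f" "r \<in> space (Rn k)"
  shows "prim_law \<mu>s f k r \<in> unit_ball meas_cone"
  by (rule kernel_ball[OF prim_law_kernel'[OF assms(1,2)] assms(3)])

lemma nn_integral_bind_ball:
  assumes "\<mu> \<in> unit_ball meas_cone" "\<nu> \<in> measurable borel (subprob_algebra borel)" "h \<in> borel_measurable borel"
  shows "(\<integral>\<^sup>+x. h x \<partial>(\<mu> \<bind> \<nu>)) = (\<integral>\<^sup>+r. \<integral>\<^sup>+x. h x \<partial>\<nu> r \<partial>\<mu>)"
proof -
  have "\<nu> \<in> measurable \<mu> (subprob_algebra borel)" using assms by (simp add: measurable_ball_iff)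
  then show ?thesis using assms by (intro nn_integral_bind)
qed

text \<open>Interpolates between the two sides: in the integral of \<open>G k\<close> the first
  \<open>k\<close> coordinates are drawn from the product measure and the others are integrated one
  after the other. Passing from \<open>k + 1\<close> to \<open>k\<close> is one application of
  Fubini; \<open>k = length \<mu>s\<close> gives the image of the product, \<open>k = 0\<close> the
  iterated law.\<close>

lemma distr_PiM_prim_law:
  assumes \<mu>s: "set \<mu>s \<subseteq> unit_ball meas_cone" and f: "prim_measurable (length \<mu>s) f"
  shows "distr (\<Pi>\<^sub>M i\<in>{..<length \<mu>s}. \<mu>s ! i) borel (\<lambda>x. f (map x [0..<length \<mu>s])) = prim_law \<mu>s f 0 (\<lambda>_. undefined)"
proof -
  let ?n = "length \<mu>s"
  \<comment> \<open>Indices beyond the list receive a Dirac measure, because the theory of finite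
    products asks for a sigma-finite family over all indices.\<close>
  define M where "M i = (if i < ?n then \<mu>s ! i else return borel 0)" for i
  have M: "M i \<in> unit_ball meas_cone" for i
  proof (cases "i < ?n")
    case True
    then have "\<mu>s ! i \<in> set \<mu>s" by simp
    then show ?thesis using \<mu>s True by (auto simp: M_def)
  qed (auto simp: M_def unit_ball_meas space_subprob_algebra intro!: prob_space_imp_subprob_space prob_space_return)
  have sM: "sets (M i) = sets borel" for i using M by (simp add: finite_borel_sets ball_meas_finite)
  have "sigma_finite_measure (M i)" for i
  proof -
    have "subprob_space (M i)" using M[of i] by (simp add: unit_ball_meas space_subprob_algebra)
    then interpret subprob_space "M i" .
    show ?thesis by unfold_locales
  qed
  then interpret product_sigma_finite M by (rule product_sigma_finite.intro)
  have sP: "sets (PiM {..<k} M) = sets (Rn k)" for k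
    using sM by (intro sets_PiM_cong) auto
  have PM: "(\<Pi>\<^sub>M i\<in>{..<?n}. \<mu>s ! i) = PiM {..<?n} M"
    by (intro PiM_cong) (auto simp: M_def)
  have g: "(\<lambda>x. f (map x [0..<?n])) \<in> borel_measurable (PiM {..<?n} M)"
    using f unfolding prim_measurable_def measurable_cong_sets[OF sP refl] .
  have drop_ball: "set (drop k \<mu>s) \<subseteq> unit_ball meas_cone" for k
    by (rule order_trans[OF set_drop_subset \<mu>s])
  show ?thesis
  proof (rule measure_eqI)
    have "prim_law \<mu>s f 0 (\<lambda>_. undefined) \<in> unit_ball meas_cone"
      using \<mu>s f by (intro prim_law_ball) (auto simp: space_PiM)
    then show "sets (distr (\<Pi>\<^sub>M i\<in>{..<?n}. \<mu>s ! i) borel (\<lambda>x. f (map x [0..<?n]))) = sets (prim_law \<mu>s f 0 (\<lambda>_. undefined))"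
      by (simp add: finite_borel_sets ball_meas_finite)
    fix U assume "U \<in> sets (distr (\<Pi>\<^sub>M i\<in>{..<?n}. \<mu>s ! i) borel (\<lambda>x. f (map x [0..<?n])))"
    then have U: "U \<in> sets borel" by simp
    define G where "G k r = emeasure (prim_law (drop k \<mu>s) f k r) U" for k r
    have G: "G k \<in> borel_measurable (Rn k)" if "k \<le> ?n" for k
    proof -
      have "prim_law (drop k \<mu>s) f k \<in> measurable (Rn k) (subprob_algebra borel)"
        using that drop_ball f by (intro prim_law_kernel') auto
      then show ?thesis unfolding G_def using U by measurable
    qed
    have "(\<integral>\<^sup>+r. G k r \<partial>PiM {..<k} M) = emeasure (PiM {..<?n} M) ((\<lambda>x. f (map x [0..<?n])) -` U \<inter> space (PiM {..<?n} M))"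
      if "k \<le> ?n" for k
      using that
    proof (induction k rule: inc_induct)
      case base
      have "(\<integral>\<^sup>+r. G ?n r \<partial>PiM {..<?n} M) =
          (\<integral>\<^sup>+r. indicator ((\<lambda>x. f (map x [0..<?n])) -` U \<inter> space (PiM {..<?n} M)) r \<partial>PiM {..<?n} M)"
        using U by (intro nn_integral_cong) (auto simp: G_def split: split_indicator)
      also have "\<dots> = emeasure (PiM {..<?n} M) ((\<lambda>x. f (map x [0..<?n])) -` U \<inter> space (PiM {..<?n} M))"
        using measurable_sets[OF g U] by simp
      finally show ?case .
    next
      case (step k)
      have "(\<integral>\<^sup>+r. G (Suc k) r \<partial>PiM {..<Suc k} M) = (\<integral>\<^sup>+r. \<integral>\<^sup>+q. G (Suc k) (r(k := q)) \<partial>M k \<partial>PiM {..<k} M)"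
        unfolding lessThan_Suc
      proof (rule product_nn_integral_insert)
        show "G (Suc k) \<in> borel_measurable (PiM (insert k {..<k}) M)"
          unfolding lessThan_Suc[symmetric] measurable_cong_sets[OF sP refl] using G[of "Suc k"] step(2) by simp
      qed auto
      also have "\<dots> = (\<integral>\<^sup>+r. G k r \<partial>PiM {..<k} M)"
      proof (intro nn_integral_cong)
        fix r assume "r \<in> space (PiM {..<k} M)"
        then have r: "r \<in> space (Rn k)" using sets_eq_imp_space_eq[OF sP] by simp
        have "drop k \<mu>s = M k # drop (Suc k) \<mu>s"
          using step(2) by (simp add: M_def Cons_nth_drop_Suc)
        moreover have "(\<lambda>q. prim_law (drop (Suc k) \<mu>s) f (Suc k) (r(k := q))) \<in> measurable borel (subprob_algebra borel)"
        proof (rule prim_law_step_kernel[OF drop_ball _ r])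
          have "Suc k + length (drop (Suc k) \<mu>s) = ?n" using step(2) by simp
          then show "prim_measurable (Suc k + length (drop (Suc k) \<mu>s)) f" using f by (simp only:)
        qed
        ultimately show "(\<integral>\<^sup>+q. G (Suc k) (r(k := q)) \<partial>M k) = G k r"
          using emeasure_bind_ball[OF M _ U] by (simp add: G_def)
      qed
      finally show ?case using step.IH by simp
    qed
    from this[of 0] have "G 0 (\<lambda>_. undefined) = emeasure (PiM {..<?n} M) ((\<lambda>x. f (map x [0..<?n])) -` U \<inter> space (PiM {..<?n} M))"
      using nn_integral_empty[of "G 0"] by simp
    then show "emeasure (distr (\<Pi>\<^sub>M i\<in>{..<?n}. \<mu>s ! i) borel (\<lambda>x. f (map x [0..<?n]))) U =
        emeasure (prim_law \<mu>s f 0 (\<lambda>_. undefined)) U"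
      unfolding PM using g U by (simp add: G_def emeasure_distr)
  qed
qed

section \<open>Application, currying and fixed points\<close>

text \<open>Tests and paths have a single tuple of parameters each. \<open>glue\<close> and the two
  projections after it identify \<open>\<real>^k \<times> \<real>^n\<close> with
  \<open>\<real>^(k+n)\<close> whenever two such tuples have to be merged.\<close>

definition glue :: "nat \<Rightarrow> nat \<Rightarrow> (nat \<Rightarrow> real) \<Rightarrow> (nat \<Rightarrow> real) \<Rightarrow> nat \<Rightarrow> real" where
  "glue k n r s = (\<lambda>i\<in>{..<k + n}. if i < k then r i else s (i - k))"

definition fst_Rn :: "nat \<Rightarrow> (nat \<Rightarrow> real) \<Rightarrow> nat \<Rightarrow> real" where
  "fst_Rn k s = (\<lambda>i\<in>{..<k}. s i)"

definition snd_Rn :: "nat \<Rightarrow> nat \<Rightarrow> (nat \<Rightarrow> real) \<Rightarrow> nat \<Rightarrow> real" where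
  "snd_Rn k n s = (\<lambda>i\<in>{..<n}. s (k + i))"

lemma measurable_glue: "(\<lambda>(r, s). glue k n r s) \<in> measurable (Rn k \<Otimes>\<^sub>M Rn n) (Rn (k + n))"
  unfolding glue_def case_prod_beta
proof (rule measurable_restrict)
  fix i assume i: "i \<in> {..<k + n}"
  show "(\<lambda>x. if i < k then fst x i else snd x (i - k)) \<in> borel_measurable (Rn k \<Otimes>\<^sub>M Rn n)"
  proof (cases "i < k")
    case True
    then have "(\<lambda>x. fst x i) \<in> borel_measurable (Rn k \<Otimes>\<^sub>M Rn n)"
      by (intro measurable_compose[OF measurable_fst measurable_component_singleton]) auto
    then show ?thesis using True by simp
  next
    case False
    then have "(\<lambda>x. snd x (i - k)) \<in> borel_measurable (Rn k \<Otimes>\<^sub>M Rn n)"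
      using i by (intro measurable_compose[OF measurable_snd measurable_component_singleton]) auto
    then show ?thesis using False by simp
  qed
qed

lemma measurable_fst_Rn: "fst_Rn k \<in> measurable (Rn (k + n)) (Rn k)"
  unfolding fst_Rn_def by (rule measurable_restrict) (auto intro: measurable_component_singleton)

lemma measurable_snd_Rn: "snd_Rn k n \<in> measurable (Rn (k + n)) (Rn n)"
  unfolding snd_Rn_def by (rule measurable_restrict) (auto intro: measurable_component_singleton)

lemma fst_Rn_glue: "r \<in> space (Rn k) \<Longrightarrow> fst_Rn k (glue k n r s) = r"
  by (auto simp: fst_Rn_def glue_def fun_eq_iff space_PiM PiE_def extensional_def)

lemma snd_Rn_glue: "s \<in> space (Rn n) \<Longrightarrow> snd_Rn k n (glue k n r s) = s"
  by (auto simp: snd_Rn_def glue_def fun_eq_iff space_PiM PiE_def extensional_def)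

section \<open>Cubes, chains and paths under a coding\<close>

locale retraction =
  fixes P :: "'a mcone" and e :: "'a \<Rightarrow> 'b" and d :: "'b \<Rightarrow> 'a"
  assumes dec_enc: "x \<in> carr P \<Longrightarrow> d (e x) = x"
begin

lemma enc_ball: "x \<in> unit_ball P \<Longrightarrow> e x \<in> unit_ball (transport e d P)"
  using dec_enc by (auto simp: unit_ball_def transport_def)

lemma dec_ball: "x \<in> unit_ball (transport e d P) \<Longrightarrow> d x \<in> unit_ball P"
  using dec_enc by (auto simp: unit_ball_def transport_def)

lemma dec_enc_ball: "x \<in> unit_ball P \<Longrightarrow> d (e x) = x"
  using dec_enc by (simp add: unit_ball_def)

lemma dec_cube:
  "cone_cube (transport e d P) ((\<lambda>\<tau> x. \<tau> (d x)) ` T) N \<phi> \<Longrightarrow> cone_cube P T N (\<lambda>I. d (\<phi> I))"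
  by (auto simp: cone_cube_def dec_ball)

lemma enc_cube:
  assumes "cone_cube P T N \<phi>"
  shows "cone_cube (transport e d P) ((\<lambda>\<tau> x. \<tau> (d x)) ` T) N (\<lambda>I. e (\<phi> I))"
proof -
  have "rcube N (\<lambda>I. \<tau> (d (e (\<phi> I)))) \<longleftrightarrow> rcube N (\<lambda>I. \<tau> (\<phi> I))" for \<tau>
    using assms by (intro rcube_cong) (auto simp: cone_cube_def dec_enc_ball)
  with assms show ?thesis by (auto simp: cone_cube_def enc_ball)
qed

lemma dec_chain:
  "cone_chain (transport e d P) ((\<lambda>\<tau> x. \<tau> (d x)) ` T) X l \<Longrightarrow> cone_chain P T (\<lambda>n. d (X n)) (d l)"
  by (auto simp: cone_chain_def dec_ball)

lemma enc_chain:
  "cone_chain P T X l \<Longrightarrow> cone_chain (transport e d P) ((\<lambda>\<tau> x. \<tau> (d x)) ` T) (\<lambda>n. e (X n)) (e l)"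
  by (auto simp: cone_chain_def enc_ball dec_enc_ball)

lemma dec_path:
  assumes "\<gamma> \<in> unit_paths (transport e d P) n"
  shows "(\<lambda>s. d (\<gamma> s)) \<in> unit_paths P n"
proof (rule unit_pathsI)
  fix k m assume "m \<in> tests P k"
  then have "(\<lambda>r x. m r (d x)) \<in> tests (transport e d P) k" by (auto simp: transport_def)
  from unit_paths_test[OF assms this]
  show "(\<lambda>(r, s). m r (d (\<gamma> s))) \<in> borel_measurable (Rn k \<Otimes>\<^sub>M Rn n)" .
qed (use unit_paths_ball[OF assms] dec_ball in auto)

lemma enc_path:
  assumes "\<gamma> \<in> unit_paths P n"
  shows "(\<lambda>s. e (\<gamma> s)) \<in> unit_paths (transport e d P) n"
proof (rule unit_pathsI)
  fix k m assume "m \<in> tests (transport e d P) k"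
  then obtain m' where m': "m' \<in> tests P k" "m = (\<lambda>r x. m' r (d x))" by (auto simp: transport_def)
  have "(\<lambda>(r, s). m r (e (\<gamma> s))) \<in> borel_measurable (Rn k \<Otimes>\<^sub>M Rn n) \<longleftrightarrow>
    (\<lambda>(r, s). m' r (\<gamma> s)) \<in> borel_measurable (Rn k \<Otimes>\<^sub>M Rn n)"
    using unit_paths_ball[OF assms]
    by (intro measurable_cong) (auto simp: space_pair_measure m' dec_enc_ball)
  then show "(\<lambda>(r, s). m r (e (\<gamma> s))) \<in> borel_measurable (Rn k \<Otimes>\<^sub>M Rn n)"
    using unit_paths_test[OF assms m'(1)] by simp
qed (use unit_paths_ball[OF assms] enc_ball in auto)

end

section \<open>Application and abstraction\<close>

context rcone_pair begin

abbreviation "F \<equiv> fun_cone P Q"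
abbreviation "FT \<equiv> fun_fns P T S"

lemma fun_ball_iff:
  "f \<in> unit_ball (fun_cone P Q) \<longleftrightarrow> f \<in> carr (fun_cone P Q) \<and> (\<forall>x\<in>unit_ball P. f x \<in> unit_ball Q)"
  using fun_norm_le_iff[of f 1] cone_map_carr[OF fun_mapD] by (auto simp: unit_ball_def)

lemma app_ball: "f \<in> unit_ball F \<Longrightarrow> x \<in> unit_ball P \<Longrightarrow> f x \<in> unit_ball Q"
  by (simp add: fun_ball_iff)

text \<open>In \<open>\<sigma> (\<phi> I (\<psi> J))\<close> the coefficient in \<open>J\<close> is
  a functional of the function cone applied to \<open>\<phi> I\<close>, hence a cube in
  \<open>I\<close>; the claim is the diagonal of this double family.\<close>

lemma app_cube:
  assumes \<phi>: "cone_cube F FT (N::nat set) \<phi>" and \<psi>: "cone_cube P T N \<psi>"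
  shows "cone_cube Q S N (\<lambda>I. \<phi> I (\<psi> I))"
  unfolding cone_cube_def
proof (intro conjI ballI allI impI)
  show N: "finite N" using \<phi> by (simp add: cone_cube_def)
  show "\<phi> I (\<psi> I) \<in> unit_ball Q" if "I \<subseteq> N" for I
    using \<phi> \<psi> that by (intro app_ball) (auto simp: cone_cube_def)
  fix \<sigma> assume \<sigma>: "\<sigma> \<in> S"
  show "rcube N (\<lambda>I. \<sigma> (\<phi> I (\<psi> I)))"
  proof (rule rcube_diagonal[OF N, where c="\<lambda>I J. \<sigma> (\<phi> I (\<psi> J))"])
    fix J assume "J \<subseteq> N"
    then have "(\<lambda>f. moebius J (\<lambda>I. \<sigma> (f (\<psi> I)))) \<in> FT"
      unfolding fun_fns_def using cone_cube_subset[OF \<psi>] \<sigma> by blast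
    then show "rcube N (\<lambda>I. moebius J (\<lambda>K. \<sigma> (\<phi> I (\<psi> K))))"
      using \<phi> by (auto simp: cone_cube_def)
  qed
qed

lemma fun_chain_apply:
  assumes X: "cone_chain F FT X f" and x: "x \<in> unit_ball P"
  shows "cone_chain Q S (\<lambda>n. X n x) (f x)"
  using X x point_fns[OF x] by (auto simp: cone_chain_def app_ball)

text \<open>Diagonal of a double sequence: one index moves the map, the other its argument.\<close>

lemma app_chain:
  assumes X: "cone_chain F FT X f" and Y: "cone_chain P T Y y"
  shows "cone_chain Q S (\<lambda>n. X n (Y n)) (f y)"
  unfolding cone_chain_def
proof (intro conjI allI ballI)
  have XF: "X n \<in> unit_ball F" "f \<in> unit_ball F" and YB: "Y n \<in> unit_ball P" "y \<in> unit_ball P" for n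
    using X Y by (auto simp: cone_chain_def)
  then show "X n (Y n) \<in> unit_ball Q" "f y \<in> unit_ball Q" for n by (auto intro: app_ball)
  fix \<sigma> assume \<sigma>: "\<sigma> \<in> S"
  have map: "cone_map P T Q S (X n)" "cone_map P T Q S f" for n
    using XF by (auto simp: fun_ball_iff intro: fun_mapD)
  have inc1: "incseq (\<lambda>n. \<sigma> (X n (Y k)))" for k
    using fun_chain_apply[OF X YB(1)] \<sigma> by (simp add: cone_chain_def)
  have inc2: "incseq (\<lambda>k. \<sigma> (X n (Y k)))" for n
    by (rule cone_map_incseq[OF P.rcone_axioms map(1) Y \<sigma>])
  show "incseq (\<lambda>n. \<sigma> (X n (Y n)))"
    using inc1 inc2 by (fastforce simp: incseq_def intro: order_trans)
  show "(\<lambda>n. \<sigma> (X n (Y n))) \<longlonglongrightarrow> \<sigma> (f y)"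
  proof (rule diagonal_limit[OF inc1 inc2])
    show "(\<lambda>k. \<sigma> (X n (Y k))) \<longlonglongrightarrow> \<sigma> (X n y)" for n
      by (rule cone_map_limit[OF map(1) Y \<sigma>])
    show "(\<lambda>n. \<sigma> (X n y)) \<longlonglongrightarrow> \<sigma> (f y)"
      using fun_chain_apply[OF X YB(2)] \<sigma> by (simp add: cone_chain_def)
  qed
qed

text \<open>The parameter of the test and the parameter of the argument path are merged into one
  function test on \<open>k + n\<close> coordinates, which is then evaluated along
  \<open>\<gamma>\<close> at the glued point.\<close>

lemma app_path:
  assumes \<gamma>: "\<gamma> \<in> unit_paths F n" and \<delta>: "\<delta> \<in> unit_paths P n"
  shows "(\<lambda>s. \<gamma> s (\<delta> s)) \<in> unit_paths Q n"
proof (rule unit_pathsI)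
  show "\<gamma> s (\<delta> s) \<in> unit_ball Q" if "s \<in> space (Rn n)" for s
    using unit_paths_ball[OF \<gamma> that] unit_paths_ball[OF \<delta> that] by (rule app_ball)
  fix k m assume m: "m \<in> tests Q k"
  have m1: "(\<lambda>r. m (fst_Rn k r)) \<in> tests Q (k + n)"
    by (rule Q.test_reindex[OF m measurable_fst_Rn])
  have d1: "(\<lambda>r. \<delta> (snd_Rn k n r)) \<in> unit_paths P (k + n)"
    by (rule unit_paths_reindex[OF \<delta> measurable_snd_Rn])
  have "(\<lambda>r f. m (fst_Rn k r) (f (\<delta> (snd_Rn k n r)))) \<in> tests F (k + n)"
    using m1 d1 by (auto simp: fun_cone_def)
  note * = unit_paths_test[OF \<gamma> this]
  have g: "(\<lambda>x. (glue k n (fst x) (snd x), snd x)) \<in> measurable (Rn k \<Otimes>\<^sub>M Rn n) (Rn (k + n) \<Otimes>\<^sub>M Rn n)"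
    using measurable_glue[of k n] by (auto simp: case_prod_beta)
  have "(\<lambda>x. m (fst_Rn k (glue k n (fst x) (snd x))) (\<gamma> (snd x) (\<delta> (snd_Rn k n (glue k n (fst x) (snd x))))))
      \<in> borel_measurable (Rn k \<Otimes>\<^sub>M Rn n)"
    using measurable_compose[OF g *] by (simp add: case_prod_beta)
  also have "?this \<longleftrightarrow> (\<lambda>(r, s). m r (\<gamma> s (\<delta> s))) \<in> borel_measurable (Rn k \<Otimes>\<^sub>M Rn n)"
    by (intro measurable_cong) (auto simp: space_pair_measure fst_Rn_glue snd_Rn_glue)
  finally show "(\<lambda>(r, s). m r (\<gamma> s (\<delta> s))) \<in> borel_measurable (Rn k \<Otimes>\<^sub>M Rn n)" .
qed

lemma curry_ball:
  assumes "\<And>N \<phi>. cone_cube P T (N::nat set) \<phi> \<Longrightarrow> cone_cube Q S N (\<lambda>I. f (\<phi> I))"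
    and "\<And>X l. cone_chain P T X l \<Longrightarrow> cone_chain Q S (\<lambda>n. f (X n)) (f l)"
    and "\<And>n \<gamma>. \<gamma> \<in> unit_paths P n \<Longrightarrow> (\<lambda>s. f (\<gamma> s)) \<in> unit_paths Q n"
  shows "(\<lambda>x\<in>unit_ball P. f x) \<in> unit_ball F"
proof -
  have ball: "f x \<in> unit_ball Q" if "x \<in> unit_ball P" for x
    using assms(2)[OF P.chain_const[OF that]] by (simp add: cone_chain_def)
  have "(\<lambda>x\<in>unit_ball P. f x) \<in> carr F"
  proof (rule restrict_mapI[where c=1])
    show "(\<lambda>(r, s). m r (f (\<gamma> s))) \<in> borel_measurable (Rn k \<Otimes>\<^sub>M Rn n)"
      if "\<gamma> \<in> unit_paths P n" "m \<in> tests Q k" for n k \<gamma> m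
      using unit_paths_test[OF assms(3)[OF that(1)] that(2)] .
  qed (use ball assms(1,2) in \<open>auto simp: cone_cube_def cone_chain_def unit_ball_def\<close>)
  then show ?thesis using ball by (simp add: fun_ball_iff)
qed

text \<open>A functional along \<open>\<psi>\<close>, applied to the curried family, is the partial
  coefficient in the variables of \<open>\<psi>\<close> of a cube over the disjoint union of both
  index sets.\<close>

lemma curry_cube:
  assumes N: "finite N" and ball: "\<And>I. I \<subseteq> N \<Longrightarrow> (\<lambda>x\<in>unit_ball P. g x I) \<in> unit_ball F"
    and cube: "\<And>N' \<psi>. cone_cube P T (N'::nat set) \<psi> \<Longrightarrow>
      cone_cube Q S (interleave N N') (\<lambda>K. g (\<psi> (odds K)) (evens K))"
  shows "cone_cube F FT N (\<lambda>I. \<lambda>x\<in>unit_ball P. g x I)"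
  unfolding cone_cube_def
proof (intro conjI ballI allI impI)
  fix \<tau> assume "\<tau> \<in> FT"
  then obtain N' \<psi> \<sigma> where *: "cone_cube P T (N'::nat set) \<psi>" "\<sigma> \<in> S"
    and \<tau>: "\<tau> = (\<lambda>f. moebius N' (\<lambda>I. \<sigma> (f (\<psi> I))))" by (rule fun_fnsE)
  have "rcube N (\<lambda>I. moebius N' (\<lambda>J. \<sigma> (g (\<psi> J) I)))"
    using * N cube[OF *(1)] by (intro rcube_interleave) (auto simp: cone_cube_def)
  also have "(\<lambda>I. moebius N' (\<lambda>J. \<sigma> (g (\<psi> J) I))) = (\<lambda>I. \<tau> (\<lambda>x\<in>unit_ball P. g x I))"
    unfolding \<tau> using * by (intro ext moebius_cong) (auto simp: cone_cube_def)
  finally show "rcube N (\<lambda>I. \<tau> (\<lambda>x\<in>unit_ball P. g x I))" .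
qed (use N ball in auto)

lemma curry_limit:
  assumes lim: "\<And>x. x \<in> unit_ball P \<Longrightarrow> cone_chain Q S (\<lambda>n. g x n) (l x)" and \<tau>: "\<tau> \<in> FT"
  shows "(\<lambda>n. \<tau> (\<lambda>x\<in>unit_ball P. g x n)) \<longlonglongrightarrow> \<tau> (\<lambda>x\<in>unit_ball P. l x)"
proof -
  from \<tau> obtain N' \<psi> \<sigma> where *: "cone_cube P T (N'::nat set) \<psi>" "\<sigma> \<in> S"
    and \<tau>: "\<tau> = (\<lambda>f. moebius N' (\<lambda>I. \<sigma> (f (\<psi> I))))" by (rule fun_fnsE)
  show ?thesis
    unfolding \<tau>
  proof (rule tendsto_moebius)
    fix I assume "I \<subseteq> N'"
    then have "\<psi> I \<in> unit_ball P" using * by (auto simp: cone_cube_def)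
    then show "(\<lambda>n. \<sigma> ((\<lambda>x\<in>unit_ball P. g x n) (\<psi> I))) \<longlonglongrightarrow> \<sigma> ((\<lambda>x\<in>unit_ball P. l x) (\<psi> I))"
      using lim[of "\<psi> I"] * by (simp add: cone_chain_def)
  qed
qed

text \<open>Counterpart of \<open>app_path\<close>: the argument path of a function test and the
  environment parameters become one path in \<open>k + n\<close> parameters.\<close>

lemma curry_path:
  assumes ball: "\<And>s. s \<in> space (Rn n) \<Longrightarrow> (\<lambda>x\<in>unit_ball P. g x s) \<in> unit_ball F"
    and path: "\<And>k \<delta>. \<delta> \<in> unit_paths P k \<Longrightarrow>
      (\<lambda>s. g (\<delta> (fst_Rn k s)) (snd_Rn k n s)) \<in> unit_paths Q (k + n)"
  shows "(\<lambda>s. \<lambda>x\<in>unit_ball P. g x s) \<in> unit_paths F n"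
proof (rule unit_pathsI[OF ball])
  fix k t assume "t \<in> tests F k"
  then obtain \<delta> m where \<delta>: "\<delta> \<in> unit_paths P k" and m: "m \<in> tests Q k" and t: "t = (\<lambda>r f. m r (f (\<delta> r)))"
    by (rule fun_testsE)
  have gl: "(\<lambda>x. (fst x, glue k n (fst x) (snd x))) \<in> measurable (Rn k \<Otimes>\<^sub>M Rn n) (Rn k \<Otimes>\<^sub>M Rn (k + n))"
    using measurable_glue[of k n] by (auto simp: case_prod_beta)
  have "(\<lambda>x. m (fst x) (g (\<delta> (fst_Rn k (glue k n (fst x) (snd x)))) (snd_Rn k n (glue k n (fst x) (snd x)))))
      \<in> borel_measurable (Rn k \<Otimes>\<^sub>M Rn n)"
    using measurable_compose[OF gl unit_paths_test[OF path[OF \<delta>] m]] by (simp add: case_prod_beta)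
  also have "?this \<longleftrightarrow> (\<lambda>(r, s). t r (\<lambda>x\<in>unit_ball P. g x s)) \<in> borel_measurable (Rn k \<Otimes>\<^sub>M Rn n)"
    using unit_paths_ball[OF \<delta>]
    by (intro measurable_cong) (auto simp: space_pair_measure fst_Rn_glue snd_Rn_glue t)
  finally show "(\<lambda>(r, s). t r (\<lambda>x\<in>unit_ball P. g x s)) \<in> borel_measurable (Rn k \<Otimes>\<^sub>M Rn n)" .
qed

end

section \<open>Least fixed points\<close>

context rcone begin

sublocale endo: rcone_pair P T P T ..

definition fixpoint :: "('a \<Rightarrow> 'a) \<Rightarrow> 'a" where
  "fixpoint f = cone_lub P (range (\<lambda>n. (f ^^ n) (zero P)))"

lemma iterate_ball: "f \<in> unit_ball (fun_cone P P) \<Longrightarrow> (f ^^ n) (zero P) \<in> unit_ball P"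
  by (induction n) (auto simp: zero_ball endo.app_ball)

lemma iterate_mono:
  assumes f: "f \<in> unit_ball (fun_cone P P)" and \<tau>: "\<tau> \<in> T"
  shows "\<tau> ((f ^^ n) (zero P)) \<le> \<tau> ((f ^^ Suc n) (zero P))"
  using \<tau>
proof (induction n arbitrary: \<tau>)
  case 0
  then show ?case using iterate_ball[OF f, of "Suc 0"] by (simp add: fn_zero fn_nonneg ball_carr)
next
  case (Suc n)
  have "cone_map P T P T f" using f by (simp add: endo.fun_ball_iff endo.fun_mapD)
  then have "\<tau> (f ((f ^^ n) (zero P))) \<le> \<tau> (f ((f ^^ Suc n) (zero P)))"
    by (rule cone_map_mono[OF rcone_axioms _ iterate_ball[OF f] iterate_ball[OF f] _ Suc.prems]) (rule Suc.IH)
  then show ?case by simp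
qed

lemma fixpoint_chain:
  assumes f: "f \<in> unit_ball (fun_cone P P)"
  shows "cone_chain P T (\<lambda>n. (f ^^ n) (zero P)) (fixpoint f)"
proof -
  let ?X = "\<lambda>n. (f ^^ n) (zero P)"
  have inc: "incseq (\<lambda>n. \<tau> (?X n))" if "\<tau> \<in> T" for \<tau>
    using iterate_mono[OF f that] by (intro incseq_SucI)
  have X: "?X n \<in> carr P" "cnorm P (?X n) \<le> 1" for n
    using iterate_ball[OF f, of n] by (auto simp: unit_ball_def)
  obtain l where l: "l \<in> carr P" "cnorm P l \<le> 1" "\<forall>\<tau>\<in>T. (\<lambda>n. \<tau> (?X n)) \<longlonglongrightarrow> \<tau> l"
    using complete[of ?X 1, OF X inc] by auto
  have "fixpoint f = l"
    unfolding fixpoint_def by (rule cone_lub_limit) (use X l inc in auto)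
  then show ?thesis using l inc iterate_ball[OF f] by (auto simp: cone_chain_def unit_ball_def)
qed

lemma fixpoint_ball: "f \<in> unit_ball (fun_cone P P) \<Longrightarrow> fixpoint f \<in> unit_ball P"
  using fixpoint_chain[of f] by (simp add: cone_chain_def)

text \<open>The sequence of iterates and its shift have the same limit; continuity of
  \<open>f\<close> identifies the limit of the shift.\<close>

lemma fixpoint_unfold:
  assumes f: "f \<in> unit_ball (fun_cone P P)"
  shows "f (fixpoint f) = fixpoint f"
proof (rule separate)
  have map: "cone_map P T P T f" using f by (simp add: endo.fun_ball_iff endo.fun_mapD)
  fix \<tau> assume \<tau>: "\<tau> \<in> T"
  have "(\<lambda>n. \<tau> ((f ^^ n) (zero P))) \<longlonglongrightarrow> \<tau> (fixpoint f)"
    using fixpoint_chain[OF f] \<tau> by (simp add: cone_chain_def)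
  then have "(\<lambda>n. \<tau> ((f ^^ Suc n) (zero P))) \<longlonglongrightarrow> \<tau> (fixpoint f)"
    by (rule LIMSEQ_Suc)
  moreover have "(\<lambda>n. \<tau> ((f ^^ Suc n) (zero P))) \<longlonglongrightarrow> \<tau> (f (fixpoint f))"
    using cone_map_limit[OF map fixpoint_chain[OF f] \<tau>] by simp
  ultimately show "\<tau> (f (fixpoint f)) = \<tau> (fixpoint f)" using LIMSEQ_unique by blast
qed (use fixpoint_ball[OF f] endo.app_ball[OF f] ball_carr in blast)+

text \<open>Every iterate depends on the map through cubes, by induction from the constant cube at
  zero, and cubes are closed under limits.\<close>

lemma fixpoint_cube:
  assumes \<phi>: "cone_cube (fun_cone P P) (fun_fns P T T) (N::nat set) \<phi>"
  shows "cone_cube P T N (\<lambda>I. fixpoint (\<phi> I))"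
proof -
  have N: "finite N" and ball: "\<phi> I \<in> unit_ball (fun_cone P P)" if "I \<subseteq> N" for I
    using \<phi> that by (auto simp: cone_cube_def)
  have it: "cone_cube P T N (\<lambda>I. (\<phi> I ^^ n) (zero P))" for n
    by (induction n) (auto intro: cube_const zero_ball N endo.app_cube[OF \<phi>])
  have "rcube N (\<lambda>I. \<tau> (fixpoint (\<phi> I)))" if "\<tau> \<in> T" for \<tau>
  proof (rule rcube_limit[where \<phi>="\<lambda>n I. \<tau> ((\<phi> I ^^ n) (zero P))"])
    show "rcube N (\<lambda>I. \<tau> ((\<phi> I ^^ n) (zero P)))" for n
      using it[of n] that by (simp add: cone_cube_def)
    show "(\<lambda>n. \<tau> ((\<phi> I ^^ n) (zero P))) \<longlonglongrightarrow> \<tau> (fixpoint (\<phi> I))" if "I \<subseteq> N" for I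
      using fixpoint_chain[OF ball[OF that]] \<open>\<tau> \<in> T\<close> by (simp add: cone_chain_def)
  qed (use N in auto)
  then show ?thesis using N ball fixpoint_ball by (auto simp: cone_cube_def)
qed

text \<open>Each iterate is continuous in the map, and the limit over the chain is exchanged with
  the limit over the number of iterations.\<close>

lemma fixpoint_continuous:
  assumes X: "cone_chain (fun_cone P P) (fun_fns P T T) X f"
  shows "cone_chain P T (\<lambda>n. fixpoint (X n)) (fixpoint f)"
proof -
  have ball: "X n \<in> unit_ball (fun_cone P P)" "f \<in> unit_ball (fun_cone P P)" for n
    using X by (auto simp: cone_chain_def)
  have it: "cone_chain P T (\<lambda>n. (X n ^^ k) (zero P)) ((f ^^ k) (zero P))" for k
    by (induction k) (auto intro: chain_const zero_ball endo.app_chain[OF X])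
  have "incseq (\<lambda>n. \<tau> (fixpoint (X n))) \<and> (\<lambda>n. \<tau> (fixpoint (X n))) \<longlonglongrightarrow> \<tau> (fixpoint f)" if \<tau>: "\<tau> \<in> T" for \<tau>
  proof
    let ?a = "\<lambda>n k. \<tau> ((X n ^^ k) (zero P))"
    have a1: "incseq (\<lambda>n. ?a n k)" and d: "(\<lambda>n. ?a n k) \<longlonglongrightarrow> \<tau> ((f ^^ k) (zero P))" for k
      using it[of k] \<tau> by (auto simp: cone_chain_def)
    have a2: "incseq (?a n)" and b: "?a n \<longlonglongrightarrow> \<tau> (fixpoint (X n))" for n
      using fixpoint_chain[OF ball(1)[of n]] \<tau> by (auto simp: cone_chain_def)
    have c: "(\<lambda>k. \<tau> ((f ^^ k) (zero P))) \<longlonglongrightarrow> \<tau> (fixpoint f)"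
      using fixpoint_chain[OF ball(2)] \<tau> by (auto simp: cone_chain_def)
    show "(\<lambda>n. \<tau> (fixpoint (X n))) \<longlonglongrightarrow> \<tau> (fixpoint f)"
      by (rule exchange_limit[OF a1 a2 b d c])
    show "incseq (\<lambda>n. \<tau> (fixpoint (X n)))"
    proof (rule incseq_SucI)
      fix n
      show "\<tau> (fixpoint (X n)) \<le> \<tau> (fixpoint (X (Suc n)))"
        by (rule LIMSEQ_le[OF b b]) (use a1 in \<open>auto simp: incseq_Suc_iff\<close>)
    qed
  qed
  then show ?thesis using ball fixpoint_ball by (auto simp: cone_chain_def)
qed

lemma fixpoint_path:
  assumes \<gamma>: "\<gamma> \<in> unit_paths (fun_cone P P) n"
  shows "(\<lambda>s. fixpoint (\<gamma> s)) \<in> unit_paths P n"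
proof (rule unit_pathsI)
  have ball: "\<gamma> s \<in> unit_ball (fun_cone P P)" if "s \<in> space (Rn n)" for s
    using unit_paths_ball[OF \<gamma> that] .
  then show "fixpoint (\<gamma> s) \<in> unit_ball P" if "s \<in> space (Rn n)" for s
    using that fixpoint_ball by blast
  fix k m assume m: "m \<in> tests P k"
  have it: "(\<lambda>s. (\<gamma> s ^^ j) (zero P)) \<in> unit_paths P n" for j
    by (induction j) (auto intro: unit_path_const zero_ball endo.app_path[OF \<gamma>])
  show "(\<lambda>(r, s). m r (fixpoint (\<gamma> s))) \<in> borel_measurable (Rn k \<Otimes>\<^sub>M Rn n)"
  proof (rule borel_measurable_LIMSEQ_metric)
    show "(\<lambda>(r, s). m r ((\<gamma> s ^^ j) (zero P))) \<in> borel_measurable (Rn k \<Otimes>\<^sub>M Rn n)" for j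
      using unit_paths_test[OF it m] .
    fix x assume "x \<in> space (Rn k \<Otimes>\<^sub>M Rn n)"
    then obtain r s where x: "x = (r, s)" "r \<in> space (Rn k)" "s \<in> space (Rn n)"
      by (auto simp: space_pair_measure)
    have "(\<lambda>j. m r ((\<gamma> s ^^ j) (zero P))) \<longlonglongrightarrow> m r (fixpoint (\<gamma> s))"
      using fixpoint_chain[OF ball[OF x(3)]]
      by (intro test_limit[OF m x(2), where c=1]) (auto simp: cone_chain_def unit_ball_def)
    then show "(\<lambda>j. case x of (r, s) \<Rightarrow> m r ((\<gamma> s ^^ j) (zero P))) \<longlonglongrightarrow> (case x of (r, s) \<Rightarrow> m r (fixpoint (\<gamma> s)))"
      by (simp add: x)
  qed
qed

end

section \<open>Denotations are morphisms\<close>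

primrec ty_fns :: "'v universe \<Rightarrow> ty \<Rightarrow> ('v \<Rightarrow> real) set" where
  "ty_fns V RealT = (\<lambda>\<tau> x. \<tau> (dec_meas V x)) ` meas_fns"
| "ty_fns V (A \<rightarrow> B) = (\<lambda>\<tau> x. \<tau> (dec_fun V x)) ` fun_fns (ty_cone V A) (ty_fns V A) (ty_fns V B)"

lemma rcone_ty: "faithful V A \<Longrightarrow> rcone (ty_cone V A) (ty_fns V A)"
proof (induction A)
  case RealT
  then show ?case by (auto intro!: rcone_transport rcone_meas)
next
  case (FunT A B)
  then have "rcone_pair (ty_cone V A) (ty_fns V A) (ty_cone V B) (ty_fns V B)"
    by (simp add: rcone_pair_def)
  then show ?case using FunT.prems by (auto intro!: rcone_transport rcone_pair.rcone_fun)
qed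

lemma rcone_pair_ty: "faithful V A \<Longrightarrow> faithful V B \<Longrightarrow>
    rcone_pair (ty_cone V A) (ty_fns V A) (ty_cone V B) (ty_fns V B)"
  by (simp add: rcone_pair_def rcone_ty)

lemma retraction_meas: "faithful V RealT \<Longrightarrow> retraction meas_cone (enc_meas V) (dec_meas V)"
  by (simp add: retraction_def)

lemma retraction_fun: "faithful V (A \<rightarrow> B) \<Longrightarrow>
    retraction (fun_cone (ty_cone V A) (ty_cone V B)) (enc_fun V) (dec_fun V)"
  by (simp add: retraction_def)

section \<open>Environments\<close>

definition env_ball :: "'v universe \<Rightarrow> ty list \<Rightarrow> 'v list \<Rightarrow> bool" where
  "env_ball V \<Gamma> g \<longleftrightarrow> (\<forall>i<length \<Gamma>. g ! i \<in> unit_ball (ty_cone V (\<Gamma> ! i)))"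

definition env_cube :: "'v universe \<Rightarrow> ty list \<Rightarrow> nat set \<Rightarrow> (nat set \<Rightarrow> 'v list) \<Rightarrow> bool" where
  "env_cube V \<Gamma> N \<phi> \<longleftrightarrow> finite N \<and> (\<forall>i<length \<Gamma>. cone_cube (ty_cone V (\<Gamma> ! i)) (ty_fns V (\<Gamma> ! i)) N (\<lambda>I. \<phi> I ! i))"

definition env_chain :: "'v universe \<Rightarrow> ty list \<Rightarrow> (nat \<Rightarrow> 'v list) \<Rightarrow> 'v list \<Rightarrow> bool" where
  "env_chain V \<Gamma> X l \<longleftrightarrow>
    (\<forall>i<length \<Gamma>. cone_chain (ty_cone V (\<Gamma> ! i)) (ty_fns V (\<Gamma> ! i)) (\<lambda>n. X n ! i) (l ! i))"

definition env_path :: "'v universe \<Rightarrow> ty list \<Rightarrow> nat \<Rightarrow> ((nat \<Rightarrow> real) \<Rightarrow> 'v list) \<Rightarrow> bool" where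
  "env_path V \<Gamma> n \<gamma> \<longleftrightarrow> (\<forall>i<length \<Gamma>. (\<lambda>s. \<gamma> s ! i) \<in> unit_paths (ty_cone V (\<Gamma> ! i)) n)"

lemma env_cube_Cons:
  "env_cube V \<Gamma> N \<phi> \<Longrightarrow> cone_cube (ty_cone V A) (ty_fns V A) N a \<Longrightarrow> env_cube V (A # \<Gamma>) N (\<lambda>I. a I # \<phi> I)"
  by (auto simp: env_cube_def less_Suc_eq_0_disj)

lemma env_chain_Cons:
  "env_chain V \<Gamma> X l \<Longrightarrow> cone_chain (ty_cone V A) (ty_fns V A) a b \<Longrightarrow>
    env_chain V (A # \<Gamma>) (\<lambda>n. a n # X n) (b # l)"
  by (auto simp: env_chain_def less_Suc_eq_0_disj)

lemma env_path_Cons: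
  "env_path V \<Gamma> n \<gamma> \<Longrightarrow> a \<in> unit_paths (ty_cone V A) n \<Longrightarrow> env_path V (A # \<Gamma>) n (\<lambda>s. a s # \<gamma> s)"
  by (auto simp: env_path_def less_Suc_eq_0_disj)

lemma env_path_reindex:
  "env_path V \<Gamma> n \<gamma> \<Longrightarrow> p \<in> measurable (Rn k) (Rn n) \<Longrightarrow> env_path V \<Gamma> k (\<lambda>s. \<gamma> (p s))"
  by (auto simp: env_path_def intro: unit_paths_reindex)

lemma env_cube_const:
  assumes "\<forall>A\<in>set \<Gamma>. faithful V A" "env_ball V \<Gamma> g" "finite N"
  shows "env_cube V \<Gamma> N (\<lambda>I. g)"
  unfolding env_cube_def using assms by (auto simp: env_ball_def intro!: rcone.cube_const rcone_ty)

lemma env_chain_const: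
  assumes "\<forall>A\<in>set \<Gamma>. faithful V A" "env_ball V \<Gamma> g"
  shows "env_chain V \<Gamma> (\<lambda>n. g) g"
  unfolding env_chain_def using assms by (auto simp: env_ball_def intro!: rcone.chain_const rcone_ty)

lemma env_path_const:
  assumes "\<forall>A\<in>set \<Gamma>. faithful V A" "env_ball V \<Gamma> g"
  shows "env_path V \<Gamma> n (\<lambda>s. g)"
  unfolding env_path_def using assms by (auto simp: env_ball_def intro!: rcone.unit_path_const rcone_ty)

lemma env_cube_at: "env_cube V \<Gamma> N \<phi> \<Longrightarrow> I \<subseteq> N \<Longrightarrow> env_ball V \<Gamma> (\<phi> I)"
  by (auto simp: env_cube_def cone_cube_def env_ball_def)

lemma env_chain_at: "env_chain V \<Gamma> X l \<Longrightarrow> env_ball V \<Gamma> (X n)" "env_chain V \<Gamma> X l \<Longrightarrow> env_ball V \<Gamma> l"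
  by (auto simp: env_chain_def cone_chain_def env_ball_def)

lemma env_path_at: "env_path V \<Gamma> n \<gamma> \<Longrightarrow> s \<in> space (Rn n) \<Longrightarrow> env_ball V \<Gamma> (\<gamma> s)"
  by (auto simp: env_path_def unit_paths_def env_ball_def)

text \<open>An edge of the chain as a cube of environments; it turns preservation of cubes into
  monotonicity along the chain.\<close>

lemma env_chain_pair:
  assumes "\<forall>A\<in>set \<Gamma>. faithful V A" "env_chain V \<Gamma> X l"
  shows "env_cube V \<Gamma> {0} (\<lambda>I. if 0 \<in> I then X (Suc n) else X n)"
  unfolding env_cube_def
proof (intro conjI allI impI)
  fix i assume i: "i < length \<Gamma>"
  have ch: "cone_chain (ty_cone V (\<Gamma> ! i)) (ty_fns V (\<Gamma> ! i)) (\<lambda>n. X n ! i) (l ! i)"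
    using assms i by (simp add: env_chain_def)
  have "cone_cube (ty_cone V (\<Gamma> ! i)) (ty_fns V (\<Gamma> ! i)) {0::nat} (\<lambda>I. if 0 \<in> I then X (Suc n) ! i else X n ! i)"
    using assms(1) i ch cone_chain_Suc[OF ch]
    by (intro rcone.cube_pair rcone_ty) (auto simp: cone_chain_def)
  then show "cone_cube (ty_cone V (\<Gamma> ! i)) (ty_fns V (\<Gamma> ! i)) {0::nat} (\<lambda>I. (if 0 \<in> I then X (Suc n) else X n) ! i)"
    by (simp add: if_distrib[of "\<lambda>g. g ! i"])
qed simp

lemma type_of_types_in: "type_of M \<Gamma> \<in> types_in M \<Gamma>"
  by (cases M) auto

text \<open>Morphisms are the maps that preserve cubes, convergent chains and measurable paths.\<close>

definition cube_ok :: "'v universe \<Rightarrow> real tm \<Rightarrow> ty list \<Rightarrow> ty \<Rightarrow> bool" where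
  "cube_ok V M \<Gamma> A \<longleftrightarrow> (\<forall>N \<phi>. env_cube V \<Gamma> N \<phi> \<longrightarrow>
     cone_cube (ty_cone V A) (ty_fns V A) N (\<lambda>I. sem V M \<Gamma> (\<phi> I)))"

definition chain_ok :: "'v universe \<Rightarrow> real tm \<Rightarrow> ty list \<Rightarrow> ty \<Rightarrow> bool" where
  "chain_ok V M \<Gamma> A \<longleftrightarrow> (\<forall>X l. env_chain V \<Gamma> X l \<longrightarrow>
     cone_chain (ty_cone V A) (ty_fns V A) (\<lambda>n. sem V M \<Gamma> (X n)) (sem V M \<Gamma> l))"

definition path_ok :: "'v universe \<Rightarrow> real tm \<Rightarrow> ty list \<Rightarrow> ty \<Rightarrow> bool" where
  "path_ok V M \<Gamma> A \<longleftrightarrow> (\<forall>n \<gamma>. env_path V \<Gamma> n \<gamma> \<longrightarrow>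
     (\<lambda>s. sem V M \<Gamma> (\<gamma> s)) \<in> unit_paths (ty_cone V A) n)"

definition sem_ok :: "'v universe \<Rightarrow> real tm \<Rightarrow> ty list \<Rightarrow> ty \<Rightarrow> bool" where
  "sem_ok V M \<Gamma> A \<longleftrightarrow> cube_ok V M \<Gamma> A \<and> chain_ok V M \<Gamma> A \<and> path_ok V M \<Gamma> A"

lemma cube_okD: "cube_ok V M \<Gamma> A \<Longrightarrow> env_cube V \<Gamma> N \<phi> \<Longrightarrow>
    cone_cube (ty_cone V A) (ty_fns V A) N (\<lambda>I. sem V M \<Gamma> (\<phi> I))"
  by (simp add: cube_ok_def)

lemma chain_okD: "chain_ok V M \<Gamma> A \<Longrightarrow> env_chain V \<Gamma> X l \<Longrightarrow>
    cone_chain (ty_cone V A) (ty_fns V A) (\<lambda>n. sem V M \<Gamma> (X n)) (sem V M \<Gamma> l)"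
  by (simp add: chain_ok_def)

lemma path_okD: "path_ok V M \<Gamma> A \<Longrightarrow> env_path V \<Gamma> n \<gamma> \<Longrightarrow>
    (\<lambda>s. sem V M \<Gamma> (\<gamma> s)) \<in> unit_paths (ty_cone V A) n"
  by (simp add: path_ok_def)

text \<open>A point is a constant chain, so preservation of chains already says that values lie in
  the unit ball.\<close>

lemma chain_ok_ball:
  assumes "chain_ok V M \<Gamma> A" "\<forall>A\<in>set \<Gamma>. faithful V A"
    "env_ball V \<Gamma> g"
  shows "sem V M \<Gamma> g \<in> unit_ball (ty_cone V A)"
  using chain_okD[OF assms(1) env_chain_const[OF assms(2,3)]] by (simp add: cone_chain_def)

lemma return_ball: "return borel (r::real) \<in> unit_ball meas_cone"
  by (auto simp: unit_ball_meas space_subprob_algebra intro!: prob_space_imp_subprob_space prob_space_return)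

lemma sem_ok_ball:
  assumes "sem_ok V M \<Gamma> A" "\<forall>A\<in>set \<Gamma>. faithful V A"
    "env_ball V \<Gamma> g"
  shows "sem V M \<Gamma> g \<in> unit_ball (ty_cone V A)"
  using assms by (intro chain_ok_ball) (auto simp: sem_ok_def)

lemma sem_ok_dec_ball:
  assumes "faithful V RealT" "sem_ok V M \<Gamma> RealT" "\<forall>A\<in>set \<Gamma>. faithful V A"
    "env_ball V \<Gamma> g"
  shows "dec_meas V (sem V M \<Gamma> g) \<in> unit_ball meas_cone"
  using retraction.dec_ball[OF retraction_meas[OF assms(1)]] sem_ok_ball[OF assms(2-4)] by simp

lemma sem_ok_dec_cube:
  assumes "faithful V RealT" "sem_ok V M \<Gamma> RealT" "env_cube V \<Gamma> N \<phi>"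
  shows "cone_cube meas_cone meas_fns N (\<lambda>I. dec_meas V (sem V M \<Gamma> (\<phi> I)))"
proof -
  have "cube_ok V M \<Gamma> RealT" using assms by (simp add: sem_ok_def)
  from cube_okD[OF this assms(3)] show ?thesis
    unfolding ty_cone.simps ty_fns.simps by (rule retraction.dec_cube[OF retraction_meas[OF assms(1)]])
qed

lemma sem_ok_dec_chain:
  assumes "faithful V RealT" "sem_ok V M \<Gamma> RealT" "env_chain V \<Gamma> X l"
  shows "cone_chain meas_cone meas_fns (\<lambda>n. dec_meas V (sem V M \<Gamma> (X n)))
    (dec_meas V (sem V M \<Gamma> l))"
proof -
  have "chain_ok V M \<Gamma> RealT" using assms by (simp add: sem_ok_def)
  from chain_okD[OF this assms(3)] show ?thesis
    unfolding ty_cone.simps ty_fns.simps by (rule retraction.dec_chain[OF retraction_meas[OF assms(1)]])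
qed

lemma sem_ok_dec_path:
  assumes "faithful V RealT" "sem_ok V M \<Gamma> RealT" "env_path V \<Gamma> n \<gamma>"
  shows "(\<lambda>s. dec_meas V (sem V M \<Gamma> (\<gamma> s))) \<in> measurable (Rn n) (subprob_algebra borel)"
proof -
  have "path_ok V M \<Gamma> RealT" using assms by (simp add: sem_ok_def)
  from path_okD[OF this assms(3)] show ?thesis
    unfolding ty_cone.simps unit_paths_meas[symmetric] by (rule retraction.dec_path[OF retraction_meas[OF assms(1)]])
qed

section \<open>The term constructors\<close>

lemma const_ok:
  assumes "faithful V RealT" "\<And>g. sem V M \<Gamma> g = enc_meas V \<mu>" "\<mu> \<in> unit_ball meas_cone"
  shows "sem_ok V M \<Gamma> RealT"
proof -
  interpret retraction meas_cone "enc_meas V" "dec_meas V" using assms(1) by (rule retraction_meas)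
  show ?thesis
    unfolding sem_ok_def cube_ok_def chain_ok_def path_ok_def assms(2) ty_cone.simps ty_fns.simps
    by (auto simp: env_cube_def intro!: enc_cube enc_chain enc_path rcone.cube_const rcone.chain_const
        rcone.unit_path_const rcone_meas assms)
qed

lemma Lam_ball:
  assumes fa: "faithful V (A \<rightarrow> B)" and \<Gamma>: "\<forall>A\<in>set \<Gamma>. faithful V A" and M: "sem_ok V M (A # \<Gamma>) B"
    and g: "env_ball V \<Gamma> g"
  shows "(\<lambda>a\<in>unit_ball (ty_cone V A). sem V M (A # \<Gamma>) (a # g)) \<in>
    unit_ball (fun_cone (ty_cone V A) (ty_cone V B))"
proof -
  interpret rcone_pair "ty_cone V A" "ty_fns V A" "ty_cone V B" "ty_fns V B"
    using fa by (intro rcone_pair_ty) auto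
  have cube: "cube_ok V M (A # \<Gamma>) B" and chain: "chain_ok V M (A # \<Gamma>) B"
    and path: "path_ok V M (A # \<Gamma>) B"
    using M by (auto simp: sem_ok_def)
  show ?thesis
  proof (rule curry_ball)
    show "cone_cube (ty_cone V B) (ty_fns V B) N (\<lambda>I. sem V M (A # \<Gamma>) (\<phi> I # g))"
      if "cone_cube (ty_cone V A) (ty_fns V A) N \<phi>" for N :: "nat set" and \<phi>
      using that by (intro cube_okD[OF cube] env_cube_Cons env_cube_const \<Gamma> g) (auto simp: cone_cube_def)
    show "cone_chain (ty_cone V B) (ty_fns V B) (\<lambda>n. sem V M (A # \<Gamma>) (X n # g)) (sem V M (A # \<Gamma>) (l # g))"
      if "cone_chain (ty_cone V A) (ty_fns V A) X l" for X l
      using that by (intro chain_okD[OF chain] env_chain_Cons env_chain_const \<Gamma> g)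
    show "(\<lambda>s. sem V M (A # \<Gamma>) (\<gamma> s # g)) \<in> unit_paths (ty_cone V B) n"
      if "\<gamma> \<in> unit_paths (ty_cone V A) n" for \<gamma> n
      using that by (intro path_okD[OF path] env_path_Cons env_path_const \<Gamma> g)
  qed
qed

lemma Lam_ok:
  assumes fa: "faithful V (A \<rightarrow> B)" and \<Gamma>: "\<forall>A\<in>set \<Gamma>. faithful V A" and M: "sem_ok V M (A # \<Gamma>) B"
  shows "sem_ok V (Lam A M) \<Gamma> (A \<rightarrow> B)"
proof -
  interpret rcone_pair "ty_cone V A" "ty_fns V A" "ty_cone V B" "ty_fns V B"
    using fa by (intro rcone_pair_ty) auto
  interpret retraction "fun_cone (ty_cone V A) (ty_cone V B)" "enc_fun V" "dec_fun V"
    using fa by (rule retraction_fun)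
  have cube: "cube_ok V M (A # \<Gamma>) B" and chain: "chain_ok V M (A # \<Gamma>) B"
    and path: "path_ok V M (A # \<Gamma>) B"
    using M by (auto simp: sem_ok_def)
  note ball = Lam_ball[OF fa \<Gamma> M]
  have cube': "cone_cube F FT N (\<lambda>I. \<lambda>a\<in>unit_ball (ty_cone V A). sem V M (A # \<Gamma>) (a # \<phi> I))"
    if \<phi>: "env_cube V \<Gamma> N \<phi>" for N \<phi>
  proof (rule curry_cube)
    show N: "finite N" using \<phi> by (simp add: env_cube_def)
    show "(\<lambda>a\<in>unit_ball (ty_cone V A). sem V M (A # \<Gamma>) (a # \<phi> I)) \<in> unit_ball F" if "I \<subseteq> N" for I
      using env_cube_at[OF \<phi> that] by (rule ball)
    fix N' \<psi> assume \<psi>: "cone_cube (ty_cone V A) (ty_fns V A) (N'::nat set) \<psi>"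
    then have N': "finite N'" by (simp add: cone_cube_def)
    \<comment> \<open>The environment occupies the even indices of the disjoint union, the argument
      the odd ones.\<close>
    have "env_cube V \<Gamma> (interleave N N') (\<lambda>K. \<phi> (evens K))"
      using \<phi> N N' by (auto simp: env_cube_def intro: cone_cube_evens)
    then show "cone_cube (ty_cone V B) (ty_fns V B) (interleave N N')
       (\<lambda>K. sem V M (A # \<Gamma>) (\<psi> (odds K) # \<phi> (evens K)))"
      using cone_cube_odds[OF \<psi> N] by (intro cube_okD[OF cube] env_cube_Cons)
  qed
  have chain': "cone_chain F FT (\<lambda>n. \<lambda>a\<in>unit_ball (ty_cone V A). sem V M (A # \<Gamma>) (a # X n))
      (\<lambda>a\<in>unit_ball (ty_cone V A). sem V M (A # \<Gamma>) (a # l))"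
    if X: "env_chain V \<Gamma> X l" for X l
    unfolding cone_chain_def
  proof (intro conjI allI ballI)
    show "(\<lambda>a\<in>unit_ball (ty_cone V A). sem V M (A # \<Gamma>) (a # X n)) \<in> unit_ball F" for n
      using env_chain_at[OF X] by (intro ball)
    show "(\<lambda>a\<in>unit_ball (ty_cone V A). sem V M (A # \<Gamma>) (a # l)) \<in> unit_ball F"
      using env_chain_at[OF X] by (intro ball)
    fix \<tau> assume \<tau>: "\<tau> \<in> FT"
    show "(\<lambda>n. \<tau> (\<lambda>a\<in>unit_ball (ty_cone V A). sem V M (A # \<Gamma>) (a # X n))) \<longlonglongrightarrow>
       \<tau> (\<lambda>a\<in>unit_ball (ty_cone V A). sem V M (A # \<Gamma>) (a # l))"
      using \<tau> by (intro curry_limit chain_okD[OF chain] env_chain_Cons X P.chain_const)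
    show "incseq (\<lambda>n. \<tau> (\<lambda>a\<in>unit_ball (ty_cone V A). sem V M (A # \<Gamma>) (a # X n)))"
    proof (rule incseq_SucI)
      fix n
      \<comment> \<open>A functional of the function cone need not be a point evaluation, so the
        increase is read off from the image of an edge of the chain.\<close>
      have "rcube {0::nat} (\<lambda>I. \<tau> (\<lambda>a\<in>unit_ball (ty_cone V A).
          sem V M (A # \<Gamma>) (a # (if 0 \<in> I then X (Suc n) else X n))))"
        using cube'[OF env_chain_pair[OF \<Gamma> X]] \<tau> by (auto simp: cone_cube_def)
      from rcube_moebius_nonneg[OF _ this]
      show "\<tau> (\<lambda>a\<in>unit_ball (ty_cone V A). sem V M (A # \<Gamma>) (a # X n)) \<le>
        \<tau> (\<lambda>a\<in>unit_ball (ty_cone V A). sem V M (A # \<Gamma>) (a # X (Suc n)))"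
        by (simp add: moebius_single)
    qed
  qed
  have path': "(\<lambda>s. \<lambda>a\<in>unit_ball (ty_cone V A). sem V M (A # \<Gamma>) (a # \<gamma> s)) \<in> unit_paths F n"
    if \<gamma>: "env_path V \<Gamma> n \<gamma>" for n \<gamma>
  proof (rule curry_path)
    show "(\<lambda>a\<in>unit_ball (ty_cone V A). sem V M (A # \<Gamma>) (a # \<gamma> s)) \<in> unit_ball F"
      if "s \<in> space (Rn n)" for s
      using env_path_at[OF \<gamma> that] by (rule ball)
    fix k \<delta> assume \<delta>: "\<delta> \<in> unit_paths (ty_cone V A) k"
    show "(\<lambda>s. sem V M (A # \<Gamma>) (\<delta> (fst_Rn k s) # \<gamma> (snd_Rn k n s)))
      \<in> unit_paths (ty_cone V B) (k + n)"
      by (intro path_okD[OF path] env_path_Cons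
          env_path_reindex[OF \<gamma> measurable_snd_Rn] unit_paths_reindex[OF \<delta> measurable_fst_Rn])
  qed
  show ?thesis
    unfolding sem_ok_def cube_ok_def chain_ok_def path_ok_def
    using enc_cube[OF cube'] enc_chain[OF chain'] enc_path[OF path'] by simp
qed

lemma App_ok:
  assumes fa: "faithful V (A \<rightarrow> B)" and M: "sem_ok V M \<Gamma> (A \<rightarrow> B)" and N: "sem_ok V N \<Gamma> A"
  shows "sem_ok V (App M N) \<Gamma> B"
proof -
  interpret rcone_pair "ty_cone V A" "ty_fns V A" "ty_cone V B" "ty_fns V B"
    using fa by (intro rcone_pair_ty) auto
  interpret retraction "fun_cone (ty_cone V A) (ty_cone V B)" "enc_fun V" "dec_fun V"
    using fa by (rule retraction_fun)
  have "cone_cube (ty_cone V B) (ty_fns V B) K (\<lambda>I. sem V (App M N) \<Gamma> (\<phi> I))"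
    if \<phi>: "env_cube V \<Gamma> K \<phi>" for K \<phi>
  proof -
    have "cone_cube (ty_cone V (A \<rightarrow> B)) (ty_fns V (A \<rightarrow> B)) K (\<lambda>I. sem V M \<Gamma> (\<phi> I))"
      "cone_cube (ty_cone V A) (ty_fns V A) K (\<lambda>I. sem V N \<Gamma> (\<phi> I))"
      using M N \<phi> by (auto simp only: sem_ok_def intro: cube_okD)
    from app_cube[OF dec_cube[OF this(1)[unfolded ty_cone.simps ty_fns.simps]] this(2)] show ?thesis by simp
  qed
  moreover have "cone_chain (ty_cone V B) (ty_fns V B) (\<lambda>n. sem V (App M N) \<Gamma> (X n)) (sem V (App M N) \<Gamma> l)"
    if X: "env_chain V \<Gamma> X l" for X l
  proof -
    have "cone_chain (ty_cone V (A \<rightarrow> B)) (ty_fns V (A \<rightarrow> B)) (\<lambda>n. sem V M \<Gamma> (X n)) (sem V M \<Gamma> l)"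
      "cone_chain (ty_cone V A) (ty_fns V A) (\<lambda>n. sem V N \<Gamma> (X n)) (sem V N \<Gamma> l)"
      using M N X by (auto simp only: sem_ok_def intro: chain_okD)
    from app_chain[OF dec_chain[OF this(1)[unfolded ty_cone.simps ty_fns.simps]] this(2)] show ?thesis by simp
  qed
  moreover have "(\<lambda>s. sem V (App M N) \<Gamma> (\<gamma> s)) \<in> unit_paths (ty_cone V B) n"
    if "env_path V \<Gamma> n \<gamma>" for n \<gamma>
  proof -
    have "(\<lambda>s. sem V M \<Gamma> (\<gamma> s)) \<in> unit_paths (ty_cone V (A \<rightarrow> B)) n"
      "(\<lambda>s. sem V N \<Gamma> (\<gamma> s)) \<in> unit_paths (ty_cone V A) n"
      using M N that by (auto simp only: sem_ok_def intro: path_okD)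
    from app_path[OF dec_path[OF this(1)[unfolded ty_cone.simps]] this(2)] show ?thesis by simp
  qed
  ultimately show ?thesis by (simp only: sem_ok_def cube_ok_def chain_ok_def path_ok_def) blast
qed

lemma sem_Fix:
  assumes "rcone (ty_cone V A) T" "type_of M \<Gamma> = (A \<rightarrow> A)"
  shows "sem V (Fix M) \<Gamma> g = rcone.fixpoint (ty_cone V A) (dec_fun V (sem V M \<Gamma> g))"
  using assms by (simp add: rcone.fixpoint_def Let_def)

lemma Fix_ok:
  assumes fa: "faithful V (A \<rightarrow> A)" and M: "sem_ok V M \<Gamma> (A \<rightarrow> A)" and ty: "type_of M \<Gamma> = (A \<rightarrow> A)"
  shows "sem_ok V (Fix M) \<Gamma> A"
proof -
  interpret rcone "ty_cone V A" "ty_fns V A"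
    using fa by (intro rcone_ty) auto
  interpret retraction "fun_cone (ty_cone V A) (ty_cone V A)" "enc_fun V" "dec_fun V"
    using fa by (rule retraction_fun)
  have eq: "sem V (Fix M) \<Gamma> g = fixpoint (dec_fun V (sem V M \<Gamma> g))" for g
    by (rule sem_Fix[OF rcone_axioms ty])
  have "cone_cube (ty_cone V A) (ty_fns V A) K (\<lambda>I. sem V (Fix M) \<Gamma> (\<phi> I))"
    if \<phi>: "env_cube V \<Gamma> K \<phi>" for K \<phi>
  proof -
    have "cone_cube (ty_cone V (A \<rightarrow> A)) (ty_fns V (A \<rightarrow> A)) K (\<lambda>I. sem V M \<Gamma> (\<phi> I))"
      using M \<phi> by (auto simp only: sem_ok_def intro: cube_okD)
    from fixpoint_cube[OF dec_cube[OF this[unfolded ty_cone.simps ty_fns.simps]]] show ?thesis unfolding eq .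
  qed
  moreover have "cone_chain (ty_cone V A) (ty_fns V A) (\<lambda>n. sem V (Fix M) \<Gamma> (X n)) (sem V (Fix M) \<Gamma> l)"
    if X: "env_chain V \<Gamma> X l" for X l
  proof -
    have "cone_chain (ty_cone V (A \<rightarrow> A)) (ty_fns V (A \<rightarrow> A)) (\<lambda>n. sem V M \<Gamma> (X n)) (sem V M \<Gamma> l)"
      using M X by (auto simp only: sem_ok_def intro: chain_okD)
    from fixpoint_continuous[OF dec_chain[OF this[unfolded ty_cone.simps ty_fns.simps]]] show ?thesis unfolding eq .
  qed
  moreover have "(\<lambda>s. sem V (Fix M) \<Gamma> (\<gamma> s)) \<in> unit_paths (ty_cone V A) n"
    if "env_path V \<Gamma> n \<gamma>" for n \<gamma>
  proof -
    have "(\<lambda>s. sem V M \<Gamma> (\<gamma> s)) \<in> unit_paths (ty_cone V (A \<rightarrow> A)) n"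
      using M that by (auto simp only: sem_ok_def intro: path_okD)
    from fixpoint_path[OF dec_path[OF this[unfolded ty_cone.simps]]] show ?thesis unfolding eq .
  qed
  ultimately show ?thesis by (simp only: sem_ok_def cube_ok_def chain_ok_def path_ok_def) blast
qed

lemma cone_cube_cong: "(\<And>I. I \<subseteq> N \<Longrightarrow> \<phi> I = \<psi> I) \<Longrightarrow> cone_cube P T N \<phi> \<longleftrightarrow> cone_cube P T N \<psi>"
  by (simp add: cone_cube_def cong: rcube_cong)

lemma unit_paths_cong:
  assumes "\<And>s. s \<in> space (Rn n) \<Longrightarrow> \<gamma> s = \<delta> s"
  shows "\<gamma> \<in> unit_paths P n \<longleftrightarrow> \<delta> \<in> unit_paths P n"
proof -
  have "(\<lambda>(r, s). m r (\<gamma> s)) \<in> borel_measurable (Rn k \<Otimes>\<^sub>M Rn n) \<longleftrightarrow>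
    (\<lambda>(r, s). m r (\<delta> s)) \<in> borel_measurable (Rn k \<Otimes>\<^sub>M Rn n)" for k and m :: "(nat \<Rightarrow> real) \<Rightarrow> 'a \<Rightarrow> real"
    using assms by (intro measurable_cong) (auto simp: space_pair_measure)
  then show ?thesis using assms by (simp add: unit_paths_def paths_def)
qed

text \<open>The real-typed constructs \<open>ifz\<close>, \<open>let\<close> and \<open>f(M\<^sub>1, \<dots>)\<close> are all binds of measures with kernels.\<close>

lemma bind_ok:
  assumes fa: "faithful V RealT" and \<Gamma>: "\<forall>A\<in>set \<Gamma>. faithful V A"
    and M: "sem_ok V M \<Gamma> RealT"
    and sem: "\<And>g. env_ball V \<Gamma> g \<Longrightarrow>
      sem V L \<Gamma> g = enc_meas V (dec_meas V (sem V M \<Gamma> g) \<bind> \<nu> g)"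
    and kernel: "\<And>g. env_ball V \<Gamma> g \<Longrightarrow>
      \<nu> g \<in> measurable borel (subprob_algebra borel)"
    and cube: "\<And>N \<phi> r. env_cube V \<Gamma> N \<phi> \<Longrightarrow> cone_cube meas_cone meas_fns N (\<lambda>I. \<nu> (\<phi> I) r)"
    and chain: "\<And>X l r. env_chain V \<Gamma> X l \<Longrightarrow> cone_chain meas_cone meas_fns (\<lambda>n. \<nu> (X n) r) (\<nu> l r)"
    and path: "\<And>\<gamma> n. env_path V \<Gamma> n \<gamma> \<Longrightarrow>
      (\<lambda>(s, r). \<nu> (\<gamma> s) r) \<in> measurable (Rn n \<Otimes>\<^sub>M borel) (subprob_algebra borel)"
  shows "sem_ok V L \<Gamma> RealT"
proof -
  interpret retraction meas_cone "enc_meas V" "dec_meas V" using fa by (rule retraction_meas)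
  have "cone_cube (ty_cone V RealT) (ty_fns V RealT) N (\<lambda>I. sem V L \<Gamma> (\<phi> I))"
    if \<phi>: "env_cube V \<Gamma> N \<phi>" for N \<phi>
  proof -
    have "cone_cube meas_cone meas_fns N (\<lambda>I. dec_meas V (sem V M \<Gamma> (\<phi> I)) \<bind> \<nu> (\<phi> I))"
      using env_cube_at[OF \<phi>] by (intro bind_cube cube[OF \<phi>] kernel sem_ok_dec_cube[OF fa M \<phi>]) auto
    from enc_cube[OF this]
    have "cone_cube (ty_cone V RealT) (ty_fns V RealT) N
      (\<lambda>I. enc_meas V (dec_meas V (sem V M \<Gamma> (\<phi> I)) \<bind> \<nu> (\<phi> I)))" by simp
    also have "?this \<longleftrightarrow> ?thesis"
      by (rule cone_cube_cong) (simp only: sem[OF env_cube_at[OF \<phi>]])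
    finally show ?thesis .
  qed
  moreover have "cone_chain (ty_cone V RealT) (ty_fns V RealT) (\<lambda>n. sem V L \<Gamma> (X n)) (sem V L \<Gamma> l)"
    if X: "env_chain V \<Gamma> X l" for X l
  proof -
    have "cone_chain meas_cone meas_fns (\<lambda>n. dec_meas V (sem V M \<Gamma> (X n)) \<bind> \<nu> (X n))
      (dec_meas V (sem V M \<Gamma> l) \<bind> \<nu> l)"
      using env_chain_at[OF X] by (intro bind_chain chain[OF X] kernel sem_ok_dec_chain[OF fa M X]) auto
    from enc_chain[OF this] show ?thesis
      using sem env_chain_at[OF X] by simp
  qed
  moreover have "(\<lambda>s. sem V L \<Gamma> (\<gamma> s)) \<in> unit_paths (ty_cone V RealT) n"
    if \<gamma>: "env_path V \<Gamma> n \<gamma>" for n \<gamma>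
  proof -
    have "(\<lambda>s. dec_meas V (sem V M \<Gamma> (\<gamma> s)) \<bind> \<nu> (\<gamma> s)) \<in> measurable (Rn n) (subprob_algebra borel)"
      by (rule measurable_bind'[OF sem_ok_dec_path[OF fa M \<gamma>] path[OF \<gamma>]])
    then have "(\<lambda>s. enc_meas V (dec_meas V (sem V M \<Gamma> (\<gamma> s)) \<bind> \<nu> (\<gamma> s))) \<in> unit_paths (ty_cone V RealT) n"
      by (auto intro!: enc_path simp flip: unit_paths_meas)
    also have "?this \<longleftrightarrow> ?thesis"
      by (rule unit_paths_cong) (simp only: sem[OF env_path_at[OF \<gamma>]])
    finally show ?thesis .
  qed
  ultimately show ?thesis by (simp add: sem_ok_def cube_ok_def chain_ok_def path_ok_def)
qed

lemma sem_Ifz: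
  assumes "dec_meas V (sem V L \<Gamma> g) \<in> unit_ball meas_cone"
    "dec_meas V (sem V M \<Gamma> g) \<in> unit_ball meas_cone" "dec_meas V (sem V N \<Gamma> g) \<in> unit_ball meas_cone"
  shows "sem V (Ifz L M N) \<Gamma> g = enc_meas V (dec_meas V (sem V L \<Gamma> g) \<bind>
    (\<lambda>r. if r = 0 then dec_meas V (sem V M \<Gamma> g) else dec_meas V (sem V N \<Gamma> g)))"
  using ifz_bind[OF assms] by (simp add: Let_def)

lemma Ifz_ok:
  assumes fa: "faithful V RealT" and \<Gamma>: "\<forall>A\<in>set \<Gamma>. faithful V A"
    and L: "sem_ok V L \<Gamma> RealT" and M: "sem_ok V M \<Gamma> RealT" and N: "sem_ok V N \<Gamma> RealT"
  shows "sem_ok V (Ifz L M N) \<Gamma> RealT"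
proof (rule bind_ok[OF fa \<Gamma> L])
  interpret retraction meas_cone "enc_meas V" "dec_meas V" using fa by (rule retraction_meas)
  let ?\<nu> = "\<lambda>g (r::real). if r = 0 then dec_meas V (sem V M \<Gamma> g) else dec_meas V (sem V N \<Gamma> g)"
  note ball = sem_ok_dec_ball[OF fa _ \<Gamma>]
  show "sem V (Ifz L M N) \<Gamma> g = enc_meas V (dec_meas V (sem V L \<Gamma> g) \<bind> ?\<nu> g)"
    if "env_ball V \<Gamma> g" for g
    using sem_Ifz[OF ball[OF L that] ball[OF M that] ball[OF N that]] by simp
  show "?\<nu> g \<in> measurable borel (subprob_algebra borel)"
    if "env_ball V \<Gamma> g" for g
    using ball[OF M that] ball[OF N that] unfolding unit_ball_meas by (intro measurable_If measurable_const) auto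
  show "cone_cube meas_cone meas_fns K (\<lambda>I. ?\<nu> (\<phi> I) r)" if \<phi>: "env_cube V \<Gamma> K \<phi>" for K \<phi> and r :: real
    using sem_ok_dec_cube[OF fa M \<phi>] sem_ok_dec_cube[OF fa N \<phi>] by (cases "r = 0") simp_all
  show "cone_chain meas_cone meas_fns (\<lambda>n. ?\<nu> (X n) r) (?\<nu> l r)" if X: "env_chain V \<Gamma> X l" for X l and r :: real
    using sem_ok_dec_chain[OF fa M X] sem_ok_dec_chain[OF fa N X] by (cases "r = 0") simp_all
  show "(\<lambda>(s, r). ?\<nu> (\<gamma> s) r) \<in> measurable (Rn n \<Otimes>\<^sub>M borel) (subprob_algebra borel)"
    if \<gamma>: "env_path V \<Gamma> n \<gamma>" for \<gamma> n
    unfolding case_prod_beta using sem_ok_dec_path[OF fa M \<gamma>] sem_ok_dec_path[OF fa N \<gamma>]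
    by (intro measurable_If measurable_compose[OF measurable_fst]) auto
qed

text \<open>The value bound by \<open>let\<close> becomes coordinate 0 of an enlarged parameter
  space and enters as a path of Dirac measures. Preservation of paths then gives measurability
  jointly in the parameters and the bound value, as the integral in the semantics of
  \<open>let\<close> requires.\<close>

lemma LetIn_path:
  assumes fa: "faithful V RealT" and N: "sem_ok V N (RealT # \<Gamma>) RealT"
    and \<gamma>: "env_path V \<Gamma> n \<gamma>"
  shows "(\<lambda>(s, r). dec_meas V (sem V N (RealT # \<Gamma>) (enc_meas V (return borel (r)) # \<gamma> s)))
    \<in> measurable (Rn n \<Otimes>\<^sub>M borel) (subprob_algebra borel)"
proof -
  interpret retraction meas_cone "enc_meas V" "dec_meas V" using fa by (rule retraction_meas)
  have "(\<lambda>s. return borel (s 0)) \<in> measurable (Rn (1 + n)) (subprob_algebra borel)"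
    by (intro measurable_compose[OF measurable_component_singleton return_measurable]) auto
  then have "(\<lambda>s. enc_meas V (return borel (s 0))) \<in> unit_paths (ty_cone V RealT) (1 + n)"
    by (auto intro!: enc_path simp flip: unit_paths_meas)
  then have "(\<lambda>s. dec_meas V (sem V N (RealT # \<Gamma>) (enc_meas V (return borel (s 0)) # \<gamma> (snd_Rn 1 n s)))) \<in> measurable (Rn (1 + n)) (subprob_algebra borel)"
    by (intro sem_ok_dec_path[OF fa N] env_path_Cons
        env_path_reindex[OF \<gamma> measurable_snd_Rn])
  moreover have "(\<lambda>x. glue 1 n (\<lambda>i\<in>{..<1}. snd x) (fst x)) \<in> measurable (Rn n \<Otimes>\<^sub>M borel) (Rn (1 + n))"
  proof -
    have "(\<lambda>x. (\<lambda>i\<in>{..<1::nat}. snd x, fst x)) \<in> measurable (Rn n \<Otimes>\<^sub>M borel) (Rn 1 \<Otimes>\<^sub>M Rn n)"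
      by (intro measurable_Pair measurable_restrict) auto
    from measurable_compose[OF this measurable_glue] show ?thesis by simp
  qed
  ultimately have "(\<lambda>x. (\<lambda>s. dec_meas V (sem V N (RealT # \<Gamma>) (enc_meas V (return borel (s 0)) # \<gamma> (snd_Rn 1 n s)))) (glue 1 n (\<lambda>i\<in>{..<1}. snd x) (fst x)))
     \<in> measurable (Rn n \<Otimes>\<^sub>M borel) (subprob_algebra borel)"
    using measurable_compose by blast
  also have "?this \<longleftrightarrow> ?thesis"
  proof (rule measurable_cong)
    fix x :: "(nat \<Rightarrow> real) \<times> real" assume "x \<in> space (Rn n \<Otimes>\<^sub>M borel)"
    then have "snd_Rn 1 n (glue 1 n (\<lambda>i\<in>{..<1}. snd x) (fst x)) = fst x"
      by (intro snd_Rn_glue) (auto simp: space_pair_measure)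
    then show "(\<lambda>s. dec_meas V (sem V N (RealT # \<Gamma>) (enc_meas V (return borel (s 0)) # \<gamma> (snd_Rn 1 n s)))) (glue 1 n (\<lambda>i\<in>{..<1}. snd x) (fst x)) =
      (case x of (s, r) \<Rightarrow> dec_meas V (sem V N (RealT # \<Gamma>) (enc_meas V (return borel (r)) # \<gamma> s)))"
      by (simp add: case_prod_beta) (simp add: glue_def)
  qed
  finally show ?thesis .
qed

lemma LetIn_kernel:
  assumes fa: "faithful V RealT" and \<Gamma>: "\<forall>A\<in>set \<Gamma>. faithful V A" and N: "sem_ok V N (RealT # \<Gamma>) RealT"
    and g: "env_ball V \<Gamma> g"
  shows "(\<lambda>r. dec_meas V (sem V N (RealT # \<Gamma>) (enc_meas V (return borel (r)) # g)))
    \<in> measurable borel (subprob_algebra borel)"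
proof -
  \<comment> \<open>A fixed environment is a path over the one-point space
    \<open>Rn 0\<close>.\<close>
  have "(\<lambda>(s, r). dec_meas V (sem V N (RealT # \<Gamma>) (enc_meas V (return borel (r)) # g))) \<in> measurable (Rn 0 \<Otimes>\<^sub>M borel) (subprob_algebra borel)"
    using LetIn_path[OF fa N, of 0 "\<lambda>_. g"] env_path_const[OF \<Gamma> g] by simp
  from measurable_compose[OF measurable_Pair1'[of "\<lambda>_. undefined"] this]
  show ?thesis by (simp add: space_PiM)
qed

lemma sem_LetIn:
  assumes "dec_meas V (sem V M \<Gamma> g) \<in> unit_ball meas_cone"
    "(\<lambda>r. dec_meas V (sem V N (RealT # \<Gamma>) (enc_meas V (return borel r) # g))) \<in> measurable borel (subprob_algebra borel)"
  shows "sem V (LetIn M N) \<Gamma> g = enc_meas V (dec_meas V (sem V M \<Gamma> g) \<bind>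
    (\<lambda>r. dec_meas V (sem V N (RealT # \<Gamma>) (enc_meas V (return borel r) # g))))"
  using measure_of_bind[OF assms] by simp

lemma LetIn_ok:
  assumes fa: "faithful V RealT" and \<Gamma>: "\<forall>A\<in>set \<Gamma>. faithful V A"
    and M: "sem_ok V M \<Gamma> RealT" and N: "sem_ok V N (RealT # \<Gamma>) RealT"
  shows "sem_ok V (LetIn M N) \<Gamma> RealT"
proof (rule bind_ok[OF fa \<Gamma> M])
  interpret retraction meas_cone "enc_meas V" "dec_meas V" using fa by (rule retraction_meas)
  let ?\<nu> = "\<lambda>g r. dec_meas V (sem V N (RealT # \<Gamma>) (enc_meas V (return borel r) # g))"
  show kernel: "?\<nu> g \<in> measurable borel (subprob_algebra borel)"
    if g: "env_ball V \<Gamma> g" for g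
    by (rule LetIn_kernel[OF fa \<Gamma> N g])
  show "sem V (LetIn M N) \<Gamma> g = enc_meas V (dec_meas V (sem V M \<Gamma> g) \<bind> ?\<nu> g)"
    if g: "env_ball V \<Gamma> g" for g
  proof -
    have "dec_meas V (sem V M \<Gamma> g) \<in> unit_ball meas_cone"
      by (rule sem_ok_dec_ball[OF fa M \<Gamma> g])
    from sem_LetIn[OF this kernel[OF g]] show ?thesis by simp
  qed
  have ret: "enc_meas V (return borel r) \<in> unit_ball (ty_cone V RealT)" for r
    using enc_ball[OF return_ball] by simp
  show "cone_cube meas_cone meas_fns K (\<lambda>I. ?\<nu> (\<phi> I) r)" if \<phi>: "env_cube V \<Gamma> K \<phi>" for K \<phi> r
    using \<phi> by (intro sem_ok_dec_cube[OF fa N] env_cube_Cons rcone.cube_const[OF rcone_ty[OF fa]] ret) (simp_all add: env_cube_def)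
  show "cone_chain meas_cone meas_fns (\<lambda>n. ?\<nu> (X n) r) (?\<nu> l r)" if X: "env_chain V \<Gamma> X l" for X l r
    by (intro sem_ok_dec_chain[OF fa N] env_chain_Cons X rcone.chain_const[OF rcone_ty[OF fa]] ret)
  show "(\<lambda>(s, r). ?\<nu> (\<gamma> s) r) \<in> measurable (Rn n \<Otimes>\<^sub>M borel) (subprob_algebra borel)"
    if "env_path V \<Gamma> n \<gamma>" for n \<gamma>
    using that by (rule LetIn_path[OF fa N])
qed

lemma sem_Prim:
  assumes "prim_measurable (length Ms) f"
    and "\<And>M. M \<in> set Ms \<Longrightarrow> dec_meas V (sem V M \<Gamma> g) \<in> unit_ball meas_cone"
  shows "sem V (Prim f Ms) \<Gamma> g = enc_meas V (prim_law (map (\<lambda>M. dec_meas V (sem V M \<Gamma> g)) Ms) f 0 (\<lambda>_. undefined))"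
  using distr_PiM_prim_law[of "map (\<lambda>M. dec_meas V (sem V M \<Gamma> g)) Ms" f] assms
  by (simp add: Let_def image_subset_iff comp_def)

text \<open>The number of arguments is arbitrary, so the preservation properties of
  \<open>prim_law\<close> take the place of \<open>bind_ok\<close>.\<close>

lemma Prim_ok:
  assumes fa: "faithful V RealT" and \<Gamma>: "\<forall>A\<in>set \<Gamma>. faithful V A" and f: "prim_measurable (length Ms) f"
    and Ms: "\<And>M. M \<in> set Ms \<Longrightarrow> sem_ok V M \<Gamma> RealT"
  shows "sem_ok V (Prim f Ms) \<Gamma> RealT"
proof -
  interpret retraction meas_cone "enc_meas V" "dec_meas V" using fa by (rule retraction_meas)
  let ?u = "\<lambda>_::nat. undefined :: real"
  have u: "?u \<in> space (Rn 0)" by (simp add: space_PiM)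
  have sem: "sem V (Prim f Ms) \<Gamma> g =
      enc_meas V (prim_law (map (\<lambda>M. dec_meas V (sem V M \<Gamma> g)) Ms) f 0 ?u)"
    if g: "env_ball V \<Gamma> g" for g
  proof -
    have "dec_meas V (sem V M \<Gamma> g) \<in> unit_ball meas_cone" if "M \<in> set Ms" for M
      by (rule sem_ok_dec_ball[OF fa Ms[OF that] \<Gamma> g])
    then show ?thesis by (rule sem_Prim[OF f])
  qed
  have "cone_cube (ty_cone V RealT) (ty_fns V RealT) N (\<lambda>I. sem V (Prim f Ms) \<Gamma> (\<phi> I))"
    if \<phi>: "env_cube V \<Gamma> N \<phi>" for N \<phi>
  proof -
    note sem_ok_dec_cube[OF fa Ms \<phi>]
    then have "cone_cube meas_cone meas_fns N (\<lambda>I. prim_law (map (\<lambda>\<kappa>. \<kappa> I) (map (\<lambda>M I. dec_meas V (sem V M \<Gamma> (\<phi> I))) Ms)) f 0 ?u)"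
      using f u \<phi> by (intro prim_law_cube) (auto simp: env_cube_def)
    from enc_cube[OF this]
    have "cone_cube (ty_cone V RealT) (ty_fns V RealT) N
      (\<lambda>I. enc_meas V (prim_law (map (\<lambda>M. dec_meas V (sem V M \<Gamma> (\<phi> I))) Ms) f 0 ?u))" by (simp add: comp_def)
    also have "?this \<longleftrightarrow> ?thesis"
      by (rule cone_cube_cong) (simp only: sem[OF env_cube_at[OF \<phi>]])
    finally show ?thesis .
  qed
  moreover have "cone_chain (ty_cone V RealT) (ty_fns V RealT) (\<lambda>n. sem V (Prim f Ms) \<Gamma> (X n)) (sem V (Prim f Ms) \<Gamma> l)"
    if X: "env_chain V \<Gamma> X l" for X l
  proof -
    note sem_ok_dec_chain[OF fa Ms X]
    then have "cone_chain meas_cone meas_fns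
      (\<lambda>n. prim_law (map (\<lambda>\<kappa>. fst \<kappa> n) (map (\<lambda>M. (\<lambda>n. dec_meas V (sem V M \<Gamma> (X n)), dec_meas V (sem V M \<Gamma> l))) Ms)) f 0 ?u)
      (prim_law (map snd (map (\<lambda>M. (\<lambda>n. dec_meas V (sem V M \<Gamma> (X n)), dec_meas V (sem V M \<Gamma> l))) Ms)) f 0 ?u)"
      using f u by (intro prim_law_chain) auto
    from enc_chain[OF this]
    have "cone_chain (ty_cone V RealT) (ty_fns V RealT)
      (\<lambda>n. enc_meas V (prim_law (map (\<lambda>M. dec_meas V (sem V M \<Gamma> (X n))) Ms) f 0 ?u))
      (enc_meas V (prim_law (map (\<lambda>M. dec_meas V (sem V M \<Gamma> l)) Ms) f 0 ?u))"
      by (simp add: comp_def)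
    moreover have "sem V (Prim f Ms) \<Gamma> (X n) =
      enc_meas V (prim_law (map (\<lambda>M. dec_meas V (sem V M \<Gamma> (X n))) Ms) f 0 ?u)" for n
      by (rule sem) (rule env_chain_at(1)[OF X])
    moreover have "sem V (Prim f Ms) \<Gamma> l =
      enc_meas V (prim_law (map (\<lambda>M. dec_meas V (sem V M \<Gamma> l)) Ms) f 0 ?u)"
      by (rule sem) (rule env_chain_at(2)[OF X])
    ultimately show ?thesis by (simp only:)
  qed
  moreover have "(\<lambda>s. sem V (Prim f Ms) \<Gamma> (\<gamma> s)) \<in> unit_paths (ty_cone V RealT) n"
    if \<gamma>: "env_path V \<Gamma> n \<gamma>" for n \<gamma>
  proof -
    note sem_ok_dec_path[OF fa Ms \<gamma>]
    then have "(\<lambda>(w, r). prim_law (map (\<lambda>\<kappa>. \<kappa> w) (map (\<lambda>M s. dec_meas V (sem V M \<Gamma> (\<gamma> s))) Ms)) f 0 r)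
       \<in> measurable (Rn n \<Otimes>\<^sub>M Rn 0) (subprob_algebra borel)"
      using f by (intro prim_law_kernel) auto
    from measurable_compose[OF measurable_Pair2'[OF u] this]
    have "(\<lambda>s. prim_law (map (\<lambda>M. dec_meas V (sem V M \<Gamma> (\<gamma> s))) Ms) f 0 ?u) \<in> unit_paths meas_cone n"
      by (simp add: comp_def unit_paths_meas)
    from enc_path[OF this]
    have "(\<lambda>s. enc_meas V (prim_law (map (\<lambda>M. dec_meas V (sem V M \<Gamma> (\<gamma> s))) Ms) f 0 ?u)) \<in> unit_paths (ty_cone V RealT) n"
      by simp
    also have "?this \<longleftrightarrow> ?thesis"
      by (rule unit_paths_cong) (simp only: sem[OF env_path_at[OF \<gamma>]])
    finally show ?thesis .
  qed
  ultimately show ?thesis by (simp only: sem_ok_def cube_ok_def chain_ok_def path_ok_def) blast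
qed

lemma uniform_ball: "density lborel (indicator {0..1::real}) \<in> unit_ball meas_cone"
proof -
  have "emeasure (density lborel (indicator {0..1::real})) UNIV = 1"
    by (simp add: emeasure_density)
  then show ?thesis
    by (simp add: unit_ball_def meas_cone_def finite_borel_measuresI measure_def)
qed

lemma signature_prim: "measurable_signature F \<Longrightarrow> (n, f) \<in> F \<Longrightarrow> prim_measurable n f"
  by (auto simp: measurable_signature_def prim_measurable_def)

text \<open>Well-definedness of the semantics. Decoding inverts the coding on the carriers, so the
  clauses of \<open>sem\<close> have their intended meaning once the denotations of the subterms are
  known to be morphisms.\<close>

lemma typing_sem_ok:
  assumes F: "measurable_signature F" and "typing F \<Gamma> M A"
    and "\<forall>B\<in>types_in M \<Gamma>. faithful V B" "\<forall>B\<in>set \<Gamma>. faithful V B"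
  shows "sem_ok V M \<Gamma> A"
  using assms(2-)
proof (induction rule: typing.induct)
  case (Var i \<Gamma>)
  then show ?case
    by (auto simp: sem_ok_def cube_ok_def chain_ok_def path_ok_def env_cube_def env_chain_def env_path_def)
next
  case (Lam A \<Gamma> M B)
  have "type_of M (A # \<Gamma>) = B" using Lam.hyps by (rule type_of_typing)
  then have "faithful V (A \<rightarrow> B)" using Lam.prems by simp
  then show ?case using Lam by (intro Lam_ok) auto
next
  case (App \<Gamma> M A B N)
  have "(A \<rightarrow> B) \<in> types_in (App M N) \<Gamma>" using type_of_types_in[of M \<Gamma>] type_of_typing[OF App.hyps(1)] by auto
  with App.prems(1) have "faithful V (A \<rightarrow> B)" by (rule bspec)
  then show ?case by (rule App_ok) (use App in auto)
next
  case (Fix \<Gamma> M A)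
  have "(A \<rightarrow> A) \<in> types_in (Fix M) \<Gamma>" using type_of_types_in[of M \<Gamma>] type_of_typing[OF Fix.hyps(1)] by auto
  with Fix.prems(1) have "faithful V (A \<rightarrow> A)" by (rule bspec)
  then show ?case by (rule Fix_ok) (use Fix type_of_typing[OF Fix.hyps(1)] in auto)
next
  case (Numeral \<Gamma> r)
  then show ?case
    by (intro const_ok[where \<mu>="return borel r"]) (auto simp: return_ball)
next
  case (Prim Ms f \<Gamma>)
  then show ?case by (intro Prim_ok signature_prim[OF F]) auto
next
  case (Ifz \<Gamma> L M N)
  then show ?case by (intro Ifz_ok) auto
next
  case (Sample \<Gamma>)
  then show ?case
    by (intro const_ok[where \<mu>="density lborel (indicator {0..1})"]) (auto simp: uniform_ball)
next
  case (LetIn \<Gamma> M N)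
  then show ?case by (intro LetIn_ok) auto
qed

section \<open>Reduction on measurable families of terms\<close>

definition is_num :: "'r tm \<Rightarrow> bool" where "is_num M \<longleftrightarrow> (\<exists>q. M = Numeral q)"
definition is_lam :: "'r tm \<Rightarrow> bool" where "is_lam M \<longleftrightarrow> (\<exists>A B. M = Lam A B)"
definition num_val :: "'r tm \<Rightarrow> 'r" where "num_val M = (THE q. M = Numeral q)"
definition lam_body :: "'r tm \<Rightarrow> 'r tm" where "lam_body M = (THE B. \<exists>A. M = Lam A B)"

lemma is_num_simps[simp]:
  "is_num (Numeral q)" "\<not> is_num (Var i)" "\<not> is_num (Lam A M)" "\<not> is_num (App M N)" "\<not> is_num (Fix M)"
  "\<not> is_num (Prim f Ms)" "\<not> is_num (Ifz L M N)" "\<not> is_num Sample" "\<not> is_num (LetIn M N)"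
  by (auto simp: is_num_def)

lemma is_lam_simps[simp]:
  "\<not> is_lam (Numeral q)" "\<not> is_lam (Var i)" "is_lam (Lam A M)" "\<not> is_lam (App M N)" "\<not> is_lam (Fix M)"
  "\<not> is_lam (Prim f Ms)" "\<not> is_lam (Ifz L M N)" "\<not> is_lam Sample" "\<not> is_lam (LetIn M N)"
  by (auto simp: is_lam_def)

lemma num_val[simp]: "num_val (Numeral q) = q" by (simp add: num_val_def)
lemma lam_body[simp]: "lam_body (Lam A M) = M" by (simp add: lam_body_def)

lemma is_num_map_tm[simp]: "is_num (map_tm \<rho> M) \<longleftrightarrow> is_num M" by (cases M) auto
lemma is_lam_map_tm[simp]: "is_lam (map_tm \<rho> M) \<longleftrightarrow> is_lam M" by (cases M) auto

text \<open>\<open>step\<close> recurses into all arguments at once, so their reducts are computed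
  in parallel; only the first argument that is not a numeral is then replaced by its reduct.\<close>

primrec advance :: "'r tm list \<Rightarrow> 'r tm list \<Rightarrow> 'r tm list" where
  "advance [] Ns = []"
| "advance (M # Ms) Ns = (if is_num M then M # advance Ms (tl Ns) else hd Ns # Ms)"

text \<open>\<open>step M r\<close> is the one-step reduct of \<open>M\<close> if a \<^const>\<open>Sample\<close> in evaluation position returns \<open>r\<close>,
  and \<open>M\<close> itself if \<open>M\<close> is normal.\<close>

primrec step :: "real tm \<Rightarrow> real \<Rightarrow> real tm" where
  "step (Var i) = (\<lambda>r. Var i)"
| "step (Lam A M) = (\<lambda>r. Lam A M)"
| "step (App M N) = (\<lambda>r. if is_lam M then subst (lam_body M) 0 N else App (step M r) N)"
| "step (Fix M) = (\<lambda>r. App M (Fix M))"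
| "step (Numeral q) = (\<lambda>r. Numeral q)"
| "step (Prim f Ms) = (\<lambda>r. if \<forall>M\<in>set Ms. is_num M then Numeral (f (map num_val Ms))
     else Prim f (advance Ms (map (\<lambda>s. s r) (map step Ms))))"
| "step (Ifz L M N) = (\<lambda>r. if is_num L then (if num_val L = 0 then M else N) else Ifz (step L r) M N)"
| "step Sample = (\<lambda>r. Numeral r)"
| "step (LetIn M N) = (\<lambda>r. if is_num M then subst N 0 M else LetIn (step M r) N)"

lemma advance_first: "\<not> is_num M \<Longrightarrow> advance (map Numeral rs @ M # Ms) (Ns @ M' # Ns') = map Numeral rs @ M' # Ms"
  if "length Ns = length rs"
  using that by (induction rs arbitrary: Ns) (auto simp: Suc_length_conv length_Suc_conv)

lemma step_Prim_first:
  "\<not> is_num M \<Longrightarrow> step (Prim f (map Numeral rs @ M # Ms)) r = Prim f (map Numeral rs @ step M r # Ms)"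
  using advance_first[of "map (\<lambda>s. s r) (map step (map Numeral rs))" rs M Ms "step M r" "map (\<lambda>M. step M r) Ms"]
  by (auto simp: comp_def)

lemma map_num_val: "\<forall>M\<in>set Ms. is_num M \<Longrightarrow> Ms = map Numeral (map num_val Ms)"
  by (induction Ms) (auto simp: is_num_def)

lemma first_non_num:
  assumes "\<not> (\<forall>M\<in>set Ms. is_num M)"
  obtains rs M Ns where "Ms = map Numeral rs @ M # Ns" "\<not> is_num M"
proof -
  obtain ys M zs where *: "Ms = ys @ M # zs" "\<not> is_num M" "\<forall>y\<in>set ys. \<not> \<not> is_num y"
    using split_list_first_prop[of Ms "\<lambda>M. \<not> is_num M"] assms by blast
  then have "ys = map Numeral (map num_val ys)" by (intro map_num_val) auto
  then show ?thesis using that[of "map num_val ys" M zs] * by simp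
qed

section \<open>Evaluation contexts and the one-step kernel\<close>

lemma redex_not_value: "redex R N \<Longrightarrow> \<not> is_num R \<and> \<not> is_lam R"
  by (cases rule: redex.cases) auto

lemma fill_not_num: "\<not> is_num R \<Longrightarrow> \<not> is_num (fill E R)"
  by (cases E) auto

lemma fill_not_lam: "\<not> is_lam R \<Longrightarrow> \<not> is_lam (fill E R)"
  by (cases E) auto

text \<open>A frame fires by itself only when its hole holds a numeral or an abstraction; for any
  other \<open>R\<close> the step passes through to the hole.\<close>

lemma step_fill:
  assumes "\<not> is_num R" "\<not> is_lam R"
  shows "step (fill E R) r = fill E (step R r)"
proof (induction E)
  case (PrimC f rs E Ms)
  then show ?case
    using step_Prim_first[OF fill_not_num[OF assms(1), of E], of f rs Ms r] by (simp del: step.simps)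
qed (auto simp: fill_not_num[OF assms(1)] fill_not_lam[OF assms(2)])

lemma step_redex: "redex R N \<Longrightarrow> step R r = N"
  by (cases rule: redex.cases) (auto simp: comp_def)

lemma step_fill_redex: "redex R N \<Longrightarrow> step (fill E R) r = fill E N"
  using step_fill[of R E r] redex_not_value[of R N] step_redex[of R N r] by simp

lemma step_fill_Sample: "step (fill E Sample) r = fill E (Numeral r)"
  using step_fill[of Sample E r] by simp

lemma map_Numeral_append_eq:
  assumes "map Numeral rs @ M # Ms = map Numeral rs' @ M' # Ms'" "\<not> is_num M" "\<not> is_num M'"
  shows "rs = rs' \<and> M = M' \<and> Ms = Ms'"
  using assms
proof (induction rs arbitrary: rs')
  case Nil
  then show ?case by (cases rs') auto
next
  case (Cons r rs)
  then show ?case by (cases rs') auto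
qed

text \<open>Makes the definite description of the context in \<open>red\<close> meaningful when
  \<open>Sample\<close> is in evaluation position.\<close>

lemma fill_Sample_inject: "fill E Sample = fill E' Sample \<Longrightarrow> E = E'"
proof (induction E arbitrary: E')
  case Hole
  then show ?case by (cases E') auto
next
  case (PrimC f rs E Ms)
  then obtain rs' E'' Ms' where E': "E' = PrimC f rs' E'' Ms'"
    by (cases E') auto
  with PrimC.prems have "map Numeral rs @ fill E Sample # Ms = map Numeral rs' @ fill E'' Sample # Ms'" by simp
  from map_Numeral_append_eq[OF this] show ?case
    using PrimC.IH[of E''] by (simp add: E' fill_not_num)
next
  case (AppC E M)
  then show ?case by (cases E') auto
next
  case (IfzC E M N)
  then show ?case by (cases E') auto
next
  case (LetC E N)
  then show ?case by (cases E') auto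
qed

text \<open>Existence of a decomposition into context and redex; that the reduct does not depend on
  the decomposition follows from \<open>step\<close> being a function. In the remaining case
  \<open>M\<close> is a fixed point of \<open>step\<close>, which matches the last clause of
  \<open>red\<close>.\<close>

definition trichotomous :: "real tm \<Rightarrow> bool" where
  "trichotomous M \<longleftrightarrow>
    (\<exists>E. M = fill E Sample) \<or> (\<exists>E R N. M = fill E R \<and> redex R N) \<or> (\<forall>r. step M r = M)"

lemma trichotomous_redex: "redex M N \<Longrightarrow> trichotomous M"
  unfolding trichotomous_def by (metis fill.simps(1))

lemma trichotomous_frame:
  assumes "trichotomous M" "\<And>E R. fill (K E) R = C (fill E R)" "\<And>r. step (C M) r = C (step M r)"
  shows "trichotomous (C M)"
  using assms(1) unfolding trichotomous_def by (metis assms(2,3))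

lemma step_trichotomy: "trichotomous M"
proof (induction M)
  case (App M N)
  show ?case
  proof (cases "is_lam M")
    case True
    then show ?thesis by (auto simp: is_lam_def intro: trichotomous_redex redex.intros)
  next
    case False
    then show ?thesis
      by (intro trichotomous_frame[OF App(1), where C="\<lambda>M. App M N" and K="\<lambda>E. AppC E N"]) auto
  qed
next
  case (Fix M)
  show ?case by (rule trichotomous_redex) (rule redex.intros)
next
  case (Prim f Ms)
  show ?case
  proof (cases "\<forall>M\<in>set Ms. is_num M")
    case True
    then show ?thesis
      by (subst map_num_val[OF True]) (rule trichotomous_redex, rule redex.intros)
  next
    case False
    then obtain rs M Ns where Ms: "Ms = map Numeral rs @ M # Ns" "\<not> is_num M" by (rule first_non_num)
    then have "trichotomous M" using Prim by simp
    then show ?thesis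
      using step_Prim_first[OF Ms(2)] unfolding Ms(1)
      by (intro trichotomous_frame[where C="\<lambda>M. Prim f (map Numeral rs @ M # Ns)" and K="\<lambda>E. PrimC f rs E Ns"])
        (auto simp del: step.simps)
  qed
next
  case (Ifz L M N)
  show ?case
  proof (cases "is_num L")
    case True
    then obtain q where "L = Numeral q" by (auto simp: is_num_def)
    then show ?thesis using trichotomous_redex[OF redex.intros(3)] by simp
  next
    case False
    then show ?thesis
      by (intro trichotomous_frame[OF Ifz(1), where C="\<lambda>L. Ifz L M N" and K="\<lambda>E. IfzC E M N"]) auto
  qed
next
  case Sample
  show ?case unfolding trichotomous_def by (metis fill.simps(1))
next
  case (LetIn M N)
  show ?case
  proof (cases "is_num M")
    case True
    then show ?thesis by (auto simp: is_num_def intro: trichotomous_redex redex.intros)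
  next
    case False
    then show ?thesis
      by (intro trichotomous_frame[OF LetIn(1), where C="\<lambda>M. LetIn M N" and K="\<lambda>E. LetC E N"]) auto
  qed
qed (auto simp: trichotomous_def)

text \<open>The kernel is the image of the uniform law under the deterministic \<open>step\<close>:
  a redex other than \<open>Sample\<close> ignores the draw, and \<open>[0, 1]\<close> has length
  1.\<close>

lemma red_step: "red M U = emeasure lborel {r \<in> {0..1}. step M r \<in> U}"
proof -
  have const: "emeasure lborel {r \<in> {0..1::real}. N \<in> U} = indicator U N" for N
  proof -
    have "{r \<in> {0..1::real}. N \<in> U} = (if N \<in> U then {0..1} else {})" by auto
    then show ?thesis by (auto split: split_indicator)
  qed
  show ?thesis
  proof (cases "\<exists>E. M = fill E Sample")
    case True
    then obtain E where E: "M = fill E Sample" by blast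
    have "(THE E. M = fill E Sample) = E"
      using E fill_Sample_inject by blast
    then show ?thesis using E by (auto simp: red_def step_fill_Sample)
  next
    case False
    show ?thesis
    proof (cases "\<exists>E R N. M = fill E R \<and> redex R N")
      case True
      then obtain E R N where *: "M = fill E R" "redex R N" by blast
      \<comment> \<open>Every decomposition computes \<open>step M 0\<close>, so the description is
        well defined; the draw 0 is arbitrary.\<close>
      have "(THE M'. \<exists>E R N. M = fill E R \<and> redex R N \<and> M' = fill E N) = fill E N"
      proof (rule the_equality)
        fix M' assume "\<exists>E R N. M = fill E R \<and> redex R N \<and> M' = fill E N"
        then obtain E' R' N' where "M = fill E' R'" "redex R' N'" "M' = fill E' N'" by blast
        then have "M' = step M 0" by (simp add: step_fill_redex)
        also have "\<dots> = fill E N" using * by (simp add: step_fill_redex)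
        finally show "M' = fill E N" .
      qed (use * in blast)
      then have "red M U = indicator U (fill E N)" using False True by (simp add: red_def)
      moreover have "step M r = fill E N" for r using * by (simp add: step_fill_redex)
      ultimately show ?thesis by (simp only: const)
    next
      case 3: False
      have "red M U = indicator U M" unfolding red_def if_not_P[OF False] if_not_P[OF 3] ..
      moreover have "step M r = M" for r using False 3 step_trichotomy[of M] by (auto simp: trichotomous_def)
      ultimately show ?thesis by (simp only: const)
    qed
  qed
qed

section \<open>Substitution, typing and relabelling of numerals\<close>

lemma map_tm_lift: "map_tm g (lift M k) = lift (map_tm g M) k"
  by (induction M arbitrary: k) auto

lemma map_tm_subst: "map_tm g (subst M k P) = subst (map_tm g M) k (map_tm g P)"
  by (induction M arbitrary: k P) (auto simp: map_tm_lift)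

lemma set_tm_lift: "set_tm (lift M k) = set_tm M"
  by (induction M arbitrary: k) auto

lemma set_tm_subst: "set_tm (subst M k P) \<subseteq> set_tm M \<union> set_tm P"
proof (induction M arbitrary: k P)
  case (Lam A M)
  show ?case using Lam[of "Suc k" "lift P 0"] by (simp add: set_tm_lift)
next
  case (LetIn M N)
  show ?case using LetIn(1)[of k P] LetIn(2)[of "Suc k" "lift P 0"] by (auto simp: set_tm_lift)
next
  case (App M N)
  show ?case using App[of k P] by auto
next
  case (Ifz L M N)
  show ?case using Ifz[of k P] by auto
next
  case (Prim f Ms)
  show ?case using Prim[of _ k P] by fastforce
qed auto

inductive_cases typing_VarE: "typing F \<Gamma> (Var i) A"
inductive_cases typing_LamE: "typing F \<Gamma> (Lam A M) B"
inductive_cases typing_AppE: "typing F \<Gamma> (App M N) B"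
inductive_cases typing_FixE: "typing F \<Gamma> (Fix M) A"
inductive_cases typing_NumeralE: "typing F \<Gamma> (Numeral r) A"
inductive_cases typing_PrimE: "typing F \<Gamma> (Prim f Ms) A"
inductive_cases typing_IfzE: "typing F \<Gamma> (Ifz L M N) A"
inductive_cases typing_SampleE: "typing F \<Gamma> Sample A"
inductive_cases typing_LetInE: "typing F \<Gamma> (LetIn M N) A"

lemma typing_lift:
  "typing F (\<Gamma>1 @ \<Gamma>2) M A \<Longrightarrow> typing F (\<Gamma>1 @ B # \<Gamma>2) (lift M (length \<Gamma>1)) A"
proof (induction "\<Gamma>1 @ \<Gamma>2" M A arbitrary: \<Gamma>1 rule: typing.induct)
  case (Var i)
  have 1: "typing F (\<Gamma>1 @ B # \<Gamma>2) (Var j) ((\<Gamma>1 @ B # \<Gamma>2) ! j)" if "j < length (\<Gamma>1 @ B # \<Gamma>2)" for j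
    using that by (rule typing.Var)
  show ?case
  proof (cases "i < length \<Gamma>1")
    case True
    then show ?thesis using 1[of i] by (simp add: nth_append)
  next
    case False
    then have "(\<Gamma>1 @ B # \<Gamma>2) ! Suc i = (\<Gamma>1 @ \<Gamma>2) ! i" by (simp add: nth_append Suc_diff_le)
    then show ?thesis using 1[of "Suc i"] Var False by simp
  qed
next
  case (Lam A M C)
  from Lam(2)[of "A # \<Gamma>1"] show ?case by (auto intro: typing.Lam)
next
  case (LetIn M N)
  from LetIn(4)[of "RealT # \<Gamma>1"] LetIn(2) show ?case by (auto intro: typing.LetIn)
next
  case (Prim Ms f)
  then show ?case by (auto intro!: typing.Prim)
qed (auto intro: typing.intros)

lemma typing_subst:
  "typing F (\<Gamma>1 @ B # \<Gamma>2) M A \<Longrightarrow> typing F (\<Gamma>1 @ \<Gamma>2) P B \<Longrightarrow>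
    typing F (\<Gamma>1 @ \<Gamma>2) (subst M (length \<Gamma>1) P) A"
proof (induction "\<Gamma>1 @ B # \<Gamma>2" M A arbitrary: \<Gamma>1 P rule: typing.induct)
  case (Var i)
  have var: "typing F (\<Gamma>1 @ \<Gamma>2) (Var j) ((\<Gamma>1 @ \<Gamma>2) ! j)" if "j < length (\<Gamma>1 @ \<Gamma>2)" for j
    using that by (rule typing.Var)
  consider "i < length \<Gamma>1" | "i = length \<Gamma>1" | "i > length \<Gamma>1" by linarith
  then show ?case
  proof cases
    case 1
    then show ?thesis using var[of i] by (simp add: nth_append)
  next
    case 2
    then show ?thesis using Var by simp
  next
    case 3
    then have "(\<Gamma>1 @ B # \<Gamma>2) ! i = (\<Gamma>1 @ \<Gamma>2) ! (i - 1)" by (auto simp: nth_append nth_Cons')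
    moreover have "i - 1 < length (\<Gamma>1 @ \<Gamma>2)" using Var(1) 3 by simp
    ultimately show ?thesis using var[of "i - 1"] 3 by simp
  qed
next
  case (Lam A M C)
  have "typing F ((A # \<Gamma>1) @ \<Gamma>2) (lift P 0) B"
    using typing_lift[of F "[]" "\<Gamma>1 @ \<Gamma>2" P B A] Lam.prems by simp
  from Lam(2)[of "A # \<Gamma>1", OF _ this] show ?case by (auto intro: typing.Lam)
next
  case (LetIn M N)
  have "typing F ((RealT # \<Gamma>1) @ \<Gamma>2) (lift P 0) B"
    using typing_lift[of F "[]" "\<Gamma>1 @ \<Gamma>2" P B RealT] LetIn.prems by simp
  from LetIn(4)[of "RealT # \<Gamma>1", OF _ this] LetIn(2)[OF LetIn.prems] show ?case by (auto intro: typing.LetIn)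
next
  case (Prim Ms f)
  then show ?case by (auto intro!: typing.Prim)
qed (auto intro: typing.intros)

lemma typing_map_tm: "typing F \<Gamma> M A \<Longrightarrow> typing F \<Gamma> (map_tm \<rho> M) A"
proof (induction rule: typing.induct)
  case (Prim Ms f \<Gamma>)
  then show ?case by (auto intro!: typing.Prim)
qed (auto intro: typing.intros)

lemma typing_map_tm_iff: "typing F \<Gamma> (map_tm \<rho> M) A \<longleftrightarrow> typing F \<Gamma> M A"
proof
  show "typing F \<Gamma> (map_tm \<rho> M) A \<Longrightarrow> typing F \<Gamma> M A"
  proof (induction M arbitrary: \<Gamma> A)
    case (Prim f Ms)
    from Prim.prems have "(length Ms, f) \<in> F" "A = RealT" "\<And>M. M \<in> set Ms \<Longrightarrow> typing F \<Gamma> (map_tm \<rho> M) RealT"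
      by (auto elim!: typing_PrimE)
    then show ?case using Prim.IH by (auto intro!: typing.Prim)
  next
    case (App M N)
    then obtain B where "typing F \<Gamma> (map_tm \<rho> M) (B \<rightarrow> A)" "typing F \<Gamma> (map_tm \<rho> N) B"
      by (auto elim: typing_AppE)
    then show ?case using App.IH by (intro typing.App)
  qed (auto elim!: typing_VarE typing_LamE typing_AppE typing_FixE typing_NumeralE typing_IfzE typing_SampleE typing_LetInE
      intro: typing.intros)
qed (rule typing_map_tm)

text \<open>A term whose numerals are functions of \<open>w\<close> is a family of terms with one
  skeleton. Since \<open>tm\<close> is polymorphic in the labels, substitution and typing apply to
  the family as such.\<close>

definition ev :: "('w \<Rightarrow> 'r) tm \<Rightarrow> 'w \<Rightarrow> 'r tm" where
  "ev T w = map_tm (\<lambda>h. h w) T"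

lemma ev_simps[simp]:
  "ev (Var i) w = Var i" "ev (Lam A M') w = Lam A (ev M' w)" "ev (App M' N') w = App (ev M' w) (ev N' w)"
  "ev (Fix M') w = Fix (ev M' w)" "ev (Numeral h) w = Numeral (h w)"
  "ev (Prim f Ms) w = Prim f (map (\<lambda>M. ev M w) Ms)"
  "ev (Ifz L' M' N') w = Ifz (ev L' w) (ev M' w) (ev N' w)" "ev Sample w = Sample"
  "ev (LetIn M' N') w = LetIn (ev M' w) (ev N' w)"
  "ev (subst M' k P) w = subst (ev M' w) k (ev P w)"
  "is_num (ev M' w) = is_num M'" "is_lam (ev M' w) = is_lam M'"
  by (simp_all add: ev_def map_tm_subst)

text \<open>A family of terms with a fixed skeleton and measurable numerals reduces to at most two such
  families, split by the test of an \<open>ifz\<close>.\<close>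

definition family_steps ::
  "signature \<Rightarrow> 'w measure \<Rightarrow> ('w \<Rightarrow> real) \<Rightarrow> ty list \<Rightarrow> ('w \<Rightarrow> real) tm \<Rightarrow> ty \<Rightarrow> bool" where
  "family_steps F M \<rho> \<Gamma> T A \<longleftrightarrow> (\<exists>S\<in>sets M. \<exists>T1 T2. (\<forall>T'\<in>{T1, T2}. typing F \<Gamma> T' A \<and> set_tm T' \<subseteq> borel_measurable M) \<and>
    (\<forall>w\<in>space M. step (ev T w) (\<rho> w) = (if w \<in> S then ev T1 w else ev T2 w)))"

lemma family_steps_single:
  assumes "typing F \<Gamma> T1 A" "set_tm T1 \<subseteq> borel_measurable M"
    "\<And>w. w \<in> space M \<Longrightarrow> step (ev T w) (\<rho> w) = ev T1 w"
  shows "family_steps F M \<rho> \<Gamma> T A"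
  unfolding family_steps_def using assms by (intro bexI[of _ "{}"] exI[of _ T1]) auto

text \<open>\<open>D w\<close> is the frame \<open>C\<close> with its own numerals evaluated at
  \<open>w\<close>; a frame inherits the case distinction of the term in its hole.\<close>

lemma family_steps_frame:
  assumes "family_steps F M \<rho> \<Gamma> T A"
    and "\<And>T'. typing F \<Gamma> T' A \<Longrightarrow> typing F \<Gamma> (C T') B"
    and "\<And>T'. set_tm T' \<subseteq> borel_measurable M \<Longrightarrow> set_tm (C T') \<subseteq> borel_measurable M"
    and "\<And>T' w. ev (C T') w = D w (ev T' w)" "\<And>w. step (D w (ev T w)) (\<rho> w) = D w (step (ev T w) (\<rho> w))"
  shows "family_steps F M \<rho> \<Gamma> (C T) B"
proof -
  from assms(1) obtain S T1 T2 where "S \<in> sets M" "\<forall>T'\<in>{T1, T2}. typing F \<Gamma> T' A \<and> set_tm T' \<subseteq> borel_measurable M"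
    "\<forall>w\<in>space M. step (ev T w) (\<rho> w) = (if w \<in> S then ev T1 w else ev T2 w)"
    unfolding family_steps_def by blast
  then show ?thesis
    unfolding family_steps_def using assms(2-)
    by (intro bexI[of _ S] exI[of _ "C T1"] exI[of _ "C T2"]) auto
qed

lemma step_family:
  fixes T :: "('w \<Rightarrow> real) tm"
  assumes F: "measurable_signature F" and "typing F \<Gamma> T A"
    and "set_tm T \<subseteq> borel_measurable M" and \<rho>: "\<rho> \<in> borel_measurable M"
  shows "family_steps F M \<rho> \<Gamma> T A"
  using assms(2,3)
proof (induction rule: typing.induct)
  case (Var i \<Gamma>)
  then show ?case by (intro family_steps_single[of _ _ "Var i"]) (auto intro: typing.intros)
next
  case (Lam A \<Gamma> M' B)
  then show ?case by (intro family_steps_single[of _ _ "Lam A M'"]) (auto intro: typing.intros)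
next
  case (App \<Gamma> M' A B N)
  show ?case
  proof (cases "is_lam M'")
    case True
    then obtain A' L where M': "M' = Lam A' L" by (auto simp: is_lam_def)
    have L: "typing F (A # \<Gamma>) L B" using App(1) unfolding M' by (auto elim: typing_LamE)
    show ?thesis
    proof (rule family_steps_single[of _ _ "subst L 0 N"])
      show "typing F \<Gamma> (subst L 0 N) B"
        using typing_subst[of F "[]" A \<Gamma> L B N] L App(2) by simp
      show "set_tm (subst L 0 N) \<subseteq> borel_measurable M"
        using set_tm_subst[of L 0 N] App.prems by (auto simp: M')
    qed (simp add: M')
  next
    case False
    then show ?thesis
      using App by (intro family_steps_frame[of _ _ _ _ M' "A \<rightarrow> B" "\<lambda>M'. App M' N", where D="\<lambda>w M'. App M' (ev N w)"])
        (auto intro: typing.intros)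
  qed
next
  case (Fix \<Gamma> M' A)
  then show ?case by (intro family_steps_single[of _ _ "App M' (Fix M')"]) (auto intro: typing.intros)
next
  case (Numeral \<Gamma> h)
  then show ?case by (intro family_steps_single[of _ _ "Numeral h"]) (auto intro: typing.intros)
next
  case (Prim Ms f \<Gamma>)
  show ?case
  proof (cases "\<forall>M\<in>set Ms. is_num M")
    case True
    define hs where "hs = map num_val Ms"
    have Ms: "Ms = map Numeral hs" unfolding hs_def by (rule map_num_val[OF True])
    have hs: "h \<in> borel_measurable M" if "h \<in> set hs" for h using Prim.prems that by (auto simp: Ms)
    \<comment> \<open>\<open>f\<close> is measurable as a function of tuples in \<open>Rn\<close>,
      so the list of values is routed through such a tuple.\<close>
    have tup: "map (\<lambda>i\<in>{..<length hs}. (hs ! i) w) [0..<length hs] = map (\<lambda>h. h w) hs" for w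
      by (rule nth_equalityI) auto
    show ?thesis
    proof (rule family_steps_single[of _ _ "Numeral (\<lambda>w. f (map (\<lambda>h. h w) hs))"])
      have "(\<lambda>w. \<lambda>i\<in>{..<length hs}. (hs ! i) w) \<in> measurable M (Rn (length hs))"
        by (intro measurable_restrict hs) auto
      moreover have "(\<lambda>x. f (map x [0..<length hs])) \<in> borel_measurable (Rn (length hs))"
        using signature_prim[OF F Prim.hyps(1)] by (simp add: prim_measurable_def Ms)
      ultimately have "(\<lambda>w. f (map (\<lambda>i\<in>{..<length hs}. (hs ! i) w) [0..<length hs])) \<in> borel_measurable M"
        by (rule measurable_compose)
      then show "set_tm (Numeral (\<lambda>w. f (map (\<lambda>h. h w) hs))) \<subseteq> borel_measurable M" by (simp add: tup)
    qed (auto simp: Ms comp_def intro: typing.intros)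
  next
    case False
    then obtain hs M' Ns where Ms: "Ms = map Numeral hs @ M' # Ns" "\<not> is_num M'" by (rule first_non_num)
    show ?thesis
      unfolding Ms(1)
    proof (rule family_steps_frame[of _ _ _ _ M' RealT "\<lambda>M'. Prim f (map Numeral hs @ M' # Ns)",
          where D="\<lambda>w M'. Prim f (map Numeral (map (\<lambda>h. h w) hs) @ M' # map (\<lambda>M. ev M w) Ns)"])
      show "family_steps F M \<rho> \<Gamma> M' RealT" using Prim.IH[of M'] Prim.prems by (simp add: Ms)
      show "typing F \<Gamma> (Prim f (map Numeral hs @ T' # Ns)) RealT" if "typing F \<Gamma> T' RealT" for T'
        using Prim.hyps that by (intro typing.Prim) (auto simp: Ms intro: typing.intros)
      show "step (Prim f (map Numeral (map (\<lambda>h. h w) hs) @ ev M' w # map (\<lambda>M. ev M w) Ns)) (\<rho> w) =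
          Prim f (map Numeral (map (\<lambda>h. h w) hs) @ step (ev M' w) (\<rho> w) # map (\<lambda>M. ev M w) Ns)" for w
        by (rule step_Prim_first) (simp add: Ms(2))
    qed (use Prim.prems in \<open>auto simp: Ms comp_def\<close>)
  qed
next
  case (Ifz \<Gamma> L M' N)
  show ?case
  proof (cases "is_num L")
    case True
    then obtain h where L: "L = Numeral h" by (auto simp: is_num_def)
    have "h \<in> borel_measurable M" using Ifz.prems by (simp add: L)
    \<comment> \<open>The zero set of the test is where the reduct changes from one family to the
      other.\<close>
    then have S: "{w \<in> space M. h w = 0} \<in> sets M" by measurable
    show ?thesis
      unfolding family_steps_def
      using S Ifz by (intro bexI[of _ "{w \<in> space M. h w = 0}"] exI[of _ M'] exI[of _ N]) (auto simp: L)
  next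
    case False
    then show ?thesis
      using Ifz by (intro family_steps_frame[of _ _ _ _ L RealT "\<lambda>L. Ifz L M' N", where D="\<lambda>w L. Ifz L (ev M' w) (ev N w)"])
        (auto intro: typing.intros)
  qed
next
  case (Sample \<Gamma>)
  then show ?case using \<rho> by (intro family_steps_single[of _ _ "Numeral \<rho>"]) (auto intro: typing.intros)
next
  case (LetIn \<Gamma> M' N)
  show ?case
  proof (cases "is_num M'")
    case True
    show ?thesis
    proof (rule family_steps_single[of _ _ "subst N 0 M'"])
      show "typing F \<Gamma> (subst N 0 M') RealT"
        using typing_subst[of F "[]" RealT \<Gamma> N RealT M'] LetIn by simp
      show "set_tm (subst N 0 M') \<subseteq> borel_measurable M"
        using set_tm_subst[of N 0 M'] LetIn.prems by auto
    qed (use True in simp)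
  next
    case False
    then show ?thesis
      using LetIn by (intro family_steps_frame[of _ _ _ _ M' RealT "\<lambda>M'. LetIn M' N", where D="\<lambda>w M'. LetIn M' (ev N w)"])
        (auto intro: typing.intros)
  qed
qed

section \<open>Measurability on the space of terms\<close>

lemma labels_map_tm: "labels (map_tm g M) = map g (labels M)"
  by (induction M) (auto simp: map_concat comp_def intro!: arg_cong[where f=concat])

lemma set_labels: "set (labels M) = set_tm M"
  by (induction M) auto

text \<open>Leaves receive a second label in their left-to-right order. With positions as second
  labels, a term is separated into its skeleton and its numerals.\<close>

lemma relabel:
  "length xs = length (labels T) \<Longrightarrow> \<exists>T'. map_tm fst T' = T \<and> labels T' = zip (labels T) xs"
proof (induction T arbitrary: xs)
  case (App M N)
  let ?n = "length (labels M)"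
  obtain M' N' where "map_tm fst M' = M" "labels M' = zip (labels M) (take ?n xs)"
    "map_tm fst N' = N" "labels N' = zip (labels N) (drop ?n xs)"
    using App(1)[of "take ?n xs"] App(2)[of "drop ?n xs"] App.prems by auto
  then show ?case by (intro exI[of _ "App M' N'"]) (simp add: zip_append1)
next
  case (LetIn M N)
  let ?n = "length (labels M)"
  obtain M' N' where "map_tm fst M' = M" "labels M' = zip (labels M) (take ?n xs)"
    "map_tm fst N' = N" "labels N' = zip (labels N) (drop ?n xs)"
    using LetIn(1)[of "take ?n xs"] LetIn(2)[of "drop ?n xs"] LetIn.prems by auto
  then show ?case by (intro exI[of _ "LetIn M' N'"]) (simp add: zip_append1)
next
  case (Ifz L M N)
  let ?l = "length (labels L)" and ?n = "length (labels M)"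
  obtain L' M' N' where "map_tm fst L' = L" "labels L' = zip (labels L) (take ?l xs)"
    "map_tm fst M' = M" "labels M' = zip (labels M) (take ?n (drop ?l xs))"
    "map_tm fst N' = N" "labels N' = zip (labels N) (drop ?n (drop ?l xs))"
    using Ifz(1)[of "take ?l xs"] Ifz(2)[of "take ?n (drop ?l xs)"] Ifz(3)[of "drop ?n (drop ?l xs)"] Ifz.prems
    by auto
  then show ?case by (intro exI[of _ "Ifz L' M' N'"]) (simp add: zip_append1)
next
  case (Prim f Ms)
  have "\<exists>Ms'. map (map_tm fst) Ms' = Ms \<and> concat (map labels Ms') = zip (concat (map labels Ms)) xs"
    if "length xs = length (concat (map labels Ms))"
    using Prim.IH that
  proof (induction Ms arbitrary: xs)
    case (Cons M Ms)
    let ?n = "length (labels M)"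
    obtain M' where "map_tm fst M' = M" "labels M' = zip (labels M) (take ?n xs)"
      using Cons.prems(1)[of M "take ?n xs"] Cons.prems(2) by auto
    moreover obtain Ms' where "map (map_tm fst) Ms' = Ms" "concat (map labels Ms') = zip (concat (map labels Ms)) (drop ?n xs)"
      using Cons.IH[of "drop ?n xs"] Cons.prems by auto
    ultimately show ?case by (intro exI[of _ "M' # Ms'"]) (simp add: zip_append1)
  qed simp
  then show ?case using Prim.prems by (metis labels.simps(6) tm.map(6))
next
  case (Lam A M)
  then show ?case by (metis labels.simps(2) tm.map(2))
next
  case (Fix M)
  then show ?case by (metis labels.simps(4) tm.map(4))
next
  case (Numeral q)
  then obtain x where "xs = [x]" by (auto simp: length_Suc_conv)
  then show ?case by (intro exI[of _ "Numeral (q, x)"]) simp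
next
  case (Var i)
  then show ?case by (intro exI[of _ "Var i"]) simp
next
  case Sample
  then show ?case by (intro exI[of _ Sample]) simp
qed

lemma skeleton_exists:
  obtains T' where "T' \<in> skeletons (length (labels T))" "T = map_tm (\<lambda>i. labels T ! i) T'"
proof -
  let ?n = "length (labels T)"
  obtain T' where T': "map_tm fst T' = T" "labels T' = zip (labels T) [0..<?n]"
    using relabel[of "[0..<?n]" T] by auto
  have "labels (map_tm snd T') = [0..<?n]" by (simp add: labels_map_tm T')
  then have "map_tm snd T' \<in> skeletons ?n" by (simp add: skeletons_def)
  moreover have "map_tm (\<lambda>i. labels T ! i) (map_tm snd T') = T"
  proof -
    have "map_tm (\<lambda>p. labels T ! snd p) T' = map_tm fst T'"
    proof (rule tm.map_cong0)
      fix p assume "p \<in> set_tm T'"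
      then have "p \<in> set (zip (labels T) [0..<?n])" using T'(2) set_labels[of T'] by simp
      then show "labels T ! snd p = fst p" by (auto simp: in_set_zip)
    qed
    then show ?thesis using T'(1) by (simp add: tm.map_comp comp_def)
  qed
  ultimately show ?thesis using that by metis
qed

lemma space_Terms: "space (Terms F \<Gamma> A) = {M. typing F \<Gamma> M A}"
  unfolding Terms_def by (rule space_measure_of) auto

text \<open>The numerals of the family form a measurable map into \<open>\<real>^n\<close>, and the
  Borel condition in the definition of \<open>Terms\<close> is applied to the common
  skeleton.\<close>

lemma measurable_family:
  fixes T :: "('w \<Rightarrow> real) tm"
  assumes T: "typing F \<Gamma> T A" "set_tm T \<subseteq> borel_measurable M"
  shows "ev T \<in> measurable M (Terms F \<Gamma> A)"
  unfolding Terms_def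
proof (rule measurable_measure_of)
  show "ev T \<in> space M \<rightarrow> {M. typing F \<Gamma> M A}"
    using T by (auto simp: ev_def intro: typing_map_tm)
  fix U assume "U \<in> {U. U \<subseteq> {M. typing F \<Gamma> M A} \<and>
         (\<forall>n. \<forall>T\<in>skeletons n. {x \<in> space (Rn n). map_tm x T \<in> U} \<in> sets (Rn n))}"
  then have U: "\<And>n T. T \<in> skeletons n \<Longrightarrow> {x \<in> space (Rn n). map_tm x T \<in> U} \<in> sets (Rn n)" by blast
  let ?n = "length (labels T)"
  obtain T' where T': "T' \<in> skeletons ?n" "T = map_tm (\<lambda>i. labels T ! i) T'" by (rule skeleton_exists)
  define x where "x w = (\<lambda>i\<in>{..<?n}. (labels T ! i) w)" for w
  have lab: "labels T ! i \<in> borel_measurable M" if "i < ?n" for i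
    using that T(2) set_labels[of T] nth_mem by blast
  have x: "x \<in> measurable M (Rn ?n)"
    unfolding x_def using lab by (intro measurable_restrict) auto
  have "ev T w = map_tm (x w) T'" for w
  proof -
    have "ev T w = map_tm (\<lambda>h. h w) (map_tm (\<lambda>i. labels T ! i) T')"
      unfolding ev_def using T'(2) by (rule arg_cong)
    also have "\<dots> = map_tm (x w) T'"
      unfolding tm.map_comp
    proof (rule tm.map_cong0)
      fix i assume "i \<in> set_tm T'"
      then have "i < ?n" using T'(1) set_labels[of T'] by (auto simp: skeletons_def)
      then show "((\<lambda>h. h w) \<circ> (\<lambda>i. labels T ! i)) i = x w i" by (simp add: x_def)
    qed
    finally show ?thesis .
  qed
  then have "ev T -` U \<inter> space M = x -` {x \<in> space (Rn ?n). map_tm x T' \<in> U} \<inter> space M"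
    using measurable_space[OF x] by auto
  also have "\<dots> \<in> sets M" using measurable_sets[OF x U[OF T'(1)]] .
  finally show "ev T -` U \<inter> space M \<in> sets M" .
qed auto

text \<open>The opposite direction: a map out of the space of terms is measurable as soon as it is
  so along each well-typed skeleton.\<close>

lemma measurable_TermsI:
  assumes sp: "\<And>M. typing F \<Gamma> M A \<Longrightarrow> g M \<in> space N"
    and meas: "\<And>n T. T \<in> skeletons n \<Longrightarrow> typing F \<Gamma> T A \<Longrightarrow> (\<lambda>x. g (map_tm x T)) \<in> measurable (Rn n) N"
  shows "g \<in> measurable (Terms F \<Gamma> A) N"
proof (rule measurableI)
  show "g M \<in> space N" if "M \<in> space (Terms F \<Gamma> A)" for M
    using that sp by (simp add: space_Terms)
  fix B assume B: "B \<in> sets N"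
  let ?U = "g -` B \<inter> {M. typing F \<Gamma> M A}"
  have "{x \<in> space (Rn n). map_tm x T \<in> ?U} \<in> sets (Rn n)" if T: "T \<in> skeletons n" for n T
  proof (cases "typing F \<Gamma> T A")
    case True
    then have "{x \<in> space (Rn n). map_tm x T \<in> ?U} = (\<lambda>x. g (map_tm x T)) -` B \<inter> space (Rn n)"
      by (auto intro: typing_map_tm)
    then show ?thesis using measurable_sets[OF meas[OF T True] B] by simp
  next
    case False
    \<comment> \<open>Typing ignores the labels, so an ill-typed skeleton has no well-typed
      instance.\<close>
    then have "{x \<in> space (Rn n). map_tm x T \<in> ?U} = {}" by (auto simp: typing_map_tm_iff)
    then show ?thesis by (metis sets.empty_sets)
  qed
  then show "g -` B \<inter> space (Terms F \<Gamma> A) \<in> sets (Terms F \<Gamma> A)"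
    unfolding space_Terms unfolding Terms_def by (intro in_measure_of) auto
qed

lemma measurable_step_family:
  fixes T :: "('w \<Rightarrow> real) tm"
  assumes "measurable_signature F" "typing F \<Gamma> T A" "set_tm T \<subseteq> borel_measurable M" "\<rho> \<in> borel_measurable M"
  shows "(\<lambda>w. step (ev T w) (\<rho> w)) \<in> measurable M (Terms F \<Gamma> A)"
proof -
  from step_family[OF assms] obtain S T1 T2 where S: "S \<in> sets M" and
    T: "\<forall>T'\<in>{T1, T2}. typing F \<Gamma> T' A \<and> set_tm T' \<subseteq> borel_measurable M" and
    eq: "\<forall>w\<in>space M. step (ev T w) (\<rho> w) = (if w \<in> S then ev T1 w else ev T2 w)"
    unfolding family_steps_def by blast
  have "(\<lambda>w. if w \<in> S then ev T1 w else ev T2 w) \<in> measurable M (Terms F \<Gamma> A)"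
    using S T by (intro measurable_If_set measurable_family) auto
  also have "?this \<longleftrightarrow> ?thesis" by (rule measurable_cong) (use eq in auto)
  finally show ?thesis .
qed

lemma measurable_step_skeleton:
  assumes F: "measurable_signature F" and T: "T \<in> skeletons n" "typing F \<Gamma> T A"
  shows "(\<lambda>(x, r). step (map_tm x T) r) \<in> measurable (Rn n \<Otimes>\<^sub>M borel) (Terms F \<Gamma> A)"
proof -
  define T' :: "((nat \<Rightarrow> real) \<times> real \<Rightarrow> real) tm" where "T' = map_tm (\<lambda>i p. fst p i) T"
  have ev: "ev T' p = map_tm (fst p) T" for p :: "(nat \<Rightarrow> real) \<times> real"
    by (simp add: ev_def T'_def tm.map_comp comp_def)
  have "set_tm T = set (labels T)" by (simp add: set_labels)
  also have "\<dots> = {..<n}" using T(1) by (simp add: skeletons_def atLeast0LessThan)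
  finally have "set_tm T = {..<n}" .
  then have "set_tm T' \<subseteq> borel_measurable (Rn n \<Otimes>\<^sub>M borel)"
    unfolding T'_def tm.set_map
    by (auto intro!: measurable_compose[OF measurable_fst measurable_component_singleton])
  then have "(\<lambda>p. step (ev T' p) (snd p)) \<in> measurable (Rn n \<Otimes>\<^sub>M borel) (Terms F \<Gamma> A)"
    using T(2) by (intro measurable_step_family[OF F]) (auto simp: T'_def intro: typing_map_tm)
  then show ?thesis by (simp add: ev case_prod_beta)
qed

lemma measurable_step:
  assumes F: "measurable_signature F" and M: "typing F \<Gamma> M A"
  shows "step M \<in> measurable borel (Terms F \<Gamma> A)"
proof -
  have "(\<lambda>r. step (ev (map_tm (\<lambda>q _. q) M) r) r) \<in> measurable borel (Terms F \<Gamma> A)"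
    using M by (intro measurable_step_family[OF F]) (auto simp: tm.set_map intro: typing_map_tm)
  then show ?thesis by (simp add: ev_def tm.map_comp comp_def tm.map_ident)
qed

text \<open>Subject reduction is contained in measurability: \<open>step M\<close> is a map into the
  space of well-typed terms.\<close>

lemma typing_step:
  assumes "measurable_signature F" "typing F \<Gamma> M A"
  shows "typing F \<Gamma> (step M r) A"
  using measurable_space[OF measurable_step[OF assms], of r] by (simp add: space_Terms)

section \<open>The reduction kernel and its iterates\<close>

abbreviation uniform :: "real measure" where "uniform \<equiv> density lborel (indicator {0..1})"

lemma prob_space_uniform: "prob_space uniform"
  by (rule prob_spaceI) (simp add: emeasure_density)

lemma emeasure_uniform: "A \<in> sets borel \<Longrightarrow> emeasure uniform A = emeasure lborel ({0..1} \<inter> A)"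
  by (simp add: emeasure_density nn_integral_indicator' flip: indicator_inter_arith)

text \<open>The expectation of \<open>h\<close> on the numerals reached within \<open>n\<close> steps.\<close>

primrec outcome :: "nat \<Rightarrow> (real \<Rightarrow> ennreal) \<Rightarrow> real tm \<Rightarrow> ennreal" where
  "outcome 0 h M = (if is_num M then h (num_val M) else 0)"
| "outcome (Suc n) h M = (\<integral>\<^sup>+r. outcome n h (step M r) \<partial>uniform)"

context
  fixes F :: signature and \<Gamma> :: "ty list" and A :: ty
  assumes F: "measurable_signature F"
begin

text \<open>Along a fixed skeleton, \<open>step\<close> is jointly measurable in the numerals and
  the draw, so integrating out the draw preserves measurability.\<close>

lemma measurable_outcome: "h \<in> borel_measurable borel \<Longrightarrow> outcome n h \<in> borel_measurable (Terms F \<Gamma> A)"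
proof (induction n)
  case 0
  show ?case
  proof (rule measurable_TermsI)
    fix n T assume T: "T \<in> skeletons n"
    show "(\<lambda>x. outcome 0 h (map_tm x T)) \<in> borel_measurable (Rn n)"
    proof (cases "is_num T")
      case True
      then obtain i where i: "T = Numeral i" by (auto simp: is_num_def)
      then have "i < n" using T by (auto simp: skeletons_def) (metis atLeastLessThan_iff atLeastLessThan_upt list.set_intros(1))
      then show ?thesis using 0 by (simp add: i)
    qed simp
  qed simp
next
  case (Suc n)
  show ?case
  proof (rule measurable_TermsI)
    fix k T assume T: "T \<in> skeletons k" "typing F \<Gamma> T A"
    interpret sigma_finite_measure uniform
      by (intro finite_measure.axioms(1)[OF prob_space.axioms(1)] prob_space_uniform)
    have "(\<lambda>(x, r). outcome n h (step (map_tm x T) r)) \<in> borel_measurable (Rn k \<Otimes>\<^sub>M borel)"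
      using measurable_compose[OF measurable_step_skeleton[OF F T] Suc.IH[OF Suc.prems]]
      by (simp add: case_prod_beta)
    then have "(\<lambda>(x, r). outcome n h (step (map_tm x T) r)) \<in> borel_measurable (Rn k \<Otimes>\<^sub>M uniform)"
      by (simp add: measurable_cong_sets[OF sets_pair_measure_cong[OF refl sets_density] refl] sets_pair_measure_cong)
    then show "(\<lambda>x. outcome (Suc n) h (map_tm x T)) \<in> borel_measurable (Rn k)"
      by (simp add: borel_measurable_nn_integral)
  qed simp
qed

text \<open>\<open>red M\<close> is a bare set function; as a genuine measure the same kernel can be
  composed by bind.\<close>

definition red_kernel :: "real tm \<Rightarrow> real tm measure" where
  "red_kernel M = distr uniform (Terms F \<Gamma> A) (step M)"

lemma step_uniform: "typing F \<Gamma> M A \<Longrightarrow> step M \<in> measurable uniform (Terms F \<Gamma> A)"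
  using measurable_step[OF F] by simp

lemma emeasure_red_kernel:
  assumes "typing F \<Gamma> M A" "U \<in> sets (Terms F \<Gamma> A)"
  shows "emeasure (red_kernel M) U = red M U"
proof -
  have "emeasure (red_kernel M) U = emeasure uniform (step M -` U)"
    unfolding red_kernel_def using assms step_uniform[of M] by (subst emeasure_distr) auto
  also have "\<dots> = emeasure lborel ({0..1} \<inter> step M -` U)"
    using measurable_sets[OF measurable_step[OF F assms(1)] assms(2)] by (intro emeasure_uniform) simp
  also have "{0..1} \<inter> step M -` U = {r \<in> {0..1}. step M r \<in> U}" by auto
  finally show ?thesis by (simp add: red_step)
qed

lemma measurable_red_kernel: "red_kernel \<in> measurable (Terms F \<Gamma> A) (subprob_algebra (Terms F \<Gamma> A))"
proof (rule measurable_subprob_algebra)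
  fix M assume "M \<in> space (Terms F \<Gamma> A)"
  then have M: "typing F \<Gamma> M A" by (simp add: space_Terms)
  show "subprob_space (red_kernel M)"
    unfolding red_kernel_def
    by (intro prob_space_imp_subprob_space prob_space.prob_space_distr prob_space_uniform step_uniform M)
  show "sets (red_kernel M) = sets (Terms F \<Gamma> A)" by (simp add: red_kernel_def)
next
  fix U assume U: "U \<in> sets (Terms F \<Gamma> A)"
  show "(\<lambda>M. emeasure (red_kernel M) U) \<in> borel_measurable (Terms F \<Gamma> A)"
  proof (rule measurable_TermsI)
    fix k T assume T: "T \<in> skeletons k" "typing F \<Gamma> T A"
    interpret sigma_finite_measure uniform
      by (intro finite_measure.axioms(1)[OF prob_space.axioms(1)] prob_space_uniform)
    have "(\<lambda>(x, r). indicator U (step (map_tm x T) r) :: ennreal) \<in> borel_measurable (Rn k \<Otimes>\<^sub>M borel)"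
      using measurable_compose[OF measurable_step_skeleton[OF F T] borel_measurable_indicator[OF U]]
      by (simp add: case_prod_beta')
    then have "(\<lambda>(x, r). indicator U (step (map_tm x T) r) :: ennreal) \<in> borel_measurable (Rn k \<Otimes>\<^sub>M uniform)"
      by (simp add: measurable_cong_sets[OF sets_pair_measure_cong[OF refl sets_density] refl] sets_pair_measure_cong)
    then have "(\<lambda>x. \<integral>\<^sup>+r. indicator U (step (map_tm x T) r) \<partial>uniform) \<in> borel_measurable (Rn k)"
      by (rule borel_measurable_nn_integral)
    also have "?this \<longleftrightarrow> (\<lambda>x. emeasure (red_kernel (map_tm x T)) U) \<in> borel_measurable (Rn k)"
    proof (rule measurable_cong)
      fix x :: "nat \<Rightarrow> real"
      have "emeasure (red_kernel (map_tm x T)) U = (\<integral>\<^sup>+t. indicator U t \<partial>red_kernel (map_tm x T))"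
        using U by (simp add: red_kernel_def)
      also have "\<dots> = (\<integral>\<^sup>+r. indicator U (step (map_tm x T) r) \<partial>uniform)"
        unfolding red_kernel_def using U typing_map_tm[OF T(2)] by (intro nn_integral_distr step_uniform) auto
      finally show "(\<integral>\<^sup>+r. indicator U (step (map_tm x T) r) \<partial>uniform) = emeasure (red_kernel (map_tm x T)) U" by simp
    qed
    finally show "(\<lambda>x. emeasure (red_kernel (map_tm x T)) U) \<in> borel_measurable (Rn k)" .
  qed simp
qed

lemma Red_iter_0:
  assumes "typing F \<Gamma> M A"
  shows "Red_iter F \<Gamma> A 0 M = red_kernel M"
proof -
  have "Red_iter F \<Gamma> A 0 M = measure_of (space (red_kernel M)) (sets (red_kernel M)) (emeasure (red_kernel M))"
    unfolding Red_iter.simps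
    by (simp add: red_kernel_def) (intro measure_of_eq sets.space_closed,
      simp add: sets.sigma_sets_eq emeasure_red_kernel[OF assms, unfolded red_kernel_def])
  then show ?thesis by (simp add: measure_of_of_measure)
qed

text \<open>\<open>measure_of\<close>, applied to a set function that agrees with a measure on its
  sigma-algebra, returns that measure, here the bind.\<close>

lemma Red_iter_Suc:
  assumes R: "Red_iter F \<Gamma> A n M \<in> space (subprob_algebra (Terms F \<Gamma> A))"
  shows "Red_iter F \<Gamma> A (Suc n) M = Red_iter F \<Gamma> A n M \<bind> red_kernel"
proof -
  let ?R = "Red_iter F \<Gamma> A n M" and ?T = "Terms F \<Gamma> A"
  have sR: "sets ?R = sets ?T" and sub: "subprob_space ?R"
    using R by (auto simp: space_subprob_algebra)
  have spR: "space ?R = space ?T" using sR by (rule sets_eq_imp_space_eq)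
  have K: "red_kernel \<in> measurable ?R (subprob_algebra ?T)"
    using measurable_red_kernel unfolding measurable_cong_sets[OF sR refl] .
  have ne: "space ?R \<noteq> {}" using sub by (rule subprob_space.subprob_not_empty)
  have sB: "sets (?R \<bind> red_kernel) = sets ?T" by (rule sets_bind_measurable[OF K ne])
  have spB: "space (?R \<bind> red_kernel) = space ?T" using sB by (rule sets_eq_imp_space_eq)
  have "emeasure (?R \<bind> red_kernel) U = (\<integral>\<^sup>+t. red t U \<partial>?R)" if U: "U \<in> sets ?T" for U
  proof -
    have "emeasure (?R \<bind> red_kernel) U = (\<integral>\<^sup>+t. emeasure (red_kernel t) U \<partial>?R)"
      by (rule emeasure_bind[OF ne K U])
    also have "\<dots> = (\<integral>\<^sup>+t. red t U \<partial>?R)"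
      using spR U by (intro nn_integral_cong emeasure_red_kernel) (auto simp: space_Terms)
    finally show ?thesis .
  qed
  then have "Red_iter F \<Gamma> A (Suc n) M = measure_of (space (?R \<bind> red_kernel)) (sets (?R \<bind> red_kernel)) (emeasure (?R \<bind> red_kernel))"
    unfolding Red_iter.simps sB spB by (intro measure_of_eq sets.space_closed) (simp add: sets.sigma_sets_eq)
  then show ?thesis by (simp add: measure_of_of_measure)
qed

lemma Red_iter_subprob:
  assumes "typing F \<Gamma> M A"
  shows "Red_iter F \<Gamma> A n M \<in> space (subprob_algebra (Terms F \<Gamma> A))"
proof (induction n)
  case 0
  then show ?case
    unfolding Red_iter_0[OF assms] using measurable_space[OF measurable_red_kernel] assms by (simp add: space_Terms)
next
  case (Suc n)
  have "(\<lambda>R. R \<bind> red_kernel) \<in> measurable (subprob_algebra (Terms F \<Gamma> A)) (subprob_algebra (Terms F \<Gamma> A))"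
    by (rule measurable_bind2[OF measurable_ident measurable_red_kernel, unfolded id_def])
  from measurable_space[OF this Suc] show ?case unfolding Red_iter_Suc[OF Suc] .
qed

lemma nn_integral_red_kernel:
  assumes "h \<in> borel_measurable borel" "typing F \<Gamma> M A"
  shows "(\<integral>\<^sup>+t. outcome k h t \<partial>red_kernel M) = outcome (Suc k) h M"
  unfolding red_kernel_def outcome.simps by (subst nn_integral_distr[OF step_uniform[OF assms(2)]]) (simp_all add: measurable_outcome[OF assms(1)])

text \<open>\<open>Red_iter\<close> adds reduction steps at the end of a run, \<open>outcome\<close>
  at its beginning; carrying \<open>k\<close> further steps in the integrand reconciles the two. The
  extra \<open>Suc\<close> appears because \<open>Red_iter\<close> at index 0 has already reduced
  once.\<close>

lemma nn_integral_Red_iter: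
  assumes h: "h \<in> borel_measurable borel" and M: "typing F \<Gamma> M A"
  shows "(\<integral>\<^sup>+t. outcome k h t \<partial>Red_iter F \<Gamma> A n M) = outcome (Suc (k + n)) h M"
proof (induction n arbitrary: k)
  case 0
  show ?case using nn_integral_red_kernel[OF h M] by (simp only: Red_iter_0[OF M] add_0_right)
next
  case (Suc n)
  let ?R = "Red_iter F \<Gamma> A n M" and ?T = "Terms F \<Gamma> A"
  have R: "?R \<in> space (subprob_algebra ?T)" by (rule Red_iter_subprob[OF M])
  then have sR: "sets ?R = sets ?T" by (simp add: space_subprob_algebra)
  have spR: "space ?R = space ?T" using sR by (rule sets_eq_imp_space_eq)
  have K: "red_kernel \<in> measurable ?R (subprob_algebra ?T)"
    using measurable_red_kernel unfolding measurable_cong_sets[OF sR refl] .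
  have "(\<integral>\<^sup>+t. outcome k h t \<partial>Red_iter F \<Gamma> A (Suc n) M) = (\<integral>\<^sup>+t. \<integral>\<^sup>+u. outcome k h u \<partial>red_kernel t \<partial>?R)"
    unfolding Red_iter_Suc[OF R] by (rule nn_integral_bind[OF measurable_outcome[OF h] K])
  also have "\<dots> = (\<integral>\<^sup>+t. outcome (Suc k) h t \<partial>?R)"
    using spR by (intro nn_integral_cong nn_integral_red_kernel h) (simp add: space_Terms)
  also have "\<dots> = outcome (Suc (k + Suc n)) h M" using Suc[of "Suc k"] by simp
  finally show ?case .
qed

end

lemma Red_inf_outcome:
  assumes F: "measurable_signature F" and M: "typing F [] M RealT" and U: "U \<in> sets borel"
  shows "Red_inf F [] RealT M (Numeral ` U) = (SUP n. outcome (Suc n) (indicator U) M)"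
proof -
  let ?T = "Terms F [] RealT"
  have h: "(indicator U :: real \<Rightarrow> ennreal) \<in> borel_measurable borel" using U by simp
  have ind: "outcome 0 (indicator U) t = indicator (Numeral ` U) t" for t
    by (auto simp: is_num_def split: split_indicator)
  \<comment> \<open>The numerals with value in \<open>U\<close> are the terms at which
    \<open>outcome 0\<close> equals 1, so their measurability follows from that of
    \<open>outcome\<close>.\<close>
  have "{t \<in> space ?T. outcome 0 (indicator U) t = 1} \<in> sets ?T"
    using measurable_outcome[OF F h] by measurable
  also have "{t \<in> space ?T. outcome 0 (indicator U) t = 1} = Numeral ` U"
    by (auto simp: ind space_Terms indicator_eq_1_iff is_num_def intro: typing.intros)
  finally have NU: "Numeral ` U \<in> sets ?T" .
  have "emeasure (Red_iter F [] RealT n M) (Numeral ` U) = outcome (Suc n) (indicator U) M" for n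
  proof -
    have "sets (Red_iter F [] RealT n M) = sets ?T"
      using Red_iter_subprob[OF F M] by (simp add: space_subprob_algebra)
    then have "emeasure (Red_iter F [] RealT n M) (Numeral ` U) = (\<integral>\<^sup>+t. outcome 0 (indicator U) t \<partial>Red_iter F [] RealT n M)"
      using NU by (simp only: ind nn_integral_indicator)
    also have "\<dots> = outcome (Suc (0 + n)) (indicator U) M" by (rule nn_integral_Red_iter[OF F h M])
    finally show ?thesis by (simp only: add_0)
  qed
  then show ?thesis by (simp add: Red_inf_def)
qed

section \<open>Soundness\<close>

lemma type_of_lift: "type_of (lift M (length \<Gamma>1)) (\<Gamma>1 @ B # \<Gamma>2) = type_of M (\<Gamma>1 @ \<Gamma>2)"
proof (induction M arbitrary: \<Gamma>1)
  case (Lam A M)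
  show ?case using Lam[of "A # \<Gamma>1"] by simp
qed (auto simp: nth_append)

lemma types_in_lift: "types_in (lift M (length \<Gamma>1)) (\<Gamma>1 @ B # \<Gamma>2) = types_in M (\<Gamma>1 @ \<Gamma>2)"
proof (induction M arbitrary: \<Gamma>1)
  case (Lam A M)
  show ?case using Lam[of "A # \<Gamma>1"] type_of_lift[of M "A # \<Gamma>1" B \<Gamma>2] by simp
next
  case (LetIn M N)
  show ?case using LetIn(1)[of \<Gamma>1] LetIn(2)[of "RealT # \<Gamma>1"] by simp
qed (auto simp: nth_append type_of_lift)

lemma type_of_subst:
  "type_of P (\<Gamma>1 @ \<Gamma>2) = B \<Longrightarrow> type_of (subst M (length \<Gamma>1) P) (\<Gamma>1 @ \<Gamma>2) = type_of M (\<Gamma>1 @ B # \<Gamma>2)"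
proof (induction M arbitrary: \<Gamma>1 P)
  case (Lam A M)
  have "type_of (lift P 0) ((A # \<Gamma>1) @ \<Gamma>2) = B"
    using type_of_lift[of P "[]" A "\<Gamma>1 @ \<Gamma>2"] Lam.prems by simp
  from Lam.IH[OF this] show ?case by simp
next
  case (Var i)
  then show ?case by (cases "i < length \<Gamma>1") (auto simp: nth_append nth_Cons')
qed auto

lemma types_in_subst:
  assumes "type_of P (\<Gamma>1 @ \<Gamma>2) = B"
  shows "types_in (subst M (length \<Gamma>1) P) (\<Gamma>1 @ \<Gamma>2) \<subseteq> types_in M (\<Gamma>1 @ B # \<Gamma>2) \<union> types_in P (\<Gamma>1 @ \<Gamma>2)"
  using assms
proof (induction M arbitrary: \<Gamma>1 P)
  case (Lam A M)
  have "type_of (lift P 0) ((A # \<Gamma>1) @ \<Gamma>2) = B"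
    using type_of_lift[of P "[]" A "\<Gamma>1 @ \<Gamma>2"] Lam.prems by simp
  from Lam.IH[OF this] type_of_subst[OF this, of M] show ?case
    using types_in_lift[of P "[]" A "\<Gamma>1 @ \<Gamma>2"] by auto
next
  case (LetIn M N)
  have "type_of (lift P 0) ((RealT # \<Gamma>1) @ \<Gamma>2) = B"
    using type_of_lift[of P "[]" RealT "\<Gamma>1 @ \<Gamma>2"] LetIn.prems by simp
  from LetIn.IH(2)[OF this] LetIn.IH(1)[OF LetIn.prems] show ?case
    using types_in_lift[of P "[]" RealT "\<Gamma>1 @ \<Gamma>2"] by auto
next
  case (Var i)
  then show ?case by (cases "i < length \<Gamma>1") (auto simp: nth_append nth_Cons')
next
  case (App M N)
  show ?case using App.IH(1)[OF App.prems] App.IH(2)[OF App.prems] type_of_subst[OF App.prems, of M] by auto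
next
  case (Fix M)
  show ?case using Fix.IH[OF Fix.prems] type_of_subst[OF Fix.prems, of M] by auto
next
  case (Ifz L M N)
  show ?case using Ifz.IH(1)[OF Ifz.prems] Ifz.IH(2)[OF Ifz.prems] Ifz.IH(3)[OF Ifz.prems] by auto
next
  case (Prim f Ms)
  show ?case using Prim.IH[OF _ Prim.prems] by fastforce
qed auto

lemma sem_Prim_cong:
  assumes "map (\<lambda>M. sem V M \<Gamma> g) Ms = map (\<lambda>M. sem V M \<Gamma>' g') Ms'"
  shows "sem V (Prim f Ms) \<Gamma> g = sem V (Prim f Ms') \<Gamma>' g'"
  using map_eq_imp_length_eq[OF assms] by (simp only: sem.simps assms)

lemma sem_lift:
  "length g1 = length \<Gamma>1 \<Longrightarrow> sem V (lift M (length \<Gamma>1)) (\<Gamma>1 @ B # \<Gamma>2) (g1 @ b # g2) = sem V M (\<Gamma>1 @ \<Gamma>2) (g1 @ g2)"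
proof (induction M arbitrary: \<Gamma>1 g1)
  case (Lam A M)
  show ?case using Lam.IH[of "_ # g1" "A # \<Gamma>1"] Lam.prems by (simp cong: restrict_cong)
next
  case (LetIn M N)
  show ?case using LetIn.IH(1)[of g1 \<Gamma>1] LetIn.IH(2)[of "_ # g1" "RealT # \<Gamma>1"] LetIn.prems by simp
next
  case (Fix M)
  show ?case using Fix type_of_lift[of M \<Gamma>1 B \<Gamma>2] by simp
next
  case (Prim f Ms)
  have "map (\<lambda>M. sem V M (\<Gamma>1 @ B # \<Gamma>2) (g1 @ b # g2)) (map (\<lambda>M. lift M (length \<Gamma>1)) Ms) =
    map (\<lambda>M. sem V M (\<Gamma>1 @ \<Gamma>2) (g1 @ g2)) Ms"
    using Prim by simp
  then show ?case unfolding lift.simps by (rule sem_Prim_cong)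
qed (auto simp: nth_append)

lemma sem_subst:
  "length g1 = length \<Gamma>1 \<Longrightarrow> type_of P (\<Gamma>1 @ \<Gamma>2) = B \<Longrightarrow>
    sem V (subst M (length \<Gamma>1) P) (\<Gamma>1 @ \<Gamma>2) (g1 @ g2) =
    sem V M (\<Gamma>1 @ B # \<Gamma>2) (g1 @ sem V P (\<Gamma>1 @ \<Gamma>2) (g1 @ g2) # g2)"
proof (induction M arbitrary: \<Gamma>1 g1 P)
  case (Lam A M)
  have "type_of (lift P 0) ((A # \<Gamma>1) @ \<Gamma>2) = B"
    using type_of_lift[of P "[]" A "\<Gamma>1 @ \<Gamma>2"] Lam.prems by simp
  note Lam.IH[OF _ this, of "_ # g1"]
  moreover have "sem V (lift P 0) (A # \<Gamma>1 @ \<Gamma>2) (a # g1 @ g2) = sem V P (\<Gamma>1 @ \<Gamma>2) (g1 @ g2)" for a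
    using sem_lift[of "[]" "[]" V P A "\<Gamma>1 @ \<Gamma>2" a "g1 @ g2"] by simp
  ultimately show ?case using Lam.prems by (simp cong: restrict_cong)
next
  case (LetIn M N)
  have "type_of (lift P 0) ((RealT # \<Gamma>1) @ \<Gamma>2) = B"
    using type_of_lift[of P "[]" RealT "\<Gamma>1 @ \<Gamma>2"] LetIn.prems by simp
  note LetIn.IH(2)[OF _ this, of "_ # g1"]
  moreover have "sem V (lift P 0) (RealT # \<Gamma>1 @ \<Gamma>2) (a # g1 @ g2) = sem V P (\<Gamma>1 @ \<Gamma>2) (g1 @ g2)" for a
    using sem_lift[of "[]" "[]" V P RealT "\<Gamma>1 @ \<Gamma>2" a "g1 @ g2"] by simp
  ultimately show ?case using LetIn.prems LetIn.IH(1)[OF LetIn.prems] by simp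
next
  case (Fix M)
  show ?case using Fix type_of_subst[of P \<Gamma>1 \<Gamma>2 B M] by simp
next
  case (Prim f Ms)
  have "map (\<lambda>M. sem V M (\<Gamma>1 @ \<Gamma>2) (g1 @ g2)) (map (\<lambda>M. subst M (length \<Gamma>1) P) Ms) =
    map (\<lambda>M. sem V M (\<Gamma>1 @ B # \<Gamma>2) (g1 @ sem V P (\<Gamma>1 @ \<Gamma>2) (g1 @ g2) # g2)) Ms"
    using Prim by simp
  then show ?case unfolding subst.simps by (rule sem_Prim_cong)
next
  case (Var i)
  then show ?case by (cases "i < length \<Gamma>1") (auto simp: nth_append nth_Cons')
qed auto

text \<open>Faithfulness is assumed for the types that occur in the original term, so reduction must
  not introduce new ones.\<close>

lemma types_in_step:
  assumes F: "measurable_signature F" and "typing F \<Gamma> M A"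
  shows "types_in (step M r) \<Gamma> \<subseteq> types_in M \<Gamma>"
  using assms(2)
proof (induction M A rule: typing.induct)
  case (App \<Gamma> M A B N)
  show ?case
  proof (cases "is_lam M")
    case True
    then obtain A' L where M: "M = Lam A' L" by (auto simp: is_lam_def)
    then have "A' = A" using App(1) by (auto elim: typing_LamE)
    then show ?thesis
      using types_in_subst[of N "[]" \<Gamma> A L] type_of_typing[OF App(2)] by (auto simp: M)
  next
    case False
    then show ?thesis using App type_of_typing[OF typing_step[OF F App(1), of r]]
      by (auto simp: type_of_typing)
  qed
next
  case (Fix \<Gamma> M A)
  then show ?case by (auto simp: type_of_typing)
next
  case (Prim Ms f \<Gamma>)
  show ?case
  proof (cases "\<forall>M\<in>set Ms. is_num M")
    case False
    then obtain rs M Ns where Ms: "Ms = map Numeral rs @ M # Ns" "\<not> is_num M" by (rule first_non_num)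
    then show ?thesis using Prim.IH[of M] unfolding Ms(1) step_Prim_first[OF Ms(2)] by auto
  qed auto
next
  case (LetIn \<Gamma> M N)
  show ?case
  proof (cases "is_num M")
    case True
    then show ?thesis
      using types_in_subst[of M "[]" \<Gamma> RealT N] type_of_typing[OF LetIn(1)] by auto
  qed (use LetIn in auto)
qed auto

text \<open>The one-step soundness statement is phrased with integrals rather than with sets, so that the
  induction hypothesis applies to the continuation of a \<open>let\<close>.\<close>

definition sound :: "'v universe \<Rightarrow> real tm \<Rightarrow> bool" where
  "sound V M \<longleftrightarrow> (\<forall>h\<in>borel_measurable borel. (\<integral>\<^sup>+x. h x \<partial>denotation V M) =
     (\<integral>\<^sup>+r. \<integral>\<^sup>+x. h x \<partial>denotation V (step M r) \<partial>uniform))"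

lemma emeasure_uniform_UNIV[simp]: "emeasure uniform UNIV = 1"
  using prob_space.emeasure_space_1[OF prob_space_uniform] by simp

lemma sound_const: "(\<And>r. sem V (step M r) [] [] = sem V M [] []) \<Longrightarrow> sound V M"
  by (simp add: sound_def denotation_def)

section \<open>Denotations of closed terms\<close>

definition good :: "signature \<Rightarrow> 'v universe \<Rightarrow> real tm \<Rightarrow> ty \<Rightarrow> bool" where
  "good F V M A \<longleftrightarrow> measurable_signature F \<and> typing F [] M A \<and> (\<forall>B\<in>types_in M []. faithful V B)"

lemma good_sem_ok: "good F V M A \<Longrightarrow> sem_ok V M [] A"
  by (auto simp: good_def intro: typing_sem_ok)

lemma good_faithful: "good F V M A \<Longrightarrow> faithful V A"
  using type_of_types_in[of M "[]"] by (auto simp: good_def type_of_typing)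

lemma good_step: "good F V M A \<Longrightarrow> good F V (step M r) A"
  using types_in_step[of F "[]" M A r] by (auto simp: good_def intro: typing_step)

lemma good_ball: assumes "good F V M A" shows "sem V M [] [] \<in> unit_ball (ty_cone V A)"
  using sem_ok_ball[OF good_sem_ok[OF assms]] by (simp add: env_ball_def)

lemma good_den_ball: assumes "good F V M RealT" shows "denotation V M \<in> unit_ball meas_cone"
  using sem_ok_dec_ball[OF good_faithful[OF assms] good_sem_ok[OF assms]]
  by (simp add: env_ball_def denotation_def)

lemma good_AppE:
  assumes "good F V (App M N) B"
  obtains A where "good F V M (A \<rightarrow> B)" "good F V N A"
  using assms by (auto simp: good_def elim: typing_AppE)

lemma good_FixD: "good F V (Fix M) A \<Longrightarrow> good F V M (A \<rightarrow> A)"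
  by (auto simp: good_def elim: typing_FixE)

lemma good_IfzD:
  assumes "good F V (Ifz L M N) A"
  shows "A = RealT" "good F V L RealT" "good F V M RealT" "good F V N RealT"
  using assms by (auto simp: good_def elim: typing_IfzE)

lemma good_PrimD:
  assumes "good F V (Prim f Ms) A"
  shows "A = RealT" "(length Ms, f) \<in> F" "M \<in> set Ms \<Longrightarrow> good F V M RealT"
  using assms by (auto simp: good_def elim: typing_PrimE)

lemma good_LetInD:
  assumes "good F V (LetIn M N) A"
  shows "A = RealT" "good F V M RealT" "sem_ok V N [RealT] RealT"
proof -
  show "A = RealT" "good F V M RealT"
    using assms by (auto simp: good_def elim: typing_LetInE)
  have "faithful V RealT" "typing F [RealT] N RealT"
    using assms by (auto simp: good_def elim: typing_LetInE)
  then show "sem_ok V N [RealT] RealT"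
    using assms by (intro typing_sem_ok[where F=F]) (auto simp: good_def)
qed

lemma dec_enc_meas: "faithful V RealT \<Longrightarrow> dec_meas V (enc_meas V \<mu>) = \<mu>" if "\<mu> \<in> unit_ball meas_cone"
  using retraction.dec_enc_ball[OF retraction_meas that] by simp

lemma den_Numeral: "faithful V RealT \<Longrightarrow> denotation V (Numeral q) = return borel q"
  by (simp add: denotation_def dec_enc_meas return_ball)

lemma den_Ifz:
  assumes "good F V (Ifz L M N) A"
  shows "denotation V (Ifz L M N) = denotation V L \<bind> (\<lambda>r. if r = 0 then denotation V M else denotation V N)"
proof -
  note g = good_IfzD[OF assms]
  have ball: "denotation V L \<in> unit_ball meas_cone" "denotation V M \<in> unit_ball meas_cone" "denotation V N \<in> unit_ball meas_cone"
    using g by (auto intro: good_den_ball)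
  have "(\<lambda>r::real. if r = 0 then denotation V M else denotation V N) \<in> measurable borel (subprob_algebra borel)"
    using ball unfolding unit_ball_meas by (intro measurable_If measurable_const) auto
  with ball show ?thesis
    using sem_Ifz[of V L "[]" "[]" M N] good_faithful[OF g(2)]
    unfolding denotation_def by (simp only:) (intro dec_enc_meas bind_ball; simp)
qed

definition let_kernel :: "'v universe \<Rightarrow> real tm \<Rightarrow> real \<Rightarrow> real measure" where
  "let_kernel V N r = dec_meas V (sem V N [RealT] [enc_meas V (return borel r)])"

lemma let_kernel_measurable:
  "faithful V RealT \<Longrightarrow> sem_ok V N [RealT] RealT \<Longrightarrow> let_kernel V N \<in> measurable borel (subprob_algebra borel)"
  using LetIn_kernel[of V "[]" N "[]"] by (simp add: env_ball_def let_kernel_def[abs_def])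

lemma den_LetIn:
  assumes "good F V (LetIn M N) A"
  shows "denotation V (LetIn M N) = denotation V M \<bind> let_kernel V N"
proof -
  note g = good_LetInD[OF assms]
  note fa = good_faithful[OF g(2)]
  have "sem V (LetIn M N) [] [] = enc_meas V (denotation V M \<bind> let_kernel V N)"
    using sem_LetIn[of V M "[]" "[]" N] good_den_ball[OF g(2)] let_kernel_measurable[OF fa g(3)]
    by (simp add: denotation_def let_kernel_def[abs_def])
  then show ?thesis
    unfolding denotation_def
    using dec_enc_meas[OF bind_ball[OF good_den_ball[OF g(2)] let_kernel_measurable[OF fa g(3)]] fa]
    by (simp add: denotation_def)
qed

lemma den_subst_numeral:
  "denotation V (subst N 0 (Numeral q)) = let_kernel V N q"
  using sem_subst[of "[]" "[]" "Numeral q" "[]" RealT V N "[]"] by (simp add: denotation_def let_kernel_def)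

text \<open>The point of \<open>\<real>^n\<close> with the given coordinates,
  \<open>undefined\<close> beyond them as extensional functions require.\<close>

definition tuple :: "real list \<Rightarrow> nat \<Rightarrow> real" where
  "tuple qs i = (if i < length qs then qs ! i else undefined)"

lemma tuple_Nil: "tuple [] = (\<lambda>_. undefined)"
  by (simp add: tuple_def fun_eq_iff)

lemma tuple_upd: "(tuple qs)(length qs := q) = tuple (qs @ [q])"
  by (auto simp: tuple_def fun_eq_iff nth_append)

lemma map_tuple: "map (tuple qs) [0..<length qs] = qs"
  by (rule nth_equalityI) (auto simp: tuple_def)

lemma tuple_space: "tuple qs \<in> space (Rn (length qs))"
  by (auto simp: tuple_def space_PiM PiE_def extensional_def)

lemma bind_return_ball:
  "\<nu> \<in> measurable borel (subprob_algebra borel) \<Longrightarrow> return borel q \<bind> \<nu> = \<nu> (q::real)"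
  by (rule bind_return) auto

lemma prim_law_kernel_tuple:
  assumes "set \<mu>s \<subseteq> unit_ball meas_cone" "prim_measurable (Suc (length qs) + length \<mu>s) f"
  shows "(\<lambda>q. prim_law \<mu>s f (Suc (length qs)) (tuple (qs @ [q]))) \<in> measurable borel (subprob_algebra borel)"
  using prim_law_step_kernel[OF assms tuple_space] by (simp add: tuple_upd)

text \<open>A Dirac law fixes its coordinate, so evaluated arguments move from the list of laws into
  the tuple.\<close>

lemma prim_law_returns:
  assumes "set \<mu>s \<subseteq> unit_ball meas_cone" "prim_measurable (length qs + length rs + length \<mu>s) f"
  shows "prim_law (map (return borel) rs @ \<mu>s) f (length qs) (tuple qs) = prim_law \<mu>s f (length (qs @ rs)) (tuple (qs @ rs))"
  using assms
proof (induction rs arbitrary: qs)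
  case (Cons r rs)
  have "set (map (return borel) rs @ \<mu>s) \<subseteq> unit_ball meas_cone"
    using Cons.prems by (auto simp: return_ball)
  moreover have "prim_measurable (Suc (length qs) + length (map (return borel) rs @ \<mu>s)) f"
    using Cons.prems(2) by (simp add: add.assoc)
  ultimately have k: "(\<lambda>q. prim_law (map (return borel) rs @ \<mu>s) f (Suc (length qs)) (tuple (qs @ [q]))) \<in> measurable borel (subprob_algebra borel)"
    by (rule prim_law_kernel_tuple)
  have "prim_law (map (return borel) (r # rs) @ \<mu>s) f (length qs) (tuple qs) =
      prim_law (map (return borel) rs @ \<mu>s) f (Suc (length qs)) (tuple (qs @ [r]))"
    using bind_return_ball[OF k] by (simp add: tuple_upd)
  also have "\<dots> = prim_law \<mu>s f (length (qs @ r # rs)) (tuple (qs @ r # rs))"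
    using Cons.IH[of "qs @ [r]"] Cons.prems by simp
  finally show ?case .
qed simp

lemma den_Prim:
  assumes "good F V (Prim f Ms) A"
  shows "denotation V (Prim f Ms) = prim_law (map (denotation V) Ms) f 0 (tuple [])"
proof -
  note g = good_PrimD[OF assms]
  have p: "prim_measurable (length Ms) f"
    using assms g(2) by (auto simp: good_def intro: signature_prim)
  have fa: "faithful V RealT" using good_faithful[OF assms] g(1) by simp
  have ball: "denotation V M \<in> unit_ball meas_cone" if "M \<in> set Ms" for M
    using g(3)[OF that] by (rule good_den_ball)
  have "sem V (Prim f Ms) [] [] = enc_meas V (prim_law (map (denotation V) Ms) f 0 (tuple []))"
    using sem_Prim[OF p, of V "[]" "[]"] ball by (simp add: denotation_def[abs_def] tuple_Nil)
  moreover have "prim_law (map (denotation V) Ms) f 0 (tuple []) \<in> unit_ball meas_cone"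
    using ball p tuple_space[of "[]"] by (intro prim_law_ball) auto
  ultimately show ?thesis using fa by (simp add: denotation_def dec_enc_meas)
qed

text \<open>Isolates the first unevaluated argument: the remaining ones form a kernel in its value,
  which matches the evaluation context for \<open>Prim\<close>.\<close>

lemma den_Prim_first:
  assumes g: "good F V (Prim f (map Numeral rs @ M # Ms)) A"
  shows "denotation V (Prim f (map Numeral rs @ M # Ms)) =
      denotation V M \<bind> (\<lambda>q. prim_law (map (denotation V) Ms) f (Suc (length rs)) (tuple (rs @ [q])))"
    and "(\<lambda>q. prim_law (map (denotation V) Ms) f (Suc (length rs)) (tuple (rs @ [q]))) \<in> measurable borel (subprob_algebra borel)"
proof -
  have fa: "faithful V RealT" using good_faithful[OF g] good_PrimD(1)[OF g] by simp
  have ball: "set (map (denotation V) (M # Ms)) \<subseteq> unit_ball meas_cone"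
    using good_PrimD(3)[OF g] by (auto intro!: good_den_ball)
  have p: "prim_measurable (length rs + length (M # Ms)) f"
    using g good_PrimD(2)[OF g] signature_prim by (auto simp: good_def)
  have "denotation V (Prim f (map Numeral rs @ M # Ms)) =
      prim_law (map (return borel) rs @ map (denotation V) (M # Ms)) f (length ([] :: real list)) (tuple [])"
    unfolding den_Prim[OF g] by (simp add: den_Numeral[OF fa] comp_def)
  also have "\<dots> = prim_law (map (denotation V) (M # Ms)) f (length rs) (tuple rs)"
    using prim_law_returns[OF ball, of "[]" rs f] p by simp
  finally show "denotation V (Prim f (map Numeral rs @ M # Ms)) =
      denotation V M \<bind> (\<lambda>q. prim_law (map (denotation V) Ms) f (Suc (length rs)) (tuple (rs @ [q])))"
    by (simp add: tuple_upd)
  show "(\<lambda>q. prim_law (map (denotation V) Ms) f (Suc (length rs)) (tuple (rs @ [q]))) \<in> measurable borel (subprob_algebra borel)"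
    using ball p by (intro prim_law_kernel_tuple) auto
qed

text \<open>The hypothesis on \<open>M\<close> is applied to the integral of \<open>h\<close>
  against \<open>\<nu>\<close>, again a measurable function.\<close>

lemma sound_bind:
  assumes M: "sound V M" and \<nu>: "\<nu> \<in> measurable borel (subprob_algebra borel)"
    and ball: "denotation V M \<in> unit_ball meas_cone" "\<And>r. denotation V (step M r) \<in> unit_ball meas_cone"
    and L: "denotation V L = denotation V M \<bind> \<nu>" "\<And>r. denotation V (step L r) = denotation V (step M r) \<bind> \<nu>"
  shows "sound V L"
  unfolding sound_def
proof
  fix h :: "real \<Rightarrow> ennreal" assume h: "h \<in> borel_measurable borel"
  have "(\<lambda>q. \<integral>\<^sup>+x. h x \<partial>\<nu> q) \<in> borel_measurable borel"
    by (rule measurable_compose[OF \<nu> nn_integral_measurable_subprob_algebra[OF h]])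
  then show "(\<integral>\<^sup>+x. h x \<partial>denotation V L) = (\<integral>\<^sup>+r. \<integral>\<^sup>+x. h x \<partial>denotation V (step L r) \<partial>uniform)"
    using M unfolding L nn_integral_bind_ball[OF ball(1) \<nu> h] nn_integral_bind_ball[OF ball(2) \<nu> h]
    by (simp add: sound_def)
qed

text \<open>Sampling never happens in head position, so at function types the denotation is invariant under
  reduction.\<close>

lemma step_sem:
  "good F V M A \<Longrightarrow> ((\<exists>B C. A = (B \<rightarrow> C)) \<longrightarrow> (\<forall>r. sem V (step M r) [] [] = sem V M [] [])) \<and> (A = RealT \<longrightarrow> sound V M)"
proof (induction M arbitrary: A)
  case (App M N)
  obtain B where M: "good F V M (B \<rightarrow> A)" and N: "good F V N B" using App.prems by (rule good_AppE)
  have "sem V (step (App M N) r) [] [] = sem V (App M N) [] []" for r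
  proof (cases "is_lam M")
    case True
    then obtain B' L where L: "M = Lam B' L" by (auto simp: is_lam_def)
    have ty: "typing F [B] L A" "B' = B" using M by (auto simp: good_def L elim: typing_LamE)
    have fa: "faithful V (B \<rightarrow> A)" using good_faithful[OF M] .
    have "sem_ok V L [B] A"
      using M fa ty by (intro typing_sem_ok[where F=F]) (auto simp: good_def L)
    \<comment> \<open>The abstraction denotes a morphism, hence decoding inverts the coding and
      application becomes evaluation of the body.\<close>
    from Lam_ball[OF fa _ this, of "[]"]
    have "(\<lambda>a\<in>unit_ball (ty_cone V B). sem V L [B] [a]) \<in> carr (fun_cone (ty_cone V B) (ty_cone V A))"
      by (simp add: env_ball_def unit_ball_def)
    then have "dec_fun V (sem V M [] []) = (\<lambda>a\<in>unit_ball (ty_cone V B). sem V L [B] [a])"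
      using fa by (simp add: L ty(2))
    then have "sem V (App M N) [] [] = sem V L [B] [sem V N [] []]"
      using good_ball[OF N] by simp
    also have "\<dots> = sem V (subst L 0 N) [] []"
      using sem_subst[of "[]" "[]" N "[]" B V L "[]"] type_of_typing[of F "[]" N B] N by (simp add: good_def)
    finally show ?thesis by (simp add: L)
  next
    case False
    then show ?thesis using App.IH(1)[OF M] by simp
  qed
  then show ?case using sound_const by blast
next
  case (Fix M)
  have M: "good F V M (A \<rightarrow> A)" using Fix.prems by (rule good_FixD)
  have fa: "faithful V (A \<rightarrow> A)" using good_faithful[OF M] .
  have rc: "rcone (ty_cone V A) (ty_fns V A)" using fa by (intro rcone_ty) simp
  have ty: "type_of M [] = (A \<rightarrow> A)" using M type_of_typing[of F "[]" M "A \<rightarrow> A"] by (simp add: good_def)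
  have "dec_fun V (sem V M [] []) \<in> unit_ball (fun_cone (ty_cone V A) (ty_cone V A))"
    using retraction.dec_ball[OF retraction_fun[OF fa]] good_ball[OF M] by simp
  from rcone.fixpoint_unfold[OF rc this]
  have "sem V (App M (Fix M)) [] [] = sem V (Fix M) [] []"
    using sem_Fix[OF rc ty, of "[]"] by (simp del: sem.simps(4))
  then have "sem V (step (Fix M) r) [] [] = sem V (Fix M) [] []" for r by simp
  then show ?case using sound_const by blast
next
  case (Prim f Ms)
  note g = good_PrimD[OF Prim.prems]
  have fa: "faithful V RealT" using good_faithful[OF Prim.prems] g(1) by simp
  have "sound V (Prim f Ms)"
  proof (cases "\<forall>M\<in>set Ms. is_num M")
    case True
    define rs where "rs = map num_val Ms"
    have Ms: "Ms = map Numeral rs" unfolding rs_def by (rule map_num_val[OF True])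
    have p: "prim_measurable (length Ms) f"
      using Prim.prems g(2) by (auto simp: good_def intro: signature_prim)
    have "denotation V (Prim f Ms) = return borel (f rs)"
      unfolding den_Prim[OF Prim.prems] using prim_law_returns[of "[]" "[]" rs f] p
      by (simp add: Ms den_Numeral[OF fa] comp_def map_tuple)
    moreover have "denotation V (step (Prim f Ms) r) = return borel (f rs)" for r
      using True by (simp add: rs_def den_Numeral[OF fa])
    ultimately show ?thesis by (simp add: sound_def del: step.simps)
  next
    case False
    then obtain rs M Ns where Ms: "Ms = map Numeral rs @ M # Ns" "\<not> is_num M" by (rule first_non_num)
    have M: "good F V M RealT" using g(3)[of M] by (simp add: Ms)
    have gs: "good F V (Prim f (map Numeral rs @ step M r # Ns)) A" for r
      using good_step[OF Prim.prems, of r] unfolding Ms(1) step_Prim_first[OF Ms(2)] .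
    show ?thesis
      unfolding Ms(1)
    proof (rule sound_bind)
      show "sound V M" using Prim.IH[of M, OF _ M] by (simp add: Ms)
      show "denotation V (step (Prim f (map Numeral rs @ M # Ns)) r) =
         denotation V (step M r) \<bind> (\<lambda>q. prim_law (map (denotation V) Ns) f (Suc (length rs)) (tuple (rs @ [q])))" for r
        unfolding step_Prim_first[OF Ms(2)] by (rule den_Prim_first(1)[OF gs])
    qed (use den_Prim_first[OF Prim.prems[unfolded Ms(1)]] good_den_ball[OF M] good_den_ball[OF good_step[OF M]] in auto)
  qed
  then show ?case using g(1) by simp
next
  case (Ifz L M N)
  note g = good_IfzD[OF Ifz.prems]
  have fa: "faithful V RealT" using good_faithful[OF g(2)] .
  have k: "(\<lambda>r::real. if r = 0 then denotation V M else denotation V N) \<in> measurable borel (subprob_algebra borel)"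
    using good_den_ball[OF g(3)] good_den_ball[OF g(4)] unfolding unit_ball_meas by (intro measurable_If measurable_const) auto
  have "sound V (Ifz L M N)"
  proof (cases "is_num L")
    case True
    then obtain q where L: "L = Numeral q" by (auto simp: is_num_def)
    have "denotation V (Ifz L M N) = denotation V (if q = 0 then M else N)"
      unfolding den_Ifz[OF Ifz.prems] using bind_return_ball[OF k] by (simp add: L den_Numeral[OF fa])
    then show ?thesis by (simp add: sound_def L)
  next
    case False
    have st: "step (Ifz L M N) r = Ifz (step L r) M N" for r using False by simp
    show ?thesis
    proof (rule sound_bind[OF _ k])
      show "sound V L" using Ifz.IH(1)[OF g(2)] by simp
      show "denotation V (step (Ifz L M N) r) = denotation V (step L r) \<bind> (\<lambda>r. if r = 0 then denotation V M else denotation V N)" for r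
        using den_Ifz[OF good_step[OF Ifz.prems, of r, unfolded st]] unfolding st .
    qed (use den_Ifz[OF Ifz.prems] good_den_ball[OF g(2)] good_den_ball[OF good_step[OF g(2)]] in auto)
  qed
  then show ?case using g(1) by simp
next
  case Sample
  have fa: "faithful V RealT" using Sample by (auto simp: good_def)
  have "denotation V Sample = uniform" using fa by (simp add: denotation_def dec_enc_meas uniform_ball)
  moreover have "(\<integral>\<^sup>+x. h x \<partial>denotation V (step Sample r)) = h r" if "h \<in> borel_measurable borel" for h r
    using that by (simp add: den_Numeral[OF fa] nn_integral_return)
  ultimately have "sound V Sample" by (simp add: sound_def del: step.simps)
  moreover have "A = RealT" using Sample by (auto simp: good_def elim: typing_SampleE)
  ultimately show ?case by simp
next
  case (LetIn M N)
  note g = good_LetInD[OF LetIn.prems]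
  have fa: "faithful V RealT" using good_faithful[OF g(2)] .
  note k = let_kernel_measurable[OF fa g(3)]
  have "sound V (LetIn M N)"
  proof (cases "is_num M")
    case True
    then obtain q where M: "M = Numeral q" by (auto simp: is_num_def)
    have "denotation V (LetIn M N) = denotation V (subst N 0 M)"
      unfolding den_LetIn[OF LetIn.prems] using bind_return_ball[OF k] by (simp add: M den_Numeral[OF fa] den_subst_numeral)
    then show ?thesis using True by (simp add: sound_def)
  next
    case False
    have st: "step (LetIn M N) r = LetIn (step M r) N" for r using False by simp
    show ?thesis
    proof (rule sound_bind[OF _ k])
      show "sound V M" using LetIn.IH(1)[OF g(2)] by simp
      show "denotation V (step (LetIn M N) r) = denotation V (step M r) \<bind> let_kernel V N" for r
        using den_LetIn[OF good_step[OF LetIn.prems, of r, unfolded st]] unfolding st .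
    qed (use den_LetIn[OF LetIn.prems] good_den_ball[OF g(2)] good_den_ball[OF good_step[OF g(2)]] in auto)
  qed
  then show ?case using g(1) by simp
qed (auto simp: good_def intro!: sound_const elim: typing_VarE)

text \<open>\<open>outcome\<close> counts only what has already reached a numeral. Before any step
  this is the value at the numeral or zero, and each step preserves the integral by
  \<open>step_sem\<close>.\<close>

lemma soundness:
  assumes "good F V M RealT" and h: "h \<in> borel_measurable borel"
  shows "outcome n h M \<le> (\<integral>\<^sup>+x. h x \<partial>denotation V M)"
  using assms(1)
proof (induction n arbitrary: M)
  case 0
  show ?case
  proof (cases "is_num M")
    case True
    then obtain q where "M = Numeral q" by (auto simp: is_num_def)
    then show ?thesis using h good_faithful[OF 0] by (simp add: den_Numeral nn_integral_return)
  qed simp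
next
  case (Suc n)
  have "outcome (Suc n) h M \<le> (\<integral>\<^sup>+r. \<integral>\<^sup>+x. h x \<partial>denotation V (step M r) \<partial>uniform)"
    unfolding outcome.simps by (intro nn_integral_mono Suc.IH good_step[OF Suc.prems])
  also have "\<dots> = (\<integral>\<^sup>+x. h x \<partial>denotation V M)"
    using step_sem[OF Suc.prems] h by (simp add: sound_def)
  finally show ?case .
qed

section \<open>Adequacy\<close>

lemma typing_weaken: "typing F \<Gamma> M A \<Longrightarrow> typing F (\<Gamma> @ \<Delta>) M A"
proof (induction rule: typing.induct)
  case (Var i \<Gamma>)
  then have "typing F (\<Gamma> @ \<Delta>) (Var i) ((\<Gamma> @ \<Delta>) ! i)" by (intro typing.Var) simp
  then show ?case using Var by (simp add: nth_append)
next
  case (Prim Ms f \<Gamma>)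
  then show ?case by (auto intro: typing.Prim)
qed (auto intro: typing.intros)

lemma lift_closed: "typing F \<Gamma> M A \<Longrightarrow> length \<Gamma> \<le> k \<Longrightarrow> lift M k = M"
  by (induction arbitrary: k rule: typing.induct) (auto simp: map_idI)

lemma subst_closed: "typing F \<Gamma> M A \<Longrightarrow> length \<Gamma> \<le> k \<Longrightarrow> subst M k P = M"
  by (induction arbitrary: k P rule: typing.induct) (auto simp: map_idI)

text \<open>Simultaneous substitution of closed terms for the variables \<open>k, k + 1, \<dots>\<close>.\<close>

primrec psub :: "'r tm \<Rightarrow> nat \<Rightarrow> 'r tm list \<Rightarrow> 'r tm" where
  "psub (Var i) k Ns = (if i < k then Var i else if i - k < length Ns then Ns ! (i - k) else Var (i - length Ns))"
| "psub (Lam A M) k Ns = Lam A (psub M (Suc k) Ns)"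
| "psub (App M N) k Ns = App (psub M k Ns) (psub N k Ns)"
| "psub (Fix M) k Ns = Fix (psub M k Ns)"
| "psub (Numeral r) k Ns = Numeral r"
| "psub (Prim f Ms) k Ns = Prim f (map (\<lambda>M. psub M k Ns) Ms)"
| "psub (Ifz L M N) k Ns = Ifz (psub L k Ns) (psub M k Ns) (psub N k Ns)"
| "psub Sample k Ns = Sample"
| "psub (LetIn M N) k Ns = LetIn (psub M k Ns) (psub N (Suc k) Ns)"

lemma psub_Nil: "psub M k [] = M"
  by (induction M arbitrary: k) (auto simp: map_idI)

definition closed_list :: "signature \<Rightarrow> 'r tm list \<Rightarrow> bool" where
  "closed_list F Ns \<longleftrightarrow> (\<forall>N\<in>set Ns. \<exists>A. typing F [] N A)"

text \<open>Closed terms are unaffected by lifting and by substitution, so filling the variable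
  \<open>k\<close> last agrees with simultaneous substitution.\<close>

lemma subst_psub:
  assumes "closed_list F (N # Ns)"
  shows "subst (psub M (Suc k) Ns) k N = psub M k (N # Ns)"
proof -
  have N: "lift N j = N" for j using assms lift_closed[of F "[]" N] by (auto simp: closed_list_def)
  have Ns: "subst (Ns ! i) j N = Ns ! i" if i: "i < length Ns" for i j
  proof -
    obtain A where "typing F [] (Ns ! i) A" using assms nth_mem[OF i] by (auto simp: closed_list_def)
    then show ?thesis by (rule subst_closed) simp
  qed
  show ?thesis
  proof (induction M arbitrary: k)
    case (Var i)
    consider "i < k" | "i = k" | j where "i = Suc (k + j)" by (metis less_iff_Suc_add linorder_neqE_nat)
    then show ?case by cases (auto simp: Ns)
  qed (auto simp: N)
qed

lemma typing_psub:
  assumes "typing F (\<Delta> @ \<Gamma>) M A" "length Ns = length \<Gamma>" "\<And>i. i < length \<Gamma> \<Longrightarrow> typing F [] (Ns ! i) (\<Gamma> ! i)"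
  shows "typing F \<Delta> (psub M (length \<Delta>) Ns) A"
  using assms(1)
proof (induction "\<Delta> @ \<Gamma>" M A arbitrary: \<Delta> rule: typing.induct)
  case (Var i)
  show ?case
  proof (cases "i < length \<Delta>")
    case True
    then show ?thesis using typing.Var[of i \<Delta> F] by (simp add: nth_append)
  next
    case False
    then have "i - length \<Delta> < length \<Gamma>" using Var by simp
    then show ?thesis using False typing_weaken[OF assms(3), of "i - length \<Delta>" \<Delta>] assms(2) by (simp add: nth_append)
  qed
next
  case (Lam A M B)
  from Lam(2)[of "A # \<Delta>"] show ?case by (auto intro: typing.Lam)
next
  case (LetIn M N)
  from LetIn(4)[of "RealT # \<Delta>"] LetIn(2) show ?case by (auto intro: typing.LetIn)
next
  case (Prim Ms f)
  then show ?case by (auto intro!: typing.Prim)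
qed (auto intro: typing.intros)

section \<open>Adequacy at the type of reals\<close>

lemma outcome_le_Suc: "outcome n h M \<le> outcome (Suc n) h M"
proof (induction n arbitrary: M)
  case 0
  show ?case by (cases "is_num M") (auto simp: is_num_def)
next
  case (Suc n)
  then show ?case unfolding outcome.simps(2)[of "Suc n"] outcome.simps(2)[of n] by (intro nn_integral_mono)
qed

lemma outcome_mono: "m \<le> n \<Longrightarrow> outcome m h M \<le> outcome n h M"
  by (rule lift_Suc_mono_le[of "\<lambda>n. outcome n h M"]) (rule outcome_le_Suc)

text \<open>The bound by 1 serves \<open>integral_chain_limit\<close> in the closure under limits of
  chains, and it is inherited by the functions \<open>outcome k h\<close>, which become test
  functions in turn.\<close>

definition adequate :: "real measure \<Rightarrow> real tm \<Rightarrow> bool" where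
  "adequate \<mu> M \<longleftrightarrow> (\<forall>h\<in>borel_measurable borel. (\<forall>x. h x \<le> 1) \<longrightarrow> (\<integral>\<^sup>+x. h x \<partial>\<mu>) \<le> (SUP n. outcome n h M))"

lemma adequate_step:
  assumes "\<And>r. step M r = M'" "adequate \<mu> M'"
  shows "adequate \<mu> M"
proof -
  have "outcome n h M' \<le> (SUP n. outcome n h M)" for n h
    using SUP_upper[of "Suc n" UNIV "\<lambda>n. outcome n h M"] by (simp add: assms(1))
  then have "(SUP n. outcome n h M') \<le> (SUP n. outcome n h M)" for h by (intro SUP_least)
  with assms(2) show ?thesis unfolding adequate_def by (meson order_trans)
qed

lemma adequate_Numeral: "adequate (return borel q) (Numeral q)"
  unfolding adequate_def
proof (intro ballI impI)
  fix h :: "real \<Rightarrow> ennreal" assume "h \<in> borel_measurable borel"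
  then have "(\<integral>\<^sup>+x. h x \<partial>return borel q) = outcome 0 h (Numeral q)" by (simp add: nn_integral_return)
  also have "\<dots> \<le> (SUP n. outcome n h (Numeral q))" by (rule SUP_upper) simp
  finally show "(\<integral>\<^sup>+x. h x \<partial>return borel q) \<le> (SUP n. outcome n h (Numeral q))" .
qed

lemma adequate_Sample: "adequate uniform Sample"
  unfolding adequate_def
proof (intro ballI impI)
  fix h :: "real \<Rightarrow> ennreal"
  have "(\<integral>\<^sup>+x. h x \<partial>uniform) = outcome (Suc 0) h Sample" by simp
  also have "\<dots> \<le> (SUP n. outcome n h Sample)" by (rule SUP_upper) simp
  finally show "(\<integral>\<^sup>+x. h x \<partial>uniform) \<le> (SUP n. outcome n h Sample)" .
qed

text \<open>Reaching a numeral within \<open>n\<close> steps and then running the frame for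
  \<open>k\<close> more takes at most \<open>n + k\<close> steps. Where the numeral is reached
  early, the surplus steps go to the frame, which can only increase its outcome.\<close>

lemma outcome_frame:
  assumes C: "\<And>M r. \<not> is_num M \<Longrightarrow> step (C M) r = C (step M r)"
  shows "outcome n (\<lambda>q. outcome k h (C (Numeral q))) M \<le> outcome (n + k) h (C M)"
proof (induction n arbitrary: M)
  case 0
  show ?case by (cases "is_num M") (auto simp: is_num_def)
next
  case (Suc n)
  show ?case
  proof (cases "is_num M")
    case True
    then obtain q where M: "M = Numeral q" by (auto simp: is_num_def)
    \<comment> \<open>A numeral is a fixed point of \<open>step\<close>, so its outcome does not
      change with the number of steps.\<close>
    have "outcome m g (Numeral q) = g q" for m and g :: "real \<Rightarrow> ennreal" by (induction m) auto
    then show ?thesis using outcome_mono[of k "Suc n + k" h "C M"] by (simp only: M)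
  next
    case False
    then show ?thesis using Suc C by (auto intro: nn_integral_mono)
  qed
qed

text \<open>Adequacy of \<open>M\<close> is applied to the test function
  \<open>q \<mapsto> outcome k h (C (Numeral q))\<close>, measurable because
  \<open>C (Numeral q)\<close> is a family with one skeleton. The supremum over \<open>k\<close> is
  pulled out of the integral by monotone convergence.\<close>

lemma adequate_frame:
  assumes C: "\<And>M r. \<not> is_num M \<Longrightarrow> step (C M) r = C (step M r)"
    and F: "measurable_signature F"
    and T: "typing F [] T RealT" "set_tm T \<subseteq> borel_measurable borel" "\<And>q. C (Numeral q) = ev T q"
    and \<mu>: "adequate \<mu> M" "\<mu> \<in> unit_ball meas_cone"
    and \<nu>: "\<And>q. adequate (\<nu> q) (C (Numeral q))" "\<nu> \<in> measurable borel (subprob_algebra borel)"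
  shows "adequate (\<mu> \<bind> \<nu>) (C M)"
  unfolding adequate_def
proof (intro ballI impI)
  fix h :: "real \<Rightarrow> ennreal" assume h: "h \<in> borel_measurable borel" and h1: "\<forall>x. h x \<le> 1"
  let ?H = "\<lambda>k q. outcome k h (C (Numeral q))"
  have H: "?H k \<in> borel_measurable borel" for k
    unfolding T(3) by (rule measurable_compose[OF measurable_family[OF T(1,2)] measurable_outcome[OF F h]])
  have W1: "outcome k h L \<le> 1" for k L
  proof (induction k arbitrary: L)
    case 0
    show ?case using h1 by simp
  next
    case (Suc k)
    have "outcome (Suc k) h L \<le> (\<integral>\<^sup>+r. 1 \<partial>uniform)" unfolding outcome.simps by (intro nn_integral_mono Suc)
    then show ?case by simp
  qed
  have "(\<integral>\<^sup>+x. h x \<partial>(\<mu> \<bind> \<nu>)) = (\<integral>\<^sup>+q. \<integral>\<^sup>+x. h x \<partial>\<nu> q \<partial>\<mu>)"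
    by (rule nn_integral_bind_ball[OF \<mu>(2) \<nu>(2) h])
  also have "\<dots> \<le> (\<integral>\<^sup>+q. (SUP k. ?H k q) \<partial>\<mu>)"
    using \<nu>(1) h h1 by (intro nn_integral_mono) (simp add: adequate_def)
  also have "\<dots> = (SUP k. \<integral>\<^sup>+q. ?H k q \<partial>\<mu>)"
    by (rule nn_integral_monotone_convergence_SUP)
      (auto simp: incseq_def le_fun_def outcome_mono measurable_ball_iff[OF \<mu>(2)] H)
  also have "\<dots> \<le> (SUP n. outcome n h (C M))"
  proof (rule SUP_least)
    fix k
    have "(\<integral>\<^sup>+q. ?H k q \<partial>\<mu>) \<le> (SUP n. outcome n (?H k) M)"
      using \<mu>(1) H[of k] W1 by (simp add: adequate_def)
    also have "\<dots> \<le> (SUP n. outcome n h (C M))"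
      by (rule SUP_least, rule order_trans[OF outcome_frame[of C, OF C]]) (auto intro: SUP_upper)
    finally show "(\<integral>\<^sup>+q. ?H k q \<partial>\<mu>) \<le> (SUP n. outcome n h (C M))" .
  qed
  finally show "(\<integral>\<^sup>+x. h x \<partial>(\<mu> \<bind> \<nu>)) \<le> (SUP n. outcome n h (C M))" .
qed

definition const_tm :: "'r tm \<Rightarrow> ('w \<Rightarrow> 'r) tm" where "const_tm = map_tm (\<lambda>r _. r)"

lemma ev_const_tm[simp]: "ev (const_tm M) w = M"
  by (simp add: ev_def const_tm_def tm.map_comp comp_def tm.map_ident)

lemma const_tm_measurable: "set_tm (const_tm M) \<subseteq> borel_measurable N"
  by (auto simp: const_tm_def tm.set_map)

lemma typing_const_tm: "typing F \<Gamma> M A \<Longrightarrow> typing F \<Gamma> (const_tm M) A"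
  by (simp add: const_tm_def typing_map_tm)

lemma adequate_Ifz:
  assumes F: "measurable_signature F" and ty: "typing F [] M RealT" "typing F [] N RealT"
    and L: "adequate l L" "l \<in> unit_ball meas_cone"
    and M: "adequate \<mu> M" "\<mu> \<in> unit_ball meas_cone" and N: "adequate \<nu> N" "\<nu> \<in> unit_ball meas_cone"
  shows "adequate (l \<bind> (\<lambda>q. if q = 0 then \<mu> else \<nu>)) (Ifz L M N)"
proof (rule adequate_frame[where C="\<lambda>L. Ifz L M N" and F=F])
  show "typing F [] (Ifz (Numeral (\<lambda>q. q)) (const_tm M) (const_tm N)) RealT"
    using ty by (intro typing.intros typing_const_tm)
  show "set_tm (Ifz (Numeral (\<lambda>q. q)) (const_tm M) (const_tm N)) \<subseteq> borel_measurable borel"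
    using const_tm_measurable by auto
  show "(\<lambda>q::real. if q = 0 then \<mu> else \<nu>) \<in> measurable borel (subprob_algebra borel)"
    using M(2) N(2) unfolding unit_ball_meas by (intro measurable_If measurable_const) auto
  show "adequate (if q = 0 then \<mu> else \<nu>) (Ifz (Numeral q) M N)" for q :: real
    by (rule adequate_step[where M'="if q = 0 then M else N"]) (use M N in auto)
qed (use F L in auto)

lemma adequate_LetIn:
  assumes F: "measurable_signature F" and ty: "typing F [RealT] N RealT"
    and M: "adequate \<mu> M" "\<mu> \<in> unit_ball meas_cone"
    and N: "\<And>q. adequate (\<nu> q) (subst N 0 (Numeral q))" "\<nu> \<in> measurable borel (subprob_algebra borel)"
  shows "adequate (\<mu> \<bind> \<nu>) (LetIn M N)"
proof (rule adequate_frame[where C="\<lambda>M. LetIn M N" and F=F])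
  show "typing F [] (LetIn (Numeral (\<lambda>q. q)) (const_tm N)) RealT"
    using ty by (intro typing.intros typing_const_tm)
  show "set_tm (LetIn (Numeral (\<lambda>q. q)) (const_tm N)) \<subseteq> borel_measurable borel"
    using const_tm_measurable by auto
  show "adequate (\<nu> q) (LetIn (Numeral q) N)" for q
    by (rule adequate_step[where M'="subst N 0 (Numeral q)"]) (use N in auto)
qed (use F M N in auto)

text \<open>Induction over the arguments still to be evaluated: \<open>rs\<close> collects the
  values obtained so far, and the context around the next argument is a frame.\<close>

lemma adequate_Prim:
  assumes F: "measurable_signature F" and f: "(length rs + length Ms, f) \<in> F"
    and Ms: "list_all2 (\<lambda>\<mu> M. adequate \<mu> M \<and> \<mu> \<in> unit_ball meas_cone \<and> typing F [] M RealT) \<mu>s Ms"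
  shows "adequate (prim_law \<mu>s f (length rs) (tuple rs)) (Prim f (map Numeral rs @ Ms))"
  using Ms f
proof (induction arbitrary: rs rule: list_all2_induct)
  case Nil
  show ?case
  proof (rule adequate_step)
    show "step (Prim f (map Numeral rs @ [])) r = Numeral (f rs)" for r by (simp add: comp_def)
    show "adequate (prim_law [] f (length rs) (tuple rs)) (Numeral (f rs))"
      by (simp add: map_tuple adequate_Numeral)
  qed
next
  case (Cons \<mu> \<mu>s M Ms)
  have len: "length \<mu>s = length Ms" using Cons.hyps(2) by (rule list_all2_lengthD)
  have ty: "typing F [] N RealT" if "N \<in> set Ms" for N
    using Cons.hyps(2) that by (auto simp: list_all2_conv_all_nth in_set_conv_nth)
  have ball: "set \<mu>s \<subseteq> unit_ball meas_cone"
    using Cons.hyps(2) by (auto simp: list_all2_conv_all_nth in_set_conv_nth)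
  have "adequate (\<mu> \<bind> (\<lambda>q. prim_law \<mu>s f (Suc (length rs)) (tuple (rs @ [q])))) (Prim f (map Numeral rs @ M # Ms))"
  proof (rule adequate_frame[where C="\<lambda>M. Prim f (map Numeral rs @ M # Ms)" and F=F])
    let ?T = "Prim f (map const_tm (map Numeral rs) @ Numeral (\<lambda>q. q) # map const_tm Ms)"
    show "step (Prim f (map Numeral rs @ M # Ms)) r = Prim f (map Numeral rs @ step M r # Ms)" if "\<not> is_num M" for M r
      using that by (rule step_Prim_first)
    show "typing F [] ?T RealT"
      using Cons.prems ty by (intro typing.Prim) (auto intro: typing.intros typing_const_tm)
    show "set_tm ?T \<subseteq> borel_measurable borel"
      using const_tm_measurable by auto
    show "Prim f (map Numeral rs @ Numeral q # Ms) = ev ?T q" for q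
      by (simp add: comp_def)
    show "adequate (prim_law \<mu>s f (Suc (length rs)) (tuple (rs @ [q]))) (Prim f (map Numeral rs @ Numeral q # Ms))" for q
      using Cons.IH[of "rs @ [q]"] Cons.prems by simp
    show "(\<lambda>q. prim_law \<mu>s f (Suc (length rs)) (tuple (rs @ [q]))) \<in> measurable borel (subprob_algebra borel)"
      using signature_prim[OF F Cons.prems] len by (intro prim_law_kernel_tuple ball) simp
  qed (use F Cons.hyps in auto)
  then show ?case by (simp add: tuple_upd)
qed

section \<open>The logical relation\<close>

primrec logrel :: "signature \<Rightarrow> 'v universe \<Rightarrow> ty \<Rightarrow> real tm \<Rightarrow> 'v \<Rightarrow> bool" where
  "logrel F V RealT M v \<longleftrightarrow> adequate (dec_meas V v) M"
| "logrel F V (A \<rightarrow> B) M v \<longleftrightarrow> (\<forall>N a. typing F [] N A \<longrightarrow> a \<in> unit_ball (ty_cone V A) \<longrightarrow> logrel F V A N a \<longrightarrow>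
     logrel F V B (App M N) (dec_fun V v a))"

text \<open>Backward closure under a step that does not depend on the draw. Abstractions are
  excluded because in function position they do not step but are consumed by the
  application.\<close>

lemma logrel_step:
  "\<not> is_lam M \<Longrightarrow> (\<And>r. step M r = M') \<Longrightarrow> logrel F V A M' v \<Longrightarrow> logrel F V A M v"
proof (induction A arbitrary: M M' v)
  case RealT
  then show ?case by (auto intro: adequate_step)
next
  case (FunT A B)
  show ?case
    unfolding logrel.simps
  proof (intro allI impI)
    fix N a assume "typing F [] N A" "a \<in> unit_ball (ty_cone V A)" "logrel F V A N a"
    then have "logrel F V B (App M' N) (dec_fun V v a)" using FunT.prems(3) by simp
    then show "logrel F V B (App M N) (dec_fun V v a)"
      using FunT.prems(1,2) by (intro FunT.IH(2)[of "App M N" "App M' N"]) auto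
  qed
qed

text \<open>The base of the iteration for \<open>fix\<close>: integrals against the null measure
  vanish, and the zero map has zero values.\<close>

lemma logrel_zero: "faithful V A \<Longrightarrow> logrel F V A M (zero (ty_cone V A))"
proof (induction A arbitrary: M)
  case RealT
  then have "dec_meas V (zero (ty_cone V RealT)) = null_measure borel"
    using rcone.zero_carr[OF rcone_meas] by (simp add: transport_def) (simp add: meas_cone_def)
  then show ?case by (simp add: adequate_def)
next
  case (FunT A B)
  interpret rcone_pair "ty_cone V A" "ty_fns V A" "ty_cone V B" "ty_fns V B"
    using FunT.prems by (intro rcone_pair_ty) auto
  have "dec_fun V (zero (ty_cone V (A \<rightarrow> B))) = zero (fun_cone (ty_cone V A) (ty_cone V B))"
    using FunT.prems fun_zero_carr by (simp add: transport_def)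
  then show ?case using FunT by (simp add: fun_zero_apply)
qed

text \<open>Convergence in a function cone implies convergence at each point, so the statement
  descends to the type of reals, where it is convergence of integrals.\<close>

lemma logrel_lub:
  "faithful V A \<Longrightarrow> cone_chain (ty_cone V A) (ty_fns V A) X l \<Longrightarrow> (\<And>n. logrel F V A M (X n)) \<Longrightarrow> logrel F V A M l"
proof (induction A arbitrary: M X l)
  case RealT
  have ch: "cone_chain meas_cone meas_fns (\<lambda>n. dec_meas V (X n)) (dec_meas V l)"
    using RealT.prems(2) unfolding ty_cone.simps ty_fns.simps
    by (rule retraction.dec_chain[OF retraction_meas[OF RealT.prems(1)]])
  show ?case
    unfolding logrel.simps adequate_def
  proof (intro ballI impI)
    fix h :: "real \<Rightarrow> ennreal" assume h: "h \<in> borel_measurable borel" "\<forall>x. h x \<le> 1"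
    have "(\<lambda>n. \<integral>\<^sup>+x. h x \<partial>dec_meas V (X n)) \<longlonglongrightarrow> (\<integral>\<^sup>+x. h x \<partial>dec_meas V l)"
      using integral_chain_limit(2)[OF ch h(1)] h(2) by simp
    moreover have "(\<integral>\<^sup>+x. h x \<partial>dec_meas V (X n)) \<le> (SUP n. outcome n h M)" for n
      using RealT.prems(3)[of n] h by (simp add: adequate_def)
    ultimately show "(\<integral>\<^sup>+x. h x \<partial>dec_meas V l) \<le> (SUP n. outcome n h M)"
      by (meson LIMSEQ_le_const2)
  qed
next
  case (FunT A B)
  interpret rcone_pair "ty_cone V A" "ty_fns V A" "ty_cone V B" "ty_fns V B"
    using FunT.prems by (intro rcone_pair_ty) auto
  have ch: "cone_chain (fun_cone (ty_cone V A) (ty_cone V B)) (fun_fns (ty_cone V A) (ty_fns V A) (ty_fns V B))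
      (\<lambda>n. dec_fun V (X n)) (dec_fun V l)"
    using FunT.prems(2) unfolding ty_cone.simps ty_fns.simps
    by (rule retraction.dec_chain[OF retraction_fun[OF FunT.prems(1)]])
  show ?case
    unfolding logrel.simps
  proof (intro allI impI)
    fix N a assume a: "typing F [] N A" "a \<in> unit_ball (ty_cone V A)" "logrel F V A N a"
    show "logrel F V B (App M N) (dec_fun V l a)"
      using FunT.prems a by (intro FunT.IH(2)[OF _ fun_chain_apply[OF ch a(2)]]) auto
  qed
qed

definition logrel_env :: "signature \<Rightarrow> 'v universe \<Rightarrow> ty list \<Rightarrow> real tm list \<Rightarrow> 'v list \<Rightarrow> bool" where
  "logrel_env F V \<Gamma> Ns g \<longleftrightarrow> length Ns = length \<Gamma> \<and> (\<forall>i<length \<Gamma>. typing F [] (Ns ! i) (\<Gamma> ! i) \<and>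
     g ! i \<in> unit_ball (ty_cone V (\<Gamma> ! i)) \<and> logrel F V (\<Gamma> ! i) (Ns ! i) (g ! i))"

lemma logrel_env_Cons:
  "logrel_env F V \<Gamma> Ns g \<Longrightarrow> typing F [] N A \<Longrightarrow> a \<in> unit_ball (ty_cone V A) \<Longrightarrow> logrel F V A N a \<Longrightarrow>
    logrel_env F V (A # \<Gamma>) (N # Ns) (a # g)"
  by (auto simp: logrel_env_def less_Suc_eq_0_disj)

lemma logrel_env_closed: "logrel_env F V \<Gamma> Ns g \<Longrightarrow> closed_list F Ns"
  by (auto simp: logrel_env_def closed_list_def in_set_conv_nth) blast

lemma logrel_env_ball: "logrel_env F V \<Gamma> Ns g \<Longrightarrow> env_ball V \<Gamma> g"
  by (simp add: logrel_env_def env_ball_def)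

lemma typing_psub_env: "typing F \<Gamma> M A \<Longrightarrow> logrel_env F V \<Gamma> Ns g \<Longrightarrow> typing F [] (psub M 0 Ns) A"
  using typing_psub[of F "[]" \<Gamma> M A Ns] by (simp add: logrel_env_def)

lemma subst_psub_env:
  assumes "logrel_env F V \<Gamma> Ns g" "typing F [] N A"
  shows "subst (psub M (Suc 0) Ns) 0 N = psub M 0 (N # Ns)"
proof (rule subst_psub)
  show "closed_list F (N # Ns)"
    using logrel_env_closed[OF assms(1)] assms(2) by (auto simp: closed_list_def)
qed

lemma logrel_fundamental:
  assumes F: "measurable_signature F" and "typing F \<Gamma> M A"
    and "\<forall>B\<in>types_in M \<Gamma>. faithful V B" "\<forall>B\<in>set \<Gamma>. faithful V B"
    and "logrel_env F V \<Gamma> Ns g"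
  shows "logrel F V A (psub M 0 Ns) (sem V M \<Gamma> g)"
  using assms(2-)
proof (induction arbitrary: Ns g rule: typing.induct)
  case (Var i \<Gamma>)
  then show ?case by (simp add: logrel_env_def)
next
  case (Lam A \<Gamma> M B)
  have "type_of M (A # \<Gamma>) = B" using Lam.hyps by (rule type_of_typing)
  then have fa: "faithful V (A \<rightarrow> B)" using Lam.prems by simp
  have ok: "sem_ok V M (A # \<Gamma>) B"
    using Lam fa by (intro typing_sem_ok[OF F Lam.hyps]) auto
  have "(\<lambda>a\<in>unit_ball (ty_cone V A). sem V M (A # \<Gamma>) (a # g)) \<in> carr (fun_cone (ty_cone V A) (ty_cone V B))"
    using Lam_ball[OF fa Lam.prems(2) ok logrel_env_ball[OF Lam.prems(3)]] by (simp add: unit_ball_def)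
  then have dec: "dec_fun V (sem V (Lam A M) \<Gamma> g) = (\<lambda>a\<in>unit_ball (ty_cone V A). sem V M (A # \<Gamma>) (a # g))"
    using fa by simp
  show ?case
    unfolding logrel.simps
  proof (intro allI impI)
    fix N a assume N: "typing F [] N A" "a \<in> unit_ball (ty_cone V A)" "logrel F V A N a"
    have "logrel F V B (psub M 0 (N # Ns)) (sem V M (A # \<Gamma>) (a # g))"
      using Lam.prems fa N by (intro Lam.IH logrel_env_Cons) auto
    then have "logrel F V B (App (psub (Lam A M) 0 Ns) N) (sem V M (A # \<Gamma>) (a # g))"
      by (rule logrel_step[rotated 2]) (simp_all add: subst_psub_env[OF Lam.prems(3) N(1)])
    then show "logrel F V B (App (psub (Lam A M) 0 Ns) N) (dec_fun V (sem V (Lam A M) \<Gamma> g) a)"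
      using N by (simp add: dec del: psub.simps sem.simps)
  qed
next
  case (App \<Gamma> M A B N)
  have fa: "\<forall>B\<in>types_in M \<Gamma>. faithful V B" "\<forall>B\<in>types_in N \<Gamma>. faithful V B" using App.prems by auto
  have "sem V N \<Gamma> g \<in> unit_ball (ty_cone V A)"
    using sem_ok_ball[OF typing_sem_ok[OF F App.hyps(2) fa(2) App.prems(2)] App.prems(2) logrel_env_ball[OF App.prems(3)]]
    by simp
  then show ?case
    using App.IH(1)[OF fa(1) App.prems(2,3)] App.IH(2)[OF fa(2) App.prems(2,3)]
      typing_psub_env[OF App.hyps(2) App.prems(3)] by simp
next
  case (Fix \<Gamma> M A)
  have faM: "\<forall>B\<in>types_in M \<Gamma>. faithful V B" using Fix.prems by auto
  have ty: "type_of M \<Gamma> = (A \<rightarrow> A)" using Fix.hyps by (rule type_of_typing)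
  have fa: "faithful V (A \<rightarrow> A)" using type_of_types_in[of M \<Gamma>] faM ty by (metis)
  then have faA: "faithful V A" by simp
  have rc: "rcone (ty_cone V A) (ty_fns V A)" by (rule rcone_ty[OF faA])
  let ?f = "dec_fun V (sem V M \<Gamma> g)" and ?P = "psub (Fix M) 0 Ns"
  have "sem V M \<Gamma> g \<in> unit_ball (ty_cone V (A \<rightarrow> A))"
    using sem_ok_ball[OF typing_sem_ok[OF F Fix.hyps faM Fix.prems(2)] Fix.prems(2) logrel_env_ball[OF Fix.prems(3)]]
    by simp
  then have f: "?f \<in> unit_ball (fun_cone (ty_cone V A) (ty_cone V A))"
    using retraction.dec_ball[OF retraction_fun[OF fa]] by simp
  have P: "typing F [] ?P A"
    by (rule typing_psub_env[OF typing.Fix[OF Fix.hyps] Fix.prems(3)])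
  have it: "logrel F V A ?P ((?f ^^ n) (zero (ty_cone V A)))" for n
  proof (induction n)
    case 0
    show ?case using logrel_zero[OF faA] by simp
  next
    case (Suc n)
    \<comment> \<open>\<open>fix M\<close> steps to \<open>M (fix M)\<close>, so each further
      iterate is matched by one more unfolding on the operational side.\<close>
    have "logrel F V A (App (psub M 0 Ns) ?P) (?f ((?f ^^ n) (zero (ty_cone V A))))"
      using Fix.IH[OF faM Fix.prems(2,3)] P rcone.iterate_ball[OF rc f, of n] Suc by simp
    then show ?case by (intro logrel_step[of ?P "App (psub M 0 Ns) ?P"]) simp_all
  qed
  show ?case
    unfolding sem_Fix[OF rc ty] by (rule logrel_lub[OF faA rcone.fixpoint_chain[OF rc f] it])
next
  case (Numeral \<Gamma> r)
  then have "faithful V RealT" by simp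
  then show ?case using dec_enc_meas[OF return_ball, of V r] by (simp add: adequate_Numeral)
next
  case (Prim Ms f \<Gamma>)
  have fa: "faithful V RealT" using Prim.prems(1) by simp
  have fM: "\<forall>B\<in>types_in M \<Gamma>. faithful V B" if "M \<in> set Ms" for M using Prim.prems(1) that by auto
  have ball: "dec_meas V (sem V M \<Gamma> g) \<in> unit_ball meas_cone" if "M \<in> set Ms" for M
    by (rule sem_ok_dec_ball[OF fa typing_sem_ok[OF F Prim.hyps(2)[OF that] fM[OF that] Prim.prems(2)] Prim.prems(2) logrel_env_ball[OF Prim.prems(3)]])
  have p: "prim_measurable (length Ms) f" by (rule signature_prim[OF F Prim.hyps(1)])
  let ?\<mu>s = "map (\<lambda>M. dec_meas V (sem V M \<Gamma> g)) Ms"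
  have "list_all2 (\<lambda>\<mu> M. adequate \<mu> M \<and> \<mu> \<in> unit_ball meas_cone \<and> typing F [] M RealT) ?\<mu>s (map (\<lambda>M. psub M 0 Ns) Ms)"
    unfolding list.rel_map list.rel_refl_strong
    using Prim.IH[OF _ fM Prim.prems(2,3)] ball typing_psub_env[OF Prim.hyps(2) Prim.prems(3)]
    by (intro list.rel_refl_strong) auto
  from adequate_Prim[OF F _ this, of "[]" f]
  have "adequate (prim_law ?\<mu>s f 0 (tuple [])) (psub (Prim f Ms) 0 Ns)"
    using Prim.hyps(1) by simp
  moreover have "prim_law ?\<mu>s f 0 (tuple []) \<in> unit_ball meas_cone"
    using ball p tuple_space[of "[]"] by (intro prim_law_ball) auto
  moreover have "sem V (Prim f Ms) \<Gamma> g = enc_meas V (prim_law ?\<mu>s f 0 (tuple []))"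
    using sem_Prim[OF p ball] by (simp only: tuple_Nil)
  ultimately show ?case
    using dec_enc_meas[of "prim_law ?\<mu>s f 0 (tuple [])" V] fa by (simp only: logrel.simps)
next
  case (Ifz \<Gamma> L M N)
  have fa: "faithful V RealT" "\<forall>B\<in>types_in L \<Gamma>. faithful V B" "\<forall>B\<in>types_in M \<Gamma>. faithful V B" "\<forall>B\<in>types_in N \<Gamma>. faithful V B"
    using Ifz.prems(1) by auto
  note ok = typing_sem_ok[OF F Ifz.hyps(1) fa(2) Ifz.prems(2)] typing_sem_ok[OF F Ifz.hyps(2) fa(3) Ifz.prems(2)]
    typing_sem_ok[OF F Ifz.hyps(3) fa(4) Ifz.prems(2)]
  note b = sem_ok_dec_ball[OF fa(1) _ Ifz.prems(2) logrel_env_ball[OF Ifz.prems(3)]]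
  note ball = b[OF ok(1)] b[OF ok(2)] b[OF ok(3)]
  let ?\<nu> = "\<lambda>r::real. if r = 0 then dec_meas V (sem V M \<Gamma> g) else dec_meas V (sem V N \<Gamma> g)"
  have k: "?\<nu> \<in> measurable borel (subprob_algebra borel)"
    using ball unfolding unit_ball_meas by (intro measurable_If measurable_const) auto
  have "adequate (dec_meas V (sem V L \<Gamma> g) \<bind> ?\<nu>) (Ifz (psub L 0 Ns) (psub M 0 Ns) (psub N 0 Ns))"
    using Ifz.IH(1)[OF fa(2) Ifz.prems(2,3)] Ifz.IH(2)[OF fa(3) Ifz.prems(2,3)] Ifz.IH(3)[OF fa(4) Ifz.prems(2,3)] ball
      typing_psub_env[OF Ifz.hyps(2) Ifz.prems(3)] typing_psub_env[OF Ifz.hyps(3) Ifz.prems(3)]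
    by (intro adequate_Ifz[OF F]) simp_all
  then show ?case
    using sem_Ifz[OF ball] dec_enc_meas[OF bind_ball[OF ball(1) k] fa(1)] by (simp del: sem.simps)
next
  case (Sample \<Gamma>)
  then have "faithful V RealT" by simp
  then show ?case using dec_enc_meas[OF uniform_ball, of V] by (simp add: adequate_Sample)
next
  case (LetIn \<Gamma> M N)
  have fa: "faithful V RealT" "\<forall>B\<in>types_in M \<Gamma>. faithful V B" "\<forall>B\<in>types_in N (RealT # \<Gamma>). faithful V B"
    using LetIn.prems(1) by auto
  have \<Gamma>': "\<forall>B\<in>set (RealT # \<Gamma>). faithful V B" using fa(1) LetIn.prems(2) by simp
  note okM = typing_sem_ok[OF F LetIn.hyps(1) fa(2) LetIn.prems(2)] and okN = typing_sem_ok[OF F LetIn.hyps(2) fa(3) \<Gamma>']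
  note ball = sem_ok_dec_ball[OF fa(1) okM LetIn.prems(2) logrel_env_ball[OF LetIn.prems(3)]]
  let ?\<nu> = "\<lambda>r. dec_meas V (sem V N (RealT # \<Gamma>) (enc_meas V (return borel r) # g))"
  have k: "?\<nu> \<in> measurable borel (subprob_algebra borel)"
    using LetIn_kernel[OF fa(1) LetIn.prems(2) okN logrel_env_ball[OF LetIn.prems(3)]] .
  have N: "adequate (?\<nu> q) (subst (psub N (Suc 0) Ns) 0 (Numeral q))" for q
  proof -
    have "enc_meas V (return borel q) \<in> unit_ball (ty_cone V RealT)"
      using retraction.enc_ball[OF retraction_meas[OF fa(1)] return_ball] by simp
    moreover have "logrel F V RealT (Numeral q) (enc_meas V (return borel q))"
      using dec_enc_meas[OF return_ball fa(1)] by (simp add: adequate_Numeral)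
    ultimately have "logrel_env F V (RealT # \<Gamma>) (Numeral q # Ns) (enc_meas V (return borel q) # g)"
      by (intro logrel_env_Cons LetIn.prems typing.Numeral)
    from LetIn.IH(2)[OF fa(3) \<Gamma>' this] show ?thesis
      using subst_psub_env[OF LetIn.prems(3) typing.Numeral] by simp
  qed
  have "typing F [RealT] (psub N (Suc 0) Ns) RealT"
    using typing_psub[of F "[RealT]" \<Gamma> N RealT Ns] LetIn.hyps(2) LetIn.prems(3) by (simp add: logrel_env_def)
  then have "adequate (dec_meas V (sem V M \<Gamma> g) \<bind> ?\<nu>) (LetIn (psub M 0 Ns) (psub N (Suc 0) Ns))"
    using LetIn.IH(1)[OF fa(2) LetIn.prems(2,3)] ball N k by (intro adequate_LetIn[OF F]) simp_all
  then show ?case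
    using sem_LetIn[OF ball k] dec_enc_meas[OF bind_ball[OF ball k] fa(1)] by (simp del: sem.simps)
qed

theorem theorem7p12:
  fixes F :: signature and M :: "real tm" and U :: "real set" and V :: "'v universe"
  assumes "measurable_signature F"
    and "typing F [] M RealT"
    and "\<forall>A\<in>types_in M []. faithful V A"
    and "U \<in> sets borel"
  shows "emeasure (denotation V M) U = Red_inf F [] RealT M (Numeral ` U)"
proof -
  have good: "good F V M RealT" using assms by (simp add: good_def)
  have h: "(indicator U :: real \<Rightarrow> ennreal) \<in> borel_measurable borel" using assms(4) by simp
  have U: "U \<in> sets (denotation V M)"
    using ball_meas_sets[OF good_den_ball[OF good]] assms(4) by simp
  have "logrel F V RealT (psub M 0 []) (sem V M [] [])"
    by (rule logrel_fundamental) (use assms in \<open>auto simp: logrel_env_def\<close>)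
  then have "(\<integral>\<^sup>+x. indicator U x \<partial>denotation V M) \<le> (SUP n. outcome n (indicator U) M)"
    using h by (auto simp: psub_Nil adequate_def denotation_def split: split_indicator)
  \<comment> \<open>The iterates of \<open>Red\<close> start at one step, hence the shifted index;
    the supremum is unchanged because \<open>outcome\<close> increases with the number of
    steps.\<close>
  also have "\<dots> \<le> (SUP n. outcome (Suc n) (indicator U) M)"
    by (intro SUP_mono) (use outcome_le_Suc in blast)
  finally have "emeasure (denotation V M) U \<le> Red_inf F [] RealT M (Numeral ` U)"
    using U by (simp add: Red_inf_outcome[OF assms(1,2,4)] del: outcome.simps)
  moreover have "Red_inf F [] RealT M (Numeral ` U) \<le> (\<integral>\<^sup>+x. indicator U x \<partial>denotation V M)"
    unfolding Red_inf_outcome[OF assms(1,2,4)] by (intro SUP_least soundness[OF good h])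
  ultimately show ?thesis using U by simp
qed

end
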